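(* Let $\lambda>0$. For all real $x$, $$\sin(\pi x)\,\big\{G_\lambda^o(x)-K_\lambda^o(x)\big\}\ge0\qquad\text{and}\qquad L_\lambda^o(x)\le G_\lambda^o(x)\le M_\lambda^o(x).$$ The function $K_\lambda^o$ interpolates the values of $G_\lambda^o$ at $\mathbb{Z}\setminus\{0\}$, and $L_\lambda^o$ and $M_\lambda^o$ interpolate the values of $G_\lambda^o$ and its derivative at $\mathbb{Z}\setminus\{0\}$. Moreover, $K_\lambda^o$ is the best approximation of exponential type $\pi$ of $G_\lambda^o$ (it minimizes $\int_{-\infty}^\infty|G_\lambda^o(x)-K(x)|\,dx$ among all entire functions $K$ of exponential type at most $\pi$), $L_\lambda^o$ is the extremal minorant of exponential type $2\pi$ of $G_\lambda^o$ (it minimizes $\int_{-\infty}^\infty\{G_\lambda^o(x)-L(x)\}\,dx$ among all entire $L$ of exponential type at most $2\pi$, real-valued on $\mathbb{R}$, with $L\le G_\lambda^o$ on $\mathbb{R}$), and $M_\lambda^o$ is the extremal majorant of exponential type $2\pi$ of $G_\lambda^o$ (it minimizes $\int_{-\infty}^\infty\{M(x)-G_\lambda^o(x)\}\,dx$ among all entire $M$ of exponential type at most $2\pi$, real-valued on $\mathbb{R}$, with $M\ge G_\lambda^o$ on $\mathbb{R}$).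
   Context: An entire function $K$ is of exponential type at most $2\pi\delta$ if for every $\epsilon>0$ there is $C_\epsilon>0$ with $|K(z)|\le C_\epsilon e^{(2\pi\delta+\epsilon)|z|}$ for all $z\in\mathbb{C}$. $G_\lambda(z)=e^{-\pi\lambda z^2}$, with derivative $G_\lambda'$. The odd Gaussian is given on the real line by $G_\lambda^o(x)=\mathrm{sgn}(x)e^{-\pi\lambda x^2}$, with $G_\lambda^o(0)=0$. Define entire functions (extending the following formulas across removable singularities) $$K_\lambda^+(z)=\frac{\sin\pi z}{\pi}\sum_{n=1}^\infty(-1)^n\left\{\frac{G_\lambda(n)}{z-n}-\frac{G_\lambda(n)}{z}\right\},$$ $$L_\lambda^+(z)=\frac{\sin^2\pi z}{\pi^2}\sum_{n=1}^\infty\left\{\frac{G_\lambda(n)}{(z-n)^2}+\frac{G_\lambda'(n)}{z-n}-\frac{G_\lambda'(n)}{z}\right\},\qquad M_\lambda^+(z)=L_\lambda^+(z)+\frac{\sin^2\pi z}{\pi^2z^2},$$ and $$K_\lambda^o(z)=K_\lambda^+(z)-K_\lambda^+(-z),\quad L_\lambda^o(z)=L_\lambda^+(z)-M_\lambda^+(-z),\quad M_\lambda^o(z)=M_\lambda^+(z)-L_\lambda^+(-z).$$ *)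

theory Defs
  imports "HOL-Complex_Analysis.Complex_Analysis"
begin

definition exp_type_le :: "real \<Rightarrow> (complex \<Rightarrow> complex) \<Rightarrow> bool" where
  "exp_type_le \<tau> K \<longleftrightarrow> K holomorphic_on UNIV \<and>
     (\<forall>\<epsilon>>0. \<exists>C>0. \<forall>z. norm (K z) \<le> C * exp ((\<tau> + \<epsilon>) * norm z))"

definition gauss :: "real \<Rightarrow> complex \<Rightarrow> complex" where
  "gauss lam z = exp (- (of_real (pi * lam) * z\<^sup>2))"

definition gauss_odd :: "real \<Rightarrow> real \<Rightarrow> real" where
  "gauss_odd lam x = sgn x * exp (- (pi * lam * x\<^sup>2))"

(* The value of "remove_sings f" at a point is the limit of f there whenever that limit exists,
   so the junk values that the formulas take at integers (division by zero) play no role. *)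

definition K_plus :: "real \<Rightarrow> complex \<Rightarrow> complex" where
  "K_plus lam = remove_sings (\<lambda>z. sin (of_real pi * z) / of_real pi *
     (\<Sum>k. let n = of_nat (Suc k) in
        (-1) ^ Suc k * (gauss lam n / (z - n) - gauss lam n / z)))"

definition L_plus :: "real \<Rightarrow> complex \<Rightarrow> complex" where
  "L_plus lam = remove_sings (\<lambda>z. (sin (of_real pi * z))\<^sup>2 / (of_real pi)\<^sup>2 *
     (\<Sum>k. let n = of_nat (Suc k) in
        gauss lam n / (z - n)\<^sup>2 + deriv (gauss lam) n / (z - n) - deriv (gauss lam) n / z))"

definition M_plus :: "real \<Rightarrow> complex \<Rightarrow> complex" where
  "M_plus lam = remove_sings (\<lambda>z. L_plus lam z +
     (sin (of_real pi * z))\<^sup>2 / ((of_real pi)\<^sup>2 * z\<^sup>2))"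

definition K_odd :: "real \<Rightarrow> complex \<Rightarrow> complex" where
  "K_odd lam z = K_plus lam z - K_plus lam (- z)"

definition L_odd :: "real \<Rightarrow> complex \<Rightarrow> complex" where
  "L_odd lam z = L_plus lam z - M_plus lam (- z)"

definition M_odd :: "real \<Rightarrow> complex \<Rightarrow> complex" where
  "M_odd lam z = M_plus lam z - L_plus lam (- z)"

definition minorant_exp_type :: "real \<Rightarrow> (real \<Rightarrow> real) \<Rightarrow> (complex \<Rightarrow> complex) \<Rightarrow> bool" where
  "minorant_exp_type \<tau> g L \<longleftrightarrow> exp_type_le \<tau> L \<and>
     (\<forall>x::real. L (of_real x) \<in> \<real> \<and> Re (L (of_real x)) \<le> g x)"

definition majorant_exp_type :: "real \<Rightarrow> (real \<Rightarrow> real) \<Rightarrow> (complex \<Rightarrow> complex) \<Rightarrow> bool" where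
  "majorant_exp_type \<tau> g M \<longleftrightarrow> exp_type_le \<tau> M \<and>
     (\<forall>x::real. M (of_real x) \<in> \<real> \<and> g x \<le> Re (M (of_real x)))"

(* The integrands are nonnegative, so the objectives are extended-valued: competitors with a
   non-integrable difference have objective infinity. The minimizer itself is
   required to have an integrable difference. *)

definition best_approximation :: "real \<Rightarrow> (real \<Rightarrow> real) \<Rightarrow> (complex \<Rightarrow> complex) \<Rightarrow> bool" where
  "best_approximation \<tau> g K \<longleftrightarrow>
     integrable lborel (\<lambda>x. of_real (g x) - K (of_real x)) \<and>
     is_arg_min (\<lambda>F. \<integral>\<^sup>+x. ennreal (norm (of_real (g x) - F (of_real x))) \<partial>lborel)
       (exp_type_le \<tau>) K"

definition extremal_minorant :: "real \<Rightarrow> (real \<Rightarrow> real) \<Rightarrow> (complex \<Rightarrow> complex) \<Rightarrow> bool" where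
  "extremal_minorant \<tau> g L \<longleftrightarrow>
     integrable lborel (\<lambda>x. g x - Re (L (of_real x))) \<and>
     is_arg_min (\<lambda>F. \<integral>\<^sup>+x. ennreal (g x - Re (F (of_real x))) \<partial>lborel)
       (minorant_exp_type \<tau> g) L"

definition extremal_majorant :: "real \<Rightarrow> (real \<Rightarrow> real) \<Rightarrow> (complex \<Rightarrow> complex) \<Rightarrow> bool" where
  "extremal_majorant \<tau> g M \<longleftrightarrow>
     integrable lborel (\<lambda>x. Re (M (of_real x)) - g x) \<and>
     is_arg_min (\<lambda>F. \<integral>\<^sup>+x. ennreal (Re (F (of_real x)) - g x) \<partial>lborel)
       (majorant_exp_type \<tau> g) M"

end

theory Submission
  imports Defs "HOL-Probability.Probability" "HOL-Real_Asymp.Real_Asymp"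
begin

text \<open>
  Write s = - pi lam. For fixed non-integral x > 0, each of the three inequalities compares
  exp (s x^2) with a series in exp (s n^2). After division by exp (s x^2) the comparison becomes
  an equality (the partial fractions of 1/sin or 1/sin^2) or a known inequality in the limit
  s to 0, so it suffices to show monotonicity in s. The derivatives in s no longer contain x
  in a denominator: they are theta-type series, whose signs come from Poisson summation. The part of
  the series with poles on the negative axis is a Laplace transform of a partial theta series
  sum_n a_n exp (s n^2 - n t); such series solve the heat equation in (t, s), and the minimum principle
  reduces their sign on t > 0 to a Neumann condition at t = 0, which is again a theta-type inequality.

  The difference D of two competitors is an integrable function of exponential type, so its Fourier transform
  vanishes outside (-tau, tau). For tau = pi this makes D orthogonal to the square wave
  sgn (sin (pi x)), which is the sign of the error of the interpolant. For tau = 2 pi, Poisson summation gives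
  that the integral of D is the sum of its values at the integers, where the interpolants are
  extremal; at 0 they take the one-sided limits -1 and 1 of the odd Gaussian.
\<close>

section \<open>Entire functions of exponential type\<close>

text \<open>Since \<open>M_odd lam z = - L_odd lam (- z)\<close>, the real work concerns
  \<open>K_odd\<close> and \<open>L_odd\<close>. For nonintegral x > 0 the odd comparison is an even
  one minus twice the part with poles at 0 and at the negative integers (\<open>even_interp\<close>
  and \<open>left_interp\<close>). For the majorant the two parts can be bounded separately: the
  even interpolant lies above the Gaussian, and the other part is nonpositive once its pole at 0 is
  removed. For the minorant the even part lies on the wrong side, so the combination itself is
  differentiated in s. Its theta constants then cancel, and only a multiple of
  \<open>psum 1 0 s + s * psum 3 0 s\<close> is left to be signed. Here the limit s to 0 cannot be
  taken termwise, because the coefficients of \<open>left_interp\<close> grow linearly. A one-sided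
  bound by the first moment replaces it, and what remains at s = 0 is 1/x <= sum of 1/(x+n)^2 over n
  >= 0. The derivatives at nonzero integers are never computed from the series: a graph that lies on
  one side of another and meets it at a point is tangent to it there.\<close>

lemma half_plane_max_principle:
  fixes f :: "complex \<Rightarrow> complex"
  assumes hol: "f holomorphic_on {z. Im z > 0}" and cont: "continuous_on {z. Im z \<ge> 0} f"
    and real: "\<And>x::real. norm (f (of_real x)) \<le> M" and M: "M > 0"
    and bdd: "\<And>z. Im z \<ge> 0 \<Longrightarrow> norm (f z) \<le> B"
    and z: "Im z \<ge> 0"
  shows "norm (f z) \<le> M"
proof -
  have nz: "norm (1 - \<i> * of_real e * w) \<ge> 1" "norm (1 - \<i> * of_real e * w) \<ge> e * norm w - 1"
    if "Im w \<ge> 0" "e > 0" for e :: real and w :: complex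
  proof -
    have "1 \<le> Re (1 - \<i> * of_real e * w)" using that by simp
    also have "\<dots> \<le> norm (1 - \<i> * of_real e * w)" by (rule complex_Re_le_cmod)
    finally show "norm (1 - \<i> * of_real e * w) \<ge> 1" .
    have "norm (\<i> * of_real e * w) - norm (1::complex) \<le> norm (\<i> * of_real e * w - 1)"
      by (rule norm_triangle_ineq2)
    then show "norm (1 - \<i> * of_real e * w) \<ge> e * norm w - 1"
      using that by (simp add: norm_mult norm_minus_commute)
  qed
  have B0: "B \<ge> 0" using bdd[OF z] norm_ge_zero[of "f z"] by linarith
  \<comment> \<open>The divisor has modulus at least 1 on the closed upper half plane and grows
    linearly there. On a large half circle it beats the crude bound \<open>B\<close>, so the
    quotient is at most \<open>M\<close> on the whole boundary of a half disc. Afterwards e tends to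
    0.\<close>
  have key: "norm (f z) \<le> M * norm (1 - \<i> * of_real e * z)" if e: "e > 0" for e :: real
  proof -
    define R where "R = max (norm z) ((B / M + 1) / e)"
    have R: "norm z \<le> R" "e * R - 1 \<ge> B / M"
      using e by (auto simp: R_def max_def field_simps)
    let ?S = "{z. Im z \<ge> 0} \<inter> cball 0 R"
    let ?g = "\<lambda>w. f w / (1 - \<i> * of_real e * w)"
    have nz0: "1 - \<i> * of_real e * w \<noteq> 0" if "Im w \<ge> 0" for w
      using nz(1)[OF that e] by auto
    have clS: "closed ?S"
      by (intro closed_Int closed_halfspace_Im_ge closed_cball)
    have intS: "interior ?S \<subseteq> {z. Im z > 0}"
      using interior_halfspace_ge[of \<i> 0] by (auto simp: inner_complex_def)
    have "norm (?g z) \<le> M"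
    proof (rule maximum_modulus_frontier[where S = ?S and f = ?g and \<xi> = z])
      show "?g holomorphic_on interior ?S"
      proof (rule holomorphic_on_divide)
        show "f holomorphic_on interior ?S" by (rule holomorphic_on_subset[OF hol intS])
        show "1 - \<i> * of_real e * w \<noteq> 0" if "w \<in> interior ?S" for w
          using nz0 that interior_subset[of ?S] by blast
      qed (auto intro!: holomorphic_intros)
      show "continuous_on (closure ?S) ?g"
        using clS nz0
        by (intro continuous_intros continuous_on_subset[OF cont]) auto
      show "bounded ?S" by (simp add: bounded_Int)
      show "z \<in> ?S" using z R by simp
      fix w assume w: "w \<in> frontier ?S"
      have wS: "w \<in> ?S" using w clS frontier_subset_eq by blast
      have "Im w = 0 \<or> norm w = R"
      proof (rule ccontr)
        assume "\<not> ?thesis"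
        then have "w \<in> {z. Im z > 0} \<inter> ball 0 R" using wS by auto
        moreover have "{z. Im z > 0} \<inter> ball 0 R \<subseteq> interior ?S"
          by (rule interior_maximal) (auto intro!: open_Int open_halfspace_Im_gt)
        ultimately have "w \<in> interior ?S" by blast
        then show False using w by (simp add: frontier_def)
      qed
      then show "norm (?g w) \<le> M"
      proof
        assume "Im w = 0"
        then have "norm (f w) \<le> M" using real[of "Re w"] by (simp add: complex_is_Real_iff)
        moreover have "norm (1 - \<i> * of_real e * w) \<ge> 1" using nz(1) wS e by blast
        ultimately have "norm (f w) \<le> M * norm (1 - \<i> * of_real e * w)"
          using M by (metis mult_left_mono mult.right_neutral less_imp_le order_trans)
        then show ?thesis using \<open>norm (1 - \<i> * of_real e * w) \<ge> 1\<close> M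
          by (auto simp: norm_divide divide_le_eq split: if_splits)
      next
        assume n: "norm w = R"
        have "norm (f w) \<le> B" using bdd wS by blast
        also have "B \<le> M * (e * R - 1)" using R M by (simp add: field_simps)
        also have "\<dots> \<le> M * norm (1 - \<i> * of_real e * w)"
          using nz(2)[of w e] wS e n M by (intro mult_left_mono) auto
        finally show ?thesis using nz(1)[of w e] wS e
          by (auto simp: norm_divide divide_le_eq split: if_splits)
      qed
    qed
    then show ?thesis using nz(1)[of z e] z e
      by (auto simp: norm_divide divide_le_eq split: if_splits)
  qed
  have "((\<lambda>e. M * norm (1 - \<i> * of_real e * z)) \<longlongrightarrow> M * norm (1 - \<i> * of_real 0 * z)) (at_right 0)"
    by (intro tendsto_intros)
  then have "norm (f z) \<le> M * norm (1 - \<i> * of_real 0 * z)"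
    by (rule tendsto_lowerbound) (auto intro!: eventually_mono[OF eventually_at_right_less] key simp del: norm_exp_eq_Re)
  then show ?thesis by simp
qed

text \<open>The multiplier \<open>exp (- (of_real e * h w))\<close>, with \<open>h\<close> a branch
  of a power 3/2, works because 3/2 lies strictly between the growth order 1 of \<open>f\<close> and
  the critical order 2 of a quadrant. After rotation the argument of \<open>v w\<close> is at most
  pi/4 in modulus, so that of \<open>h w\<close> is at most 3 pi/8, which gives the constant
  \<open>\<kappa>\<close>.\<close>

lemma Phragmen_Lindelof_quadrant:
  fixes f :: "complex \<Rightarrow> complex"
  assumes hol: "f holomorphic_on UNIV"
    and re: "\<And>x. x \<ge> 0 \<Longrightarrow> norm (f (of_real x)) \<le> M"
    and im: "\<And>x. x \<ge> 0 \<Longrightarrow> norm (f (\<i> * of_real x)) \<le> M"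
    and M: "M > 0" and C: "C > 0" and c: "c \<ge> 0"
    and growth: "\<And>z. norm (f z) \<le> C * exp (c * norm z)"
    and z: "Re z \<ge> 0" "Im z \<ge> 0"
  shows "norm (f z) \<le> M"
proof -
  define \<kappa> where "\<kappa> = cos (3 * pi / 8)"
  have \<kappa>: "\<kappa> > 0" unfolding \<kappa>_def by (intro cos_gt_zero) (use pi_gt_zero in linarith)+
  \<comment> \<open>The rotation centres the quadrant on the positive real axis. The shift by
    \<open>1 + \<i>\<close> keeps \<open>v\<close> away from 0, so that \<open>Ln\<close> is
    holomorphic up to and including the corner, and it only increases the modulus.\<close>
  define v where "v = (\<lambda>w. cis (- (pi/4)) * (w + 1 + \<i>))"
  define h where "h = (\<lambda>w. exp (of_real (3/2) * Ln (v w)))"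
  have cis4: "cis (- (pi/4)) = of_real (sqrt 2 / 2) * (1 - \<i>)"
    by (simp add: complex_eq_iff cos_45 sin_45)
  have vRe: "Re (v w) > 0" "\<bar>Im (v w)\<bar> \<le> Re (v w)" if "Re w \<ge> 0" "Im w \<ge> 0" for w
  proof -
    have v: "Re (v w) = sqrt 2 / 2 * (Re w + Im w + 2)" "Im (v w) = sqrt 2 / 2 * (Im w - Re w)"
      unfolding v_def cis4 by (simp_all add: field_simps)
    show "Re (v w) > 0" unfolding v using that by (intro mult_pos_pos) auto
    have "\<bar>Im (v w)\<bar> = sqrt 2 / 2 * \<bar>Im w - Re w\<bar>" unfolding v by (simp add: abs_mult)
    also have "\<dots> \<le> Re (v w)" unfolding v using that by (intro mult_left_mono) auto
    finally show "\<bar>Im (v w)\<bar> \<le> Re (v w)" .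
  qed
  have vnorm: "norm (v w) = norm (w + 1 + \<i>)" for w
    by (simp add: v_def norm_mult)
  have hRe: "Re (h w) \<ge> \<kappa> * norm w powr (3/2)" if w: "Re w \<ge> 0" "Im w \<ge> 0" for w
  proof -
    have nz: "v w \<noteq> 0" using vRe[OF w] by auto
    have arg: "\<bar>Im (Ln (v w))\<bar> \<le> pi/4"
    proof -
      have "Im (Ln (v w)) = arctan (Im (v w) / Re (v w))"
        using vRe[OF w] nz by (subst Im_Ln_eq) (auto)
      moreover have "\<bar>Im (v w) / Re (v w)\<bar> \<le> 1" using vRe[OF w] by (simp add: divide_le_eq)
      moreover have "\<bar>arctan r\<bar> \<le> pi / 4" if "\<bar>r\<bar> \<le> 1" for r
        using that arctan_le_iff[of r 1] arctan_le_iff[of "-1" r]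
        unfolding abs_le_iff arctan_minus arctan_one by linarith
      ultimately show ?thesis by metis
    qed
    have "Re (h w) = exp (3/2 * ln (norm (v w))) * cos (3/2 * Im (Ln (v w)))"
      using nz by (simp add: h_def Re_exp)
    also have "exp (3/2 * ln (norm (v w))) = norm (v w) powr (3/2)"
      using nz by (simp add: powr_def)
    also have "norm (v w) powr (3/2) * cos (3/2 * Im (Ln (v w))) \<ge> norm w powr (3/2) * \<kappa>"
    proof (rule mult_mono)
      have "norm w \<le> norm (w + 1 + \<i>)"
        using w unfolding cmod_def by (intro real_sqrt_le_mono add_mono power_mono) auto
      then show "norm w powr (3/2) \<le> norm (v w) powr (3/2)"
        unfolding vnorm by (intro powr_mono2) auto
      have "cos (3 * pi / 8) \<le> cos \<bar>3/2 * Im (Ln (v w))\<bar>"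
        using arg by (intro cos_monotone_0_pi_le) (auto simp: abs_mult)
      then show "\<kappa> \<le> cos (3/2 * Im (Ln (v w)))" unfolding \<kappa>_def cos_abs_real .
    qed (use \<kappa> in auto)
    finally show ?thesis by (simp add: mult.commute)
  qed
  let ?Q = "{w. Re w \<ge> 0} \<inter> {w. Im w \<ge> 0}"
  have key: "norm (f z) \<le> M * norm (exp (of_real e * h z))" if e: "e > 0" for e :: real
  proof -
    have "filterlim (\<lambda>R. (e*\<kappa>) * R powr (3/2) - c * R - ln (C/M)) at_top at_top"
      using e \<kappa> by real_asymp
    note this[unfolded filterlim_at_top, rule_format, of 0]
    then have "eventually (\<lambda>R. (e*\<kappa>) * R powr (3/2) - c * R - ln (C/M) \<ge> 0 \<and> R \<ge> norm z) at_top"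
      by (intro eventually_conj eventually_ge_at_top)
    then obtain R where R: "(e*\<kappa>) * R powr (3/2) - c * R - ln (C/M) \<ge> 0" "R \<ge> norm z"
      by (auto simp: eventually_at_top_linorder)
    let ?S = "?Q \<inter> cball 0 R"
    let ?g = "\<lambda>w. f w * exp (- (of_real e * h w))"
    have clS: "closed ?S"
      by (intro closed_Int closed_halfspace_Im_ge closed_halfspace_Re_ge closed_cball)
    have hh: "h holomorphic_on ?Q"
    proof -
      have "v w \<notin> \<real>\<^sub>\<le>\<^sub>0" if "w \<in> ?Q" for w
        using vRe(1)[of w] that by (auto simp: complex_nonpos_Reals_iff)
      moreover have "v holomorphic_on ?Q" unfolding v_def by (intro holomorphic_intros)
      ultimately show ?thesis unfolding h_def
        by (intro holomorphic_intros) auto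
    qed
    have hg: "?g holomorphic_on ?Q"
      by (intro holomorphic_intros hh holomorphic_on_subset[OF hol]) auto
    have small: "norm (exp (- (of_real e * h w))) \<le> exp (- e * \<kappa> * norm w powr (3/2))"
      if "w \<in> ?Q" for w
      using hRe[of w] that e by (simp add: mult_left_mono mult.assoc)
    have small1: "norm (exp (- (of_real e * h w))) \<le> 1" if "w \<in> ?Q" for w
      by (rule order_trans[OF small[OF that]]) (use e \<kappa> in simp)
    have "norm (?g z) \<le> M"
    proof (rule maximum_modulus_frontier[where S = ?S and f = ?g and \<xi> = z])
      show "?g holomorphic_on interior ?S"
        using hg interior_subset by (rule_tac holomorphic_on_subset) auto
      show "continuous_on (closure ?S) ?g"
        using holomorphic_on_imp_continuous_on[OF hg] clS
        by (rule_tac continuous_on_subset) auto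
      show "bounded ?S" by (simp add: bounded_Int)
      show "z \<in> ?S" using z R by simp
      fix w assume w: "w \<in> frontier ?S"
      have wS: "w \<in> ?S" using w clS frontier_subset_eq by blast
      have "Re w = 0 \<or> Im w = 0 \<or> norm w = R"
      proof (rule ccontr)
        assume "\<not> ?thesis"
        then have "w \<in> {z. Re z > 0} \<inter> {z. Im z > 0} \<inter> ball 0 R" using wS by auto
        moreover have "{z. Re z > 0} \<inter> {z. Im z > 0} \<inter> ball 0 R \<subseteq> interior ?S"
          by (rule interior_maximal)
            (auto intro!: open_Int open_halfspace_Im_gt open_halfspace_Re_gt)
        ultimately have "w \<in> interior ?S" by blast
        then show False using w by (simp add: frontier_def)
      qed
      then consider "norm (f w) \<le> M" | "norm w = R"
      proof (elim disjE)
        assume "Re w = 0"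
        then have "w = \<i> * of_real (Im w)" by (simp add: complex_eq_iff)
        then show ?thesis using im[of "Im w"] wS that by auto
      next
        assume "Im w = 0"
        then have "w = of_real (Re w)" by (simp add: complex_eq_iff)
        then show ?thesis using re[of "Re w"] wS that by auto
      qed (use that in auto)
      then show "norm (?g w) \<le> M"
      proof cases
        case 1
        have "norm (?g w) \<le> M * 1" unfolding norm_mult
          using 1 small1[of w] wS M by (intro mult_mono) auto
        then show ?thesis by simp
      next
        case 2
        have "norm (?g w) \<le> (C * exp (c * R)) * exp (- e * \<kappa> * R powr (3/2))"
          unfolding norm_mult using growth[of w] small[of w] wS C 2 by (intro mult_mono) auto
        also have "\<dots> = C * exp (c * R - e * \<kappa> * R powr (3/2))"
          by (simp add: exp_diff exp_minus field_simps)
        also have "\<dots> \<le> C * exp (- ln (C / M))"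
          using C R by (intro mult_left_mono) auto
        also have "\<dots> = M" using C M by (simp add: exp_minus)
        finally show ?thesis .
      qed
    qed
    then show ?thesis
      by (simp add: exp_minus norm_inverse norm_divide field_simps)
  qed
  have "((\<lambda>e. M * norm (exp (of_real e * h z))) \<longlongrightarrow> M * norm (exp (of_real 0 * h z))) (at_right 0)"
    by (intro tendsto_intros)
  then have "norm (f z) \<le> M * norm (exp (of_real 0 * h z))"
    by (rule tendsto_lowerbound) (auto intro!: eventually_mono[OF eventually_at_right_less] key simp del: norm_exp_eq_Re)
  then show ?thesis by simp
qed

text \<open>Multiplication by \<open>exp (\<i> * of_real (\<tau> + e) * z)\<close> leaves the
  modulus on the real axis unchanged and makes the function bounded on the positive imaginary axis.
  The two quadrants then give a bound \<open>max M C\<close> in the upper half plane, where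
  \<open>C\<close> depends on e. The half-plane principle improves it to \<open>M\<close>, and only
  after that can e tend to 0.\<close>

lemma exp_type_bounded_real_upper:
  assumes f: "exp_type_le \<tau> f" and \<tau>: "\<tau> \<ge> 0"
    and M: "M > 0" and bdd: "\<And>x::real. norm (f (of_real x)) \<le> M" and z: "Im z \<ge> 0"
  shows "norm (f z) \<le> M * exp (\<tau> * Im z)"
proof -
  have hol: "f holomorphic_on UNIV" using f by (simp add: exp_type_le_def)
  have key: "norm (f z) \<le> M * exp ((\<tau> + e) * Im z)" if e: "e > 0" for e :: real
  proof -
    obtain C where C: "C > 0" "\<And>z. norm (f z) \<le> C * exp ((\<tau> + e) * norm z)"
      using f e unfolding exp_type_le_def by blast
    define g where "g = (\<lambda>z. f z * exp (\<i> * of_real (\<tau> + e) * z))"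
    have holg: "g holomorphic_on A" for A
      unfolding g_def by (intro holomorphic_intros holomorphic_on_subset[OF hol]) auto
    have ng: "norm (g w) = norm (f w) * exp (- ((\<tau> + e) * Im w))" for w
      by (simp add: g_def norm_mult)
    have growth: "norm (g w) \<le> C * exp ((2 * \<tau> + 2 * e) * norm w)" for w
    proof -
      have "norm (g w) \<le> (C * exp ((\<tau> + e) * norm w)) * exp ((\<tau> + e) * norm w)"
        unfolding ng
      proof (intro mult_mono C(2))
        have "(\<tau> + e) * (- Im w) \<le> (\<tau> + e) * norm w"
          using abs_Im_le_cmod[of w] \<tau> e by (intro mult_left_mono) linarith+
        then show "exp (- ((\<tau> + e) * Im w)) \<le> exp ((\<tau> + e) * norm w)" by simp
      qed (use C(1) in auto)
      also have "\<dots> = C * exp ((2 * \<tau> + 2 * e) * norm w)"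
        by (simp add: algebra_simps flip: exp_add)
      finally show ?thesis .
    qed
    have gre: "norm (g (of_real x)) \<le> max M C" for x
      using bdd[of x] by (simp add: ng)
    have gim: "norm (g (\<i> * of_real x)) \<le> max M C" if "x \<ge> 0" for x
    proof -
      have "norm (g (\<i> * of_real x)) \<le> (C * exp ((\<tau> + e) * x)) * exp (- ((\<tau> + e) * x))"
        unfolding ng using C(2)[of "\<i> * of_real x"] C(1) that by (intro mult_mono) (auto simp: norm_mult)
      also have "\<dots> = C" by (simp add: exp_minus)
      finally show ?thesis by simp
    qed
    have Q1: "norm (g w) \<le> max M C" if "Re w \<ge> 0" "Im w \<ge> 0" for w
      by (rule Phragmen_Lindelof_quadrant[OF holg gre gim _ C(1) _ growth that]) (use M e \<tau> in auto)
    have Q2: "norm (g (\<i> * w)) \<le> max M C" if "Re w \<ge> 0" "Im w \<ge> 0" for w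
    proof (rule Phragmen_Lindelof_quadrant[OF _ _ _ _ C(1) _ _ that, where f = "\<lambda>w. g (\<i> * w)"])
      show "(\<lambda>w. g (\<i> * w)) holomorphic_on UNIV"
        unfolding g_def by (intro holomorphic_intros holomorphic_on_compose_gen[OF _ hol, unfolded o_def]) auto
      show "norm (g (\<i> * (\<i> * of_real x))) \<le> max M C" for x
        using gre[of "- x"] by (simp flip: mult.assoc)
      show "norm (g (\<i> * w)) \<le> C * exp ((2 * \<tau> + 2 * e) * norm w)" for w
        using growth[of "\<i> * w"] by (simp add: norm_mult)
    qed (use M e \<tau> gim in auto)
    have all: "norm (g w) \<le> max M C" if "Im w \<ge> 0" for w
      using Q1[of w] Q2[of "- \<i> * w"] that by (cases "Re w \<ge> 0") auto
    have "norm (g z) \<le> M"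
      by (rule half_plane_max_principle[OF holg holomorphic_on_imp_continuous_on[OF holg] _ M all z])
        (use bdd in \<open>simp add: ng\<close>)
    then show ?thesis unfolding ng exp_minus inverse_eq_divide
      by (simp only: times_divide_eq_right mult_1_right pos_divide_le_eq exp_gt_zero)
  qed
  have "((\<lambda>e. M * exp ((\<tau> + e) * Im z)) \<longlongrightarrow> M * exp ((\<tau> + 0) * Im z)) (at_right 0)"
    by (intro tendsto_intros)
  then have "norm (f z) \<le> M * exp ((\<tau> + 0) * Im z)"
    by (rule tendsto_lowerbound) (auto intro!: eventually_mono[OF eventually_at_right_less] key simp del: norm_exp_eq_Re)
  then show ?thesis by simp
qed

lemma exp_type_le_uminus:
  assumes "exp_type_le \<tau> f"
  shows "exp_type_le \<tau> (\<lambda>z. f (- z))"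
proof -
  have "(\<lambda>z. f (- z)) holomorphic_on UNIV"
    using assms unfolding exp_type_le_def
    by (intro holomorphic_on_compose_gen[of uminus UNIV f UNIV, unfolded o_def] holomorphic_intros) auto
  moreover have "\<forall>\<epsilon>>0. \<exists>C>0. \<forall>z. norm (f (- z)) \<le> C * exp ((\<tau> + \<epsilon>) * norm z)"
    using assms unfolding exp_type_le_def by (metis norm_minus_cancel)
  ultimately show ?thesis by (simp add: exp_type_le_def)
qed

lemma exp_type_bounded_real:
  assumes f: "exp_type_le \<tau> f" and \<tau>: "\<tau> \<ge> 0"
    and M: "M > 0" and bdd: "\<And>x::real. norm (f (of_real x)) \<le> M"
  shows "norm (f z) \<le> M * exp (\<tau> * \<bar>Im z\<bar>)"
proof (cases "Im z \<ge> 0")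
  case True
  then show ?thesis using exp_type_bounded_real_upper[OF f \<tau> M bdd] by simp
next
  case False
  have "norm (f (- (- z))) \<le> M * exp (\<tau> * Im (- z))"
    by (rule exp_type_bounded_real_upper[OF exp_type_le_uminus[OF f] \<tau> M])
      (use False bdd[of "- x" for x] in auto)
  then show ?thesis using False by simp
qed

lemma exp_type_le_add:
  assumes "exp_type_le \<tau> f" "exp_type_le \<tau> g"
  shows "exp_type_le \<tau> (\<lambda>z. f z + g z)"
proof -
  have "\<exists>C>0. \<forall>z. norm (f z + g z) \<le> C * exp ((\<tau> + e) * norm z)" if e: "e > 0" for e
  proof -
    obtain C D where "C > 0" "\<And>z. norm (f z) \<le> C * exp ((\<tau> + e) * norm z)"
      "D > 0" "\<And>z. norm (g z) \<le> D * exp ((\<tau> + e) * norm z)"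
      using assms e unfolding exp_type_le_def by meson
    then have "norm (f z + g z) \<le> (C + D) * exp ((\<tau> + e) * norm z)" for z
      unfolding distrib_right by (intro norm_triangle_mono)
    then show ?thesis using \<open>C > 0\<close> \<open>D > 0\<close> by (intro exI[of _ "C + D"]) auto
  qed
  then show ?thesis using assms by (auto simp: exp_type_le_def intro!: holomorphic_intros)
qed

lemma exp_type_le_minus:
  assumes "exp_type_le \<tau> f"
  shows "exp_type_le \<tau> (\<lambda>z. - f z)"
  using assms by (auto simp: exp_type_le_def intro!: holomorphic_intros)

lemma exp_type_le_diff:
  assumes "exp_type_le \<tau> f" "exp_type_le \<tau> g"
  shows "exp_type_le \<tau> (\<lambda>z. f z - g z)"
  using exp_type_le_add[OF assms(1) exp_type_le_minus[OF assms(2)]] by simp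

lemma exp_type_le_mult:
  assumes "exp_type_le \<sigma> f" "exp_type_le \<tau> g"
  shows "exp_type_le (\<sigma> + \<tau>) (\<lambda>z. f z * g z)"
proof -
  have "\<exists>C>0. \<forall>z. norm (f z * g z) \<le> C * exp ((\<sigma> + \<tau> + e) * norm z)" if e: "e > 0" for e
  proof -
    have "e / 2 > 0" using e by simp
    obtain C where C: "C > 0" "\<And>z. norm (f z) \<le> C * exp ((\<sigma> + e/2) * norm z)"
      using assms(1) \<open>e / 2 > 0\<close> unfolding exp_type_le_def by meson
    obtain D where D: "D > 0" "\<And>z. norm (g z) \<le> D * exp ((\<tau> + e/2) * norm z)"
      using assms(2) \<open>e / 2 > 0\<close> unfolding exp_type_le_def by meson
    have "norm (f z * g z) \<le> (C * exp ((\<sigma> + e/2) * norm z)) * (D * exp ((\<tau> + e/2) * norm z))" for z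
      unfolding norm_mult using C D by (intro mult_mono) auto
    also have "(C * exp ((\<sigma> + e/2) * norm z)) * (D * exp ((\<tau> + e/2) * norm z))
        = C * D * exp ((\<sigma> + \<tau> + e) * norm z)" for z
      by (simp add: algebra_simps flip: exp_add)
    finally show ?thesis using C(1) D(1) by (intro exI[of _ "C * D"]) auto
  qed
  then show ?thesis using assms by (auto simp: exp_type_le_def intro!: holomorphic_intros)
qed

text \<open>A primitive of \<open>D\<close> is bounded on the real line by the L1 norm of
  \<open>D\<close> and has the same type, so \<open>exp_type_bounded_real\<close> applies to it. The
  Cauchy estimate on circles of radius 1 carries the bound back to \<open>D\<close> at the price of
  a factor \<open>exp \<tau>\<close>.\<close>

lemma exp_type_le_L1_bound:
  assumes D: "exp_type_le \<tau> D" and \<tau>: "\<tau> \<ge> 0"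
    and int: "integrable lborel (\<lambda>x. D (of_real x))"
  shows "\<exists>M>0. \<forall>z. norm (D z) \<le> M * exp (\<tau> * \<bar>Im z\<bar>)"
proof -
  have hol: "D holomorphic_on UNIV" using D by (simp add: exp_type_le_def)
  obtain I0 where I0: "\<And>z. (I0 has_field_derivative D z) (at z)"
    using holomorphic_convex_primitive'[OF convex_UNIV open_UNIV hol] by auto
  define I where "I = (\<lambda>z. I0 z - I0 0)"
  have I: "(I has_field_derivative D z) (at z)" for z
    unfolding I_def using I0[of z] by (auto intro!: derivative_eq_intros)
  have holI: "I holomorphic_on A" for A
    using I by (meson DERIV_subset UNIV_I field_differentiable_def field_differentiable_at_within holomorphic_on_def)
  have contD: "continuous_on UNIV (\<lambda>x::real. D (of_real x))"
    by (intro continuous_on_compose2[OF holomorphic_on_imp_continuous_on[OF hol]] continuous_intros) auto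
  define K where "K = (LINT x|lborel. norm (D (of_real x)))"
  have K0: "K \<ge> 0" unfolding K_def by simp
  have FTC: "norm (I (of_real b) - I (of_real a)) \<le> K" if "a \<le> b" for a b :: real
  proof -
    have "(LBINT x. indicator {a..b} x *\<^sub>R D (of_real x)) = I (of_real b) - I (of_real a)"
    proof (rule integral_FTC_Icc[OF that])
      show "((\<lambda>x. I (of_real x)) has_vector_derivative D (of_real x)) (at x within {a..b})" for x
        by (rule has_vector_derivative_real_field[OF I])
    qed (rule continuous_on_subset[OF contD], simp)
    then have "norm (I (of_real b) - I (of_real a)) = norm (LBINT x. indicator {a..b} x *\<^sub>R D (of_real x))"
      by simp
    also have "\<dots> \<le> (LBINT x. norm (indicator {a..b} x *\<^sub>R D (of_real x)))"
      by (rule integral_norm_bound)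
    also have "\<dots> \<le> K" unfolding K_def
      by (rule integral_mono_AE') (use int in \<open>auto simp: indicator_def\<close>)
    finally show ?thesis .
  qed
  have Ireal: "norm (I (of_real x)) \<le> K + 1" for x
    using FTC[of 0 x] FTC[of x 0] by (cases "x \<ge> 0") (auto simp: I_def norm_minus_commute)
  have typeI: "exp_type_le \<tau> I"
    unfolding exp_type_le_def
  proof (intro conjI allI impI holI)
    fix e :: real assume e: "e > 0"
    obtain C where C: "C > 0" "\<And>z. norm (D z) \<le> C * exp ((\<tau> + e/2) * norm z)"
      using D e unfolding exp_type_le_def by (meson half_gt_zero)
    have "norm (I z) \<le> (2 * C / e) * exp ((\<tau> + e) * norm z)" for z
    proof -
      have "norm (I z - I 0) \<le> (C * exp ((\<tau> + e/2) * norm z)) * norm (z - 0)"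
      proof (rule field_differentiable_bound[where S = "cball 0 (norm z)" and f' = D])
        fix w :: complex assume "w \<in> cball 0 (norm z)"
        then have "C * exp ((\<tau> + e/2) * norm w) \<le> C * exp ((\<tau> + e/2) * norm z)"
          using C \<tau> e by (auto intro!: mult_left_mono)
        then show "norm (D w) \<le> C * exp ((\<tau> + e/2) * norm z)" using C(2)[of w] by linarith
      qed (use has_field_derivative_at_within[OF I] in auto)
      also have "\<dots> \<le> (C * exp ((\<tau> + e/2) * norm z)) * (2 / e * exp (e/2 * norm z))"
      proof (intro mult_left_mono)
        have "e/2 * norm z \<le> exp (e/2 * norm z)"
          using exp_ge_add_one_self[of "e/2 * norm z"] by linarith
        then show "norm (z - 0) \<le> 2 / e * exp (e/2 * norm z)" using e by (simp add: field_simps)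
      qed (use C in auto)
      also have "\<dots> = (2 * C / e) * exp ((\<tau> + e) * norm z)"
        by (simp add: algebra_simps flip: exp_add)
      finally show ?thesis by (simp add: I_def)
    qed
    then show "\<exists>C>0. \<forall>z. norm (I z) \<le> C * exp ((\<tau> + e) * norm z)"
      using C e by (intro exI[of _ "2 * C / e"]) auto
  qed
  have Ib: "norm (I z) \<le> (K + 1) * exp (\<tau> * \<bar>Im z\<bar>)" for z
    by (rule exp_type_bounded_real[OF typeI \<tau> _ Ireal]) (use K0 in simp)
  have "norm (D z) \<le> ((K + 1) * exp \<tau>) * exp (\<tau> * \<bar>Im z\<bar>)" for z
  proof -
    have "norm ((deriv ^^ 1) I z) \<le> fact 1 * ((K + 1) * exp (\<tau> * (\<bar>Im z\<bar> + 1))) / 1 ^ 1"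
    proof (rule Cauchy_inequality)
      fix w assume w: "norm (z - w) = 1"
      have "\<bar>Im w\<bar> \<le> \<bar>Im z\<bar> + 1" using abs_Im_le_cmod[of "z - w"] w by auto
      then have "(K + 1) * exp (\<tau> * \<bar>Im w\<bar>) \<le> (K + 1) * exp (\<tau> * (\<bar>Im z\<bar> + 1))"
        using K0 \<tau> by (intro mult_left_mono) (auto intro!: mult_left_mono)
      then show "norm (I w) \<le> (K + 1) * exp (\<tau> * (\<bar>Im z\<bar> + 1))" using Ib[of w] by linarith
    qed (use holI holomorphic_on_imp_continuous_on in auto)
    moreover have "deriv I z = D z" by (rule DERIV_imp_deriv[OF I])
    ultimately show ?thesis by (simp add: algebra_simps exp_add)
  qed
  then show ?thesis using K0 by (intro exI[of _ "(K + 1) * exp \<tau>"]) auto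
qed

section \<open>Vanishing of the Fourier transform outside the band\<close>

lemma integrable_mult_bounded:
  fixes f g :: "'a \<Rightarrow> 'b::{real_normed_field, banach, second_countable_topology}"
  assumes f: "integrable M f" and g: "g \<in> borel_measurable M"
    and bdd: "\<And>x. norm (g x) \<le> B"
  shows "integrable M (\<lambda>x. f x * g x)"
proof (rule Bochner_Integration.integrable_bound)
  show "integrable M (\<lambda>x. B * norm (f x))" using f by simp
  have "norm (f x * g x) \<le> norm (B * norm (f x))" for x
    using mult_left_mono[OF order_trans[OF bdd[of x] abs_ge_self] norm_ge_zero[of "f x"]]
    by (simp add: norm_mult abs_mult mult.commute)
  then show "AE x in M. norm (f x * g x) \<le> norm (B * norm (f x))" by simp
qed (use f g in measurable)

lemma damping_norm:
  assumes "Im z \<ge> 0" "e > 0"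
  shows "norm ((1 - \<i> * of_real e * z)\<^sup>2) \<ge> 1"
    and "norm ((1 - \<i> * of_real e * z)\<^sup>2) \<ge> (e * Re z)\<^sup>2"
proof -
  have *: "norm ((1 - \<i> * of_real e * z)\<^sup>2) = (1 + e * Im z)\<^sup>2 + (e * Re z)\<^sup>2"
    by (simp add: norm_power cmod_power2)
  show "norm ((1 - \<i> * of_real e * z)\<^sup>2) \<ge> 1"
    unfolding * using assms by (simp add: power2_eq_square algebra_simps)
  show "norm ((1 - \<i> * of_real e * z)\<^sup>2) \<ge> (e * Re z)\<^sup>2"
    unfolding * by simp
qed

text \<open>The contour is closed in the upper half plane. The damping factor, whose pole lies in the lower half plane,
  makes the vertical sides negligible.\<close>

lemma exp_type_fourier_vanish_damped:
  assumes D: "exp_type_le \<tau> D" and \<tau>: "\<tau> \<ge> 0"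
    and int: "integrable lborel (\<lambda>x. D (of_real x))" and b: "b > \<tau>" and e: "e > 0"
  shows "(LINT x|lborel. D (of_real x) * exp (\<i> * of_real (b * x)) / (1 - \<i> * of_real (e * x))\<^sup>2) = 0"
proof -
  have hol: "D holomorphic_on UNIV" using D by (simp add: exp_type_le_def)
  obtain M where M: "M > 0" "\<And>z. norm (D z) \<le> M * exp (\<tau> * \<bar>Im z\<bar>)"
    using exp_type_le_L1_bound[OF D \<tau> int] by blast
  define h where "h = (\<lambda>z. D z * exp (\<i> * of_real b * z) / (1 - \<i> * of_real e * z)\<^sup>2)"
  \<comment> \<open>The integrand has its only pole at - i/e. This half plane avoids it, contains
    the closed upper half plane, and is convex, so a primitive exists on it.\<close>
  define S where "S = {z. Im z > - (1/e)}"
  have S: "convex S" "open S"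
    unfolding S_def by (simp_all add: convex_halfspace_Im_gt open_halfspace_Im_gt)
  have upS: "z \<in> S" if "Im z \<ge> 0" for z using that e by (simp add: S_def less_le_trans[of _ 0])
  have nz: "1 - \<i> * of_real e * z \<noteq> 0" if "z \<in> S" for z
  proof
    assume "1 - \<i> * of_real e * z = 0"
    then have "1 + e * Im z = 0" by (simp add: complex_eq_iff)
    then show False using that e by (simp add: S_def field_simps)
  qed
  have holh: "h holomorphic_on S"
    unfolding h_def using nz by (intro holomorphic_intros holomorphic_on_subset[OF hol]) auto
  obtain F where F0: "\<And>z. z \<in> S \<Longrightarrow> (F has_field_derivative h z) (at z within S)"
    using holomorphic_convex_primitive'[OF S holh] by auto
  have F: "(F has_field_derivative h z) (at z)" if "z \<in> S" for z
    using F0[OF that] at_within_open[OF that S(2)] by simp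
  have hb: "norm (h z) \<le> M * exp (- (b - \<tau>) * Im z) / norm ((1 - \<i> * of_real e * z)\<^sup>2)"
    if "Im z \<ge> 0" for z
  proof -
    have "norm (D z * exp (\<i> * of_real b * z)) \<le> M * exp (\<tau> * \<bar>Im z\<bar>) * exp (- b * Im z)"
      unfolding norm_mult using M by (intro mult_mono) auto
    also have "\<dots> = M * exp (- (b - \<tau>) * Im z)" using that by (simp add: algebra_simps flip: exp_add)
    finally show ?thesis unfolding h_def norm_divide by (rule divide_right_mono) simp
  qed
  have hb1: "norm (h z) \<le> M * exp (- (b - \<tau>) * Im z)" if "Im z \<ge> 0" for z
  proof -
    have "M * exp (- (b - \<tau>) * Im z) / norm ((1 - \<i> * of_real e * z)\<^sup>2) \<le> M * exp (- (b - \<tau>) * Im z) / 1"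
      using damping_norm(1)[OF that e] M by (intro divide_left_mono) auto
    then show ?thesis using hb[OF that] by simp
  qed
  have hb2: "norm (h z) \<le> M / (e * R)\<^sup>2" if "Im z \<ge> 0" "\<bar>Re z\<bar> = R" "R > 0" for z R
  proof -
    have "M * exp (- (b - \<tau>) * Im z) / norm ((1 - \<i> * of_real e * z)\<^sup>2) \<le> M / (e * R)\<^sup>2"
    proof (rule frac_le)
      show "(e * R)\<^sup>2 \<le> norm ((1 - \<i> * of_real e * z)\<^sup>2)"
        using damping_norm(2)[OF that(1) e] that by (metis power2_abs abs_mult power_mult_distrib)
      have "(b - \<tau>) * Im z \<ge> 0" using b that by (intro mult_nonneg_nonneg) auto
      then have "exp (- (b - \<tau>) * Im z) \<le> 1" by (simp only: exp_le_one_iff mult_minus_left neg_le_0_iff_le)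
      then show "M * exp (- (b - \<tau>) * Im z) \<le> M" using M by simp
    qed (use M e that in auto)
    then show ?thesis using hb[OF that(1)] by linarith
  qed
  \<comment> \<open>Since \<open>F\<close> is a primitive, no contour integral is needed: the
    increment along the base is the sum of the increments along the two sides of length R and the
    top of length 2 R, each at most length times the supremum of \<open>h\<close>.\<close>
  have bound: "norm (F (of_real R) - F (of_real (- R))) \<le> 2 * (M / (e * R)\<^sup>2 * R) + M * exp (- (b - \<tau>) * R) * (2 * R)"
    if R: "R > 0" for R :: real
  proof -
    have side: "norm (F (of_real r + \<i> * of_real R) - F (of_real r)) \<le> M / (e * R)\<^sup>2 * R" if r: "\<bar>r\<bar> = R" for r
    proof -
      have sub: "Im z \<ge> 0" "Re z = r" if "z \<in> closed_segment (of_real r) (of_real r + \<i> * of_real R)" for z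
        using that R by (auto simp: closed_segment_def algebra_simps)
      have "norm (F (of_real r + \<i> * of_real R) - F (of_real r)) \<le> M / (e * R)\<^sup>2 * norm (of_real r + \<i> * of_real R - of_real r)"
        by (rule field_differentiable_bound[OF convex_closed_segment[of "of_real r" "of_real r + \<i> * of_real R"], where f' = h])
          (use sub R r in \<open>auto intro!: hb2 has_field_derivative_at_within[OF F[OF upS]]\<close>)
      then show ?thesis using R by (simp add: norm_mult)
    qed
    have top: "norm (F (of_real R + \<i> * of_real R) - F (of_real (- R) + \<i> * of_real R)) \<le> M * exp (- (b - \<tau>) * R) * (2 * R)"
    proof -
      let ?a = "of_real (- R) + \<i> * of_real R" and ?c = "of_real R + \<i> * of_real R"
      have sub: "Im z = R" if z: "z \<in> closed_segment ?a ?c" for z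
      proof -
        obtain u where "z = (1 - u) *\<^sub>R ?a + u *\<^sub>R ?c" using z by (auto simp: closed_segment_def)
        then have "Im z = (1 - u) * R + u * R" by simp
        then show ?thesis by (simp add: algebra_simps)
      qed
      have "norm (F ?c - F ?a) \<le> M * exp (- (b - \<tau>) * R) * norm (?c - ?a)"
      proof (rule field_differentiable_bound[OF convex_closed_segment[of ?a ?c], where f' = h])
        fix z assume z: "z \<in> closed_segment ?a ?c"
        show "norm (h z) \<le> M * exp (- (b - \<tau>) * R)" using hb1[of z] sub[OF z] R by simp
        show "(F has_field_derivative h z) (at z within closed_segment ?a ?c)"
          by (rule has_field_derivative_at_within[OF F[OF upS]]) (use sub[OF z] R in simp)
      qed auto
      moreover have "?c - ?a = of_real (2 * R)" by (simp add: complex_eq_iff)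
      ultimately show ?thesis using R by (simp only: norm_of_real abs_of_pos mult_pos_pos zero_less_numeral)
    qed
    let ?A = "F (of_real R + \<i> * of_real R) - F (of_real R)"
    let ?B = "F (of_real R + \<i> * of_real R) - F (of_real (- R) + \<i> * of_real R)"
    let ?C = "F (of_real (- R) + \<i> * of_real R) - F (of_real (- R))"
    have id: "a - d = ((b - c) - (b - a)) + (c - d)" for a b c d :: complex by simp
    have eq: "F (of_real R) - F (of_real (- R)) = (?B - ?A) + ?C" by (rule id)
    have "norm ((?B - ?A) + ?C) \<le> norm (?B - ?A) + norm ?C" by (rule norm_triangle_ineq)
    moreover have "norm (?B - ?A) \<le> norm ?B + norm ?A" by (rule norm_triangle_ineq4)
    moreover have "norm ?A \<le> M / (e * R)\<^sup>2 * R" "norm ?C \<le> M / (e * R)\<^sup>2 * R"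
      using R by (intro side; simp)+
    moreover note top
    ultimately show ?thesis unfolding eq by linarith
  qed
  let ?h = "\<lambda>x::real. h (of_real x)"
  have conth: "continuous_on UNIV ?h"
    by (intro continuous_on_compose2[OF holomorphic_on_imp_continuous_on[OF holh]] continuous_intros)
      (auto intro: upS)
  have inth: "integrable lborel ?h"
  proof -
    have *: "?h = (\<lambda>x. D (of_real x) * (exp (\<i> * of_real b * of_real x) / (1 - \<i> * of_real e * of_real x)\<^sup>2))"
      by (simp add: h_def)
    have nz': "(1 - \<i> * of_real e * of_real x)\<^sup>2 \<noteq> 0" for x :: real using nz[of "of_real x"] upS by simp
    show ?thesis unfolding *
    proof (rule integrable_mult_bounded[OF int])
      show "(\<lambda>x. exp (\<i> * of_real b * of_real x) / (1 - \<i> * of_real e * of_real x)\<^sup>2) \<in> borel_measurable lborel"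
        by measurable
      show "norm (exp (\<i> * of_real b * of_real x) / (1 - \<i> * of_real e * of_real x)\<^sup>2) \<le> 1" for x :: real
        using damping_norm(1)[of "of_real x" e] e nz'[of x] by (simp add: norm_divide divide_le_eq)
    qed
  qed
  have "(\<lambda>n. LBINT x. indicator {- real n..real n} x *\<^sub>R ?h x) \<longlonglongrightarrow> (LBINT x. ?h x)"
  proof (rule integral_dominated_convergence[where w = "\<lambda>x. norm (?h x)"])
    show "AE x in lborel. (\<lambda>n. indicator {- real n..real n} x *\<^sub>R ?h x) \<longlonglongrightarrow> ?h x"
    proof (rule AE_I2)
      fix x :: real
      have "eventually (\<lambda>n. \<bar>x\<bar> \<le> real n) sequentially"
        using filterlim_real_sequentially by (simp add: filterlim_at_top)
      then have "eventually (\<lambda>n. indicator {- real n..real n} x *\<^sub>R ?h x = ?h x) sequentially"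
        by eventually_elim (auto simp: indicator_def)
      then show "(\<lambda>n. indicator {- real n..real n} x *\<^sub>R ?h x) \<longlonglongrightarrow> ?h x"
        by (rule tendsto_eventually)
    qed
  qed (use inth in \<open>auto simp: indicator_def\<close>)
  moreover have "(LBINT x. indicator {- real n..real n} x *\<^sub>R ?h x) = F (of_real (real n)) - F (of_real (- real n))" for n
    by (rule integral_FTC_Icc) (auto intro!: has_vector_derivative_real_field F upS continuous_on_subset[OF conth])
  moreover have "(\<lambda>n. F (of_real (real n)) - F (of_real (- real n))) \<longlonglongrightarrow> 0"
  proof (rule Lim_null_comparison)
    show "eventually (\<lambda>n. norm (F (of_real (real n)) - F (of_real (- real n)))
        \<le> 2 * (M / (e * real n)\<^sup>2 * real n) + M * exp (- (b - \<tau>) * real n) * (2 * real n)) sequentially"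
      using eventually_gt_at_top[of 0] by eventually_elim (rule bound, simp)
    show "(\<lambda>n. 2 * (M / (e * real n)\<^sup>2 * real n) + M * exp (- (b - \<tau>) * real n) * (2 * real n)) \<longlonglongrightarrow> 0"
      using M e b by real_asymp
  qed
  ultimately have "(LBINT x. ?h x) = 0" using LIMSEQ_unique by fastforce
  then show ?thesis by (simp add: h_def mult.assoc)
qed

lemma integral_mult_tendsto_bounded:
  fixes f :: "'a \<Rightarrow> 'b::{real_normed_field, banach, second_countable_topology}"
  assumes f: "integrable M f" and g: "\<And>n. g n \<in> borel_measurable M"
    and bdd: "\<And>n x. norm (g n x) \<le> B" and lim: "\<And>x. (\<lambda>n. g n x) \<longlonglongrightarrow> g' x"
  shows "(\<lambda>n. LINT x|M. f x * g n x) \<longlonglongrightarrow> (LINT x|M. f x * g' x)"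
proof (rule integral_dominated_convergence[where w = "\<lambda>x. B * norm (f x)"])
  have [measurable]: "g' \<in> borel_measurable M"
    by (rule borel_measurable_LIMSEQ_metric[OF g lim])
  show "(\<lambda>x. f x * g' x) \<in> borel_measurable M" using f by measurable
  show "AE x in M. norm (f x * g n x) \<le> B * norm (f x)" for n
    using bdd by (auto simp: norm_mult mult.commute[of B] intro!: AE_I2 mult_left_mono)
  show "AE x in M. (\<lambda>n. f x * g n x) \<longlonglongrightarrow> f x * g' x"
    using lim by (auto intro!: AE_I2 tendsto_intros)
qed (use f g in auto)

text \<open>For b > \<open>\<tau>\<close> the damping is removed by dominated convergence. The
  endpoint b = \<open>\<tau>\<close> follows by letting the frequency decrease to it; this endpoint
  matters, since the square wave contains the frequency pi and Poisson summation the frequency 2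
  pi.\<close>

lemma exp_type_fourier_vanish:
  assumes D: "exp_type_le \<tau> D" and \<tau>: "\<tau> \<ge> 0"
    and int: "integrable lborel (\<lambda>x. D (of_real x))" and b: "b \<ge> \<tau>"
  shows "(LINT x|lborel. D (of_real x) * exp (\<i> * of_real (b * x))) = 0"
proof -
  have strict: "(LINT x|lborel. D (of_real x) * exp (\<i> * of_real (b * x))) = 0" if b: "b > \<tau>" for b
  proof -
    let ?g = "\<lambda>n x. exp (\<i> * of_real (b * x)) / (1 - \<i> * of_real (1 / real (Suc n) * x))\<^sup>2"
    have "(\<lambda>n. LINT x|lborel. D (of_real x) * ?g n x) \<longlonglongrightarrow> (LINT x|lborel. D (of_real x) * exp (\<i> * of_real (b * x)))"
    proof (rule integral_mult_tendsto_bounded[OF int, where B = 1])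
      show "norm (?g n x) \<le> 1" for n x
      proof -
        have "norm ((1 - \<i> * of_real (1 / real (Suc n) * x))\<^sup>2) \<ge> 1"
          using damping_norm(1)[of "of_real x" "1 / real (Suc n)"] by (simp add: mult.assoc)
        then have "1 / norm ((1 - \<i> * of_real (1 / real (Suc n) * x))\<^sup>2) \<le> 1"
          by (intro divide_le_eq_1[THEN iffD2]) auto
        then show ?thesis by (simp add: norm_divide)
      qed
      show "(\<lambda>n. ?g n x) \<longlonglongrightarrow> exp (\<i> * of_real (b * x))" for x
      proof -
        have t0: "(\<lambda>n. 1 / real (Suc n)) \<longlonglongrightarrow> 0" by real_asymp
        have "(\<lambda>n. ?g n x) \<longlonglongrightarrow> exp (\<i> * of_real (b * x)) / (1 - \<i> * of_real (0 * x))\<^sup>2"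
          by (intro tendsto_intros t0) simp
        then show ?thesis by simp
      qed
    qed measurable
    moreover have "(LINT x|lborel. D (of_real x) * ?g n x) = 0" for n
      using exp_type_fourier_vanish_damped[OF D \<tau> int b, of "1 / real (Suc n)"] by simp
    ultimately show ?thesis by (simp only: LIMSEQ_const_iff)
  qed
  let ?g = "\<lambda>n x. exp (\<i> * of_real ((b + 1 / real (Suc n)) * x))"
  have "(\<lambda>n. LINT x|lborel. D (of_real x) * ?g n x) \<longlonglongrightarrow> (LINT x|lborel. D (of_real x) * exp (\<i> * of_real (b * x)))"
  proof (rule integral_mult_tendsto_bounded[OF int, where B = 1])
    show "(\<lambda>n. ?g n x) \<longlonglongrightarrow> exp (\<i> * of_real (b * x))" for x
    proof -
      have "(\<lambda>n. 1 / real (Suc n)) \<longlonglongrightarrow> 0" by real_asymp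
      then have "(\<lambda>n. ?g n x) \<longlonglongrightarrow> exp (\<i> * of_real ((b + 0) * x))"
        by (intro tendsto_intros)
      then show ?thesis by simp
    qed
  qed auto
  moreover have "(LINT x|lborel. D (of_real x) * ?g n x) = 0" for n
  proof (rule strict)
    have "1 / real (Suc n) > 0" by simp
    then show "\<tau> < b + 1 / real (Suc n)" using b by linarith
  qed
  ultimately show ?thesis by (simp only: LIMSEQ_const_iff)
qed

lemma lborel_integral_reflect:
  fixes f :: "real \<Rightarrow> 'b::{banach, second_countable_topology}"
  shows "(LINT x|lborel. f (- x)) = (LINT x|lborel. f x)"
  using lborel_integral_real_affine[of "-1" f 0] by simp

lemma lborel_integrable_reflect:
  fixes f :: "real \<Rightarrow> 'b::{banach, second_countable_topology}"
  assumes "integrable lborel f" shows "integrable lborel (\<lambda>x. f (- x))"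
  using lborel_integrable_real_affine[OF assms, of "-1" 0] by simp

lemma exp_type_fourier_vanish_abs:
  assumes D: "exp_type_le \<tau> D" and \<tau>: "\<tau> \<ge> 0"
    and int: "integrable lborel (\<lambda>x. D (of_real x))" and b: "\<bar>b\<bar> \<ge> \<tau>"
  shows "(LINT x|lborel. D (of_real x) * exp (\<i> * of_real (b * x))) = 0"
proof (cases "b \<ge> 0")
  case True
  then show ?thesis using exp_type_fourier_vanish[OF D \<tau> int] b by simp
next
  case False
  have "integrable lborel (\<lambda>x. D (- of_real x))"
    using lborel_integrable_reflect[OF int] by simp
  then have "(LINT x|lborel. D (- of_real x) * exp (\<i> * of_real (- b * x))) = 0"
    using exp_type_fourier_vanish[OF exp_type_le_uminus[OF D] \<tau>, of "- b"] b False by simp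
  then show ?thesis
    using lborel_integral_reflect[of "\<lambda>x. D (of_real x) * exp (\<i> * of_real (b * x))"] by simp
qed

section \<open>Orthogonality to the square wave\<close>

text \<open>An odd power of the sine is a combination of exponentials with frequencies pi (2k - m).
  As 2k - m is odd, it is at least 1 in modulus, so every frequency lies outside the open
  band.\<close>

lemma exp_type_fourier_vanish_sin_power:
  assumes D: "exp_type_le pi D" and int: "integrable lborel (\<lambda>x. D (of_real x))" and m: "odd m"
  shows "(LINT x|lborel. D (of_real x) * of_real (sin (pi * x) ^ m)) = 0"
proof -
  let ?c = "\<lambda>k. of_nat (m choose k) * (-1) ^ (m - k) / (2 * \<i>) ^ m :: complex"
  let ?b = "\<lambda>k. pi * (2 * real k - real m)"
  have eq: "of_real (sin (pi * x) ^ m) = (\<Sum>k\<le>m. ?c k * exp (\<i> * of_real (?b k * x)))" for x :: real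
  proof -
    have "of_real (sin (pi * x) ^ m) = (sin (of_real (pi * x)) :: complex) ^ m"
      by (simp only: sin_of_real of_real_power)
    also have "\<dots> = (exp (\<i> * of_real (pi * x)) + - exp (- (\<i> * of_real (pi * x)))) ^ m / (2 * \<i>) ^ m"
      unfolding sin_exp_eq by (simp only: power_divide add_uminus_conv_diff)
    also have "(exp (\<i> * of_real (pi * x)) + - exp (- (\<i> * of_real (pi * x)))) ^ m
        = (\<Sum>k\<le>m. of_nat (m choose k) * exp (\<i> * of_real (pi * x)) ^ k * (- exp (- (\<i> * of_real (pi * x)))) ^ (m - k))"
      by (rule binomial_ring)
    also have "\<dots> = (\<Sum>k\<le>m. of_nat (m choose k) * (-1) ^ (m - k) * exp (\<i> * of_real (?b k * x)))"
    proof (rule sum.cong[OF refl])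
      fix k assume "k \<in> {..m}"
      then have k: "k \<le> m" by simp
      have "exp (\<i> * of_real (pi * x)) ^ k * exp (- (\<i> * of_real (pi * x))) ^ (m - k)
          = exp (\<i> * of_real (?b k * x))"
        using k by (simp add: algebra_simps of_nat_diff flip: exp_of_nat_mult exp_add)
      then show "of_nat (m choose k) * exp (\<i> * of_real (pi * x)) ^ k * (- exp (- (\<i> * of_real (pi * x)))) ^ (m - k)
          = of_nat (m choose k) * (-1) ^ (m - k) * exp (\<i> * of_real (?b k * x))"
        by (subst power_minus) (simp add: mult_ac)
    qed
    finally show ?thesis by (simp add: sum_divide_distrib)
  qed
  have int': "integrable lborel (\<lambda>x. D (of_real x) * exp (\<i> * of_real (?b k * x)))" for k
    by (rule integrable_mult_bounded[OF int, where B = 1]) auto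
  have z: "(LINT x|lborel. D (of_real x) * exp (\<i> * of_real (?b k * x))) = 0" for k
  proof (rule exp_type_fourier_vanish_abs[OF D _ int])
    have "2 * int k - int m \<noteq> 0" using m by presburger
    then have "\<bar>2 * int k - int m\<bar> \<ge> 1" by linarith
    then have "\<bar>2 * real k - real m\<bar> \<ge> 1" by linarith
    then show "pi \<le> \<bar>?b k\<bar>" by (simp add: abs_mult)
  qed simp
  have "(LINT x|lborel. D (of_real x) * of_real (sin (pi * x) ^ m))
      = (LINT x|lborel. (\<Sum>k\<le>m. ?c k * (D (of_real x) * exp (\<i> * of_real (?b k * x)))))"
    unfolding eq sum_distrib_left by (intro Bochner_Integration.integral_cong refl sum.cong) (simp_all add: mult_ac)
  also have "\<dots> = (\<Sum>k\<le>m. ?c k * (LINT x|lborel. D (of_real x) * exp (\<i> * of_real (?b k * x))))"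
    by (subst Bochner_Integration.integral_sum) (use int' in auto)
  finally show ?thesis using z by simp
qed

text \<open>The function v / sqrt (v^2 + e) tends to the sign of v and is bounded by 1. The
  Weierstrass theorem is applied to 1 / sqrt (y + e) on [0,1] and the result is used as v p(v^2),
  which makes the approximating polynomial odd by construction.\<close>

lemma odd_polynomials_tendsto_sgn:
  "\<exists>a N. (\<forall>n v. \<bar>v\<bar> \<le> 1 \<longrightarrow> \<bar>\<Sum>i\<le>N n. a n i * v ^ (2*i+1)\<bar> \<le> (2::real)) \<and>
     (\<forall>v. \<bar>v\<bar> \<le> 1 \<longrightarrow> (\<lambda>n. \<Sum>i\<le>(N n::nat). a n i * v ^ (2*i+1)) \<longlonglongrightarrow> sgn v)"
proof -
  define e where "e = (\<lambda>n::nat. 1 / real (Suc n))"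
  have e: "e n > 0" "e n \<le> 1" for n by (auto simp: e_def)
  have "\<exists>a N. \<forall>y\<in>{0..1}. \<bar>1 / sqrt (y + e n) - (\<Sum>i\<le>N. a i * y ^ i)\<bar> < e n" for n
  proof -
    have "continuous_on {0..1} (\<lambda>y. 1 / sqrt (y + e n))"
      using e[of n] by (intro continuous_intros) (auto simp: add_nonneg_eq_0_iff)
    then obtain g where g: "real_polynomial_function g" "\<And>y. y \<in> {0..1} \<Longrightarrow> \<bar>1 / sqrt (y + e n) - g y\<bar> < e n"
      using Stone_Weierstrass_real_polynomial_function[of "{0..1}" "\<lambda>y. 1 / sqrt (y + e n)" "e n"] e by auto
    then show ?thesis unfolding real_polynomial_function_iff_sum by metis
  qed
  then obtain a N where aN: "\<And>n y. y \<in> {0..1} \<Longrightarrow> \<bar>1 / sqrt (y + e n) - (\<Sum>i\<le>N n. a n i * y ^ i)\<bar> < e n"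
    by metis
  have p: "\<bar>v / sqrt (v\<^sup>2 + e n) - (\<Sum>i\<le>N n. a n i * v ^ (2*i+1))\<bar> \<le> e n" if v: "\<bar>v\<bar> \<le> 1" for v n
  proof -
    have "v\<^sup>2 \<in> {0..1}" using v by (simp add: abs_square_le_1)
    note * = aN[OF this, of n]
    have pw: "v ^ (2*i+1) = v * (v\<^sup>2) ^ i" for i by (simp add: power_mult)
    have "v / sqrt (v\<^sup>2 + e n) - (\<Sum>i\<le>N n. a n i * v ^ (2*i+1)) = v * (1 / sqrt (v\<^sup>2 + e n) - (\<Sum>i\<le>N n. a n i * (v\<^sup>2) ^ i))"
      unfolding pw right_diff_distrib sum_distrib_left by (simp add: mult.left_commute)
    then have "\<bar>v / sqrt (v\<^sup>2 + e n) - (\<Sum>i\<le>N n. a n i * v ^ (2*i+1))\<bar> = \<bar>v\<bar> * \<bar>1 / sqrt (v\<^sup>2 + e n) - (\<Sum>i\<le>N n. a n i * (v\<^sup>2) ^ i)\<bar>"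
      by (simp add: abs_mult)
    also have "\<dots> \<le> 1 * e n" using v * by (intro mult_mono) auto
    finally show ?thesis by simp
  qed
  have q: "\<bar>v / sqrt (v\<^sup>2 + e n)\<bar> \<le> 1" for v n
  proof -
    have "\<bar>v\<bar> \<le> sqrt (v\<^sup>2 + e n)" using e[of n] by (intro real_le_rsqrt) simp
    moreover have "sqrt (v\<^sup>2 + e n) > 0" using e[of n] by (simp add: add_nonneg_pos)
    ultimately show ?thesis by (simp add: abs_divide divide_le_eq)
  qed
  have lim: "(\<lambda>n. \<Sum>i\<le>N n. a n i * v ^ (2*i+1)) \<longlonglongrightarrow> sgn v" if v: "\<bar>v\<bar> \<le> 1" for v
  proof -
    have e0: "e \<longlonglongrightarrow> 0" unfolding e_def by real_asymp
    have "(\<lambda>n. v / sqrt (v\<^sup>2 + e n)) \<longlonglongrightarrow> sgn v"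
    proof (cases "v = 0")
      case False
      have "(\<lambda>n. v / sqrt (v\<^sup>2 + e n)) \<longlonglongrightarrow> v / sqrt (v\<^sup>2 + 0)"
        by (intro tendsto_intros e0) (use False in auto)
      then show ?thesis by (simp add: sgn_real_def) (use False in \<open>auto simp: sgn_real_def abs_if split: if_splits\<close>)
    qed auto
    moreover have "(\<lambda>n. v / sqrt (v\<^sup>2 + e n) - (\<Sum>i\<le>N n. a n i * v ^ (2*i+1))) \<longlonglongrightarrow> 0"
      by (rule Lim_null_comparison[OF _ e0]) (use p[OF v] in auto)
    ultimately show ?thesis using tendsto_diff by fastforce
  qed
  have "\<bar>\<Sum>i\<le>N n. a n i * v ^ (2*i+1)\<bar> \<le> 2" if "\<bar>v\<bar> \<le> 1" for n v
    using p[OF that, of n] q[of v n] e[of n] by linarith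
  then show ?thesis using lim by (intro exI[of _ a] exI[of _ N]) blast
qed

text \<open>Bounded pointwise convergence of odd polynomials in \<open>sin (pi * x)\<close> permits
  dominated convergence against \<open>D\<close>. The Fourier series of the square wave, which is
  not absolutely convergent, is thereby avoided.\<close>

lemma exp_type_pi_orthogonal_square_wave:
  assumes D: "exp_type_le pi D" and int: "integrable lborel (\<lambda>x. D (of_real x))"
  shows "(LINT x|lborel. D (of_real x) * of_real (sgn (sin (pi * x)))) = 0"
proof -
  obtain a N where ex: "(\<forall>n v. \<bar>v\<bar> \<le> 1 \<longrightarrow> \<bar>\<Sum>i\<le>N n. a n i * v ^ (2*i+1)\<bar> \<le> (2::real)) \<and>
     (\<forall>v. \<bar>v\<bar> \<le> 1 \<longrightarrow> (\<lambda>n. \<Sum>i\<le>(N n::nat). a n i * v ^ (2*i+1)) \<longlonglongrightarrow> sgn v)"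
    using odd_polynomials_tendsto_sgn by (elim exE) (rule that)
  note aN = ex[THEN conjunct1, rule_format] ex[THEN conjunct2, rule_format]
  let ?g = "\<lambda>n x. complex_of_real (\<Sum>i\<le>N n. a n i * sin (pi * x) ^ (2*i+1))"
  have "(\<lambda>n. LINT x|lborel. D (of_real x) * ?g n x) \<longlonglongrightarrow> (LINT x|lborel. D (of_real x) * of_real (sgn (sin (pi * x))))"
  proof (rule integral_mult_tendsto_bounded[OF int, where B = 2])
    show "norm (?g n x) \<le> 2" for n x
      unfolding norm_of_real using aN(1)[of "sin (pi * x)" n] by simp
    show "(\<lambda>n. ?g n x) \<longlonglongrightarrow> of_real (sgn (sin (pi * x)))" for x
      using aN(2)[of "sin (pi * x)"] by (intro tendsto_of_real) simp
  qed measurable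
  moreover have "(LINT x|lborel. D (of_real x) * ?g n x) = 0" for n
  proof -
    have "(LINT x|lborel. D (of_real x) * ?g n x)
      = (LINT x|lborel. (\<Sum>i\<le>N n. of_real (a n i) * (D (of_real x) * of_real (sin (pi * x) ^ (2*i+1)))))"
      unfolding of_real_sum sum_distrib_left by (intro Bochner_Integration.integral_cong refl sum.cong) (simp_all add: mult_ac)
    also have "\<dots> = (\<Sum>i\<le>N n. of_real (a n i) * (LINT x|lborel. D (of_real x) * of_real (sin (pi * x) ^ (2*i+1))))"
    proof (subst Bochner_Integration.integral_sum)
      fix i :: nat
      have "integrable lborel (\<lambda>x. D (of_real x) * of_real (sin (pi * x) ^ (2*i+1)))"
        by (rule integrable_mult_bounded[OF int, where B = 1])
          (auto simp: norm_mult norm_power intro!: mult_le_one power_le_one)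
      then show "integrable lborel (\<lambda>x. of_real (a n i) * (D (of_real x) * of_real (sin (pi * x) ^ (2*i+1))))"
        by simp
    qed simp
    also have "\<dots> = 0"
    proof (intro sum.neutral ballI)
      fix i :: nat
      have "odd (2*i+1)" for i :: nat by simp
      from exp_type_fourier_vanish_sin_power[OF D int this]
      show "of_real (a n i) * (LINT x|lborel. D (of_real x) * of_real (sin (pi * x) ^ (2*i+1))) = 0"
        by (simp only: mult_zero_right)
    qed
    finally show ?thesis .
  qed
  ultimately show ?thesis by (simp only: LIMSEQ_const_iff)
qed

section \<open>Poisson summation\<close>

lemma cos_even_power_expansion:
  fixes t :: real
  shows "4 ^ N * cos t ^ (2*N) = real (2*N choose N) + 2 * (\<Sum>j<N. real (2*N choose (N + Suc j)) * cos (2 * real (Suc j) * t))"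
proof -
  let ?f = "\<lambda>m. real (2*N choose m) * cos ((2 * real m - 2 * real N) * t)"
  have "4 ^ N * cos t ^ (2*N) = Re (of_real ((2 * cos t) ^ (2*N)))"
    by (simp add: power_mult_distrib power_mult)
  also have "of_real ((2 * cos t) ^ (2*N)) = (cis t + cis (- t)) ^ (2*N)"
  proof -
    have "cis t + cis (- t) = of_real (2 * cos t)" by (simp add: complex_eq_iff)
    then show ?thesis by simp
  qed
  also have "\<dots> = (\<Sum>m\<le>2*N. of_nat (2*N choose m) * cis t ^ m * cis (- t) ^ (2*N - m))"
    by (rule binomial_ring)
  also have "Re \<dots> = (\<Sum>m\<le>2*N. ?f m)"
  proof (subst Re_sum, rule sum.cong[OF refl])
    fix m assume "m \<in> {..2*N}"
    then have m: "m \<le> 2*N" by simp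
    have "cis t ^ m * cis (- t) ^ (2*N - m) = cis ((2 * real m - 2 * real N) * t)"
      unfolding Complex.DeMoivre cis_mult using m by (simp add: of_nat_diff algebra_simps)
    then show "Re (of_nat (2*N choose m) * cis t ^ m * cis (- t) ^ (2*N - m)) = ?f m"
      by (simp add: mult.assoc)
  qed
  also have "{..2*N} = {..<N} \<union> {N} \<union> {N<..2*N}" by auto
  also have "sum ?f \<dots> = sum ?f {..<N} + ?f N + sum ?f {N<..2*N}"
    by (subst sum.union_disjoint; (subst sum.union_disjoint)?) auto
  also have "sum ?f {N<..2*N} = (\<Sum>j<N. real (2*N choose (N + Suc j)) * cos (2 * real (Suc j) * t))"
    by (rule sum.reindex_bij_witness[of _ "\<lambda>j. N + Suc j" "\<lambda>m. m - Suc N"]) (auto simp: algebra_simps)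
  also have "sum ?f {..<N} = (\<Sum>j<N. real (2*N choose (N + Suc j)) * cos (2 * real (Suc j) * t))"
  proof (rule sum.reindex_bij_witness[of _ "\<lambda>j. N - Suc j" "\<lambda>m. N - Suc m"])
    fix j assume j: "j \<in> {..<N}"
    have "2*N choose (N + Suc (N - Suc j)) = 2*N choose j"
      using j by (subst binomial_symmetric) (auto intro!: arg_cong[where f = "binomial (2*N)"])
    moreover have "2 * real (Suc (N - Suc j)) * t = - ((2 * real j - 2 * real N) * t)"
      using j by (simp add: of_nat_diff algebra_simps)
    ultimately show "real (2*N choose (N + Suc (N - Suc j))) * cos (2 * real (Suc (N - Suc j)) * t) = ?f j"
      by (simp only: cos_minus)
  qed auto
  finally show ?thesis by simp
qed

text \<open>Consecutive ratios differ by the factor (N - j) / (N + j + 1), which tends to 1 for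
  fixed j. Hence each Fourier coefficient of \<open>cos_kernel\<close> tends to 1.\<close>

lemma central_binomial_ratio_tendsto:
  "(\<lambda>N. real (2*N choose (N + j)) / real (2*N choose N)) \<longlonglongrightarrow> 1"
proof (induction j)
  case 0
  have "real (2*N choose N) \<noteq> 0" for N by simp
  then show ?case by simp
next
  case (Suc j)
  have "(\<lambda>N. (real N - real j) / (real N + real j + 1)) \<longlonglongrightarrow> 1" by real_asymp
  from tendsto_mult[OF this Suc.IH]
  have "(\<lambda>N. (real N - real j) / (real N + real j + 1) * (real (2*N choose (N + j)) / real (2*N choose N))) \<longlonglongrightarrow> 1"
    by simp
  moreover have "eventually (\<lambda>N. (real N - real j) / (real N + real j + 1) * (real (2*N choose (N + j)) / real (2*N choose N))
      = real (2*N choose (N + Suc j)) / real (2*N choose N)) sequentially"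
    using eventually_ge_at_top[of j]
  proof eventually_elim
    case (elim N)
    have "(2*N choose Suc (N + j)) * Suc (N + j) = (2*N choose (N + j)) * (2*N - (N + j))"
      using binomial_absorb_comp[of "2*N" "N+j"] Suc_times_binomial_eq[of "2*N - 1" "N+j"] elim
      by (metis binomial_absorption mult.commute choose_mult_lemma binomial_absorb_comp Suc_times_binomial)
    then have "real ((2*N choose Suc (N + j)) * Suc (N + j)) = real ((2*N choose (N + j)) * (2*N - (N + j)))"
      by (simp only:)
    then have "real (2*N choose (N + Suc j)) * (real N + real j + 1) = real (2*N choose (N + j)) * (real N - real j)"
      using elim by (simp add: of_nat_diff algebra_simps)
    then have "real (2*N choose (N + Suc j)) = real (2*N choose (N + j)) * (real N - real j) / (real N + real j + 1)"
      by (simp add: eq_divide_eq)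
    then show ?case by (simp add: mult.commute)
  qed
  ultimately show ?case by (rule Lim_transform_eventually)
qed

lemma central_binomial_ratio_le: "real (2*N choose k) / real (2*N choose N) \<le> 1"
  using binomial_maximum'[of N k] by (simp add: divide_le_eq)

text \<open>A nonnegative trigonometric polynomial of unit mass over a period, used in place of the Fejer kernel: its Fourier
  coefficients are quotients of binomial coefficients.\<close>

definition cos_kernel :: "nat \<Rightarrow> real \<Rightarrow> real" where
  "cos_kernel N x = 4 ^ N * cos (pi * x) ^ (2*N) / real (2*N choose N)"

lemma cos_kernel_nonneg: "cos_kernel N x \<ge> 0"
  by (simp add: cos_kernel_def power_mult)

lemma cos_kernel_expansion:
  "cos_kernel N x = 1 + 2 * (\<Sum>j<N. real (2*N choose (N + Suc j)) / real (2*N choose N) * cos (2 * pi * real (Suc j) * x))"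
  unfolding cos_kernel_def cos_even_power_expansion
  by (simp add: add_divide_distrib sum_divide_distrib sum_distrib_left mult_ac)

lemma cos_kernel_periodic: "cos_kernel N (x + of_int n) = cos_kernel N x"
proof -
  have "(cos (pi * (x + of_int n)))\<^sup>2 = (cos (pi * x))\<^sup>2"
    by (simp add: distrib_left cos_add sin_times_pi_eq_0 power_mult_distrib cos_int_times_real
        sin_int_times_real flip: mult.commute[of pi])
  then show ?thesis by (simp add: cos_kernel_def power_mult)
qed

lemma continuous_on_cos_kernel: "continuous_on A (cos_kernel N)"
  unfolding cos_kernel_def by (intro continuous_intros) auto

lemma integral_cos_period:
  "((\<lambda>x. cos (2 * pi * real (Suc j) * x)) has_integral 0) {-1/2..1/2::real}"
proof -
  let ?F = "\<lambda>x. sin (2 * pi * real (Suc j) * x) / (2 * pi * real (Suc j))"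
  have "((\<lambda>x. cos (2 * pi * real (Suc j) * x)) has_integral (?F (1/2) - ?F (-1/2))) {-1/2..1/2}"
    by (rule fundamental_theorem_of_calculus)
      (auto intro!: derivative_eq_intros simp: has_real_derivative_iff_has_vector_derivative[symmetric])
  moreover have "sin (pi * real (Suc j)) = 0" by (metis mult.commute sin_npi)
  ultimately show ?thesis by (simp add: mult.assoc)
qed

lemma has_integral_cos_kernel: "(cos_kernel N has_integral 1) {-1/2..1/2}"
proof -
  have "((\<lambda>x. 1 + 2 * (\<Sum>j<N. real (2*N choose (N + Suc j)) / real (2*N choose N) * cos (2 * pi * real (Suc j) * x)))
      has_integral (1 + 2 * (\<Sum>j<N. real (2*N choose (N + Suc j)) / real (2*N choose N) * 0))) {-1/2..1/2::real}"
    using has_integral_const_real[of "1::real" "-1/2" "1/2"]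
    by (intro has_integral_add has_integral_mult_right has_integral_sum integral_cos_period) auto
  then show ?thesis by (simp add: cos_kernel_expansion[abs_def])
qed

text \<open>Multiplication by the squared cosine turns one kernel into a multiple of the next, with
  factor (2 N + 1) / (2 N + 2). The resulting integral plays the role of a variance: its decay is
  what concentrates the kernel at 0.\<close>

lemma has_integral_cos_kernel_sin_sq:
  "((\<lambda>x. cos_kernel N x * (sin (pi * x))\<^sup>2) has_integral (1 / (2 * real N + 2))) {-1/2..1/2}"
proof -
  have c: "real (2 * Suc N choose Suc N) * (real N + 1) = 2 * (2 * real N + 1) * real (2*N choose N)"
  proof -
    have "Suc N * (2 * Suc N choose Suc N) = 2 * (2*N+1) * (2*N choose N)"
    proof -
      define D where "D = Suc (2*N) choose Suc N"
      have "Suc (2*N) choose N = D"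
        unfolding D_def by (subst binomial_symmetric) (auto intro!: arg_cong[where f = "binomial (Suc (2*N))"])
      then have "2 * Suc N choose Suc N = 2 * D"
        using binomial_Suc_Suc[of "Suc (2*N)" N] by (simp del: binomial_Suc_Suc add: D_def)
      moreover have "Suc N * D = Suc (2*N) * (2*N choose N)"
        unfolding D_def by (rule Suc_times_binomial)
      ultimately show ?thesis by simp
    qed
    then have "real (Suc N * (2 * Suc N choose Suc N)) = real (2 * (2*N+1) * (2*N choose N))"
      by (simp only:)
    then show ?thesis by (simp add: algebra_simps)
  qed
  have "cos_kernel N x * (sin (pi * x))\<^sup>2 = cos_kernel N x - (2 * real N + 1) / (2 * real N + 2) * cos_kernel (Suc N) x" for x
  proof -
    have nz: "real (2*N choose N) \<noteq> 0" by simp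
    have b: "real (2 * Suc N choose Suc N) = 2 * (2 * real N + 1) * real (2*N choose N) / (real N + 1)"
      using c by (simp add: field_simps)
    have "cos_kernel (Suc N) x = 4 * (4 ^ N * cos (pi * x) ^ (2*N)) * (cos (pi * x))\<^sup>2 / (2 * (2 * real N + 1) * real (2*N choose N) / (real N + 1))"
      unfolding cos_kernel_def b by (simp add: power2_eq_square mult_ac)
    also have "\<dots> = (2 * real N + 2) / (2 * real N + 1) * cos_kernel N x * (cos (pi * x))\<^sup>2"
      unfolding cos_kernel_def using nz by (simp add: divide_simps) (simp add: algebra_simps)
    finally have "(2 * real N + 1) / (2 * real N + 2) * cos_kernel (Suc N) x = cos_kernel N x * (cos (pi * x))\<^sup>2"
      by (simp add: divide_simps) (simp add: algebra_simps)
    then show ?thesis by (simp add: sin_squared_eq algebra_simps)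
  qed
  moreover have "((\<lambda>x. cos_kernel N x - (2 * real N + 1) / (2 * real N + 2) * cos_kernel (Suc N) x)
      has_integral (1 - (2 * real N + 1) / (2 * real N + 2) * 1)) {-1/2..1/2}"
    by (intro has_integral_diff has_integral_mult_right has_integral_cos_kernel)
  moreover have "1 - (2 * real N + 1) / (2 * real N + 2) * 1 = 1 / (2 * real N + 2)" by (simp add: field_simps)
  ultimately show ?thesis by simp
qed

text \<open>Chebyshev's argument: near 0 continuity makes \<open>g x - g 0\<close> small, and
  elsewhere it is at most a constant times \<open>(sin (pi * x))\<^sup>2\<close>, whose integral
  against the kernel is 1 / (2 N + 2).\<close>

lemma cos_kernel_approximate_identity:
  assumes cont: "continuous_on {-1/2..1/2} g"
  shows "(\<lambda>N. integral {-1/2..1/2} (\<lambda>x. cos_kernel N x * g x)) \<longlonglongrightarrow> g (0::real)"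
proof (rule LIMSEQ_I)
  fix r :: real assume r: "r > 0"
  have "compact (g ` {-1/2..1/2})" by (rule compact_continuous_image[OF cont]) simp
  then obtain G where G: "\<And>x. x \<in> {-1/2..1/2} \<Longrightarrow> \<bar>g x\<bar> \<le> G"
    using compact_imp_bounded[THEN bounded_iff[THEN iffD1]] by (metis image_eqI real_norm_def)
  have G0: "G \<ge> 0" using G[of 0] by simp
  obtain d where d: "d > 0" "\<And>x. x \<in> {-1/2..1/2} \<Longrightarrow> \<bar>x\<bar> < d \<Longrightarrow> \<bar>g x - g 0\<bar> < r/2"
    using cont[unfolded continuous_on_iff, rule_format, of 0 "r/2"] r by (auto simp: dist_real_def)
  define d' where "d' = min d (1/2)"
  have d': "d' > 0" "d' \<le> 1/2" "d' \<le> d" using d by (auto simp: d'_def)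
  define s where "s = (sin (pi * d'))\<^sup>2"
  have s: "s > 0" unfolding s_def using d' by (intro zero_less_power sin_gt_zero) auto
  have est: "\<bar>g x - g 0\<bar> \<le> r/2 + 2 * G / s * (sin (pi * x))\<^sup>2" if x: "x \<in> {-1/2..1/2}" for x
  proof (cases "\<bar>x\<bar> < d'")
    case True
    then have "\<bar>g x - g 0\<bar> < r/2" using d x d' by auto
    moreover have "2 * G / s * (sin (pi * x))\<^sup>2 \<ge> 0" using G0 s by auto
    ultimately show ?thesis by linarith
  next
    case False
    have "pi * d' \<ge> 0" using d' by simp
    then have "sin (pi * d') \<le> sin (pi * \<bar>x\<bar>)"
      using False x d' pi_gt_zero by (intro sin_monotone_2pi_le) (linarith | auto simp: abs_if split: if_splits)+
    moreover have "sin (pi * d') \<ge> 0" using d' by (intro sin_ge_zero) auto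
    ultimately have "s \<le> (sin (pi * \<bar>x\<bar>))\<^sup>2" unfolding s_def by (intro power_mono)
    also have "\<dots> = (sin (pi * x))\<^sup>2" by (auto simp: abs_if)
    finally have "2 * G / s * s \<le> 2 * G / s * (sin (pi * x))\<^sup>2"
      using G0 s by (intro mult_left_mono) auto
    moreover have "\<bar>g x - g 0\<bar> \<le> 2 * G" using G[OF x] G[of 0] by simp
    ultimately show ?thesis using s r by simp
  qed
  let ?K = cos_kernel
  have int: "(\<lambda>x. ?K N x * g x) integrable_on {-1/2..1/2}" for N
    by (intro integrable_continuous_real continuous_intros continuous_on_cos_kernel cont)
  have bound: "\<bar>integral {-1/2..1/2} (\<lambda>x. ?K N x * g x) - g 0\<bar> \<le> r/2 + 2 * G / s * (1 / (2 * real N + 2))" for N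
  proof -
    have "((\<lambda>x. ?K N x * g x - ?K N x * g 0) has_integral (integral {-1/2..1/2} (\<lambda>x. ?K N x * g x) - 1 * g 0)) {-1/2..1/2}"
      by (intro has_integral_diff has_integral_mult_left has_integral_cos_kernel integrable_integral int)
    moreover have "((\<lambda>x. ?K N x * (r/2) + 2 * G / s * (?K N x * (sin (pi * x))\<^sup>2)) has_integral
        (1 * (r/2) + 2 * G / s * (1 / (2 * real N + 2)))) {-1/2..1/2}"
      by (intro has_integral_add has_integral_mult_left has_integral_mult_right has_integral_cos_kernel
          has_integral_cos_kernel_sin_sq)
    moreover have "norm (?K N x * g x - ?K N x * g 0) \<le> ?K N x * (r/2) + 2 * G / s * (?K N x * (sin (pi * x))\<^sup>2)"
      if "x \<in> {-1/2..1/2}" for x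
    proof -
      have "norm (?K N x * g x - ?K N x * g 0) = ?K N x * \<bar>g x - g 0\<bar>"
        using cos_kernel_nonneg[of N x] by (simp add: abs_mult flip: right_diff_distrib)
      also have "\<dots> \<le> ?K N x * (r/2 + 2 * G / s * (sin (pi * x))\<^sup>2)"
        by (intro mult_left_mono est that cos_kernel_nonneg)
      finally show ?thesis by (simp add: algebra_simps)
    qed
    ultimately have "norm (integral {-1/2..1/2} (\<lambda>x. ?K N x * g x) - 1 * g 0) \<le> 1 * (r/2) + 2 * G / s * (1 / (2 * real N + 2))"
      using integral_norm_bound_integral[of "\<lambda>x. ?K N x * g x - ?K N x * g 0" "{-1/2..1/2}"
          "\<lambda>x. ?K N x * (r/2) + 2 * G / s * (?K N x * (sin (pi * x))\<^sup>2)"]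
      by (metis (no_types, lifting) has_integral_integrable integral_unique)
    then show ?thesis by simp
  qed
  have "(\<lambda>N. 2 * G / s * (1 / (2 * real N + 2))) \<longlonglongrightarrow> 0" by real_asymp
  then have "eventually (\<lambda>N. 2 * G / s * (1 / (2 * real N + 2)) < r/2) sequentially"
    using r by (intro order_tendstoD) auto
  then obtain N0 where N0: "\<And>N. N \<ge> N0 \<Longrightarrow> 2 * G / s * (1 / (2 * real N + 2)) < r/2"
    by (auto simp: eventually_sequentially)
  show "\<exists>N0. \<forall>N\<ge>N0. norm (integral {-1/2..1/2} (\<lambda>x. ?K N x * g x) - g 0) < r"
  proof (intro exI[of _ N0] allI impI)
    fix N assume N: "N \<ge> N0"
    show "norm (integral {-1/2..1/2} (\<lambda>x. ?K N x * g x) - g 0) < r"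
      using bound[of N] N0[OF N] by (simp only: real_norm_def)
  qed
qed

lemma integrable_const_over_1_plus_square: "integrable lborel (\<lambda>x::real. C / (1 + x\<^sup>2))"
proof -
  have "integrable lborel (\<lambda>x::real. inverse (1 + x\<^sup>2))"
    using integrable_inverse_1_plus_square
    by (simp add: set_integrable_def einterval_def)
  then have "integrable lborel (\<lambda>x::real. C * inverse (1 + x\<^sup>2))" by (rule integrable_mult_right)
  then show ?thesis by (simp add: divide_inverse)
qed

lemma integrable_bounded_by_inverse_square:
  fixes E :: "real \<Rightarrow> 'b::{banach, second_countable_topology}"
  assumes "E \<in> borel_measurable borel" "\<And>x. norm (E x) \<le> C / (1 + x\<^sup>2)"
  shows "integrable lborel E"
proof (rule Bochner_Integration.integrable_bound[OF integrable_const_over_1_plus_square])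
  have "norm (E x) \<le> norm (C / (1 + x\<^sup>2))" for x
    unfolding real_norm_def[of "C / (1 + x\<^sup>2)"] by (rule order_trans[OF assms(2) abs_ge_self])
  then show "AE x in lborel. norm (E x) \<le> norm (C / (1 + x\<^sup>2))" by (intro AE_I2)
qed (use assms in simp)

text \<open>The line is cut into unit intervals centred at the integers, so that each cell contains
  one sample point in its middle. By evenness the cells around j and - j contribute equally.\<close>

lemma lborel_integral_even_cells:
  fixes g :: "real \<Rightarrow> real"
  assumes cont: "continuous_on UNIV g" and int: "integrable lborel g" and even: "\<And>x. g (- x) = g x"
  shows "(\<lambda>n. integral {-1/2..1/2} g + 2 * (\<Sum>j<n. integral {-1/2..1/2} (\<lambda>u. g (u + real (Suc j))))) \<longlonglongrightarrow> (LINT x|lborel. g x)"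
proof -
  have intg: "g integrable_on {a..b}" for a b
    by (rule integrable_continuous_real[OF continuous_on_subset[OF cont]]) auto
  have eq: "integral {- (real n + 1/2)..real n + 1/2} g
     = integral {-1/2..1/2} g + 2 * (\<Sum>j<n. integral {-1/2..1/2} (\<lambda>u. g (u + real (Suc j))))" for n
  proof (induction n)
    case (Suc n)
    have shift: "integral {real n + 1/2..real (Suc n) + 1/2} g = integral {-1/2..1/2} (\<lambda>u. g (u + real (Suc n)))"
    proof -
      have "(g has_integral integral {real n + 1/2..real (Suc n) + 1/2} g) (cbox (real n + 1/2) (real (Suc n) + 1/2))"
        using intg by (simp add: integrable_integral)
      from has_integral_affinity[OF this, of 1 "real (Suc n)"]
      have "((\<lambda>u. g (u + real (Suc n))) has_integral integral {real n + 1/2..real (Suc n) + 1/2} g) ((\<lambda>x. x - real (Suc n)) ` {real n + 1/2..real (Suc n) + 1/2})"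
        by simp
      also have "(\<lambda>x. x - real (Suc n)) ` {real n + 1/2..real (Suc n) + 1/2} = {-1/2..1/2}"
        by (auto simp: image_iff intro!: bexI[of _ "_ + real (Suc n)"])
      finally show ?thesis by (simp add: integral_unique)
    qed
    have refl: "integral {- (real (Suc n) + 1/2)..- (real n + 1/2)} g = integral {real n + 1/2..real (Suc n) + 1/2} g"
      using Henstock_Kurzweil_Integration.integral_reflect_real[of "real (Suc n) + 1/2" "real n + 1/2" g] even by simp
    have "integral {- (real (Suc n) + 1/2)..real (Suc n) + 1/2} g =
      integral {- (real (Suc n) + 1/2)..- (real n + 1/2)} g + integral {- (real n + 1/2)..real n + 1/2} g
      + integral {real n + 1/2..real (Suc n) + 1/2} g"
      using Henstock_Kurzweil_Integration.integral_combine[of "- (real (Suc n) + 1/2)" "- (real n + 1/2)" "real (Suc n) + 1/2" g]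
        Henstock_Kurzweil_Integration.integral_combine[of "- (real n + 1/2)" "real n + 1/2" "real (Suc n) + 1/2" g]
        intg by simp
    then show ?case unfolding refl shift Suc.IH by simp
  qed simp
  have "(\<lambda>n. LBINT x. indicator {- (real n + 1/2)..real n + 1/2} x *\<^sub>R g x) \<longlonglongrightarrow> (LBINT x. g x)"
  proof (rule integral_dominated_convergence[where w = "\<lambda>x. norm (g x)"])
    show "AE x in lborel. (\<lambda>n. indicator {- (real n + 1/2)..real n + 1/2} x *\<^sub>R g x) \<longlonglongrightarrow> g x"
    proof (rule AE_I2)
      fix x :: real
      have "eventually (\<lambda>n. \<bar>x\<bar> \<le> real n) sequentially"
        using filterlim_real_sequentially by (simp add: filterlim_at_top)
      then have "eventually (\<lambda>n. indicator {- (real n + 1/2)..real n + 1/2} x *\<^sub>R g x = g x) sequentially"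
        by eventually_elim (auto simp: indicator_def)
      then show "(\<lambda>n. indicator {- (real n + 1/2)..real n + 1/2} x *\<^sub>R g x) \<longlonglongrightarrow> g x"
        by (rule tendsto_eventually)
    qed
  qed (use int in \<open>auto simp: indicator_def\<close>)
  moreover have "(LBINT x. indicator {- (real n + 1/2)..real n + 1/2} x *\<^sub>R g x) = integral {- (real n + 1/2)..real n + 1/2} g" for n
  proof -
    have "set_integrable lborel {- (real n + 1/2)..real n + 1/2} g"
      unfolding set_integrable_def by (rule integrable_mult_indicator[OF _ int]) simp
    from set_borel_integral_eq_integral(2)[OF this] show ?thesis
      by (simp only: set_lebesgue_integral_def)
  qed
  ultimately show ?thesis by (simp only: eq)
qed

text \<open>The integral of \<open>E\<close> against \<open>cos_kernel N\<close> is evaluated in two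
  ways, and both sides of the formula arise as its limit for large N. The quadratic decay and the
  absolute summability of \<open>c\<close> are the majorants for Tannery's theorem on the two
  sides.\<close>

theorem poisson_summation_even:
  fixes E :: "real \<Rightarrow> real"
  assumes cont: "continuous_on UNIV E" and even: "\<And>x. E (- x) = E x"
    and decay: "\<And>x. \<bar>E x\<bar> \<le> C / (1 + x\<^sup>2)"
    and c: "\<And>k. c k = (LINT x|lborel. E x * cos (2 * pi * real k * x))"
    and sc: "summable (\<lambda>k. \<bar>c k\<bar>)"
  shows "E 0 + 2 * (\<Sum>n. E (real (Suc n))) = c 0 + 2 * (\<Sum>k. c (Suc k))"
proof -
  have E[measurable]: "E \<in> borel_measurable borel" using cont by (rule borel_measurable_continuous_onI)
  have intE: "integrable lborel E" by (rule integrable_bounded_by_inverse_square[OF E]) (use decay in simp)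
  have C0: "C \<ge> 0" using decay[of 0] by simp
  have intEb: "integrable lborel (\<lambda>x. E x * b x)" if "continuous_on UNIV b" "\<And>x. \<bar>b x\<bar> \<le> B" for b B
    by (rule integrable_mult_bounded[OF intE, where B = B])
      (use that borel_measurable_continuous_onI in auto)
  have Kb: "\<bar>cos_kernel N x\<bar> \<le> 4 ^ N / real (2*N choose N)" for N x
    unfolding cos_kernel_def by (auto simp: abs_mult power_abs divide_right_mono power_le_one)
  let ?I = "\<lambda>N j. integral {-1/2..1/2} (\<lambda>u. cos_kernel N u * E (u + real j))"
  let ?a = "\<lambda>N j. real (2*N choose (N + j)) / real (2*N choose N)"
  let ?L = "\<lambda>N. LINT x|lborel. E x * cos_kernel N x"
  \<comment> \<open>A point of the cell around \<open>Suc j\<close> has modulus at least half of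
    \<open>Suc j\<close>, whence the factor 4.\<close>
  have cell: "\<bar>E (u + real (Suc j))\<bar> \<le> 4 * C / (real (Suc j))\<^sup>2" if "u \<in> {-1/2..1/2}" for u j
  proof -
    have "(real (Suc j) / 2)\<^sup>2 \<le> (u + real (Suc j))\<^sup>2" using that by (intro power_mono) auto
    then have "C / (1 + (u + real (Suc j))\<^sup>2) \<le> C / (real (Suc j) / 2)\<^sup>2"
      using C0 by (intro divide_left_mono) (auto intro!: mult_pos_pos add_pos_nonneg)
    then show ?thesis using decay[of "u + real (Suc j)"] by (simp add: power_divide mult.commute)
  qed
  have Ib: "\<bar>?I N (Suc j)\<bar> \<le> 4 * C / (real (Suc j))\<^sup>2" for N j
  proof -
    have "norm (?I N (Suc j)) \<le> integral {-1/2..1/2} (\<lambda>u. cos_kernel N u * (4 * C / (real (Suc j))\<^sup>2))"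
    proof (rule integral_norm_bound_integral)
      show "(\<lambda>u. cos_kernel N u * E (u + real (Suc j))) integrable_on {-1/2..1/2}"
        by (intro integrable_continuous_real continuous_intros continuous_on_cos_kernel
            continuous_on_compose2[OF cont]) auto
      show "(\<lambda>u. cos_kernel N u * (4 * C / (real (Suc j))\<^sup>2)) integrable_on {-1/2..1/2}"
        by (intro integrable_continuous_real continuous_intros continuous_on_cos_kernel)
      show "norm (cos_kernel N u * E (u + real (Suc j))) \<le> cos_kernel N u * (4 * C / (real (Suc j))\<^sup>2)"
        if "u \<in> {-1/2..1/2}" for u
        using mult_left_mono[OF cell[OF that, of j] cos_kernel_nonneg[of N u]]
        unfolding real_norm_def abs_mult abs_of_nonneg[OF cos_kernel_nonneg] .
    qed
    also have "\<dots> = 1 * (4 * C / (real (Suc j))\<^sup>2)"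
      by (intro integral_unique has_integral_mult_left has_integral_cos_kernel)
    finally show ?thesis by simp
  qed
  have Il: "(\<lambda>N. ?I N j) \<longlonglongrightarrow> E (real j)" for j
  proof -
    have "continuous_on {-1/2..1/2} (\<lambda>u. E (u + real j))"
      by (rule continuous_on_compose2[OF cont]) (auto intro!: continuous_intros)
    from cos_kernel_approximate_identity[OF this] show ?thesis by simp
  qed
  have sq: "summable (\<lambda>j. 4 * C / (real (Suc j))\<^sup>2)"
  proof -
    have "summable (\<lambda>j. (4 * C) * (1 / (real (Suc j))\<^sup>2))"
      by (intro summable_mult) (use inverse_squares_sums in \<open>auto simp: sums_iff\<close>)
    then show ?thesis by simp
  qed
  \<comment> \<open>Physical side: the kernel has period 1, so every cell sees the same kernel on
    [-1/2, 1/2], and the cell around j contributes E(j) in the limit.\<close>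
  have L1: "?L N = ?I N 0 + 2 * (\<Sum>j. ?I N (Suc j))" for N
  proof -
    have kp: "cos_kernel N (u + real j) = cos_kernel N u" for u j
      using cos_kernel_periodic[of N u "int j"] by simp
    have "(\<lambda>n. integral {-1/2..1/2} (\<lambda>x. E x * cos_kernel N x) + 2 * (\<Sum>j<n. integral {-1/2..1/2} (\<lambda>u. E (u + real (Suc j)) * cos_kernel N (u + real (Suc j))))) \<longlonglongrightarrow> ?L N"
    proof (rule lborel_integral_even_cells)
      show "continuous_on UNIV (\<lambda>x. E x * cos_kernel N x)"
        by (intro continuous_intros cont continuous_on_cos_kernel)
      show "integrable lborel (\<lambda>x. E x * cos_kernel N x)"
        by (rule intEb[OF continuous_on_cos_kernel Kb])
      show "E (- x) * cos_kernel N (- x) = E x * cos_kernel N x" for x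
        using even by (simp add: cos_kernel_def)
    qed
    then have "(\<lambda>n. ?I N 0 + 2 * (\<Sum>j<n. ?I N (Suc j))) \<longlonglongrightarrow> ?L N"
      unfolding kp by (simp add: mult.commute)
    moreover have "(\<lambda>n. ?I N 0 + 2 * (\<Sum>j<n. ?I N (Suc j))) \<longlonglongrightarrow> ?I N 0 + 2 * (\<Sum>j. ?I N (Suc j))"
      by (intro tendsto_intros summable_LIMSEQ summable_comparison_test'[OF sq]) (use Ib in simp)
    ultimately show ?thesis by (rule LIMSEQ_unique)
  qed
  have "(\<lambda>N. \<Sum>j. ?I N (Suc j)) \<longlonglongrightarrow> (\<Sum>j. E (real (Suc j)))"
  proof (rule tannerys_theorem[THEN conjunct2, THEN conjunct2])
    show "(\<lambda>N. ?I N (Suc k)) \<longlonglongrightarrow> E (real (Suc k))" for k by (rule Il)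
    show "\<forall>\<^sub>F (k, N) in at_top \<times>\<^sub>F sequentially. norm (?I N (Suc k)) \<le> 4 * C / (real (Suc k))\<^sup>2"
      using Ib by (intro always_eventually) (auto simp del: of_nat_Suc)
  qed (use sq in auto)
  then have lim1: "?L \<longlonglongrightarrow> E 0 + 2 * (\<Sum>j. E (real (Suc j)))"
    unfolding L1 using Il[of 0] by (intro tendsto_intros) auto
  \<comment> \<open>Frequency side: the kernel is a finite cosine sum. The binomial coefficients
    vanish beyond N, so it may be written as a full series whose weights lie in [0,1] and tend to
    1.\<close>
  have L2: "?L N = c 0 + 2 * (\<Sum>j. ?a N (Suc j) * c (Suc j))" for N
  proof -
    have ic: "integrable lborel (\<lambda>x. E x * cos (2 * pi * real k * x))" for k
      by (rule intEb[where B = 1]) (auto intro!: continuous_intros)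
    have "?L N = (LINT x|lborel. E x + 2 * (\<Sum>j<N. ?a N (Suc j) * (E x * cos (2 * pi * real (Suc j) * x))))"
      unfolding cos_kernel_expansion
      by (intro Bochner_Integration.integral_cong refl) (simp add: distrib_left sum_distrib_left mult_ac)
    also have "\<dots> = (LINT x|lborel. E x) + 2 * (\<Sum>j<N. ?a N (Suc j) * (LINT x|lborel. E x * cos (2 * pi * real (Suc j) * x)))"
    proof -
      have j: "integrable lborel (\<lambda>x. ?a N (Suc j) * (E x * cos (2 * pi * real (Suc j) * x)))" for j
        by (intro integrable_mult_right ic)
      show ?thesis
        by (simp only: Bochner_Integration.integral_add[OF intE integrable_mult_right[OF Bochner_Integration.integrable_sum[OF j]]]
            integral_mult_right_zero Bochner_Integration.integral_sum[OF j])
    qed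
    also have "\<dots> = c 0 + 2 * (\<Sum>j<N. ?a N (Suc j) * c (Suc j))" unfolding c by simp
    also have "(\<Sum>j<N. ?a N (Suc j) * c (Suc j)) = (\<Sum>j. ?a N (Suc j) * c (Suc j))"
      by (rule suminf_finite[symmetric]) (auto simp: binomial_eq_0)
    finally show ?thesis .
  qed
  have "(\<lambda>N. \<Sum>j. ?a N (Suc j) * c (Suc j)) \<longlonglongrightarrow> (\<Sum>j. 1 * c (Suc j))"
  proof (rule tannerys_theorem[THEN conjunct2, THEN conjunct2])
    show "(\<lambda>N. ?a N (Suc k) * c (Suc k)) \<longlonglongrightarrow> 1 * c (Suc k)" for k
      by (intro tendsto_intros central_binomial_ratio_tendsto)
    have "norm (?a N (Suc k) * c (Suc k)) \<le> \<bar>c (Suc k)\<bar>" for N k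
    proof -
      have "norm (?a N (Suc k) * c (Suc k)) \<le> 1 * \<bar>c (Suc k)\<bar>"
        unfolding norm_mult using central_binomial_ratio_le[of N "N + Suc k"]
        by (intro mult_mono) auto
      then show ?thesis by simp
    qed
    then show "\<forall>\<^sub>F (k, N) in at_top \<times>\<^sub>F sequentially. norm (?a N (Suc k) * c (Suc k)) \<le> \<bar>c (Suc k)\<bar>"
      by (intro always_eventually) auto
    show "summable (\<lambda>k. \<bar>c (Suc k)\<bar>)" by (rule summable_Suc_iff[THEN iffD2, OF sc])
  qed simp
  then have lim2: "?L \<longlonglongrightarrow> c 0 + 2 * (\<Sum>j. c (Suc j))"
    unfolding L2 by (intro tendsto_intros) simp
  show ?thesis by (rule LIMSEQ_unique[OF lim1 lim2])
qed

section \<open>Theta series and the heat equation\<close>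

text \<open>With exp y >= 1 + y^2/2 at y = r x^2, the constant 2 + 4/r^2 is chosen so that the
  product dominates 2 + 2 x^4, which is at least (1 + x^2)^2. The power 2 leaves room for a
  quadratic factor in front of the Gaussian.\<close>

lemma gaussian_decay:
  fixes r x :: real
  assumes r: "r > 0"
  shows "exp (- (r * x\<^sup>2)) \<le> (2 + 4 / r\<^sup>2) / (1 + x\<^sup>2)\<^sup>2"
proof -
  let ?C = "2 + 4 / r\<^sup>2"
  have "1 + r * x\<^sup>2 + (r * x\<^sup>2)\<^sup>2 / 2 \<le> exp (r * x\<^sup>2)"
    by (rule exp_lower_Taylor_quadratic) (use r in simp)
  moreover have "r * x\<^sup>2 \<ge> 0" using r by simp
  ultimately have "1 + (r * x\<^sup>2)\<^sup>2 / 2 \<le> exp (r * x\<^sup>2)" by linarith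
  then have "?C * (1 + (r * x\<^sup>2)\<^sup>2 / 2) \<le> ?C * exp (r * x\<^sup>2)"
    using r by (intro mult_left_mono) auto
  moreover have "?C * (1 + (r * x\<^sup>2)\<^sup>2 / 2) = 2 + 4 / r\<^sup>2 + r\<^sup>2 * x^4 + 2 * x^4"
    using r by (simp add: field_simps power2_eq_square power4_eq_xxxx)
  moreover have "(1 + x\<^sup>2)\<^sup>2 \<le> 2 + 2 * x^4"
    using zero_le_power2[of "1 - x\<^sup>2"] by (simp add: power2_eq_square power4_eq_xxxx algebra_simps)
  moreover have "4 / r\<^sup>2 + r\<^sup>2 * x^4 \<ge> 0" by simp
  ultimately have "(1 + x\<^sup>2)\<^sup>2 \<le> ?C * exp (r * x\<^sup>2)" by linarith
  moreover have "(1 + x\<^sup>2)\<^sup>2 > 0" by (intro zero_less_power add_pos_nonneg) auto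
  ultimately show ?thesis by (simp add: exp_minus field_simps)
qed

lemma gaussian_moment_decay:
  fixes r x :: real
  assumes r: "r > 0" and p: "\<bar>p\<bar> \<le> A * (1 + x\<^sup>2)" and A: "A \<ge> 0"
  shows "\<bar>p * exp (- (r * x\<^sup>2))\<bar> \<le> (A * (2 + 4 / r\<^sup>2)) / (1 + x\<^sup>2)"
proof -
  have pos: "1 + x\<^sup>2 > 0" by (intro add_pos_nonneg) auto
  have "\<bar>p * exp (- (r * x\<^sup>2))\<bar> \<le> (A * (1 + x\<^sup>2)) * ((2 + 4 / r\<^sup>2) / (1 + x\<^sup>2)\<^sup>2)"
    unfolding abs_mult using p A pos gaussian_decay[OF r, of x] by (intro mult_mono) auto
  also have "\<dots> = (A * (2 + 4 / r\<^sup>2)) / (1 + x\<^sup>2)"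
    using pos by (simp add: power2_eq_square[of "1 + x\<^sup>2"])
  finally show ?thesis .
qed

lemma gaussian_cos_decay:
  fixes r x y :: real
  assumes r: "r > 0"
  shows "\<bar>exp (- (r * x\<^sup>2)) * cos y\<bar> \<le> (2 + 4 / r\<^sup>2) / (1 + x\<^sup>2)"
proof -
  have "\<bar>cos y\<bar> \<le> 1 * (1 + x\<^sup>2)" by (rule order_trans[OF abs_cos_le_one]) simp
  from gaussian_moment_decay[OF r this] show ?thesis by (simp add: mult.commute)
qed

lemma abs_le_1_plus_square: "\<bar>x\<bar> \<le> 1 * (1 + x\<^sup>2)" for x :: real
proof -
  have "0 \<le> (\<bar>x\<bar> - 1)\<^sup>2" by simp
  also have "(\<bar>x\<bar> - 1)\<^sup>2 = 1 + x\<^sup>2 - 2 * \<bar>x\<bar>" by (simp add: power2_eq_square algebra_simps)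
  finally have "2 * \<bar>x\<bar> \<le> 1 + x\<^sup>2" by simp
  moreover have "\<bar>x\<bar> \<le> 2 * \<bar>x\<bar>" by simp
  ultimately show ?thesis unfolding mult_1_left by (rule order_trans[rotated])
qed

text \<open>The value is read off from the characteristic function of the standard normal
  distribution, rescaled by c = sqrt (2 r).\<close>

lemma gaussian_fourier:
  assumes r: "r > 0"
  shows "(LINT x|lborel. exp (- (r * x\<^sup>2)) * cos (w * x)) = sqrt (pi / r) * exp (- (w\<^sup>2 / (4 * r)))"
proof -
  define c where "c = sqrt (2 * r)"
  have c: "c > 0" "c\<^sup>2 = 2 * r" using r by (auto simp: c_def)
  let ?t = "w / c"
  have int: "integrable std_normal_distribution (\<lambda>x. iexp (?t * x))"
    by (rule prob_space.integrable_iexp) (auto intro: prob_space_normal_density)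
  have "Re (char std_normal_distribution ?t) = (LINT x|std_normal_distribution. cos (?t * x))"
    unfolding char_def by (subst integral_Re[OF int, symmetric]) (simp only: cis_conv_exp[symmetric] cis.sel)
  also have "\<dots> = (LINT x|lborel. std_normal_density x * cos (?t * x))"
    by (subst integral_real_density) auto
  also have "\<dots> = \<bar>c\<bar> *\<^sub>R (LINT x|lborel. std_normal_density (0 + c * x) * cos (?t * (0 + c * x)))"
    by (rule lborel_integral_real_affine) (use c in simp)
  also have "\<dots> = c * (LINT x|lborel. 1 / sqrt (2 * pi) * (exp (- (r * x\<^sup>2)) * cos (w * x)))"
    using c by (simp add: std_normal_density_def power_mult_distrib)
  also have "\<dots> = c * (1 / sqrt (2 * pi) * (LINT x|lborel. exp (- (r * x\<^sup>2)) * cos (w * x)))"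
    by (subst Bochner_Integration.integral_mult_right_zero) simp
  finally have *: "exp (- (?t\<^sup>2) / 2) = c / sqrt (2 * pi) * (LINT x|lborel. exp (- (r * x\<^sup>2)) * cos (w * x))"
    unfolding char_std_normal_distribution Re_complex_of_real by simp
  have "?t\<^sup>2 / 2 = w\<^sup>2 / (4 * r)" using c by (simp add: power_divide)
  moreover have "sqrt (2 * pi) / c = sqrt (pi / r)"
    unfolding c_def by (simp add: real_sqrt_divide[symmetric])
  moreover have "(LINT x|lborel. exp (- (r * x\<^sup>2)) * cos (w * x)) = sqrt (2 * pi) / c * exp (- (?t\<^sup>2) / 2)"
    unfolding * using c by simp
  ultimately show ?thesis by simp
qed

lemma lborel_integral_derivative_vanish:
  fixes F g :: "real \<Rightarrow> real"
  assumes F: "\<And>x. (F has_real_derivative g x) (at x)" and cont: "continuous_on UNIV g"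
    and int: "integrable lborel g" and lim: "(\<lambda>n. F (real n) - F (- real n)) \<longlonglongrightarrow> 0"
  shows "(LINT x|lborel. g x) = 0"
proof -
  have "(\<lambda>n. LBINT x. indicator {- real n..real n} x *\<^sub>R g x) \<longlonglongrightarrow> (LBINT x. g x)"
  proof (rule integral_dominated_convergence[where w = "\<lambda>x. norm (g x)"])
    show "AE x in lborel. (\<lambda>n. indicator {- real n..real n} x *\<^sub>R g x) \<longlonglongrightarrow> g x"
    proof (rule AE_I2)
      fix x :: real
      have "eventually (\<lambda>n. \<bar>x\<bar> \<le> real n) sequentially"
        using filterlim_real_sequentially by (simp add: filterlim_at_top)
      then have "eventually (\<lambda>n. indicator {- real n..real n} x *\<^sub>R g x = g x) sequentially"
        by eventually_elim (auto simp: indicator_def)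
      then show "(\<lambda>n. indicator {- real n..real n} x *\<^sub>R g x) \<longlonglongrightarrow> g x"
        by (rule tendsto_eventually)
    qed
  qed (use int in \<open>auto simp: indicator_def\<close>)
  moreover have "(LBINT x. indicator {- real n..real n} x *\<^sub>R g x) = F (real n) - F (- real n)" for n
    by (rule integral_FTC_Icc)
      (auto intro!: continuous_on_subset[OF cont] has_field_derivative_at_within[OF F]
        simp: has_real_derivative_iff_has_vector_derivative[symmetric])
  ultimately show ?thesis using lim LIMSEQ_unique by fastforce
qed

text \<open>The derivatives of x exp(- r x^2) cos(w x) and of exp(- r x^2) sin(w x) integrate to 0.
  This gives two linear relations between the moments \<open>J0\<close>, \<open>J1\<close> and
  \<open>J2\<close>, so that no differentiation under the integral sign is required.\<close>

lemma gaussian_second_moment_fourier: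
  assumes r: "r > 0"
  shows "(LINT x|lborel. x\<^sup>2 * exp (- (r * x\<^sup>2)) * cos (w * x))
    = (1 / (2 * r) - w\<^sup>2 / (4 * r\<^sup>2)) * (sqrt (pi / r) * exp (- (w\<^sup>2 / (4 * r))))"
proof -
  have i: "integrable lborel (\<lambda>x. p x * exp (- (r * x\<^sup>2)) * q x)"
    if "\<And>x. \<bar>p x\<bar> \<le> 1 * (1 + x\<^sup>2)" "continuous_on UNIV p" "continuous_on UNIV q" "\<And>x. \<bar>q x\<bar> \<le> 1"
    for p q :: "real \<Rightarrow> real"
  proof (rule integrable_bounded_by_inverse_square)
    show "(\<lambda>x. p x * exp (- (r * x\<^sup>2)) * q x) \<in> borel_measurable borel"
      using that by (intro borel_measurable_continuous_onI continuous_intros)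
    fix x
    have "\<bar>p x * exp (- (r * x\<^sup>2))\<bar> * \<bar>q x\<bar> \<le> (1 * (2 + 4 / r\<^sup>2)) / (1 + x\<^sup>2) * 1"
      using that r by (intro mult_mono gaussian_moment_decay) (auto intro!: divide_nonneg_nonneg add_nonneg_nonneg)
    then show "norm (p x * exp (- (r * x\<^sup>2)) * q x) \<le> (1 * (2 + 4 / r\<^sup>2)) / (1 + x\<^sup>2)"
      by (simp add: abs_mult)
  qed
  have i0: "integrable lborel (\<lambda>x. exp (- (r * x\<^sup>2)) * cos (w * x))"
    using i[of "\<lambda>_. 1" "\<lambda>x. cos (w * x)"] by (simp add: continuous_intros)
  have i1: "integrable lborel (\<lambda>x. x * exp (- (r * x\<^sup>2)) * sin (w * x))"
    by (rule i[OF abs_le_1_plus_square]) (auto intro!: continuous_intros)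
  have i2: "integrable lborel (\<lambda>x. x\<^sup>2 * exp (- (r * x\<^sup>2)) * cos (w * x))"
    by (rule i) (auto intro!: continuous_intros)
  have "(LINT x|lborel. exp (- (r * x\<^sup>2)) * cos (w * x) - 2 * r * (x\<^sup>2 * exp (- (r * x\<^sup>2)) * cos (w * x)) - w * (x * exp (- (r * x\<^sup>2)) * sin (w * x))) = 0"
  proof (rule lborel_integral_derivative_vanish[where F = "\<lambda>x. x * exp (- (r * x\<^sup>2)) * cos (w * x)"])
    show "((\<lambda>x. x * exp (- (r * x\<^sup>2)) * cos (w * x)) has_real_derivative
        exp (- (r * x\<^sup>2)) * cos (w * x) - 2 * r * (x\<^sup>2 * exp (- (r * x\<^sup>2)) * cos (w * x)) - w * (x * exp (- (r * x\<^sup>2)) * sin (w * x))) (at x)" for x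
      by (auto intro!: derivative_eq_intros simp: algebra_simps power2_eq_square)
    have "(\<lambda>n. 2 * (real n * exp (- (r * (real n)\<^sup>2)))) \<longlonglongrightarrow> 0" using r by real_asymp
    then show "(\<lambda>n. real n * exp (- (r * (real n)\<^sup>2)) * cos (w * real n) - - real n * exp (- (r * (- real n)\<^sup>2)) * cos (w * - real n)) \<longlonglongrightarrow> 0"
      by (rule Lim_null_comparison[rotated]) (auto simp: abs_mult intro!: always_eventually mult_left_mono mult_left_le_one_le mult_right_le_one_le)
  qed (use i0 i1 i2 in \<open>auto intro!: continuous_intros\<close>)
  then have a: "(LINT x|lborel. exp (- (r * x\<^sup>2)) * cos (w * x)) - 2 * r * (LINT x|lborel. x\<^sup>2 * exp (- (r * x\<^sup>2)) * cos (w * x))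
      - w * (LINT x|lborel. x * exp (- (r * x\<^sup>2)) * sin (w * x)) = 0"
    using i0 i1 i2 by simp
  have "(LINT x|lborel. w * (exp (- (r * x\<^sup>2)) * cos (w * x)) - 2 * r * (x * exp (- (r * x\<^sup>2)) * sin (w * x))) = 0"
  proof (rule lborel_integral_derivative_vanish[where F = "\<lambda>x. exp (- (r * x\<^sup>2)) * sin (w * x)"])
    show "((\<lambda>x. exp (- (r * x\<^sup>2)) * sin (w * x)) has_real_derivative
        w * (exp (- (r * x\<^sup>2)) * cos (w * x)) - 2 * r * (x * exp (- (r * x\<^sup>2)) * sin (w * x))) (at x)" for x
      by (auto intro!: derivative_eq_intros simp: algebra_simps power2_eq_square)
    have "(\<lambda>n. 2 * exp (- (r * (real n)\<^sup>2))) \<longlonglongrightarrow> 0" using r by real_asymp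
    then show "(\<lambda>n. exp (- (r * (real n)\<^sup>2)) * sin (w * real n) - exp (- (r * (- real n)\<^sup>2)) * sin (w * - real n)) \<longlonglongrightarrow> 0"
      by (rule Lim_null_comparison[rotated]) (auto simp: abs_mult intro!: always_eventually mult_left_mono mult_left_le_one_le mult_right_le_one_le)
  qed (use i0 i1 in \<open>auto intro!: continuous_intros\<close>)
  then have b: "w * (LINT x|lborel. exp (- (r * x\<^sup>2)) * cos (w * x)) - 2 * r * (LINT x|lborel. x * exp (- (r * x\<^sup>2)) * sin (w * x)) = 0"
    using i0 i1 by simp
  define J0 where "J0 = (LINT x|lborel. exp (- (r * x\<^sup>2)) * cos (w * x))"
  define J1 where "J1 = (LINT x|lborel. x * exp (- (r * x\<^sup>2)) * sin (w * x))"
  define J2 where "J2 = (LINT x|lborel. x\<^sup>2 * exp (- (r * x\<^sup>2)) * cos (w * x))"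
  have "J1 = w / (2 * r) * J0" using b r unfolding J0_def[symmetric] J1_def[symmetric] by (simp add: field_simps)
  note J1 = this
  have "J2 * (2 * r) = J0 - w * J1"
    using a unfolding J0_def[symmetric] J1_def[symmetric] J2_def[symmetric] by (simp add: mult_ac)
  then have "J2 = (J0 - w * J1) / (2 * r)" using r by (simp add: eq_divide_eq)
  then have "J2 = (J0 - w * (w / (2 * r) * J0)) / (2 * r)" unfolding J1 .
  also have "\<dots> = (1 / (2 * r) - w\<^sup>2 / (4 * r\<^sup>2)) * J0"
    using r by (simp add: field_simps power2_eq_square)
  finally have "J2 = (1 / (2 * r) - w\<^sup>2 / (4 * r\<^sup>2)) * J0" .
  then show ?thesis unfolding J0_def J2_def gaussian_fourier[OF r] .
qed

section \<open>Theta inequalities from Poisson summation\<close>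

definition gauss_hat :: "real \<Rightarrow> real \<Rightarrow> real" where
  "gauss_hat r w = sqrt (pi / r) * exp (- (w\<^sup>2 / (4 * r)))"

lemma gauss_hat_nonneg: "r > 0 \<Longrightarrow> gauss_hat r w \<ge> 0"
  by (simp add: gauss_hat_def)

lemma gauss_hat_bound:
  assumes r: "r > 0" and p: "\<bar>p\<bar> \<le> A * (1 + w\<^sup>2)" and A: "A \<ge> 0"
  shows "\<bar>p * gauss_hat r w\<bar> \<le> (sqrt (pi / r) * A * (2 + 64 * r\<^sup>2)) / (1 + w\<^sup>2)"
proof -
  have e: "exp (- (w\<^sup>2 / (4 * r))) = exp (- (1 / (4 * r) * w\<^sup>2))" by simp
  have "\<bar>p * exp (- (w\<^sup>2 / (4 * r)))\<bar> \<le> (A * (2 + 4 / (1 / (4 * r))\<^sup>2)) / (1 + w\<^sup>2)"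
    unfolding e by (rule gaussian_moment_decay[OF _ p A]) (use r in simp)
  then have "sqrt (pi / r) * \<bar>p * exp (- (w\<^sup>2 / (4 * r)))\<bar> \<le> sqrt (pi / r) * ((A * (2 + 4 / (1 / (4 * r))\<^sup>2)) / (1 + w\<^sup>2))"
    using r by (intro mult_left_mono) auto
  then show ?thesis using r by (simp add: gauss_hat_def abs_mult power_divide mult_ac)
qed

lemma summable_inverse_1_plus_square:
  assumes "\<And>k::nat. \<bar>f k\<bar> \<le> K / (1 + (w k)\<^sup>2)" "\<And>k. real k \<le> \<bar>w k\<bar>" "K \<ge> 0"
  shows "summable (\<lambda>k. \<bar>f k\<bar> :: real)"
proof (rule summable_comparison_test')
  show "summable (\<lambda>k. 2 * K * (1 / (real (Suc k))\<^sup>2))"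
    by (intro summable_mult) (use inverse_squares_sums in \<open>auto simp: sums_iff\<close>)
  fix k :: nat
  have "(real k)\<^sup>2 \<le> (w k)\<^sup>2" using assms(2)[of k] by (metis abs_of_nat abs_le_square_iff)
  moreover have "(real (Suc k))\<^sup>2 \<le> 2 * (1 + (real k)\<^sup>2)"
    using zero_le_power2[of "real k - 1"] by (simp add: power2_eq_square algebra_simps)
  ultimately have "(real (Suc k))\<^sup>2 / 2 \<le> 1 + (w k)\<^sup>2" by (simp add: divide_le_eq del: of_nat_Suc)
  then have *: "K / (1 + (w k)\<^sup>2) \<le> K / ((real (Suc k))\<^sup>2 / 2)"
    using assms(3) by (intro divide_left_mono) (auto intro!: mult_pos_pos add_pos_nonneg)
  have "K / ((real (Suc k))\<^sup>2 / 2) = 2 * K * (1 / (real (Suc k))\<^sup>2)"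
    by (simp only: divide_divide_eq_right times_divide_eq_right mult_1_right mult.commute[of K 2])
  then show "norm \<bar>f k\<bar> \<le> 2 * K * (1 / (real (Suc k))\<^sup>2)"
    using order_trans[OF assms(1)[of k] *] by (simp only: real_norm_def abs_idempotent)
qed

text \<open>An alternating sign at the integers is the factor cos(pi x). On the frequency side it
  moves 2 pi k by pi in both directions, so that only odd multiples of pi occur and the frequency 0
  disappears.\<close>

lemma cos_pi_mult_cos: "cos (pi * x) * cos (2 * pi * real k * x) = (cos (pi * (2 * real k + 1) * x) + cos (pi * (2 * real k - 1) * x)) / 2"
proof -
  have "pi * x - 2 * pi * real k * x = - (pi * (2 * real k - 1) * x)" "pi * x + 2 * pi * real k * x = pi * (2 * real k + 1) * x"
    by (simp_all add: algebra_simps)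
  then show ?thesis unfolding cos_times_cos by (simp only: cos_minus add.commute)
qed

lemma odd_frequency_ge: "real k \<le> \<bar>pi * (2 * real k + 1)\<bar>" "real k \<le> \<bar>pi * (2 * real k - 1)\<bar>"
proof -
  have "real k \<le> \<bar>2 * real k + 1\<bar>" "real k \<le> \<bar>2 * real k - 1\<bar>" by (cases k; simp)+
  moreover have "\<bar>v\<bar> \<le> \<bar>pi * v\<bar>" for v
    using pi_gt3 mult_right_mono[of 1 pi "\<bar>v\<bar>"] by (simp add: abs_mult)
  ultimately show "real k \<le> \<bar>pi * (2 * real k + 1)\<bar>" "real k \<le> \<bar>pi * (2 * real k - 1)\<bar>"
    by (meson order_trans)+
qed

text \<open>After Poisson summation all terms are Gaussians at odd multiples of pi, hence
  nonnegative, although the original series alternates.\<close>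

lemma alternating_theta_nonneg:
  assumes r: "r > 0"
  shows "1 + 2 * (\<Sum>n. (-1) ^ Suc n * exp (- (r * (real (Suc n))\<^sup>2))) \<ge> 0"
proof -
  let ?E = "\<lambda>x. exp (- (r * x\<^sup>2)) * cos (pi * x)"
  define c where "c = (\<lambda>k::nat. (gauss_hat r (pi * (2 * real k + 1)) + gauss_hat r (pi * (2 * real k - 1))) / 2)"
  have s: "summable (\<lambda>k. \<bar>gauss_hat r (w k)\<bar>)" if "\<And>k. real k \<le> \<bar>w k\<bar>" for w
  proof (rule summable_inverse_1_plus_square[OF _ that])
    show "\<bar>gauss_hat r (w k)\<bar> \<le> (sqrt (pi / r) * 1 * (2 + 64 * r\<^sup>2)) / (1 + (w k)\<^sup>2)" for k
      using gauss_hat_bound[OF r, of 1 1 "w k"] by simp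
  qed (use r in simp)
  have sc: "summable (\<lambda>k. \<bar>c k\<bar>)"
    unfolding c_def using s[OF odd_frequency_ge(1)] s[OF odd_frequency_ge(2)] gauss_hat_nonneg[OF r]
    by (simp add: summable_add summable_divide)
  have i: "integrable lborel (\<lambda>x. exp (- (r * x\<^sup>2)) * cos (w * x))" for w
  proof (rule integrable_bounded_by_inverse_square)
    show "norm (exp (- (r * x\<^sup>2)) * cos (w * x)) \<le> (1 * (2 + 4 / r\<^sup>2)) / (1 + x\<^sup>2)" for x
      using gaussian_cos_decay[OF r, of x "w * x"] by simp
  qed simp
  have "?E 0 + 2 * (\<Sum>n. ?E (real (Suc n))) = c 0 + 2 * (\<Sum>k. c (Suc k))"
  proof (rule poisson_summation_even)
    show "continuous_on UNIV ?E" by (intro continuous_intros)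
    show "\<bar>?E x\<bar> \<le> (1 * (2 + 4 / r\<^sup>2)) / (1 + x\<^sup>2)" for x
      using gaussian_cos_decay[OF r, of x "pi * x"] by simp
    show "c k = (LINT x|lborel. ?E x * cos (2 * pi * real k * x))" for k
    proof -
      have eq: "?E x * cos (2 * pi * real k * x) =
        (exp (- (r * x\<^sup>2)) * cos (pi * (2 * real k + 1) * x) + exp (- (r * x\<^sup>2)) * cos (pi * (2 * real k - 1) * x)) / 2" for x
      proof -
        have "?E x * cos (2 * pi * real k * x) = exp (- (r * x\<^sup>2)) * (cos (pi * x) * cos (2 * pi * real k * x))"
          by (rule mult.assoc)
        then show ?thesis unfolding cos_pi_mult_cos by (simp only: distrib_left times_divide_eq_right)
      qed
      have "(LINT x|lborel. ?E x * cos (2 * pi * real k * x)) =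
         (LINT x|lborel. (exp (- (r * x\<^sup>2)) * cos (pi * (2 * real k + 1) * x) + exp (- (r * x\<^sup>2)) * cos (pi * (2 * real k - 1) * x)) / 2)"
        unfolding eq ..
      then show ?thesis using i gaussian_fourier[OF r] by (simp add: c_def gauss_hat_def)
    qed
  qed (use sc in auto)
  moreover have "c k \<ge> 0" for k using gauss_hat_nonneg[OF r] by (simp add: c_def)
  then have "c 0 + 2 * (\<Sum>k. c (Suc k)) \<ge> 0"
    using summable_Suc_iff[THEN iffD2, OF summable_rabs_cancel[OF sc]]
    by (intro add_nonneg_nonneg mult_nonneg_nonneg suminf_nonneg) auto
  moreover have "?E (real (Suc n)) = (-1) ^ Suc n * exp (- (r * (real (Suc n))\<^sup>2))" for n
    by (simp add: cos_npi[of "Suc n", simplified] mult.commute del: of_nat_Suc)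
  ultimately show ?thesis by (simp add: mult.commute del: of_nat_Suc power_Suc)
qed

text \<open>The dual terms carry the factor 1/(2 r) - w^2/(4 r^2), which is nonpositive once w^2 >=
  2 r. The frequencies are odd multiples of pi, so w^2 > 9, and the assumption r <= 4 is what makes
  this exceed 2 r. The overall sign flips because cos(pi (n+1)) = - (-1)^n.\<close>

lemma alternating_square_moment_nonneg:
  assumes r: "r > 0" "r \<le> 4"
  shows "(\<Sum>n. (-1) ^ n * (real (Suc n))\<^sup>2 * exp (- (r * (real (Suc n))\<^sup>2))) \<ge> 0"
proof -
  let ?E = "\<lambda>x. x\<^sup>2 * exp (- (r * x\<^sup>2)) * cos (pi * x)"
  let ?h = "\<lambda>w. (1 / (2 * r) - w\<^sup>2 / (4 * r\<^sup>2)) * gauss_hat r w"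
  define c where "c = (\<lambda>k::nat. (?h (pi * (2 * real k + 1)) + ?h (pi * (2 * real k - 1))) / 2)"
  have b: "\<bar>x\<^sup>2 * exp (- (r * x\<^sup>2)) * cos y\<bar> \<le> (1 * (2 + 4 / r\<^sup>2)) / (1 + x\<^sup>2)" for x y
  proof -
    have "\<bar>x\<^sup>2 * exp (- (r * x\<^sup>2))\<bar> * \<bar>cos y\<bar> \<le> (1 * (2 + 4 / r\<^sup>2)) / (1 + x\<^sup>2) * 1"
      using r by (intro mult_mono gaussian_moment_decay) (auto intro!: divide_nonneg_nonneg add_nonneg_nonneg)
    then show ?thesis by (simp only: abs_mult mult_1_right)
  qed
  have s: "summable (\<lambda>k. \<bar>?h (w k)\<bar>)" if "\<And>k. real k \<le> \<bar>w k\<bar>" for w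
  proof (rule summable_inverse_1_plus_square[OF _ that])
    let ?A = "1 / (2 * r) + 1 / (4 * r\<^sup>2)"
    fix k
    have "\<bar>1 / (2 * r) - (w k)\<^sup>2 / (4 * r\<^sup>2)\<bar> \<le> 1 / (2 * r) + (w k)\<^sup>2 / (4 * r\<^sup>2)"
      using r by (intro order_trans[OF abs_triangle_ineq4]) simp
    also have "\<dots> \<le> 1 / (2 * r) + (w k)\<^sup>2 / (4 * r\<^sup>2) + ((w k)\<^sup>2 / (2 * r) + 1 / (4 * r\<^sup>2))"
      using r by simp
    also have "\<dots> = ?A * (1 + (w k)\<^sup>2)" by (simp add: algebra_simps add_divide_distrib)
    finally show "\<bar>?h (w k)\<bar> \<le> (sqrt (pi / r) * ?A * (2 + 64 * r\<^sup>2)) / (1 + (w k)\<^sup>2)"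
      using r by (intro gauss_hat_bound) auto
  qed (use r in simp)
  have "summable (\<lambda>k. (\<bar>?h (pi * (2 * real k + 1))\<bar> + \<bar>?h (pi * (2 * real k - 1))\<bar>) / 2)"
    by (intro summable_divide summable_add s odd_frequency_ge)
  then have sc: "summable (\<lambda>k. \<bar>c k\<bar>)"
  proof (rule summable_comparison_test'[where N = 0])
    fix k
    have "\<bar>(a + b) / 2\<bar> \<le> (\<bar>a\<bar> + \<bar>b\<bar>) / 2" for a b :: real by simp
    then show "norm \<bar>c k\<bar> \<le> (\<bar>?h (pi * (2 * real k + 1))\<bar> + \<bar>?h (pi * (2 * real k - 1))\<bar>) / 2"
      unfolding c_def real_norm_def abs_idempotent .
  qed
  have i: "integrable lborel (\<lambda>x. x\<^sup>2 * exp (- (r * x\<^sup>2)) * cos (w * x))" for w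
    by (rule integrable_bounded_by_inverse_square) (use b in \<open>simp_all only: real_norm_def, measurable\<close>)
  have pois: "?E 0 + 2 * (\<Sum>n. ?E (real (Suc n))) = c 0 + 2 * (\<Sum>k. c (Suc k))"
  proof (rule poisson_summation_even)
    show "continuous_on UNIV ?E" by (intro continuous_intros)
    show "\<bar>?E x\<bar> \<le> (1 * (2 + 4 / r\<^sup>2)) / (1 + x\<^sup>2)" for x by (rule b)
    show "c k = (LINT x|lborel. ?E x * cos (2 * pi * real k * x))" for k
    proof -
      have eq: "?E x * cos (2 * pi * real k * x) =
        (x\<^sup>2 * exp (- (r * x\<^sup>2)) * cos (pi * (2 * real k + 1) * x) + x\<^sup>2 * exp (- (r * x\<^sup>2)) * cos (pi * (2 * real k - 1) * x)) / 2" for x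
      proof -
        have "?E x * cos (2 * pi * real k * x) = x\<^sup>2 * exp (- (r * x\<^sup>2)) * (cos (pi * x) * cos (2 * pi * real k * x))"
          by (rule mult.assoc)
        then show ?thesis unfolding cos_pi_mult_cos by (simp only: distrib_left times_divide_eq_right)
      qed
      show ?thesis unfolding eq
        using i gaussian_second_moment_fourier[OF r(1)] by (simp add: c_def gauss_hat_def)
    qed
  qed (use sc in auto)
  moreover have cneg: "c k \<le> 0" for k
  proof -
    have "?h (pi * v) \<le> 0" if v: "\<bar>v\<bar> \<ge> 1" for v
    proof (rule mult_nonpos_nonneg[OF _ gauss_hat_nonneg[OF r(1)]])
      have "3 * 1 \<le> pi * \<bar>v\<bar>" using pi_gt3 v by (intro mult_mono) auto
      then have "3\<^sup>2 \<le> (pi * \<bar>v\<bar>)\<^sup>2" by (intro power_mono) auto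
      then have "(pi * v)\<^sup>2 \<ge> 9" by (simp add: power_mult_distrib)
      then have "2 * r \<le> (pi * v)\<^sup>2" using r by linarith
      then show "1 / (2 * r) - (pi * v)\<^sup>2 / (4 * r\<^sup>2) \<le> 0"
        using r by (simp add: field_simps power2_eq_square)
    qed
    moreover have "\<bar>2 * real k + 1\<bar> \<ge> 1" "\<bar>2 * real k - 1\<bar> \<ge> 1" by (cases k; simp)+
    ultimately have "?h (pi * (2 * real k + 1)) \<le> 0" "?h (pi * (2 * real k - 1)) \<le> 0" by blast+
    then show ?thesis unfolding c_def by - (rule divide_nonpos_pos[OF add_nonpos_nonpos], assumption+, simp)
  qed
  have "(\<Sum>k. c (Suc k)) \<le> 0"
    using suminf_le[OF _ summable_Suc_iff[THEN iffD2, OF summable_rabs_cancel[OF sc]] summable_zero] cneg by simp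
  moreover have eqE: "?E (real (Suc n)) = - ((-1) ^ n * (real (Suc n))\<^sup>2 * exp (- (r * (real (Suc n))\<^sup>2)))" for n
    using cos_npi[of "Suc n"] by (simp add: mult.commute[of pi] del: of_nat_Suc)
  have minus: "(\<Sum>n. - ((-1) ^ n * (real (Suc n))\<^sup>2 * exp (- (r * (real (Suc n))\<^sup>2))))
      = - (\<Sum>n. (-1) ^ n * (real (Suc n))\<^sup>2 * exp (- (r * (real (Suc n))\<^sup>2)))"
  proof (rule suminf_minus)
    show "summable (\<lambda>n. (-1) ^ n * (real (Suc n))\<^sup>2 * exp (- (r * (real (Suc n))\<^sup>2)))"
    proof (rule summable_rabs_cancel, rule summable_inverse_1_plus_square)
      show "\<bar>(-1) ^ n * (real (Suc n))\<^sup>2 * exp (- (r * (real (Suc n))\<^sup>2))\<bar> \<le> (1 * (2 + 4 / r\<^sup>2)) / (1 + (real (Suc n))\<^sup>2)" for n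
        using gaussian_moment_decay[OF r(1), of "(real (Suc n))\<^sup>2" 1 "real (Suc n)"] by (simp add: abs_mult del: of_nat_Suc)
    qed (use r in auto)
  qed
  ultimately show ?thesis using cneg[of 0] pois[unfolded eqE minus] by simp
qed

text \<open>With theta(r) the sum of exp (- r n^2) over all integers n, this is theta(r) + 2 r theta'(r),
  which Poisson summation turns into a series of nonnegative terms.\<close>

definition theta_dilation :: "real \<Rightarrow> real" where
  "theta_dilation r = 1 + 2 * (\<Sum>n. (1 - 2 * r * (real (Suc n))\<^sup>2) * exp (- (r * (real (Suc n))\<^sup>2)))"

text \<open>The summand (1 - 2 r x^2) exp(- r x^2) is the derivative of x exp(- r x^2), so its
  integral, the coefficient of frequency 0, vanishes. At frequency w the two Gaussian transforms
  combine to the nonnegative factor w^2/(2 r).\<close>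

lemma theta_dilation_eq:
  assumes r: "r > 0"
  shows "theta_dilation r = 2 * (\<Sum>k. (2 * pi * real (Suc k))\<^sup>2 / (2 * r) * gauss_hat r (2 * pi * real (Suc k)))"
    and "summable (\<lambda>k. (2 * pi * real (Suc k))\<^sup>2 / (2 * r) * gauss_hat r (2 * pi * real (Suc k)))"
proof -
  let ?E = "\<lambda>x. (1 - 2 * r * x\<^sup>2) * exp (- (r * x\<^sup>2))"
  define c where "c = (\<lambda>k::nat. (2 * pi * real k)\<^sup>2 / (2 * r) * gauss_hat r (2 * pi * real k))"
  have p: "\<bar>1 - 2 * r * x\<^sup>2\<bar> \<le> (1 + 2 * r) * (1 + x\<^sup>2)" for x
  proof -
    have "\<bar>1 - 2 * r * x\<^sup>2\<bar> \<le> 1 + 2 * r * x\<^sup>2" using r by (intro order_trans[OF abs_triangle_ineq4]) simp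
    also have "\<dots> \<le> (1 + 2 * r) * (1 + x\<^sup>2)" using r by (simp add: algebra_simps)
    finally show ?thesis .
  qed
  have sc: "summable (\<lambda>k. \<bar>c k\<bar>)"
    unfolding c_def
  proof (rule summable_inverse_1_plus_square)
    fix k
    show "real k \<le> \<bar>2 * pi * real k\<bar>" using pi_gt3 mult_right_mono[of 1 "2 * pi" "real k"] by (simp add: abs_mult)
    show "\<bar>(2 * pi * real k)\<^sup>2 / (2 * r) * gauss_hat r (2 * pi * real k)\<bar>
      \<le> (sqrt (pi / r) * (1 / (2 * r)) * (2 + 64 * r\<^sup>2)) / (1 + (2 * pi * real k)\<^sup>2)"
      using r by (intro gauss_hat_bound) (auto simp: field_simps)
  qed (use r in simp)
  have "?E 0 + 2 * (\<Sum>n. ?E (real (Suc n))) = c 0 + 2 * (\<Sum>k. c (Suc k))"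
  proof (rule poisson_summation_even[OF _ _ _ _ sc])
    show "continuous_on UNIV ?E" by (intro continuous_intros)
    show "\<bar>?E x\<bar> \<le> ((1 + 2 * r) * (2 + 4 / r\<^sup>2)) / (1 + x\<^sup>2)" for x
      by (rule gaussian_moment_decay[OF r p]) (use r in simp)
    show "c k = (LINT x|lborel. ?E x * cos (2 * pi * real k * x))" for k
    proof -
      let ?w = "2 * pi * real k"
      have i: "integrable lborel (\<lambda>x. q x * exp (- (r * x\<^sup>2)) * cos (?w * x))"
        if q: "\<And>x. \<bar>q x\<bar> \<le> 1 * (1 + x\<^sup>2)" and [measurable]: "q \<in> borel_measurable borel" for q
      proof (rule integrable_bounded_by_inverse_square)
        fix x
        have "\<bar>q x * exp (- (r * x\<^sup>2))\<bar> * \<bar>cos (?w * x)\<bar> \<le> (1 * (2 + 4 / r\<^sup>2)) / (1 + x\<^sup>2) * 1"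
          using r q by (intro mult_mono gaussian_moment_decay) (auto intro!: divide_nonneg_nonneg add_nonneg_nonneg)
        then show "norm (q x * exp (- (r * x\<^sup>2)) * cos (?w * x)) \<le> (1 * (2 + 4 / r\<^sup>2)) / (1 + x\<^sup>2)"
          by (simp only: abs_mult mult_1_right real_norm_def)
      qed measurable
      have i0: "integrable lborel (\<lambda>x. exp (- (r * x\<^sup>2)) * cos (?w * x))" using i[of "\<lambda>_. 1"] by simp
      have i2: "integrable lborel (\<lambda>x. x\<^sup>2 * exp (- (r * x\<^sup>2)) * cos (?w * x))" by (rule i) auto
      have "(LINT x|lborel. ?E x * cos (?w * x)) = (LINT x|lborel. exp (- (r * x\<^sup>2)) * cos (?w * x) - 2 * r * (x\<^sup>2 * exp (- (r * x\<^sup>2)) * cos (?w * x)))"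
        by (intro Bochner_Integration.integral_cong refl) (simp only: left_diff_distrib mult_1_left mult.assoc)
      also have "\<dots> = (LINT x|lborel. exp (- (r * x\<^sup>2)) * cos (?w * x)) - 2 * r * (LINT x|lborel. x\<^sup>2 * exp (- (r * x\<^sup>2)) * cos (?w * x))"
        by (simp only: Bochner_Integration.integral_diff[OF i0 integrable_mult_right[OF i2]] integral_mult_right_zero)
      also have "\<dots> = gauss_hat r ?w - 2 * r * ((1 / (2 * r) - ?w\<^sup>2 / (4 * r\<^sup>2)) * gauss_hat r ?w)"
        unfolding gaussian_fourier[OF r] gaussian_second_moment_fourier[OF r] gauss_hat_def ..
      also have "\<dots> = ?w\<^sup>2 / (2 * r) * gauss_hat r ?w" using r by (simp add: field_simps power2_eq_square)
      finally show ?thesis by (simp add: c_def)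
    qed
  qed simp
  then show "theta_dilation r = 2 * (\<Sum>k. (2 * pi * real (Suc k))\<^sup>2 / (2 * r) * gauss_hat r (2 * pi * real (Suc k)))"
    by (simp add: theta_dilation_def c_def)
  have "summable (\<lambda>k. c (Suc k))" by (rule summable_Suc_iff[THEN iffD2, OF summable_rabs_cancel[OF sc]])
  then show "summable (\<lambda>k. (2 * pi * real (Suc k))\<^sup>2 / (2 * r) * gauss_hat r (2 * pi * real (Suc k)))"
    by (simp only: c_def)
qed

lemma theta_dilation_nonneg:
  assumes "r > 0" shows "theta_dilation r \<ge> 0"
  unfolding theta_dilation_eq(1)[OF assms]
  using assms gauss_hat_nonneg[OF assms]
  by (intro mult_nonneg_nonneg suminf_nonneg theta_dilation_eq(2)) auto

text \<open>Each dual term depends on r through r^(-3/2) exp(- w^2/(4 r)), which increases as long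
  as r <= w^2/6; here r <= 1 while w^2 > 36. The threshold 8 is what the short estimate u^(3/2) <=
  u^2 <= exp(2 (u - 1)) with u = r2/r1 asks for.\<close>

lemma theta_dilation_mono:
  assumes r: "0 < r1" "r1 \<le> r2" "r2 \<le> 1"
  shows "theta_dilation r1 \<le> theta_dilation r2"
proof -
  have "w\<^sup>2 / (2 * r1) * gauss_hat r1 w \<le> w\<^sup>2 / (2 * r2) * gauss_hat r2 w" if w: "w\<^sup>2 \<ge> 8" for w
  proof -
    let ?u = "r2 / r1"
    have u: "?u \<ge> 1" using r by simp
    have "sqrt ?u \<le> sqrt (?u\<^sup>2)" using u by (intro real_sqrt_le_mono self_le_power) auto
    then have "?u * sqrt ?u \<le> ?u * ?u" using u by (intro mult_left_mono) auto
    also have "\<dots> \<le> exp (?u - 1) * exp (?u - 1)"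
      using u exp_ge_add_one_self[of "?u - 1"] by (intro mult_mono) auto
    also have "\<dots> = exp (2 * (?u - 1))" by (simp flip: exp_add)
    also have "\<dots> \<le> exp (w\<^sup>2 / (4 * r1) - w\<^sup>2 / (4 * r2))"
    proof -
      have e: "w\<^sup>2 / (4 * r1) - w\<^sup>2 / (4 * r2) = w\<^sup>2 / (4 * r2) * (?u - 1)"
        using r by (simp add: field_simps)
      have "2 \<le> w\<^sup>2 / (4 * r2)" using w r by (simp add: le_divide_eq)
      then show ?thesis unfolding e using u by (intro exp_le_cancel_iff[THEN iffD2] mult_right_mono) auto
    qed
    finally have "?u * sqrt ?u * exp (- (w\<^sup>2 / (4 * r1))) \<le> exp (w\<^sup>2 / (4 * r1) - w\<^sup>2 / (4 * r2)) * exp (- (w\<^sup>2 / (4 * r1)))"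
      by (rule mult_right_mono) simp
    also have "\<dots> = exp (- (w\<^sup>2 / (4 * r2)))" by (simp flip: exp_add)
    finally have *: "?u * sqrt ?u * exp (- (w\<^sup>2 / (4 * r1))) \<le> exp (- (w\<^sup>2 / (4 * r2)))" .
    have "w\<^sup>2 / (2 * r2) * sqrt (pi / r2) * (?u * sqrt ?u * exp (- (w\<^sup>2 / (4 * r1)))) \<le> w\<^sup>2 / (2 * r2) * sqrt (pi / r2) * exp (- (w\<^sup>2 / (4 * r2)))"
      using r by (intro mult_left_mono *) auto
    moreover have "w\<^sup>2 / (2 * r2) * sqrt (pi / r2) * (?u * sqrt ?u * exp (- (w\<^sup>2 / (4 * r1)))) = w\<^sup>2 / (2 * r1) * gauss_hat r1 w"
    proof -
      have "sqrt (pi / r2) * sqrt ?u = sqrt (pi / r1)" using r by (simp flip: real_sqrt_mult)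
      moreover have "w\<^sup>2 / (2 * r2) * ?u = w\<^sup>2 / (2 * r1)" using r by simp
      moreover have "w\<^sup>2 / (2 * r2) * sqrt (pi / r2) * (?u * sqrt ?u * exp (- (w\<^sup>2 / (4 * r1))))
          = (w\<^sup>2 / (2 * r2) * ?u) * ((sqrt (pi / r2) * sqrt ?u) * exp (- (w\<^sup>2 / (4 * r1))))"
        by (simp only: mult_ac)
      ultimately show ?thesis unfolding gauss_hat_def by (simp only:)
    qed
    ultimately show ?thesis unfolding gauss_hat_def by (simp only: mult.assoc)
  qed
  moreover have "(2 * pi * real (Suc k))\<^sup>2 \<ge> 8" for k
  proof -
    have "6 * 1 \<le> 2 * pi * real (Suc k)" using pi_gt3 by (intro mult_mono) auto
    then have "6\<^sup>2 \<le> (2 * pi * real (Suc k))\<^sup>2" by (intro power_mono) auto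
    then show ?thesis by simp
  qed
  ultimately show ?thesis
    unfolding theta_dilation_eq(1)[OF r(1)] theta_dilation_eq(1)[OF less_le_trans[OF r(1,2)]]
    using r by (intro mult_left_mono suminf_le theta_dilation_eq(2)) auto
qed

section \<open>Termwise calculus for theta series and the minimum principle\<close>

lemma summable_theta_terms:
  fixes s c :: real
  assumes s: "s < 0"
  shows "summable (\<lambda>n. real (Suc n) ^ k * exp (s * (real (Suc n))\<^sup>2 + c * real (Suc n)))"
proof (rule summable_comparison_test'[where N = 0])
  \<comment> \<open>The power N^k is absorbed as exp(k N). The additional 1 splits off a geometric
    factor exp(- N), and completing the square bounds the rest by the constant
    \<open>?K\<close>.\<close>
  define b where "b = real k + c + 1"
  let ?K = "exp (b\<^sup>2 / (- 4 * s))"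
  have "summable (\<lambda>n. exp (-1::real) ^ Suc n)"
    by (rule summable_Suc_iff[THEN iffD2]) (rule summable_geometric, simp)
  then show "summable (\<lambda>n. ?K * exp (-1::real) ^ Suc n)" by (rule summable_mult)
  fix n :: nat
  define N where "N = real (Suc n)"
  have N: "N \<ge> 0" by (simp add: N_def)
  have "N \<le> exp N" using exp_ge_add_one_self[of N] by linarith
  then have "N ^ k \<le> exp N ^ k" using N by (rule power_mono)
  also have "\<dots> = exp (real k * N)" by (simp add: exp_of_nat_mult)
  finally have "N ^ k * exp (s * N\<^sup>2 + c * N) \<le> exp (real k * N) * exp (s * N\<^sup>2 + c * N)"
    by (rule mult_right_mono) simp
  also have "\<dots> = exp (s * N\<^sup>2 + b * N) * exp (- N)"
    by (simp add: b_def algebra_simps flip: exp_add)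
  also have "\<dots> \<le> ?K * exp (- N)"
  proof -
    have "0 \<le> (2 * s * N + b)\<^sup>2" by simp
    also have "(2 * s * N + b)\<^sup>2 = 4 * s * (s * N\<^sup>2 + b * N) + b\<^sup>2" by (simp add: power2_eq_square algebra_simps)
    finally have "(- 4 * s) * (s * N\<^sup>2 + b * N) \<le> b\<^sup>2" by simp
    then have "s * N\<^sup>2 + b * N \<le> b\<^sup>2 / (- 4 * s)" using s by (simp add: field_simps)
    then show ?thesis by (intro mult_right_mono) auto
  qed
  also have "exp (- N) = exp (-1::real) ^ Suc n" unfolding N_def exp_of_nat_mult[symmetric] by (simp only: mult_minus1_right)
  finally show "norm (real (Suc n) ^ k * exp (s * (real (Suc n))\<^sup>2 + c * real (Suc n))) \<le> ?K * exp (-1::real) ^ Suc n"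
    by (simp add: N_def abs_mult)
qed

lemma has_derivative_suminf_dominated:
  fixes f f' :: "nat \<Rightarrow> real \<Rightarrow> real"
  assumes S: "convex S" "open S" and x: "x \<in> S"
    and d: "\<And>n y. y \<in> S \<Longrightarrow> (f n has_real_derivative f' n y) (at y)"
    and M: "\<And>n y. y \<in> S \<Longrightarrow> \<bar>f' n y\<bar> \<le> M n" "summable M" and sx: "summable (\<lambda>n. f n x)"
  shows "((\<lambda>y. \<Sum>n. f n y) has_real_derivative (\<Sum>n. f' n x)) (at x)"
proof (rule has_field_derivative_series'(2)[where S = S and ?x0.0 = x and f' = f'])
  show "uniformly_convergent_on S (\<lambda>n y. \<Sum>i<n. f' i y)"
    by (rule Weierstrass_m_test'[OF _ M(2)]) (use M(1) in simp)
  show "x \<in> interior S" using S x by (simp add: interior_open)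
  show "(f n has_real_derivative f' n y) (at y within S)" if "y \<in> S" for n y
    by (rule has_field_derivative_at_within[OF d[OF that]])
qed (use S x sx in auto)

lemma continuous_on_suminf_dominated:
  fixes f :: "nat \<Rightarrow> 'a::topological_space \<Rightarrow> real"
  assumes c: "\<And>n. continuous_on A (f n)" and M: "\<And>n x. x \<in> A \<Longrightarrow> \<bar>f n x\<bar> \<le> M n" "summable M"
  shows "continuous_on A (\<lambda>x. \<Sum>n. f n x)"
proof (rule uniform_limit_theorem)
  show "uniform_limit A (\<lambda>n x. \<Sum>i<n. f i x) (\<lambda>x. \<Sum>n. f n x) sequentially"
    by (rule Weierstrass_m_test[OF _ M(2)]) (use M(1) in simp)
  show "\<forall>\<^sub>F n in sequentially. continuous_on A (\<lambda>x. \<Sum>i<n. f i x)"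
    by (intro always_eventually allI continuous_on_sum c)
qed simp

text \<open>The equation is encoded by letting \<open>us\<close> be both the s-derivative of
  \<open>u\<close> and the t-derivative of \<open>ut\<close>. At a negative minimum of exp(- s) u,
  away from the initial line and from t = T, the weight gives the strict inequality us <= u < 0.
  There ut vanishes, at t = 0 because the Neumann condition and minimality force opposite signs.
  Then ut is negative just to the right, and u drops below its minimum.\<close>

lemma heat_min_principle:
  fixes u ut us :: "real \<Rightarrow> real \<Rightarrow> real"
  assumes cont: "continuous_on ({0..T} \<times> {s0..s1}) (\<lambda>(t,s). u t s)"
    and dt: "\<And>t s. t \<in> {0..T} \<Longrightarrow> s \<in> {s0..s1} \<Longrightarrow> ((\<lambda>t. u t s) has_real_derivative ut t s) (at t)"
    and dtt: "\<And>t s. t \<in> {0..T} \<Longrightarrow> s \<in> {s0..s1} \<Longrightarrow> ((\<lambda>t. ut t s) has_real_derivative us t s) (at t)"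
    and ds: "\<And>t s. t \<in> {0..T} \<Longrightarrow> s \<in> {s0..s1} \<Longrightarrow> ((\<lambda>s. u t s) has_real_derivative us t s) (at s)"
    and left: "\<And>s. s \<in> {s0..s1} \<Longrightarrow> ut 0 s \<le> 0"
    and right: "\<And>s. s \<in> {s0..s1} \<Longrightarrow> u T s \<ge> 0"
    and init: "\<And>t. t \<in> {0..T} \<Longrightarrow> u t s0 \<ge> 0"
    and ts: "t \<in> {0..T}" "s \<in> {s0..s1}"
  shows "u t s \<ge> 0"
proof (rule ccontr)
  assume neg: "\<not> u t s \<ge> 0"
  let ?D = "{0..T} \<times> {s0..s1}"
  define W where "W = (\<lambda>(t,s). exp (- s) * u t s)"
  have "continuous_on ?D W"
    unfolding W_def case_prod_beta
    using cont[unfolded case_prod_beta] by (intro continuous_intros)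
  moreover have "compact ?D" by (intro compact_Times) auto
  ultimately obtain z where z: "z \<in> ?D" "\<And>w. w \<in> ?D \<Longrightarrow> W z \<le> W w"
    using continuous_attains_inf[of ?D W] ts by blast
  obtain t' s' where zz: "z = (t', s')" by (cases z)
  have t's': "t' \<in> {0..T}" "s' \<in> {s0..s1}" using z(1) zz by auto
  have min: "exp (- s') * u t' s' \<le> exp (- b) * u a b" if "a \<in> {0..T}" "b \<in> {s0..s1}" for a b
    using z(2)[of "(a,b)"] that by (simp add: zz W_def)
  have "exp (- s') * u t' s' \<le> exp (- s) * u t s" by (rule min[OF ts])
  also have "\<dots> < 0" using neg by (simp add: mult_less_0_iff)
  finally have un: "u t' s' < 0" by (simp add: mult_less_0_iff)
  have tT: "t' < T" using right[OF t's'(2)] un t's'(1) by (cases "t' = T") auto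
  have ss: "s0 < s'" using init[OF t's'(1)] un t's'(2) by (cases "s' = s0") auto
  have us_neg: "us t' s' < 0"
  proof (rule ccontr)
    assume "\<not> us t' s' < 0"
    then have pos: "exp (- s') * us t' s' - exp (- s') * u t' s' > 0"
      using un by (simp add: mult_less_0_iff flip: right_diff_distrib)
    have "((\<lambda>s. exp (- s) * u t' s) has_real_derivative (exp (- s') * us t' s' - exp (- s') * u t' s')) (at s')"
      using ds[OF t's'] by (auto intro!: derivative_eq_intros)
    from DERIV_pos_inc_left[OF this pos]
    obtain d where d: "d > 0" "\<And>h. 0 < h \<Longrightarrow> h < d \<Longrightarrow> exp (- (s' - h)) * u t' (s' - h) < exp (- s') * u t' s'"
      by blast
    define h where "h = min (d/2) (s' - s0)"
    have "0 < h" "h < d" "s' - h \<in> {s0..s1}" using d(1) ss t's'(2) by (auto simp: h_def min_def)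
    then show False using d(2)[of h] min[OF t's'(1), of "s' - h"] by simp
  qed
  have tmin: "u t' s' \<le> u a s'" if "a \<in> {0..T}" for a
    using min[OF that t's'(2)] by simp
  have ut0: "ut t' s' = 0"
  proof (cases "t' = 0")
    case True
    show ?thesis
    proof (rule ccontr)
      assume "ut t' s' \<noteq> 0"
      then have "ut t' s' < 0" using left[OF t's'(2)] True by simp
      from DERIV_neg_dec_right[OF dt[OF t's'] this]
      obtain d where d: "d > 0" "\<And>h. 0 < h \<Longrightarrow> h < d \<Longrightarrow> u (t' + h) s' < u t' s'" by auto
      define h where "h = min (d/2) (T - t')"
      have "0 < h" "h < d" "t' + h \<in> {0..T}" using d(1) tT t's'(1) by (auto simp: h_def min_def)
      then show False using d(2)[of h] tmin[of "t' + h"] by simp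
    qed
  next
    case False
    show ?thesis
    proof (rule DERIV_local_min[OF dt[OF t's']])
      show "0 < min t' (T - t')" using False tT t's'(1) by auto
      show "\<forall>y. \<bar>t' - y\<bar> < min t' (T - t') \<longrightarrow> u t' s' \<le> u y s'"
        using tmin by (auto simp: abs_if split: if_splits)
    qed
  qed
  from DERIV_neg_dec_right[OF dtt[OF t's'] us_neg]
  obtain d where d: "d > 0" "\<And>h. 0 < h \<Longrightarrow> h < d \<Longrightarrow> ut (t' + h) s' < 0" using ut0 by auto
  define h where "h = min (d/2) (T - t')"
  have h: "0 < h" "h < d" "t' + h \<in> {0..T}" using d(1) tT t's'(1) by (auto simp: h_def min_def)
  have "\<exists>y>t'. y < t' + h \<and> u (t' + h) s' - u t' s' = (t' + h - t') * ut y s'"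
    using h t's' by (intro MVT2) (auto intro!: dt)
  then obtain y where y: "t' < y" "y < t' + h" "u (t' + h) s' - u t' s' = h * ut y s'" by auto
  have "ut y s' < 0" using d(2)[of "y - t'"] y h by simp
  then have "h * ut y s' < 0" using h by (simp add: mult_less_0_iff)
  then show False using y(3) tmin[OF h(3)] by simp
qed

text \<open>Every term solves the heat equation d/ds = (d/dt)^2.\<close>

definition tsum :: "(nat \<Rightarrow> real) \<Rightarrow> nat \<Rightarrow> real \<Rightarrow> real \<Rightarrow> real" where
  "tsum a k t s = (\<Sum>n. a n * real (Suc n) ^ k * exp (s * (real (Suc n))\<^sup>2 - t * real (Suc n)))"

context
  fixes a :: "nat \<Rightarrow> real"
  assumes a: "\<And>n. \<bar>a n\<bar> \<le> 1"
begin

lemma tsum_term_bound: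
  assumes "s \<le> s1" "- t \<le> c"
  shows "\<bar>a n * real (Suc n) ^ k * exp (s * (real (Suc n))\<^sup>2 - t * real (Suc n))\<bar>
    \<le> real (Suc n) ^ k * exp (s1 * (real (Suc n))\<^sup>2 + c * real (Suc n))"
proof -
  have "- t * real (Suc n) \<le> c * real (Suc n)" using assms(2) by (intro mult_right_mono) auto
  moreover have "s * (real (Suc n))\<^sup>2 \<le> s1 * (real (Suc n))\<^sup>2" using assms(1) by (intro mult_right_mono) auto
  ultimately have "s * (real (Suc n))\<^sup>2 - t * real (Suc n) \<le> s1 * (real (Suc n))\<^sup>2 + c * real (Suc n)" by linarith
  then have "\<bar>a n\<bar> * real (Suc n) ^ k * exp (s * (real (Suc n))\<^sup>2 - t * real (Suc n))
      \<le> 1 * real (Suc n) ^ k * exp (s1 * (real (Suc n))\<^sup>2 + c * real (Suc n))"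
    using a[of n] by (intro mult_mono) auto
  then show ?thesis by (simp add: abs_mult)
qed

lemma summable_tsum:
  assumes "s < 0"
  shows "summable (\<lambda>n. a n * real (Suc n) ^ k * exp (s * (real (Suc n))\<^sup>2 - t * real (Suc n)))"
  by (rule summable_comparison_test'[OF summable_theta_terms[OF assms, of k "- t"], where N = 0])
    (use tsum_term_bound[of s s t "- t"] in auto)

lemma tsum_deriv_t:
  assumes s: "s < 0"
  shows "((\<lambda>t. tsum a k t s) has_real_derivative - tsum a (Suc k) t s) (at t)"
proof -
  have "((\<lambda>t. tsum a k t s) has_real_derivative (\<Sum>n. - (a n * real (Suc n) ^ Suc k * exp (s * (real (Suc n))\<^sup>2 - t * real (Suc n))))) (at t)"
    unfolding tsum_def
  proof (rule has_derivative_suminf_dominated[where S = "{t-1<..}"])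
    show "((\<lambda>t. a n * real (Suc n) ^ k * exp (s * (real (Suc n))\<^sup>2 - t * real (Suc n))) has_real_derivative
        - (a n * real (Suc n) ^ Suc k * exp (s * (real (Suc n))\<^sup>2 - y * real (Suc n)))) (at y)" for n y
      by (auto intro!: derivative_eq_intros simp: algebra_simps)
    show "\<bar>- (a n * real (Suc n) ^ Suc k * exp (s * (real (Suc n))\<^sup>2 - y * real (Suc n)))\<bar>
      \<le> real (Suc n) ^ Suc k * exp (s * (real (Suc n))\<^sup>2 + (1 - t) * real (Suc n))" if "y \<in> {t-1<..}" for n y
      unfolding abs_minus_cancel using that by (intro tsum_term_bound) auto
    show "summable (\<lambda>n. real (Suc n) ^ Suc k * exp (s * (real (Suc n))\<^sup>2 + (1 - t) * real (Suc n)))"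
      by (rule summable_theta_terms[OF s])
  qed (use s summable_tsum in auto)
  also have "(\<Sum>n. - (a n * real (Suc n) ^ Suc k * exp (s * (real (Suc n))\<^sup>2 - t * real (Suc n)))) = - tsum a (Suc k) t s"
    unfolding tsum_def by (rule suminf_minus[OF summable_tsum[OF s]])
  finally show ?thesis .
qed

lemma tsum_deriv_s:
  assumes s: "s < 0"
  shows "((\<lambda>s. tsum a k t s) has_real_derivative tsum a (Suc (Suc k)) t s) (at s)"
  unfolding tsum_def
proof (rule has_derivative_suminf_dominated[where S = "{..<s/2}"])
  show "((\<lambda>s. a n * real (Suc n) ^ k * exp (s * (real (Suc n))\<^sup>2 - t * real (Suc n))) has_real_derivative
      a n * real (Suc n) ^ Suc (Suc k) * exp (y * (real (Suc n))\<^sup>2 - t * real (Suc n))) (at y)" for n y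
    by (auto intro!: derivative_eq_intros simp: power2_eq_square)
  show "\<bar>a n * real (Suc n) ^ Suc (Suc k) * exp (y * (real (Suc n))\<^sup>2 - t * real (Suc n))\<bar>
    \<le> real (Suc n) ^ Suc (Suc k) * exp (s/2 * (real (Suc n))\<^sup>2 + (- t) * real (Suc n))" if "y \<in> {..<s/2}" for n y
    using that by (intro tsum_term_bound) auto
  show "summable (\<lambda>n. real (Suc n) ^ Suc (Suc k) * exp (s/2 * (real (Suc n))\<^sup>2 + (- t) * real (Suc n)))"
    using s by (intro summable_theta_terms) simp
qed (use s summable_tsum in auto)

lemma continuous_on_tsum:
  assumes s1: "s1 < 0"
  shows "continuous_on ({0..T} \<times> {s0..s1}) (\<lambda>z. tsum a k (fst z) (snd z))"
  unfolding tsum_def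
proof (rule continuous_on_suminf_dominated)
  show "continuous_on ({0..T} \<times> {s0..s1}) (\<lambda>z. a n * real (Suc n) ^ k * exp (snd z * (real (Suc n))\<^sup>2 - fst z * real (Suc n)))" for n
    by (intro continuous_intros)
  show "\<bar>a n * real (Suc n) ^ k * exp (snd z * (real (Suc n))\<^sup>2 - fst z * real (Suc n))\<bar>
      \<le> real (Suc n) ^ k * exp (s1 * (real (Suc n))\<^sup>2 + 0 * real (Suc n))" if "z \<in> {0..T} \<times> {s0..s1}" for n z
    using that by (intro tsum_term_bound) auto
qed (rule summable_theta_terms[OF s1])

end

section \<open>Signs of the partial theta series on t >= 0\<close>

text \<open>In either region the exponents of consecutive terms differ by at least 1, so the
  exponential at least halves, while N + 1 <= 2 N. The terms therefore decrease and the Leibniz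
  criterion applies. The lines s = -1 and t = 1 are two edges of the rectangle for the minimum
  principle.\<close>

lemma alternating_tsum_nonneg_termwise:
  assumes s: "s < 0" and t: "t \<ge> 0" and st: "s \<le> -1 \<or> t \<ge> 1"
  shows "tsum (\<lambda>n. (-1) ^ n) 1 t s \<ge> 0"
proof -
  let ?b = "\<lambda>n. real (Suc n) * exp (s * (real (Suc n))\<^sup>2 - t * real (Suc n))"
  have sum: "summable ?b" using summable_theta_terms[OF s, of 1 "- t"] by simp
  have mono: "?b (Suc n) \<le> ?b n" for n
  proof -
    define N where "N = real (Suc n)"
    have N: "N \<ge> 1" by (simp add: N_def)
    have "s * (2 * N + 1) \<le> s * 1" using s N by (intro mult_left_mono_neg) auto
    then have e: "s * (2 * N + 1) - t \<le> -1"
    proof (cases "s \<le> -1")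
      case False
      then have "t \<ge> 1" using st by simp
      then show ?thesis using \<open>s * (2 * N + 1) \<le> s * 1\<close> s by linarith
    qed (use t in linarith)
    have "exp (1::real) \<ge> 2" using exp_ge_add_one_self[of 1] by simp
    then have "exp (-1::real) \<le> 1 / 2" by (simp add: exp_minus field_simps)
    moreover have "exp (s * (2 * N + 1) - t) \<le> exp (-1)" using e by (simp only: exp_le_cancel_iff)
    ultimately have "exp (s * (2 * N + 1) - t) \<le> 1 / 2" by (rule order_trans[rotated])
    then have "(N + 1) * exp (s * (2 * N + 1) - t) \<le> (N + 1) * (1 / 2)" using N by (intro mult_left_mono) auto
    also have "\<dots> \<le> N" using N by simp
    finally have "(N + 1) * exp (s * (2 * N + 1) - t) * exp (s * N\<^sup>2 - t * N) \<le> N * exp (s * N\<^sup>2 - t * N)"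
      by (rule mult_right_mono) simp
    moreover have "exp (s * (2 * N + 1) - t) * exp (s * N\<^sup>2 - t * N) = exp (s * (N + 1)\<^sup>2 - t * (N + 1))"
      by (simp add: power2_eq_square algebra_simps flip: exp_add)
    ultimately have "(N + 1) * exp (s * (N + 1)\<^sup>2 - t * (N + 1)) \<le> N * exp (s * N\<^sup>2 - t * N)"
      by (simp only: mult.assoc)
    then show ?thesis by (simp add: N_def add.commute)
  qed
  have "(\<Sum>i<2*0. (-1) ^ i * ?b i) \<le> (\<Sum>i. (-1) ^ i * ?b i)"
    by (rule summable_Leibniz'(2)[OF summable_LIMSEQ_zero[OF sum] _ mono]) simp
  then show ?thesis by (simp add: tsum_def mult.assoc)
qed

text \<open>On [0,1] x [-1,s] the edges s = -1 and t = 1 are settled termwise. On the edge t = 0 the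
  t-derivative is minus an alternating second moment, signed by
  \<open>alternating_square_moment_nonneg\<close>.\<close>

theorem alternating_tsum_nonneg:
  assumes s: "s < 0" and t: "t \<ge> 0"
  shows "tsum (\<lambda>n. (-1) ^ n) 1 t s \<ge> 0"
proof (cases "s \<le> -1 \<or> t \<ge> 1")
  case False
  let ?a = "\<lambda>n::nat. (-1::real) ^ n"
  show ?thesis
  proof (rule heat_min_principle[where T = 1 and ?s0.0 = "-1" and ?s1.0 = s and u = "tsum ?a 1"
        and ut = "\<lambda>t s. - tsum ?a 2 t s" and us = "tsum ?a 3"])
    show "continuous_on ({0..1} \<times> {-1..s}) (\<lambda>(t,s). tsum ?a 1 t s)"
      unfolding case_prod_beta by (rule continuous_on_tsum[OF _ s]) simp
    fix t' s' assume t': "t' \<in> {0..1::real}" and s': "s' \<in> {-1..s}"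
    have neg: "s' < 0" using s' s by simp
    have Dt: "((\<lambda>t. tsum ?a k t s') has_real_derivative - tsum ?a (Suc k) t' s') (at t')" for k
      by (rule tsum_deriv_t[OF _ neg]) simp
    show "((\<lambda>t. tsum ?a 1 t s') has_real_derivative - tsum ?a 2 t' s') (at t')"
      using Dt[of 1] by (simp add: numeral_2_eq_2)
    show "((\<lambda>t. - tsum ?a 2 t s') has_real_derivative tsum ?a 3 t' s') (at t')"
      using DERIV_minus[OF Dt[of 2]] by (simp add: numeral_3_eq_3 numeral_2_eq_2)
    have "((\<lambda>s. tsum ?a 1 t' s) has_real_derivative tsum ?a (Suc (Suc 1)) t' s') (at s')"
      by (rule tsum_deriv_s[OF _ neg]) simp
    then show "((\<lambda>s. tsum ?a 1 t' s) has_real_derivative tsum ?a 3 t' s') (at s')"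
      by (simp add: numeral_3_eq_3)
  next
    fix s' assume s': "s' \<in> {-1..s}"
    have "tsum ?a 2 0 s' = (\<Sum>n. (-1) ^ n * (real (Suc n))\<^sup>2 * exp (- ((- s') * (real (Suc n))\<^sup>2)))"
      by (simp add: tsum_def)
    also have "\<dots> \<ge> 0" using s' s by (intro alternating_square_moment_nonneg) auto
    finally show "- tsum ?a 2 0 s' \<le> 0" by simp
    show "tsum ?a 1 1 s' \<ge> 0" using s' s by (intro alternating_tsum_nonneg_termwise) auto
  next
    fix t' assume "t' \<in> {0..1::real}"
    then show "tsum ?a 1 t' (-1) \<ge> 0" by (intro alternating_tsum_nonneg_termwise) auto
  qed (use False t s in auto)
qed (use alternating_tsum_nonneg_termwise[OF s t] in simp)

abbreviation "psum \<equiv> tsum (\<lambda>_. 1)"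

text \<open>The n-th term has the factor t N - 2 s N^2 - 2, and either - 2 s N^2 or t N alone is
  already at least 2.\<close>

lemma dilation_heat_nonneg_termwise:
  assumes s: "s < 0" and t: "t \<ge> 0" and st: "s \<le> -1 \<or> t \<ge> 2"
  shows "t * psum 2 t s - 2 * s * psum 3 t s - 2 * psum 1 t s \<ge> 0"
proof -
  let ?e = "\<lambda>k n. 1 * real (Suc n) ^ k * exp (s * (real (Suc n))\<^sup>2 - t * real (Suc n))"
  have sm: "summable (?e k)" for k by (rule summable_tsum[OF _ s]) simp
  have S: "(\<lambda>n. t * ?e 2 n - 2 * s * ?e 3 n - 2 * ?e 1 n) sums (t * psum 2 t s - 2 * s * psum 3 t s - 2 * psum 1 t s)"
    unfolding tsum_def by (intro sums_diff sums_mult summable_sums sm)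
  have nn: "0 \<le> t * ?e 2 n - 2 * s * ?e 3 n - 2 * ?e 1 n" for n
  proof -
    define N where "N = real (Suc n)"
    have N: "N \<ge> 1" by (simp add: N_def)
    have "t * N - 2 * s * N\<^sup>2 - 2 \<ge> 0"
    proof (cases "s \<le> -1")
      case True
      have "2 * 1 \<le> (- 2 * s) * N\<^sup>2" using True N by (intro mult_mono) (auto simp: one_le_power)
      moreover have "t * N \<ge> 0" using t N by simp
      ultimately show ?thesis by simp
    next
      case False
      then have "2 * 1 \<le> t * N" using st N by (intro mult_mono) auto
      moreover have "(- 2 * s) * N\<^sup>2 \<ge> 0" by (rule mult_nonneg_nonneg) (use s in auto)
      ultimately show ?thesis by simp
    qed
    then have "N * (t * N - 2 * s * N\<^sup>2 - 2) * exp (s * N\<^sup>2 - t * N) \<ge> 0" using N by (intro mult_nonneg_nonneg) auto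
    also have "N * (t * N - 2 * s * N\<^sup>2 - 2) * exp (s * N\<^sup>2 - t * N)
       = t * (1 * N ^ 2 * exp (s * N\<^sup>2 - t * N)) - 2 * s * (1 * N ^ 3 * exp (s * N\<^sup>2 - t * N)) - 2 * (1 * N ^ 1 * exp (s * N\<^sup>2 - t * N))"
      by (simp add: algebra_simps power2_eq_square power3_eq_cube)
    finally show ?thesis unfolding N_def .
  qed
  show ?thesis by (rule sums_le[OF nn sums_zero S])
qed

lemma theta_dilation_psum:
  assumes s: "s < 0"
  shows "theta_dilation (- s) = 1 + 2 * (psum 0 0 s + 2 * s * psum 2 0 s)"
proof -
  let ?e = "\<lambda>k n. 1 * real (Suc n) ^ k * exp (s * (real (Suc n))\<^sup>2 - 0 * real (Suc n))"
  have sm: "summable (?e k)" for k by (rule summable_tsum[OF _ s]) simp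
  have "(\<lambda>n. ?e 0 n + 2 * s * ?e 2 n) sums (psum 0 0 s + 2 * s * psum 2 0 s)"
    unfolding tsum_def by (intro sums_add sums_mult summable_sums sm)
  moreover have "?e 0 n + 2 * s * ?e 2 n = (1 - 2 * (- s) * (real (Suc n))\<^sup>2) * exp (- ((- s) * (real (Suc n))\<^sup>2))" for n
    by (simp add: algebra_simps)
  ultimately show ?thesis unfolding theta_dilation_def by (simp only: sums_iff)
qed

text \<open>A positive value would make psum 0 0 s + 2 s psum 2 0 s increase to the right of s,
  against the monotonicity of the theta dilation. The latter is available for r <= 1, which is why
  the rectangle of the minimum principle starts at s = -1.\<close>

lemma dilation_heat_left:
  assumes s: "-1 \<le> s" "s < 0"
  shows "3 * psum 2 0 s + 2 * s * psum 4 0 s \<le> 0"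
proof (rule ccontr)
  assume "\<not> ?thesis"
  then have pos: "3 * psum 2 0 s + 2 * s * psum 4 0 s > 0" by simp
  have d: "((\<lambda>s. psum k 0 s) has_real_derivative psum (Suc (Suc k)) 0 s) (at s)" for k
    by (rule tsum_deriv_s[OF _ s(2)]) simp
  have "((\<lambda>s. psum 0 0 s + 2 * s * psum 2 0 s) has_real_derivative (3 * psum 2 0 s + 2 * s * psum 4 0 s)) (at s)"
    using d[of 0] d[of 2] by (auto intro!: derivative_eq_intros simp: numeral_2_eq_2 eval_nat_numeral)
  from DERIV_pos_inc_right[OF this pos]
  obtain d where d: "d > 0" "\<And>h. 0 < h \<Longrightarrow> h < d \<Longrightarrow> psum 0 0 s + 2 * s * psum 2 0 s < psum 0 0 (s + h) + 2 * (s + h) * psum 2 0 (s + h)"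
    by blast
  define h where "h = min (d/2) (- s / 2)"
  have h: "0 < h" "h < d" "s + h < 0" using d(1) s by (auto simp: h_def min_def)
  have "theta_dilation (- (s + h)) \<le> theta_dilation (- s)"
    using h s by (intro theta_dilation_mono) auto
  then show False using d(2)[OF h(1,2)] unfolding theta_dilation_psum[OF s(2)] theta_dilation_psum[OF h(3)] by simp
qed

text \<open>The left-hand side solves the heat equation, and its t-derivative at t = 0 is half the s-derivative of
  \<open>theta_dilation (- s)\<close>.\<close>

theorem dilation_heat_nonneg:
  assumes s: "s < 0" and t: "t \<ge> 0"
  shows "t * psum 2 t s - 2 * s * psum 3 t s - 2 * psum 1 t s \<ge> 0"
proof (cases "s \<le> -1 \<or> t \<ge> 2")
  case False
  have a: "\<bar>1\<bar> \<le> (1::real)" by simp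
  show ?thesis
  proof (rule heat_min_principle[where T = 2 and ?s0.0 = "-1" and ?s1.0 = s
        and u = "\<lambda>t s. t * psum 2 t s - 2 * s * psum 3 t s - 2 * psum 1 t s"
        and ut = "\<lambda>t s. 3 * psum 2 t s - t * psum 3 t s + 2 * s * psum 4 t s"
        and us = "\<lambda>t s. t * psum 4 t s - 4 * psum 3 t s - 2 * s * psum 5 t s"])
    show "continuous_on ({0..2} \<times> {-1..s}) (\<lambda>(t,s). t * psum 2 t s - 2 * s * psum 3 t s - 2 * psum 1 t s)"
      unfolding case_prod_beta by (intro continuous_intros continuous_on_tsum[OF a s])
    fix t' s' assume t': "t' \<in> {0..2::real}" and s': "s' \<in> {-1..s}"
    have neg: "s' < 0" using s' s by simp
    have Dt: "((\<lambda>t. psum k t s') has_real_derivative - psum (Suc k) t' s') (at t')" for k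
      by (rule tsum_deriv_t[OF a neg])
    have Ds: "((\<lambda>s. psum k t' s) has_real_derivative psum (Suc (Suc k)) t' s') (at s')" for k
      by (rule tsum_deriv_s[OF a neg])
    have n: "Suc 1 = 2" "Suc 2 = 3" "Suc 3 = 4" "Suc 4 = 5" by simp_all
    note Dts = Dt[of 1, unfolded n] Dt[of 2, unfolded n] Dt[of 3, unfolded n] Dt[of 4, unfolded n]
    note Dss = Ds[of 1, unfolded n] Ds[of 2, unfolded n] Ds[of 3, unfolded n]
    show "((\<lambda>t. t * psum 2 t s' - 2 * s' * psum 3 t s' - 2 * psum 1 t s') has_real_derivative
        3 * psum 2 t' s' - t' * psum 3 t' s' + 2 * s' * psum 4 t' s') (at t')"
      by (rule derivative_eq_intros Dts refl)+ (simp add: algebra_simps)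
    show "((\<lambda>t. 3 * psum 2 t s' - t * psum 3 t s' + 2 * s' * psum 4 t s') has_real_derivative
        t' * psum 4 t' s' - 4 * psum 3 t' s' - 2 * s' * psum 5 t' s') (at t')"
      by (rule derivative_eq_intros Dts refl)+ (simp add: algebra_simps)
    show "((\<lambda>s. t' * psum 2 t' s - 2 * s * psum 3 t' s - 2 * psum 1 t' s) has_real_derivative
        t' * psum 4 t' s' - 4 * psum 3 t' s' - 2 * s' * psum 5 t' s') (at s')"
      by (rule derivative_eq_intros Dss refl)+ (simp add: algebra_simps)
  next
    fix s' assume s': "s' \<in> {-1..s}"
    show "3 * psum 2 0 s' - 0 * psum 3 0 s' + 2 * s' * psum 4 0 s' \<le> 0"
      using dilation_heat_left[of s'] s' s by simp
    show "2 * psum 2 2 s' - 2 * s' * psum 3 2 s' - 2 * psum 1 2 s' \<ge> 0"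
      using s' s by (intro dilation_heat_nonneg_termwise) auto
  next
    fix t' assume "t' \<in> {0..2::real}"
    then show "t' * psum 2 t' (-1) - 2 * (-1) * psum 3 t' (-1) - 2 * psum 1 t' (-1) \<ge> 0"
      by (intro dilation_heat_nonneg_termwise) auto
  qed (use False t s in auto)
qed (use dilation_heat_nonneg_termwise[OF s t] in simp)

text \<open>The edge t = 0 of \<open>dilation_heat_nonneg\<close>. It signs the s-derivative that
  governs the minorant.\<close>

lemma first_moment_dilation_nonpos:
  assumes s: "s < 0"
  shows "psum 1 0 s + s * psum 3 0 s \<le> 0"
proof -
  define A B where "A = psum 1 0 s" and "B = s * psum 3 0 s"
  have "0 - 2 * B - 2 * A \<ge> 0"
    using dilation_heat_nonneg[OF s, of 0] by (simp only: A_def B_def mult.assoc mult_zero_left)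
  then show ?thesis unfolding A_def[symmetric] B_def[symmetric] by simp
qed

text \<open>As a function of t the left-hand side vanishes at 0, is convex by \<open>dilation_heat_nonneg\<close>, and is bounded above.\<close>

lemma truncated_laplace_kernel_nonpos:
  assumes s: "s < 0" and t: "t \<ge> 0"
  shows "t * psum 0 t s + 2 * s * (psum 1 0 s - psum 1 t s) \<le> 0"
proof (rule ccontr)
  define \<Phi> where "\<Phi> = (\<lambda>t. t * psum 0 t s + 2 * s * (psum 1 0 s - psum 1 t s))"
  define \<Phi>' where "\<Phi>' = (\<lambda>t. psum 0 t s - t * psum 1 t s + 2 * s * psum 2 t s)"
  assume "\<not> ?thesis"
  then have pos: "\<Phi> t > 0" by (simp add: \<Phi>_def)
  have a: "\<bar>1\<bar> \<le> (1::real)" by simp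
  have D: "((\<lambda>t. psum k t s) has_real_derivative - psum (Suc k) t s) (at t)" for k t
    by (rule tsum_deriv_t[OF a s])
  have n: "Suc 0 = 1" "Suc 1 = 2" "Suc 2 = 3" by simp_all
  note Ds = D[of 0, unfolded n(1)] D[of 1, unfolded n(2)] D[of 2, unfolded n(3)]
  have d1: "(\<Phi> has_real_derivative \<Phi>' t) (at t)" for t
    unfolding \<Phi>_def \<Phi>'_def by (rule derivative_eq_intros Ds refl)+ (simp add: algebra_simps)
  have d2: "(\<Phi>' has_real_derivative (t * psum 2 t s - 2 * s * psum 3 t s - 2 * psum 1 t s)) (at t)" for t
    unfolding \<Phi>'_def by (rule derivative_eq_intros Ds refl)+ (simp add: algebra_simps)
  have mono: "\<Phi>' x \<le> \<Phi>' y" if "0 \<le> x" "x \<le> y" for x y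
    by (rule DERIV_nonneg_imp_nondecreasing[OF that(2)])
      (use d2 dilation_heat_nonneg[OF s] that in \<open>meson order_trans\<close>)
  have "\<Phi> 0 = 0" by (simp add: \<Phi>_def)
  then have t0: "t > 0" using pos t by (cases "t = 0") auto
  obtain \<xi> where \<xi>: "0 < \<xi>" "\<xi> < t" "\<Phi> t - \<Phi> 0 = (t - 0) * \<Phi>' \<xi>"
    using MVT2[OF t0, of \<Phi> \<Phi>'] d1 by blast
  define m where "m = \<Phi>' \<xi>"
  have m: "m > 0" using \<xi>(3) pos t0 \<open>\<Phi> 0 = 0\<close> by (simp add: m_def zero_less_mult_iff)
  \<comment> \<open>From x <= exp(x N) the first summand is at most the series at t = 0; the second
    summand is nonpositive because s < 0.\<close>
  have bound: "\<Phi> x \<le> psum 0 0 s" if x: "x > 0" for x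
  proof -
    have sm: "summable (\<lambda>n. 1 * real (Suc n) ^ k * exp (s * (real (Suc n))\<^sup>2 - y * real (Suc n)))" for k y
      by (rule summable_tsum[OF a s])
    have "x * psum 0 x s = (\<Sum>n. x * (1 * real (Suc n) ^ 0 * exp (s * (real (Suc n))\<^sup>2 - x * real (Suc n))))"
      unfolding tsum_def by (rule suminf_mult[OF sm, symmetric])
    also have "\<dots> \<le> psum 0 0 s" unfolding tsum_def
    proof (rule suminf_le[OF _ summable_mult[OF sm] sm])
      fix n
      have "x * 1 \<le> x * real (Suc n)" using x by (intro mult_left_mono) auto
      also have "\<dots> \<le> exp (x * real (Suc n))" using exp_ge_add_one_self[of "x * real (Suc n)"] by linarith
      finally have "x * exp (s * (real (Suc n))\<^sup>2 - x * real (Suc n)) \<le> exp (x * real (Suc n)) * exp (s * (real (Suc n))\<^sup>2 - x * real (Suc n))"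
        by (intro mult_right_mono) auto
      also have "\<dots> = exp (s * (real (Suc n))\<^sup>2)" by (simp flip: exp_add)
      finally show "x * (1 * real (Suc n) ^ 0 * exp (s * (real (Suc n))\<^sup>2 - x * real (Suc n)))
        \<le> 1 * real (Suc n) ^ 0 * exp (s * (real (Suc n))\<^sup>2 - 0 * real (Suc n))" by simp
    qed
    finally have 1: "x * psum 0 x s \<le> psum 0 0 s" .
    have "psum 1 x s \<le> psum 1 0 s"
      unfolding tsum_def by (rule suminf_le[OF _ sm sm]) (use x in \<open>auto intro!: mult_left_mono\<close>)
    then have "psum 1 0 s - psum 1 x s \<ge> 0" by simp
    then have "2 * s * (psum 1 0 s - psum 1 x s) \<le> 0"
      using s mult_nonpos_nonneg[of "2 * s" "psum 1 0 s - psum 1 x s"] by simp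
    with 1 show ?thesis by (simp add: \<Phi>_def)
  qed
  \<comment> \<open>Over a run of this length a slope of at least m raises the value by
    \<open>psum 0 0 s + 1\<close>, past the upper bound.\<close>
  define y where "y = t + (psum 0 0 s + 1) / m"
  have P0: "psum 0 0 s \<ge> 0" using bound[OF t0] pos by linarith
  have y: "t < y" using m P0 by (simp add: y_def add_pos_nonneg)
  obtain z where z: "t < z" "z < y" "\<Phi> y - \<Phi> t = (y - t) * \<Phi>' z"
    using MVT2[OF y, of \<Phi> \<Phi>'] d1 by blast
  have "(y - t) * m \<le> (y - t) * \<Phi>' z"
    using mono[of \<xi> z] \<xi> z y by (intro mult_left_mono) (auto simp: m_def)
  moreover have "(y - t) * m = psum 0 0 s + 1" using m by (simp add: y_def)
  ultimately show False using z(3) pos bound[of y] y t0 by simp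
qed

text \<open>A midpoint comparison: 2 y <= exp y - exp(- y) at y = - s N bounds each term by a
  multiple of the increment of exp(s v^2) between the half-integers N - 1/2 and N + 1/2. The sum
  telescopes, and exp(- s/4) cancels the value at v = 1/2, leaving exactly 1.\<close>

lemma first_moment_bound:
  assumes s: "s < 0"
  shows "- 2 * s * psum 1 0 s \<le> 1"
proof -
  have sinh: "2 * y \<le> exp y - exp (- y)" if "y \<ge> 0" for y :: real
  proof -
    have "(\<lambda>y. exp y - exp (- y) - 2 * y) 0 \<le> (\<lambda>y. exp y - exp (- y) - 2 * y) y"
    proof (rule DERIV_nonneg_imp_nondecreasing[OF that])
      fix x :: real
      have "((\<lambda>y. exp y - exp (- y) - 2 * y) has_real_derivative (exp x + exp (- x) - 2)) (at x)"
        by (auto intro!: derivative_eq_intros)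
      moreover have "exp x + exp (- x) - 2 \<ge> 0"
        using exp_ge_add_one_self[of x] exp_ge_add_one_self[of "- x"] by linarith
      ultimately show "\<exists>z. ((\<lambda>y. exp y - exp (- y) - 2 * y) has_real_derivative z) (at x) \<and> 0 \<le> z" by blast
    qed
    then show ?thesis by simp
  qed
  let ?g = "\<lambda>n. exp (s * (real n + 1/2)\<^sup>2)"
  have trm: "- 2 * s * (1 * real (Suc n) ^ 1 * exp (s * (real (Suc n))\<^sup>2 - 0 * real (Suc n))) \<le> exp (- s / 4) * (?g n - ?g (Suc n))" for n
  proof -
    define N where "N = real (Suc n)"
    have "2 * (- s * N) \<le> exp (- s * N) - exp (- (- s * N))" using s by (intro sinh) (simp add: N_def mult_nonpos_nonneg)
    then have "2 * (- s * N) * exp (s * N\<^sup>2) \<le> (exp (- s * N) - exp (s * N)) * exp (s * N\<^sup>2)"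
      by (intro mult_right_mono) auto
    also have "\<dots> = exp (- s / 4) * (exp (s * (N - 1/2)\<^sup>2) - exp (s * (N + 1/2)\<^sup>2))"
      by (simp add: algebra_simps power2_eq_square flip: exp_add)
    finally show ?thesis by (simp add: N_def algebra_simps)
  qed
  have sm: "summable (\<lambda>n. 1 * real (Suc n) ^ 1 * exp (s * (real (Suc n))\<^sup>2 - 0 * real (Suc n)))"
    by (rule summable_tsum[OF _ s]) simp
  have "- 2 * s * psum 1 0 s = (\<Sum>n. - 2 * s * (1 * real (Suc n) ^ 1 * exp (s * (real (Suc n))\<^sup>2 - 0 * real (Suc n))))"
    unfolding tsum_def by (rule suminf_mult[OF sm, symmetric])
  also have "\<dots> \<le> 1"
  proof (rule suminf_le_const[OF summable_mult[OF sm]])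
    fix m
    have "(\<Sum>n<m. - 2 * s * (1 * real (Suc n) ^ 1 * exp (s * (real (Suc n))\<^sup>2 - 0 * real (Suc n)))) \<le> (\<Sum>n<m. exp (- s / 4) * (?g n - ?g (Suc n)))"
      by (intro sum_mono trm)
    also have "\<dots> = exp (- s / 4) * (?g 0 - ?g m)"
      by (simp only: sum_distrib_left[symmetric] sum_lessThan_telescope'[of ?g])
    also have "\<dots> \<le> exp (- s / 4) * ?g 0" by (intro mult_left_mono) auto
    also have "\<dots> = 1" by (simp add: power2_eq_square flip: exp_add)
    finally show "(\<Sum>n<m. - 2 * s * (1 * real (Suc n) ^ 1 * exp (s * (real (Suc n))\<^sup>2 - 0 * real (Suc n)))) \<le> 1" .
  qed
  finally show ?thesis .
qed

section \<open>Quadrature at the integers and partial fractions\<close>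

definition csinc :: "complex \<Rightarrow> complex" where
  "csinc z = (if z = 0 then 1 else sin z / z)"

definition rsinc :: "real \<Rightarrow> real" where
  "rsinc x = (if x = 0 then 1 else sin x / x)"

lemma csinc_of_real: "csinc (of_real x) = of_real (rsinc x)"
  by (simp add: csinc_def rsinc_def sin_of_real)

lemma rsinc_0 [simp]: "rsinc 0 = 1"
  by (simp add: rsinc_def)

lemma rsinc_minus: "rsinc (- x) = rsinc x"
  by (simp add: rsinc_def)

lemma isCont_rsinc: "isCont rsinc x"
  using isCont_sinc[of x] by (simp add: rsinc_def[abs_def])

lemma csinc_minus: "csinc (- z) = csinc z"
  by (simp add: csinc_def)

lemma holomorphic_on_csinc: "csinc holomorphic_on A"
proof -
  have "(\<lambda>z. if z = 0 then deriv sin 0 else (sin z - sin 0) / (z - 0)) holomorphic_on UNIV"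
    by (rule pole_lemma) (auto intro: holomorphic_intros)
  moreover have "deriv sin (0::complex) = 1" by (simp add: DERIV_imp_deriv[OF DERIV_sin])
  ultimately have "csinc holomorphic_on UNIV"
    by (simp add: csinc_def[abs_def] cong: if_cong)
  then show ?thesis by (rule holomorphic_on_subset) simp
qed

lemma norm_cos_le_exp_Im: "norm (cos z) \<le> exp \<bar>Im z\<bar>" for z :: complex
proof -
  have "norm (exp (\<i> * z) + exp (- (\<i> * z))) \<le> exp (- Im z) + exp (Im z)"
    by (rule order_trans[OF norm_triangle_ineq]) simp
  also have "\<dots> \<le> exp \<bar>Im z\<bar> + exp \<bar>Im z\<bar>" by (intro add_mono) auto
  finally show ?thesis unfolding cos_exp_eq by (simp add: norm_divide)
qed

lemma norm_sin_le: "norm (sin z) \<le> norm z * exp \<bar>Im z\<bar>" for z :: complex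
proof -
  have "norm (sin z - sin 0) \<le> exp \<bar>Im z\<bar> * norm (z - 0)"
  proof (rule field_differentiable_bound[where S = "closed_segment 0 z" and f' = cos])
    fix w assume "w \<in> closed_segment 0 z"
    then obtain u where u: "0 \<le> u" "u \<le> 1" "w = of_real u * z"
      by (auto simp: closed_segment_def scaleR_conv_of_real)
    then have "\<bar>Im w\<bar> \<le> \<bar>Im z\<bar>" by (simp add: abs_mult mult_left_le_one_le)
    then show "norm (cos w) \<le> exp \<bar>Im z\<bar>" by (intro order_trans[OF norm_cos_le_exp_Im]) simp
    show "(sin has_field_derivative cos w) (at w within closed_segment 0 z)"
      by (rule has_field_derivative_at_within[OF DERIV_sin])
  qed auto
  then show ?thesis by (simp add: mult.commute)
qed

lemma norm_csinc_le: "norm (csinc z) \<le> exp \<bar>Im z\<bar>"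
  using norm_sin_le[of z] by (auto simp: csinc_def norm_divide divide_le_eq mult.commute)

lemma continuous_on_rsinc: "continuous_on UNIV rsinc"
  by (rule continuous_at_imp_continuous_on) (simp add: isCont_rsinc)

lemma exp_type_leI:
  assumes "f holomorphic_on UNIV" "C > 0" "\<And>z. norm (f z) \<le> C * exp (\<tau> * norm z)"
  shows "exp_type_le \<tau> f"
  unfolding exp_type_le_def
proof (intro conjI allI impI exI)
  fix e :: real and z :: complex assume "e > 0"
  then have "C * exp (\<tau> * norm z) \<le> C * exp ((\<tau> + e) * norm z)"
    using assms(2) by (simp add: algebra_simps)
  then show "norm (f z) \<le> C * exp ((\<tau> + e) * norm z)" using assms(3)[of z] by linarith
qed (use assms in auto)

lemma exp_type_csinc_affine:
  assumes "c \<ge> 0"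
  shows "exp_type_le c (\<lambda>z. csinc (of_real c * (z - of_real a)))"
proof (rule exp_type_leI[where C = 1])
  show "(\<lambda>z. csinc (of_real c * (z - of_real a))) holomorphic_on UNIV"
    by (intro holomorphic_on_compose_gen[OF _ holomorphic_on_csinc[of UNIV], unfolded o_def] holomorphic_intros) auto
  fix z :: complex
  have "\<bar>Im (of_real c * (z - of_real a))\<bar> \<le> c * norm z"
    using assms abs_Im_le_cmod[of z] by (simp add: abs_mult mult_left_mono)
  then show "norm (csinc (of_real c * (z - of_real a))) \<le> 1 * exp (c * norm z)"
    by (intro order_trans[OF norm_csinc_le]) simp
qed simp

lemma rsinc_square_decay: "(rsinc v)\<^sup>2 \<le> 2 / (1 + v\<^sup>2)" for v :: real
proof (cases "v = 0")
  case False
  have pos: "1 + v\<^sup>2 > 0" by (simp add: add_pos_nonneg)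
  have "(sin v)\<^sup>2 \<le> v\<^sup>2" using abs_sin_x_le_abs_x[of v] by (simp add: abs_le_square_iff)
  moreover have "(sin v)\<^sup>2 \<le> 1" by (simp add: abs_square_le_1)
  then have "(sin v)\<^sup>2 * v\<^sup>2 \<le> v\<^sup>2" using mult_right_mono[of "(sin v)\<^sup>2" 1 "v\<^sup>2"] by simp
  ultimately have "(sin v)\<^sup>2 * (1 + v\<^sup>2) \<le> 2 * v\<^sup>2" by (simp add: algebra_simps)
  then show ?thesis using False pos by (simp add: rsinc_def power_divide field_simps)
qed simp

lemma one_plus_square_shift: "1 + u\<^sup>2 \<le> 2 * (1 + x\<^sup>2) * (1 + (u - x)\<^sup>2)" for u x :: real
proof -
  have "2 * (u - x)\<^sup>2 + 2 * x\<^sup>2 - u\<^sup>2 = (u - 2 * x)\<^sup>2" by (simp add: power2_eq_square algebra_simps)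
  then have "u\<^sup>2 \<le> 2 * (u - x)\<^sup>2 + 2 * x\<^sup>2" using zero_le_power2[of "u - 2 * x"] by linarith
  moreover have "2 * (1 + x\<^sup>2) * (1 + (u - x)\<^sup>2) = 2 + 2 * (u - x)\<^sup>2 + 2 * x\<^sup>2 + 2 * (x\<^sup>2 * (u - x)\<^sup>2)"
    by (simp add: algebra_simps)
  moreover have "x\<^sup>2 * (u - x)\<^sup>2 \<ge> 0" by simp
  ultimately show ?thesis by linarith
qed

lemma fourier_vanish_even_part:
  assumes D: "exp_type_le \<tau> D" and \<tau>: "\<tau> \<ge> 0" and int: "integrable lborel (\<lambda>x. D (of_real x))"
    and b: "\<bar>b\<bar> \<ge> \<tau>" and re: "\<And>x::real. D (of_real x) = of_real (E x)"
  shows "(LINT x|lborel. E x * cos (b * x)) = 0"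
proof -
  have i: "integrable lborel (\<lambda>x. D (of_real x) * exp (\<i> * of_real (b * x)))"
    by (rule integrable_mult_bounded[OF int, where B = 1]) auto
  have "(LINT x|lborel. E x * cos (b * x)) = (LINT x|lborel. Re (D (of_real x) * exp (\<i> * of_real (b * x))))"
    by (intro Bochner_Integration.integral_cong refl) (simp only: re cis_conv_exp[symmetric] Re_complex_of_real Im_complex_of_real
      times_complex.sel cis.sel mult_zero_left diff_zero)
  also have "\<dots> = Re (LINT x|lborel. D (of_real x) * exp (\<i> * of_real (b * x)))"
    by (rule integral_Re[OF i])
  finally show ?thesis using exp_type_fourier_vanish_abs[OF D \<tau> int b] by simp
qed

text \<open>The squared sinc has type 2 pi, so Poisson summation leaves only the frequency 0, whose
  coefficient does not depend on the shift x. The sum of shifted squared sincs over the integers is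
  therefore constant in x, and dividing by the common factor sin^2/pi^2 gives the partial
  fractions.\<close>

theorem csc_square_partial_fractions:
  fixes x :: real
  assumes x: "x \<notin> \<int>"
  shows "(\<lambda>n. 1 / (x - real (Suc n))\<^sup>2 + 1 / (x + real (Suc n))\<^sup>2) sums (pi\<^sup>2 / (sin (pi * x))\<^sup>2 - 1 / x\<^sup>2)"
proof -
  \<comment> \<open>Averaging over x and - x makes the function even in u, as
    \<open>poisson_summation_even\<close> requires.\<close>
  define E where "E = (\<lambda>x u. ((rsinc (pi * (u - x)))\<^sup>2 + (rsinc (pi * (u + x)))\<^sup>2) / 2 :: real)"
  define c where "c = (\<lambda>x k. LINT u|lborel. E x u * cos (2 * pi * real k * u))"
  define D where "D = (\<lambda>x z. ((csinc (of_real pi * (z - of_real x)))\<^sup>2 + (csinc (of_real pi * (z - of_real (- x))))\<^sup>2) * (1/2))"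
  have contE: "continuous_on UNIV (E x)" for x
    unfolding E_def by (intro continuous_intros continuous_on_compose2[OF continuous_on_rsinc]) auto
  have decay: "\<bar>E x u\<bar> \<le> (4 * (1 + x\<^sup>2)) / (1 + u\<^sup>2)" for x u
  proof -
    have one: "(rsinc (pi * (u - y)))\<^sup>2 \<le> (4 * (1 + y\<^sup>2)) / (1 + u\<^sup>2)" for y
    proof -
      have "(u - y)\<^sup>2 \<le> (pi * (u - y))\<^sup>2"
        using pi_gt3 by (simp add: power_mult_distrib mult_le_cancel_right1 one_le_power)
      then have "2 / (1 + (pi * (u - y))\<^sup>2) \<le> 2 / (1 + (u - y)\<^sup>2)"
        by (intro divide_left_mono) (auto intro!: mult_pos_pos add_pos_nonneg)
      also have "\<dots> \<le> (4 * (1 + y\<^sup>2)) / (1 + u\<^sup>2)"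
        using one_plus_square_shift[of u y]
        by (subst frac_le_eq) (auto simp: add_nonneg_eq_0_iff algebra_simps intro!: divide_nonpos_pos mult_pos_pos add_pos_nonneg)
      finally show ?thesis using rsinc_square_decay[of "pi * (u - y)"] by linarith
    qed
    have "\<bar>E x u\<bar> = E x u" by (simp add: E_def)
    also have "\<dots> \<le> (4 * (1 + x\<^sup>2)) / (1 + u\<^sup>2)"
    proof -
      have avg: "(a + b) / 2 \<le> c" if "a \<le> c" "b \<le> c" for a b c :: real using that by simp
      show ?thesis unfolding E_def by (rule avg) (use one[of x] one[of "- x"] in simp_all)
    qed
    finally show ?thesis .
  qed
  have DE: "D x (of_real u) = of_real (E x u)" for x u
    unfolding D_def E_def
    by (simp only: of_real_diff[symmetric] of_real_mult[symmetric] csinc_of_real of_real_power[symmetric]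
        of_real_add[symmetric] diff_minus_eq_add) simp
  have typeD: "exp_type_le (2 * pi) (D x)" for x
  proof -
    have sq: "exp_type_le (2 * pi) (\<lambda>z. (csinc (of_real pi * (z - of_real a)))\<^sup>2)" for a
      using exp_type_le_mult[OF exp_type_csinc_affine[of pi a] exp_type_csinc_affine[of pi a]]
      by (simp add: power2_eq_square)
    have "exp_type_le 0 (\<lambda>z. 1/2)" by (rule exp_type_leI[where C = 1]) auto
    from exp_type_le_mult[OF exp_type_le_add[OF sq[of x] sq[of "- x"]] this]
    show ?thesis by (simp add: D_def)
  qed
  have intE: "integrable lborel (E x)" for x
    by (rule integrable_bounded_by_inverse_square[OF borel_measurable_continuous_onI[OF contE]]) (use decay in simp)
  have intD: "integrable lborel (\<lambda>u. D x (of_real u))" for x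
    unfolding DE using intE by simp
  \<comment> \<open>The frequency 2 pi (k + 1) is at or beyond the edge of the band; for k = 0 the
    closed endpoint of the vanishing theorem is used.\<close>
  have ck: "c x (Suc k) = 0" for x k
    unfolding c_def by (rule fourier_vanish_even_part[OF typeD _ intD _ DE]) (auto simp: abs_mult)
  have c0: "c x 0 = (LINT u|lborel. (rsinc (pi * u))\<^sup>2)" for x
  proof -
    have i: "integrable lborel (\<lambda>u. (rsinc (pi * u))\<^sup>2)" using intE[of 0] by (simp add: E_def)
    have sh: "(LINT u|lborel. (rsinc (pi * (u - y)))\<^sup>2) = (LINT u|lborel. (rsinc (pi * u))\<^sup>2)"
      and ish: "integrable lborel (\<lambda>u. (rsinc (pi * (u - y)))\<^sup>2)" for y
      using lborel_integral_real_affine[of 1 "\<lambda>u. (rsinc (pi * u))\<^sup>2" "- y"]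
        lborel_integrable_real_affine[OF i, of 1 "- y"] by simp_all
    have "c x 0 = ((LINT u|lborel. (rsinc (pi * (u - x)))\<^sup>2) + (LINT u|lborel. (rsinc (pi * (u - (- x))))\<^sup>2)) / 2"
      unfolding c_def E_def using ish[of x] ish[of "- x"] by simp
    then show ?thesis unfolding sh by simp
  qed
  have pois: "E x 0 + 2 * (\<Sum>n. E x (real (Suc n))) = c x 0" for x
  proof -
    have "E x 0 + 2 * (\<Sum>n. E x (real (Suc n))) = c x 0 + 2 * (\<Sum>k. c x (Suc k))"
    proof (rule poisson_summation_even[OF contE _ decay])
      show "E x (- u) = E x u" for u
      proof -
        have "rsinc (pi * (- u - x)) = rsinc (pi * (u + x))" "rsinc (pi * (- u + x)) = rsinc (pi * (u - x))"
          using rsinc_minus[of "pi * (u + x)"] rsinc_minus[of "pi * (u - x)"] by (simp_all add: algebra_simps)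
        then show ?thesis unfolding E_def by (simp only: add.commute)
      qed
      show "summable (\<lambda>k. \<bar>c x k\<bar>)" by (rule summable_Suc_iff[THEN iffD1]) (simp add: ck)
    qed (simp add: c_def)
    then show ?thesis by (simp add: ck)
  qed
  \<comment> \<open>At x = 0 only one sample is nonzero, so the constant is 1; this also evaluates
    the integral of the squared sinc without any computation.\<close>
  have "E 0 0 = 1" "\<And>n. E 0 (real (Suc n)) = 0"
    by (simp add: E_def, simp add: E_def rsinc_def mult.commute[of pi] del: of_nat_Suc)
  then have "c x 0 = 1" for x using pois[of 0] c0 by simp
  then have "E x 0 + 2 * (\<Sum>n. E x (real (Suc n))) = 1" using pois by simp
  moreover have nz: "x \<noteq> 0" "x - real (Suc n) \<noteq> 0" "x + real (Suc n) \<noteq> 0" for n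
    using x by (auto simp: eq_neg_iff_add_eq_0[symmetric] simp del: of_nat_Suc)
  have s: "sin (pi * x) \<noteq> 0" using x sin_times_pi_eq_0[of x] by (simp add: mult.commute)
  have E0: "E x 0 = (sin (pi * x))\<^sup>2 / pi\<^sup>2 * (1 / x\<^sup>2)"
    using nz by (simp add: E_def rsinc_def power_divide power_mult_distrib)
  have EN: "E x (real (Suc n)) = (sin (pi * x))\<^sup>2 / pi\<^sup>2 * (1 / (x - real (Suc n))\<^sup>2 + 1 / (x + real (Suc n))\<^sup>2) / 2" for n
  proof -
    have sq: "(sin (pi * (real (Suc n) - y)))\<^sup>2 = (sin (pi * y))\<^sup>2" for y
    proof -
      have "sin (pi * (real (Suc n) - y)) = - (cos (pi * real (Suc n)) * sin (pi * y))"
        using sin_npi2[of "Suc n"] by (simp only: right_diff_distrib sin_diff)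
      moreover have "(cos (pi * real (Suc n)))\<^sup>2 = 1" unfolding cos_npi2 by (simp flip: power_mult)
      ultimately show ?thesis by (simp add: power_mult_distrib)
    qed
    have one: "(rsinc (pi * (real (Suc n) - y)))\<^sup>2 = (sin (pi * y))\<^sup>2 / pi\<^sup>2 * (1 / (y - real (Suc n))\<^sup>2)"
      if "y - real (Suc n) \<noteq> 0" for y
    proof -
      have "real (Suc n) - y \<noteq> 0" using that by simp
      then have "(rsinc (pi * (real (Suc n) - y)))\<^sup>2 = (sin (pi * y))\<^sup>2 / (pi\<^sup>2 * (real (Suc n) - y)\<^sup>2)"
        using sq[of y] by (simp add: rsinc_def power_divide power_mult_distrib)
      then show ?thesis by (simp add: power2_commute)
    qed
    have "E x (real (Suc n)) = ((rsinc (pi * (real (Suc n) - x)))\<^sup>2 + (rsinc (pi * (real (Suc n) - (- x))))\<^sup>2) / 2"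
      by (simp add: E_def)
    also have "\<dots> = ((sin (pi * x))\<^sup>2 / pi\<^sup>2 * (1 / (x - real (Suc n))\<^sup>2) + (sin (pi * (- x)))\<^sup>2 / pi\<^sup>2 * (1 / ((- x) - real (Suc n))\<^sup>2)) / 2"
      using nz(2)[of n] nz(3)[of n] by (subst one, simp, subst one) (simp_all add: algebra_simps)
    also have "((- x) - real (Suc n))\<^sup>2 = (x + real (Suc n))\<^sup>2" by (simp add: power2_eq_square algebra_simps)
    finally show ?thesis by (simp add: distrib_left)
  qed
  have smE: "summable (\<lambda>n. E x (real (Suc n)))"
  proof (rule summable_rabs_cancel, rule summable_inverse_1_plus_square)
    show "\<bar>E x (real (Suc n))\<bar> \<le> (4 * (1 + x\<^sup>2)) / (1 + (real (Suc n))\<^sup>2)" for n by (rule decay)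
  qed auto
  let ?q = "(sin (pi * x))\<^sup>2 / pi\<^sup>2"
  have q: "?q \<noteq> 0" using s by simp
  have "(\<lambda>n. 2 / ?q * E x (real (Suc n))) sums (2 / ?q * (\<Sum>n. E x (real (Suc n))))"
    by (intro sums_mult summable_sums smE)
  moreover have "2 / ?q * E x (real (Suc n)) = 1 / (x - real (Suc n))\<^sup>2 + 1 / (x + real (Suc n))\<^sup>2" for n
    unfolding EN using s by (simp del: of_nat_Suc)
  moreover have "2 / ?q * (\<Sum>n. E x (real (Suc n))) = pi\<^sup>2 / (sin (pi * x))\<^sup>2 - 1 / x\<^sup>2"
  proof -
    have "2 * (\<Sum>n. E x (real (Suc n))) = 1 - ?q * (1 / x\<^sup>2)" using calculation E0 by simp
    then have "2 / ?q * (\<Sum>n. E x (real (Suc n))) = (1 - ?q * (1 / x\<^sup>2)) / ?q" by (simp only: times_divide_eq_left)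
    also have "\<dots> = 1 / ?q - 1 / x\<^sup>2" using q by (simp only: diff_divide_distrib nonzero_mult_div_cancel_left not_False_eq_True)
    finally show ?thesis by simp
  qed
  ultimately show ?thesis by (simp only:)
qed

text \<open>Damping by \<open>(rsinc (\<delta> * x))\<^sup>2\<close> supplies the decay needed for Poisson summation but widens the spectrum, so that the
  frequencies 1 and -1 survive; their contribution vanishes as \<open>\<delta>\<close> tends to 0.\<close>

theorem exp_type_2pi_integral_nonneg:
  assumes D: "exp_type_le (2 * pi) D" and int: "integrable lborel (\<lambda>x. D (of_real x))"
    and re: "\<And>x::real. D (of_real x) = of_real (d x)" and nn: "\<And>n::int. d (of_int n) \<ge> 0"
  shows "(LINT x|lborel. d x) \<ge> 0"
proof -
  have hol: "D holomorphic_on UNIV" using D by (simp add: exp_type_le_def)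
  obtain M where M: "M > 0" "\<And>z. norm (D z) \<le> M * exp (2 * pi * \<bar>Im z\<bar>)"
    using exp_type_le_L1_bound[OF D _ int] by auto
  have dM: "\<bar>d x\<bar> \<le> M" for x using M(2)[of "of_real x"] by (simp add: re)
  have contd: "continuous_on UNIV d"
  proof -
    have "continuous_on UNIV (\<lambda>x. Re (D (of_real x)))"
      by (intro continuous_intros continuous_on_compose2[OF holomorphic_on_imp_continuous_on[OF hol]]) auto
    then show ?thesis by (simp add: re)
  qed
  \<comment> \<open>Passing to the even part keeps the integral and the nonnegativity at the
    integers.\<close>
  define e where "e = (\<lambda>x. (d x + d (- x)) / 2)"
  have intd: "integrable lborel d" using int by (simp add: re complex_of_real_integrable_eq)
  have inte: "integrable lborel e" unfolding e_def
    using intd lborel_integrable_reflect[OF intd] by simp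
  have conte: "continuous_on UNIV e" unfolding e_def
    by (intro continuous_intros contd continuous_on_compose2[OF contd]) auto
  define De where "De = (\<lambda>z. (D z + D (- z)) * (1/2))"
  have half: "exp_type_le 0 (\<lambda>z. 1/2)" by (rule exp_type_leI[where C = 1]) auto
  have typeDe: "exp_type_le (2 * pi) De"
    using exp_type_le_mult[OF exp_type_le_add[OF D exp_type_le_uminus[OF D]] half] by (simp add: De_def)
  have De: "De (of_real x) = of_real (e x)" for x
    unfolding De_def e_def of_real_minus[symmetric] re by simp
  have intDe: "integrable lborel (\<lambda>x. De (of_real x))" unfolding De using inte by simp
  define g where "g = (\<lambda>\<delta> x. (rsinc (\<delta> * x))\<^sup>2 :: real)"
  have contg: "continuous_on UNIV (g \<delta>)" for \<delta>
    unfolding g_def by (intro continuous_intros continuous_on_compose2[OF continuous_on_rsinc]) auto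
  have g1: "0 \<le> g \<delta> x" "g \<delta> x \<le> 1" for \<delta> x
  proof -
    show "0 \<le> g \<delta> x" by (simp add: g_def)
    have "\<bar>rsinc v\<bar> \<le> 1" for v :: real
      using abs_sin_x_le_abs_x[of v] by (simp add: rsinc_def abs_divide divide_le_eq)
    then show "g \<delta> x \<le> 1" by (simp add: g_def abs_square_le_1)
  qed
  have pos: "(LINT x|lborel. e x * g \<delta> x) + 2 * (LINT x|lborel. e x * (g \<delta> x * cos (2 * pi * x))) \<ge> 0"
    if \<delta>: "0 < \<delta>" "\<delta> \<le> 1" for \<delta>
  proof -
    define E where "E = (\<lambda>x. e x * g \<delta> x)"
    define c where "c = (\<lambda>k::nat. LINT x|lborel. E x * cos (2 * pi * real k * x))"
    define DE where "DE = (\<lambda>z. De z * (csinc (of_real \<delta> * (z - of_real 0)) * csinc (of_real \<delta> * (z - of_real 0))))"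
    have type: "exp_type_le (2 * pi + (\<delta> + \<delta>)) DE"
      unfolding DE_def using \<delta> by (intro exp_type_le_mult typeDe exp_type_csinc_affine) auto
    have DE: "DE (of_real x) = of_real (E x)" for x
      unfolding DE_def E_def g_def of_real_0 diff_zero of_real_mult[symmetric] csinc_of_real De
      by (simp add: power2_eq_square)
    have intE: "integrable lborel E" unfolding E_def
      by (rule integrable_mult_bounded[OF inte, where B = 1])
        (use g1 borel_measurable_continuous_onI[OF contg] in auto)
    have intDE: "integrable lborel (\<lambda>x. DE (of_real x))" unfolding DE using intE by simp
    \<comment> \<open>For \<delta> <= 1 the widened band 2 pi + 2 \<delta> stays below 4 pi, so only
      the indices 0 and 1 survive.\<close>
    have ck: "c (Suc (Suc k)) = 0" for k unfolding c_def
    proof (rule fourier_vanish_even_part[OF type _ intDE _ DE])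
      have "2 * pi + (\<delta> + \<delta>) \<le> 2 * pi * 2" using \<delta> pi_gt3 by simp
      also have "\<dots> \<le> 2 * pi * real (Suc (Suc k))" by (intro mult_left_mono) auto
      finally show "2 * pi + (\<delta> + \<delta>) \<le> \<bar>2 * pi * real (Suc (Suc k))\<bar>" by simp
    qed (use \<delta> in simp)
    have "E 0 + 2 * (\<Sum>n. E (real (Suc n))) = c 0 + 2 * (\<Sum>k. c (Suc k))"
    proof (rule poisson_summation_even)
      show "continuous_on UNIV E" unfolding E_def by (intro continuous_intros conte contg)
      show "E (- x) = E x" for x
      proof -
        have "rsinc (\<delta> * (- x)) = rsinc (\<delta> * x)" using rsinc_minus[of "\<delta> * x"] by simp
        then show ?thesis unfolding E_def e_def g_def by (simp only: minus_minus add.commute)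
      qed
      show "\<bar>E x\<bar> \<le> (2 * M / \<delta>\<^sup>2) / (1 + x\<^sup>2)" for x
      proof -
        have "\<bar>e x\<bar> \<le> M" using dM[of x] dM[of "- x"] by (simp add: e_def abs_le_iff)
        moreover have "g \<delta> x \<le> 2 / (\<delta>\<^sup>2 * (1 + x\<^sup>2))"
        proof -
          have "\<delta>\<^sup>2 \<le> 1" using \<delta> by (simp add: power_le_one)
          then have "\<delta>\<^sup>2 * (1 + x\<^sup>2) \<le> 1 + (\<delta> * x)\<^sup>2" by (simp add: power_mult_distrib distrib_left)
          then have "2 / (1 + (\<delta> * x)\<^sup>2) \<le> 2 / (\<delta>\<^sup>2 * (1 + x\<^sup>2))"
            using \<delta> by (intro divide_left_mono) (auto intro!: mult_pos_pos add_pos_nonneg)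
          then show ?thesis using rsinc_square_decay[of "\<delta> * x"] unfolding g_def by linarith
        qed
        ultimately have "\<bar>e x\<bar> * g \<delta> x \<le> M * (2 / (\<delta>\<^sup>2 * (1 + x\<^sup>2)))"
          using g1[of \<delta> x] M by (intro mult_mono) auto
        then show ?thesis using g1[of \<delta> x] by (simp add: E_def abs_mult mult.commute)
      qed
      show "summable (\<lambda>k. \<bar>c k\<bar>)"
        by (rule summable_Suc_iff[THEN iffD1], rule summable_Suc_iff[THEN iffD1]) (simp add: ck)
    qed (simp add: c_def)
    moreover have "(\<Sum>k. c (Suc k)) = c 1"
    proof -
      have "(\<Sum>k. c (Suc k)) = (\<Sum>k\<in>{0}. c (Suc k))"
        by (rule suminf_finite) (use ck in \<open>auto simp: gr0_conv_Suc\<close>)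
      then show ?thesis by simp
    qed
    moreover have En: "E (real n) \<ge> 0" for n
      using nn[of "int n"] nn[of "- int n"] g1[of \<delta> "real n"] by (simp add: E_def e_def)
    have "E 0 + 2 * (\<Sum>n. E (real (Suc n))) \<ge> 0"
    proof -
      have "summable (\<lambda>n. E (real (Suc n)))"
      proof (rule summable_comparison_test'[where N = 0])
        have "summable (\<lambda>n. (2 * M / \<delta>\<^sup>2) * (1 / (real (Suc n))\<^sup>2))"
          by (intro summable_mult) (use inverse_squares_sums in \<open>auto simp: sums_iff\<close>)
        then show "summable (\<lambda>n. (2 * M / \<delta>\<^sup>2) * (1 / (real (Suc n))\<^sup>2))" .
        fix n
        have "\<bar>e (real (Suc n))\<bar> \<le> M" using dM[of "real (Suc n)"] dM[of "- real (Suc n)"] by (simp add: e_def abs_le_iff)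
        moreover have "g \<delta> (real (Suc n)) \<le> 2 / (\<delta> * real (Suc n))\<^sup>2"
        proof -
          have "2 / (1 + (\<delta> * real (Suc n))\<^sup>2) \<le> 2 / (\<delta> * real (Suc n))\<^sup>2"
            using \<delta> by (intro divide_left_mono) (auto intro!: mult_pos_pos add_pos_nonneg simp del: of_nat_Suc)
          then show ?thesis using rsinc_square_decay[of "\<delta> * real (Suc n)"] unfolding g_def by linarith
        qed
        ultimately have "\<bar>e (real (Suc n))\<bar> * g \<delta> (real (Suc n)) \<le> M * (2 / (\<delta> * real (Suc n))\<^sup>2)"
          using g1[of \<delta> "real (Suc n)"] M by (intro mult_mono) auto
        then show "norm (E (real (Suc n))) \<le> (2 * M / \<delta>\<^sup>2) * (1 / (real (Suc n))\<^sup>2)"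
          using g1[of \<delta> "real (Suc n)"] by (simp add: E_def abs_mult mult.commute power_mult_distrib del: of_nat_Suc)
      qed
      then show ?thesis using En[of 0] En by (intro add_nonneg_nonneg mult_nonneg_nonneg suminf_nonneg) (auto simp del: of_nat_Suc)
    qed
    ultimately have "c 0 + 2 * c 1 \<ge> 0" by simp
    then show ?thesis by (simp add: c_def E_def mult.assoc)
  qed
  have lim: "(\<lambda>m. g (1 / real (Suc m)) x) \<longlonglongrightarrow> 1" for x
  proof -
    have t0: "(\<lambda>n. 1 / real (Suc n)) \<longlonglongrightarrow> 0" by real_asymp
    have "(\<lambda>m. rsinc (1 / real (Suc m) * x)) \<longlonglongrightarrow> rsinc (0 * x)"
      by (rule isCont_tendsto_compose[OF isCont_rsinc]) (intro tendsto_intros t0)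
    from tendsto_power[OF this, of 2] show ?thesis by (simp add: g_def)
  qed
  have "(\<lambda>m. (LINT x|lborel. e x * g (1 / real (Suc m)) x) + 2 * (LINT x|lborel. e x * (g (1 / real (Suc m)) x * cos (2 * pi * x))))
     \<longlonglongrightarrow> (LINT x|lborel. e x * 1) + 2 * (LINT x|lborel. e x * (1 * cos (2 * pi * x)))"
  proof (intro tendsto_intros integral_mult_tendsto_bounded[OF inte, where B = 1] lim)
    show "g (1 / real (Suc m)) \<in> borel_measurable lborel" for m
      using borel_measurable_continuous_onI[OF contg] by simp
    then show "(\<lambda>x. g (1 / real (Suc m)) x * cos (2 * pi * x)) \<in> borel_measurable lborel" for m
      by measurable
    show "norm (g (1 / real (Suc m)) x * cos (2 * pi * x)) \<le> 1" for m x
      using g1[of "1 / real (Suc m)" x] by (auto simp: abs_mult intro!: mult_le_one)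
  qed (use g1 in auto)
  then have "(LINT x|lborel. e x * 1) + 2 * (LINT x|lborel. e x * (1 * cos (2 * pi * x))) \<ge> 0"
    by (rule LIMSEQ_le_const) (use pos in auto)
  \<comment> \<open>Without damping the type is 2 pi exactly, so the transform vanishes at the
    endpoint 2 pi; this is the limit of the surviving coefficient.\<close>
  moreover have "(LINT x|lborel. e x * cos (2 * pi * x)) = 0"
    by (rule fourier_vanish_even_part[OF typeDe _ intDe _ De]) auto
  moreover have "(LINT x|lborel. e x) = (LINT x|lborel. d x)"
    unfolding e_def using intd lborel_integrable_reflect[OF intd] lborel_integral_reflect[of d] by simp
  ultimately show ?thesis by simp
qed

section \<open>Partial fractions of the cosecant\<close>

lemma csc_partial_fractions_summable:
  fixes x :: real
  shows "summable (\<lambda>n. \<bar>(-1) ^ Suc n * (2 * x / (x\<^sup>2 - (real (Suc n))\<^sup>2))\<bar>)"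
proof -
  define b where "b = (\<lambda>n. (-1) ^ Suc n * (2 * x / (x\<^sup>2 - (real (Suc n))\<^sup>2)))"
  have "(\<lambda>n. 2 * x / (x\<^sup>2 - (real (Suc n))\<^sup>2)) \<in> O(\<lambda>n. 1 / (real (Suc n))\<^sup>2)" by real_asymp
  moreover have "b \<in> O(\<lambda>n. 2 * x / (x\<^sup>2 - (real (Suc n))\<^sup>2))"
    unfolding b_def by (intro bigoI[where c = 1]) (simp add: norm_mult norm_power abs_mult)
  ultimately have "b \<in> O(\<lambda>n. 1 / (real (Suc n))\<^sup>2)" by (rule landau_o.big_trans[rotated])
  moreover have "summable (\<lambda>n. norm (1 / (real (Suc n))\<^sup>2))"
    using inverse_squares_sums by (auto simp: sums_iff)
  ultimately have "summable (\<lambda>j. \<bar>b j\<bar>)"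
    using summable_comparison_test_bigo[of "\<lambda>n. 1 / (real (Suc n))\<^sup>2" "\<lambda>j. \<bar>b j\<bar>"] by simp
  then show ?thesis unfolding b_def .
qed

text \<open>This is the Fourier series of v -> cos(2 pi x v) on [-1/2, 1/2], evaluated at v = 0. Its
  coefficients are sin(pi x)/pi times the partial fractions, and \<open>cos_kernel\<close> acts as a
  summation method; by absolute summability the generalized sum is the ordinary one.\<close>

theorem csc_partial_fractions:
  fixes x :: real
  assumes x: "x \<notin> \<int>"
  shows "(\<lambda>n. (-1) ^ Suc n * (2 * x / (x\<^sup>2 - (real (Suc n))\<^sup>2))) sums (pi / sin (pi * x) - 1 / x)"
proof -
  have nz: "x \<noteq> 0" "x - real (Suc n) \<noteq> 0" "x + real (Suc n) \<noteq> 0" for n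
    using x by (auto simp: eq_neg_iff_add_eq_0[symmetric] simp del: of_nat_Suc)
  have s: "sin (pi * x) \<noteq> 0" using x sin_times_pi_eq_0[of x] by (simp add: mult.commute)
  define b where "b = (\<lambda>n. (-1) ^ Suc n * (2 * x / (x\<^sup>2 - (real (Suc n))\<^sup>2)))"
  have base: "((\<lambda>v. cos (2 * pi * y * v)) has_integral sin (pi * y) / (pi * y)) {-1/2..1/2}" if y: "y \<noteq> 0" for y
  proof -
    let ?F = "\<lambda>v. sin (2 * pi * y * v) / (2 * pi * y)"
    have "((\<lambda>v. cos (2 * pi * y * v)) has_integral (?F (1/2) - ?F (-1/2))) {-1/2..1/2}"
      by (rule fundamental_theorem_of_calculus)
        (use y in \<open>auto intro!: derivative_eq_intros simp: has_real_derivative_iff_has_vector_derivative[symmetric]\<close>)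
    then show ?thesis by (simp add: field_simps)
  qed
  have coeff: "((\<lambda>v. cos (2 * pi * real (Suc j) * v) * cos (2 * pi * x * v)) has_integral (sin (pi * x) / pi * (b j / 2))) {-1/2..1/2}" for j
  proof -
    define J where "J = real (Suc j)"
    have nzJ: "x - J \<noteq> 0" "x + J \<noteq> 0" using nz(2)[of j] nz(3)[of j] by (simp_all add: J_def)
    have "((\<lambda>v. (cos (2 * pi * (x - J) * v) + cos (2 * pi * (x + J) * v)) * (1/2)) has_integral
        (sin (pi * (x - J)) / (pi * (x - J)) + sin (pi * (x + J)) / (pi * (x + J))) * (1/2)) {-1/2..1/2}"
      by (intro has_integral_mult_left has_integral_add base nzJ)
    moreover have "(cos (2 * pi * (x - J) * v) + cos (2 * pi * (x + J) * v)) * (1/2) = cos (2 * pi * J * v) * cos (2 * pi * x * v)" for v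
      by (simp add: algebra_simps cos_add cos_diff)
    moreover have "(sin (pi * (x - J)) / (pi * (x - J)) + sin (pi * (x + J)) / (pi * (x + J))) * (1/2) = sin (pi * x) / pi * (b j / 2)"
    proof -
      have c: "cos (pi * J) = (-1) ^ Suc j" "sin (pi * J) = 0"
        unfolding J_def by (rule cos_npi2, rule sin_npi2)
      have "sin (pi * (x - J)) = (-1) ^ Suc j * sin (pi * x)" "sin (pi * (x + J)) = (-1) ^ Suc j * sin (pi * x)"
        unfolding right_diff_distrib distrib_left sin_diff sin_add c by simp_all
      moreover have "(A * S / (pi * (x - J)) + A * S / (pi * (x + J))) * (1/2) = S / pi * (A * (2 * x / (x\<^sup>2 - J\<^sup>2)) / 2)" for A S
      proof -
        have sqd: "x\<^sup>2 - J\<^sup>2 = (x - J) * (x + J)" by (simp add: power2_eq_square algebra_simps)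
        have e: "1 / (x - J) + 1 / (x + J) = 2 * x / (x\<^sup>2 - J\<^sup>2)"
          unfolding sqd using nzJ by (simp add: add_frac_eq)
        have sum: "A * S / (pi * (x - J)) + A * S / (pi * (x + J)) = A * S / pi * (1 / (x - J) + 1 / (x + J))"
          by (simp add: distrib_left)
        have gen: "(A * S / pi * R) * (1/2) = S / pi * (A * R / 2)" for R :: real by simp
        show ?thesis unfolding sum e by (rule gen)
      qed
      ultimately show ?thesis unfolding b_def J_def[symmetric] by (simp only:)
    qed
    ultimately show ?thesis by (simp only: J_def)
  qed
  let ?a = "\<lambda>N j. real (2*N choose (N + j)) / real (2*N choose N)"
  have I: "integral {-1/2..1/2} (\<lambda>v. cos_kernel N v * cos (2 * pi * x * v)) = sin (pi * x) / (pi * x) + sin (pi * x) / pi * (\<Sum>j. ?a N (Suc j) * b j)" for N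
  proof -
    have "((\<lambda>v. cos (2 * pi * x * v) + 2 * (\<Sum>j<N. ?a N (Suc j) * (cos (2 * pi * real (Suc j) * v) * cos (2 * pi * x * v)))) has_integral
       (sin (pi * x) / (pi * x) + 2 * (\<Sum>j<N. ?a N (Suc j) * (sin (pi * x) / pi * (b j / 2))))) {-1/2..1/2}"
      by (intro has_integral_add has_integral_mult_right has_integral_sum base coeff nz) auto
    moreover have "cos (2 * pi * x * v) + 2 * (\<Sum>j<N. ?a N (Suc j) * (cos (2 * pi * real (Suc j) * v) * cos (2 * pi * x * v))) = cos_kernel N v * cos (2 * pi * x * v)" for v
      unfolding cos_kernel_expansion by (simp add: distrib_right sum_distrib_right mult.assoc)
    moreover have "2 * (\<Sum>j<N. ?a N (Suc j) * (sin (pi * x) / pi * (b j / 2))) = sin (pi * x) / pi * (\<Sum>j<N. ?a N (Suc j) * b j)"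
      unfolding sum_distrib_left by (intro sum.cong refl) (simp add: mult_ac)
    moreover have "(\<Sum>j<N. ?a N (Suc j) * b j) = (\<Sum>j. ?a N (Suc j) * b j)"
      by (rule suminf_finite[symmetric]) (auto simp: binomial_eq_0)
    ultimately show ?thesis by (simp only: integral_unique)
  qed
  have sb: "summable (\<lambda>j. \<bar>b j\<bar>)" unfolding b_def by (rule csc_partial_fractions_summable)
  have "(\<lambda>N. \<Sum>j. ?a N (Suc j) * b j) \<longlonglongrightarrow> (\<Sum>j. 1 * b j)"
  proof (rule tannerys_theorem[THEN conjunct2, THEN conjunct2])
    show "(\<lambda>N. ?a N (Suc k) * b k) \<longlonglongrightarrow> 1 * b k" for k
      by (intro tendsto_intros central_binomial_ratio_tendsto)
    have "norm (?a N (Suc k) * b k) \<le> \<bar>b k\<bar>" for N k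
    proof -
      have "norm (?a N (Suc k) * b k) \<le> 1 * \<bar>b k\<bar>"
        unfolding norm_mult using central_binomial_ratio_le[of N "N + Suc k"]
        by (intro mult_mono) auto
      then show ?thesis by simp
    qed
    then show "\<forall>\<^sub>F (k, N) in at_top \<times>\<^sub>F sequentially. norm (?a N (Suc k) * b k) \<le> \<bar>b k\<bar>"
      by (intro always_eventually) auto
  qed (use sb in auto)
  then have "(\<lambda>N. sin (pi * x) / (pi * x) + sin (pi * x) / pi * (\<Sum>j. ?a N (Suc j) * b j)) \<longlonglongrightarrow> sin (pi * x) / (pi * x) + sin (pi * x) / pi * (\<Sum>j. 1 * b j)"
    by (intro tendsto_intros)
  moreover have "(\<lambda>N. sin (pi * x) / (pi * x) + sin (pi * x) / pi * (\<Sum>j. ?a N (Suc j) * b j)) \<longlonglongrightarrow> cos (2 * pi * x * 0)"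
    unfolding I[symmetric] by (rule cos_kernel_approximate_identity) (intro continuous_intros)
  ultimately have "sin (pi * x) / (pi * x) + sin (pi * x) / pi * (\<Sum>j. b j) = 1"
    using LIMSEQ_unique by fastforce
  then have "(\<Sum>j. b j) = pi / sin (pi * x) - 1 / x" using s nz(1) by (simp add: field_simps)
  then show ?thesis using summable_sums[OF summable_rabs_cancel[OF sb]] unfolding b_def by simp
qed

section \<open>Monotonicity in the Gaussian parameter\<close>

definition gsum :: "(nat \<Rightarrow> real) \<Rightarrow> real \<Rightarrow> real" where
  "gsum c s = (\<Sum>n. c n * exp (s * (real (Suc n))\<^sup>2))"

text \<open>A class of coefficients closed under sums, products and multiplication by powers of
  \<open>Suc n\<close>. Summability, linearity and termwise differentiation of \<open>gsum\<close>
  then need only a syntactic check by \<open>poly_growth_intros\<close>.\<close>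

definition poly_growth :: "(nat \<Rightarrow> real) \<Rightarrow> bool" where
  "poly_growth c \<longleftrightarrow> (\<exists>C k. \<forall>n. \<bar>c n\<bar> \<le> C * real (Suc n) ^ k)"

lemma poly_growthI: "(\<And>n. \<bar>c n\<bar> \<le> C * real (Suc n) ^ k) \<Longrightarrow> poly_growth c"
  unfolding poly_growth_def by blast

lemma poly_growth_bounded: "(\<And>n. \<bar>c n\<bar> \<le> C) \<Longrightarrow> poly_growth c"
  by (rule poly_growthI[where k = 0]) simp

lemma poly_growth_add:
  assumes "poly_growth c" "poly_growth d" shows "poly_growth (\<lambda>n. c n + d n)"
proof -
  obtain C k D l where C: "\<And>n. \<bar>c n\<bar> \<le> C * real (Suc n) ^ k" and D: "\<And>n. \<bar>d n\<bar> \<le> D * real (Suc n) ^ l"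
    using assms unfolding poly_growth_def by blast
  have C0: "C \<ge> 0" "D \<ge> 0" using C[of 0] D[of 0] by auto
  show ?thesis
  proof (rule poly_growthI[where C = "C + D" and k = "k + l"])
    fix n
    have "real (Suc n) ^ k \<le> real (Suc n) ^ (k + l)" "real (Suc n) ^ l \<le> real (Suc n) ^ (k + l)"
      by (intro power_increasing; simp)+
    then have "C * real (Suc n) ^ k + D * real (Suc n) ^ l \<le> (C + D) * real (Suc n) ^ (k + l)"
      unfolding distrib_right using C0 by (intro add_mono mult_left_mono)
    then show "\<bar>c n + d n\<bar> \<le> (C + D) * real (Suc n) ^ (k + l)"
      using C[of n] D[of n] abs_triangle_ineq[of "c n" "d n"] by linarith
  qed
qed

lemma poly_growth_mult:
  assumes "poly_growth c" "poly_growth d" shows "poly_growth (\<lambda>n. c n * d n)"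
proof -
  obtain C k D l where C: "\<And>n. \<bar>c n\<bar> \<le> C * real (Suc n) ^ k" and D: "\<And>n. \<bar>d n\<bar> \<le> D * real (Suc n) ^ l"
    using assms unfolding poly_growth_def by blast
  have "\<bar>c n * d n\<bar> \<le> (C * real (Suc n) ^ k) * (D * real (Suc n) ^ l)" for n
    unfolding abs_mult using C[of n] D[of n] by (intro mult_mono) auto
  then show ?thesis
    by (intro poly_growthI[where C = "C * D" and k = "k + l"]) (simp add: power_add mult_ac)
qed

lemma poly_growth_power: "poly_growth (\<lambda>n. real (Suc n) ^ k)"
  by (rule poly_growthI[where C = 1 and k = k]) simp

lemma poly_growth_const: "poly_growth (\<lambda>n. a)"
  by (rule poly_growth_bounded[where C = "\<bar>a\<bar>"]) simp

lemma poly_growth_diff: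
  assumes "poly_growth c" "poly_growth d" shows "poly_growth (\<lambda>n. c n - d n)"
  using poly_growth_add[OF assms(1) poly_growth_mult[OF poly_growth_const[of "-1"] assms(2)]] by simp

lemma poly_growth_alternating: "poly_growth (\<lambda>n. (-1) ^ n)" "poly_growth (\<lambda>n. (-1) ^ Suc n)"
  by (rule poly_growth_bounded[where C = 1], simp)+

lemmas poly_growth_intros = poly_growth_add poly_growth_mult poly_growth_power poly_growth_const
  poly_growth_diff poly_growth_alternating

lemma summable_gsum:
  assumes c: "poly_growth c" and s: "s < 0"
  shows "summable (\<lambda>n. \<bar>c n * exp (s * (real (Suc n))\<^sup>2)\<bar>)"
proof -
  obtain C k where C: "\<And>n. \<bar>c n\<bar> \<le> C * real (Suc n) ^ k"
    using c unfolding poly_growth_def by blast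
  show ?thesis
  proof (rule summable_comparison_test'[where N = 0])
    show "summable (\<lambda>n. C * (real (Suc n) ^ k * exp (s * (real (Suc n))\<^sup>2 + 0 * real (Suc n))))"
      by (intro summable_mult summable_theta_terms s)
    show "norm \<bar>c n * exp (s * (real (Suc n))\<^sup>2)\<bar> \<le> C * (real (Suc n) ^ k * exp (s * (real (Suc n))\<^sup>2 + 0 * real (Suc n)))" for n
      using mult_right_mono[OF C[of n], of "exp (s * (real (Suc n))\<^sup>2)"] by (simp add: abs_mult mult.assoc)
  qed
qed

lemma gsum_sums:
  assumes "poly_growth c" "s < 0"
  shows "(\<lambda>n. c n * exp (s * (real (Suc n))\<^sup>2)) sums gsum c s"
  unfolding gsum_def by (rule summable_sums[OF summable_rabs_cancel[OF summable_gsum[OF assms]]])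

lemma gsum_add:
  assumes "poly_growth c" "poly_growth d" "s < 0"
  shows "gsum (\<lambda>n. c n + d n) s = gsum c s + gsum d s"
  using sums_add[OF gsum_sums[OF assms(1,3)] gsum_sums[OF assms(2,3)]]
  by (simp add: gsum_def sums_iff distrib_right)

lemma gsum_cmult:
  assumes "poly_growth c" "s < 0"
  shows "gsum (\<lambda>n. a * c n) s = a * gsum c s"
  using sums_mult[OF gsum_sums[OF assms], of a] by (simp add: gsum_def sums_iff mult.assoc)

lemma gsum_diff:
  assumes "poly_growth c" "poly_growth d" "s < 0"
  shows "gsum (\<lambda>n. c n - d n) s = gsum c s - gsum d s"
  using sums_diff[OF gsum_sums[OF assms(1,3)] gsum_sums[OF assms(2,3)]]
  by (simp add: gsum_def sums_iff left_diff_distrib)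

lemma gsum_mono:
  assumes "poly_growth c" "poly_growth d" "s < 0" "\<And>n. c n \<le> d n"
  shows "gsum c s \<le> gsum d s"
  by (rule sums_le[OF _ gsum_sums[OF assms(1,3)] gsum_sums[OF assms(2,3)]])
    (use assms(4) in \<open>simp add: mult_right_mono\<close>)

lemma gsum_deriv:
  assumes c: "poly_growth c" and s: "s < 0"
  shows "(gsum c has_real_derivative gsum (\<lambda>n. c n * (real (Suc n))\<^sup>2) s) (at s)"
proof -
  obtain C k where C: "\<And>n. \<bar>c n\<bar> \<le> C * real (Suc n) ^ k"
    using c unfolding poly_growth_def by blast
  have "((\<lambda>s. gsum c s) has_real_derivative gsum (\<lambda>n. c n * (real (Suc n))\<^sup>2) s) (at s)"
    unfolding gsum_def
  proof (rule has_derivative_suminf_dominated[where S = "{..<s/2}"])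
    show "((\<lambda>s. c n * exp (s * (real (Suc n))\<^sup>2)) has_real_derivative c n * (real (Suc n))\<^sup>2 * exp (y * (real (Suc n))\<^sup>2)) (at y)" for n y
      by (auto intro!: derivative_eq_intros)
    show "\<bar>c n * (real (Suc n))\<^sup>2 * exp (y * (real (Suc n))\<^sup>2)\<bar>
      \<le> C * (real (Suc n) ^ (k + 2) * exp (s/2 * (real (Suc n))\<^sup>2 + 0 * real (Suc n)))" if "y \<in> {..<s/2}" for n y
    proof -
      have "y * (real (Suc n))\<^sup>2 \<le> s/2 * (real (Suc n))\<^sup>2" using that by (intro mult_right_mono) auto
      moreover have C0: "C \<ge> 0" using C[of 0] by auto
      ultimately have "\<bar>c n\<bar> * ((real (Suc n))\<^sup>2 * exp (y * (real (Suc n))\<^sup>2)) \<le> (C * real (Suc n) ^ k) * ((real (Suc n))\<^sup>2 * exp (s/2 * (real (Suc n))\<^sup>2))"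
        using C[of n] by (intro mult_mono) auto
      moreover have "\<bar>c n * (real (Suc n))\<^sup>2 * exp (y * (real (Suc n))\<^sup>2)\<bar> = \<bar>c n\<bar> * ((real (Suc n))\<^sup>2 * exp (y * (real (Suc n))\<^sup>2))"
        by (simp only: abs_mult mult.assoc abs_power2 abs_exp_cancel)
      moreover have "(C * real (Suc n) ^ k) * ((real (Suc n))\<^sup>2 * exp (s/2 * (real (Suc n))\<^sup>2))
          = C * (real (Suc n) ^ (k + 2) * exp (s/2 * (real (Suc n))\<^sup>2 + 0 * real (Suc n)))"
        by (simp only: power_add mult_zero_left add_0_right mult_ac)
      ultimately show ?thesis by (simp only:)
    qed
    show "summable (\<lambda>n. C * (real (Suc n) ^ (k + 2) * exp (s/2 * (real (Suc n))\<^sup>2 + 0 * real (Suc n))))"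
      using s by (intro summable_mult summable_theta_terms) simp
    show "summable (\<lambda>n. c n * exp (s * (real (Suc n))\<^sup>2))"
      by (rule summable_rabs_cancel[OF summable_gsum[OF c s]])
  qed (use s in auto)
  then show ?thesis by simp
qed

lemma psum_eq_gsum: "psum k 0 s = gsum (\<lambda>n. real (Suc n) ^ k) s"
  by (simp add: tsum_def gsum_def)

text \<open>A sequence of negative parameters tending to 0. Along it the Gaussian weights disappear
  and the partial fractions remain.\<close>

definition null_time :: "nat \<Rightarrow> real" where "null_time m = - (1 / real (Suc m))"

lemma null_time: "null_time m < 0" "null_time \<longlonglongrightarrow> 0"
proof -
  show "null_time m < 0" by (simp add: null_time_def)
  show "null_time \<longlonglongrightarrow> 0" unfolding null_time_def by real_asymp
qed

lemma gsum_tendsto: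
  assumes sum: "summable (\<lambda>n. \<bar>c n\<bar>)"
  shows "(\<lambda>m. gsum c (null_time m)) \<longlonglongrightarrow> (\<Sum>n. c n)"
  unfolding gsum_def
proof (rule tannerys_theorem[THEN conjunct2, THEN conjunct2])
  show "(\<lambda>m. c n * exp (null_time m * (real (Suc n))\<^sup>2)) \<longlonglongrightarrow> c n" for n
  proof -
    have "(\<lambda>m. c n * exp (null_time m * (real (Suc n))\<^sup>2)) \<longlonglongrightarrow> c n * exp (0 * (real (Suc n))\<^sup>2)"
      by (intro tendsto_intros null_time)
    then show ?thesis by simp
  qed
  have "norm (c n * exp (null_time m * (real (Suc n))\<^sup>2)) \<le> \<bar>c n\<bar>" for n m
  proof -
    have "exp (null_time m * (real (Suc n))\<^sup>2) \<le> 1"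
      using null_time(1)[of m] by (simp add: mult_nonpos_nonneg less_imp_le)
    then show ?thesis using mult_left_mono[of _ 1 "\<bar>c n\<bar>"] by (simp add: abs_mult)
  qed
  then show "\<forall>\<^sub>F (n, m) in at_top \<times>\<^sub>F sequentially. norm (c n * exp (null_time m * (real (Suc n))\<^sup>2)) \<le> \<bar>c n\<bar>"
    by (intro always_eventually) auto
qed (use sum in auto)

text \<open>The sum itself may blow up as s tends to 0, since its coefficients are merely bounded.
  With the factor s in front, r exp(- r N^2) <= 1/N^2 is a majorant uniform in r, so Tannery's
  theorem still applies.\<close>

lemma null_time_gsum_bounded_tendsto:
  assumes c: "\<And>n. \<bar>c n\<bar> \<le> C"
  shows "(\<lambda>m. null_time m * gsum c (null_time m)) \<longlonglongrightarrow> 0"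
proof -
  have pg: "poly_growth c" by (rule poly_growth_bounded[OF c])
  have eq: "null_time m * gsum c (null_time m) = (\<Sum>n. null_time m * (c n * exp (null_time m * (real (Suc n))\<^sup>2)))" for m
    unfolding gsum_def
    by (rule suminf_mult[symmetric, OF summable_rabs_cancel[OF summable_gsum[OF pg null_time(1)]]])
  have "(\<lambda>m. \<Sum>n. null_time m * (c n * exp (null_time m * (real (Suc n))\<^sup>2))) \<longlonglongrightarrow> (\<Sum>n. 0)"
  proof (rule tannerys_theorem[THEN conjunct2, THEN conjunct2])
    show "(\<lambda>m. null_time m * (c n * exp (null_time m * (real (Suc n))\<^sup>2))) \<longlonglongrightarrow> 0" for n
    proof -
      have "(\<lambda>m. null_time m * (c n * exp (null_time m * (real (Suc n))\<^sup>2))) \<longlonglongrightarrow> 0 * (c n * exp (0 * (real (Suc n))\<^sup>2))"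
        by (intro tendsto_intros null_time)
      then show ?thesis by simp
    qed
    have C0: "C \<ge> 0" using c[of 0] by auto
    have "norm (null_time m * (c n * exp (null_time m * (real (Suc n))\<^sup>2))) \<le> C * (1 / (real (Suc n))\<^sup>2)" for n m
    proof -
      define r where "r = - null_time m"
      define N where "N = real (Suc n)"
      have r: "r > 0" and N: "N > 0" using null_time(1)[of m] by (simp_all add: r_def N_def)
      have "r * N\<^sup>2 \<le> exp (r * N\<^sup>2)" using exp_ge_add_one_self[of "r * N\<^sup>2"] by linarith
      then have "r * exp (- r * N\<^sup>2) \<le> 1 / N\<^sup>2"
        using N by (simp add: exp_minus field_simps)
      then have "\<bar>c n\<bar> * (r * exp (- r * N\<^sup>2)) \<le> C * (1 / N\<^sup>2)"
        using c[of n] C0 r by (intro mult_mono) auto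
      moreover have "norm (null_time m * (c n * exp (null_time m * N\<^sup>2))) = \<bar>c n\<bar> * (r * exp (- r * N\<^sup>2))"
        using r by (simp add: r_def abs_mult)
      ultimately show ?thesis by (simp only: N_def)
    qed
    then show "\<forall>\<^sub>F (n, m) in at_top \<times>\<^sub>F sequentially. norm (null_time m * (c n * exp (null_time m * (real (Suc n))\<^sup>2))) \<le> C * (1 / (real (Suc n))\<^sup>2)"
      by (intro always_eventually) auto
    show "summable (\<lambda>n. C * (1 / (real (Suc n))\<^sup>2))"
      by (intro summable_mult) (use inverse_squares_sums in \<open>auto simp: sums_iff\<close>)
  qed simp
  then show ?thesis unfolding eq by simp
qed

lemma antimono_from_deriv_to_null_time:
  fixes F :: "real \<Rightarrow> real"
  assumes d: "\<And>s. s < 0 \<Longrightarrow> \<exists>D. (F has_real_derivative D) (at s) \<and> D \<le> 0" and s: "s < 0"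
  shows "eventually (\<lambda>m. F (null_time m) \<le> F s) sequentially"
proof -
  have "eventually (\<lambda>m. s < null_time m) sequentially"
    using order_tendstoD(1)[OF null_time(2) s] .
  then show ?thesis
  proof eventually_elim
    case (elim m)
    show ?case
      by (rule DERIV_nonpos_imp_nonincreasing[of s "null_time m"]) (use elim d null_time(1)[of m] in force)+
  qed
qed

text \<open>Poisson summation covers - s <= 4. Beyond that the terms decrease, because exp(s (2 N +
  1)) <= 1/4 outweighs (N + 1)^2 <= (2 N)^2, and the Leibniz criterion finishes.\<close>

lemma alternating_gsum_square_nonneg:
  assumes s: "s < 0"
  shows "gsum (\<lambda>n. (-1) ^ n * (real (Suc n))\<^sup>2) s \<ge> 0"
proof (cases "s \<ge> -4")
  case True
  have "gsum (\<lambda>n. (-1) ^ n * (real (Suc n))\<^sup>2) s = (\<Sum>n. (-1) ^ n * (real (Suc n))\<^sup>2 * exp (- ((- s) * (real (Suc n))\<^sup>2)))"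
    by (simp add: gsum_def)
  also have "\<dots> \<ge> 0" using True s by (intro alternating_square_moment_nonneg) auto
  finally show ?thesis .
next
  case False
  let ?b = "\<lambda>n. (real (Suc n))\<^sup>2 * exp (s * (real (Suc n))\<^sup>2)"
  have sum: "summable ?b" using summable_theta_terms[OF s, of 2 0] by simp
  have mono: "?b (Suc n) \<le> ?b n" for n
  proof -
    define N where "N = real (Suc n)"
    have N: "N \<ge> 1" by (simp add: N_def)
    have "(- s) * (2 * N + 1) \<ge> 4 * 1" using False N by (intro mult_mono) auto
    then have "exp ((- s) * (2 * N + 1)) \<ge> 4" using exp_ge_add_one_self[of "(- s) * (2 * N + 1)"] by linarith
    then have "exp (s * (2 * N + 1)) * 4 \<le> exp (s * (2 * N + 1)) * exp ((- s) * (2 * N + 1))"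
      by (intro mult_left_mono) auto
    also have "\<dots> = 1" by (simp flip: exp_add)
    finally have e: "exp (s * (2 * N + 1)) \<le> 1 / 4" by simp
    have "(N + 1)\<^sup>2 \<le> (2 * N)\<^sup>2" using N by (intro power_mono) auto
    then have "(N + 1)\<^sup>2 * exp (s * (2 * N + 1)) \<le> (2 * N)\<^sup>2 * (1 / 4)" using e by (intro mult_mono) auto
    then have "(N + 1)\<^sup>2 * exp (s * (2 * N + 1)) * exp (s * N\<^sup>2) \<le> N\<^sup>2 * exp (s * N\<^sup>2)"
      by (intro mult_right_mono) (simp_all add: power_mult_distrib)
    moreover have "exp (s * (2 * N + 1)) * exp (s * N\<^sup>2) = exp (s * (N + 1)\<^sup>2)"
      by (simp add: power2_eq_square algebra_simps flip: exp_add)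
    ultimately have "(N + 1)\<^sup>2 * exp (s * (N + 1)\<^sup>2) \<le> N\<^sup>2 * exp (s * N\<^sup>2)"
      by (simp only: mult.assoc)
    then show ?thesis by (simp add: N_def add.commute)
  qed
  have "(\<Sum>i<2*0. (-1) ^ i * ?b i) \<le> (\<Sum>i. (-1) ^ i * ?b i)"
    by (rule summable_Leibniz'(2)[OF summable_LIMSEQ_zero[OF sum] _ mono]) simp
  then show ?thesis by (simp add: gsum_def mult.assoc)
qed

text \<open>In the applications \<open>H t\<close> is the Laplace transform at x of h shifted by t, so \<open>H 0\<close> is the transform of h.\<close>

lemma laplace_sign:
  fixes H h :: "real \<Rightarrow> real"
  assumes x: "x > 0"
    and d: "\<And>t. t \<ge> 0 \<Longrightarrow> ((\<lambda>t. exp (- x * t) * H t) has_real_derivative - exp (- x * t) * h t) (at t)"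
    and h: "\<And>t. t \<ge> 0 \<Longrightarrow> h t \<ge> 0"
    and H: "\<And>t. t \<ge> 0 \<Longrightarrow> \<bar>H t\<bar> \<le> A + B * t"
  shows "H 0 \<ge> 0"
proof -
  have "(\<lambda>n. (A + B * real n) * exp (- x * real n)) \<longlonglongrightarrow> 0" using x by real_asymp
  then have lim: "(\<lambda>n. exp (- x * real n) * H (real n)) \<longlonglongrightarrow> 0"
  proof (rule Lim_null_comparison[rotated], intro always_eventually allI)
    fix n
    show "norm (exp (- x * real n) * H (real n)) \<le> (A + B * real n) * exp (- x * real n)"
      using H[of "real n"] by (simp add: abs_mult mult.commute mult_right_mono)
  qed
  have le: "exp (- x * real n) * H (real n) \<le> H 0" for n
  proof -
    have "(\<lambda>t. exp (- x * t) * H t) (real n) \<le> (\<lambda>t. exp (- x * t) * H t) 0"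
    proof (rule DERIV_nonpos_imp_nonincreasing[of 0 "real n"])
      fix t :: real assume "0 \<le> t" "t \<le> real n"
      then show "\<exists>y. ((\<lambda>t. exp (- x * t) * H t) has_real_derivative y) (at t) \<and> y \<le> 0"
        using d[of t] h[of t] by (intro exI[of _ "- exp (- x * t) * h t"]) (simp add: mult_nonpos_nonneg)
    qed simp
    then show ?thesis by simp
  qed
  show ?thesis by (rule LIMSEQ_le_const2[OF lim]) (use le in auto)
qed

lemma tsum_bounded:
  assumes a: "\<And>n. \<bar>a n\<bar> \<le> 1" and s: "s < 0" and t: "t \<ge> 0"
  shows "\<bar>tsum a k t s\<bar> \<le> psum k 0 s"
proof -
  have b: "norm (a n * real (Suc n) ^ k * exp (s * (real (Suc n))\<^sup>2 - t * real (Suc n))) \<le> 1 * real (Suc n) ^ k * exp (s * (real (Suc n))\<^sup>2 - 0 * real (Suc n))" for n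
  proof -
    have "\<bar>a n * real (Suc n) ^ k * exp (s * (real (Suc n))\<^sup>2 - t * real (Suc n))\<bar> \<le> real (Suc n) ^ k * exp (s * (real (Suc n))\<^sup>2 + 0 * real (Suc n))"
      by (rule tsum_term_bound) (use a t in auto)
    then show ?thesis by simp
  qed
  have sm: "summable (\<lambda>n. 1 * real (Suc n) ^ k * exp (s * (real (Suc n))\<^sup>2 - 0 * real (Suc n)))"
    by (rule summable_tsum[OF _ s]) simp
  show ?thesis unfolding tsum_def
    using norm_suminf_le[OF b sm] by simp
qed

section \<open>The part with poles on the negative axis as a Laplace transform\<close>

lemma recip_bound:
  fixes x :: real
  assumes x: "x > 0"
  shows "\<bar>1 / (x + real (Suc n))\<bar> \<le> 1" "\<bar>1 / (x + real (Suc n))\<^sup>2\<bar> \<le> 1"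
  using x by (auto simp: divide_le_eq_1 one_le_power intro!: one_le_power)

context
  fixes x s :: real
  assumes x: "x > 0" and s: "s < 0"
begin

text \<open>As 1/(x + N) is the Laplace transform of exp(- N t) at x, the sum is the transform of
  the alternating series that \<open>alternating_tsum_nonneg\<close> shows to be
  nonnegative.\<close>

lemma alternating_cauchy_sum_nonneg:
  "gsum (\<lambda>n. (-1) ^ n * (real (Suc n) / (x + real (Suc n)))) s \<ge> 0"
proof -
  define a where "a = (\<lambda>n. (-1) ^ n * (1 / (x + real (Suc n))))"
  have a: "\<bar>a n\<bar> \<le> 1" for n using recip_bound(1)[OF x, of n] by (simp add: a_def abs_mult del: of_nat_Suc)
  have "tsum a 1 0 s \<ge> 0"
  proof (rule laplace_sign[where h = "\<lambda>t. tsum (\<lambda>n. (-1) ^ n) 1 t s" and A = "psum 1 0 s" and B = 0, OF x])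
    fix t :: real assume t: "t \<ge> 0"
    show "tsum (\<lambda>n. (-1) ^ n) 1 t s \<ge> 0" by (rule alternating_tsum_nonneg[OF s t])
    have "\<bar>tsum a 1 t s\<bar> \<le> psum 1 0 s" by (rule tsum_bounded[OF _ s t]) (rule a)
    then show "\<bar>tsum a 1 t s\<bar> \<le> psum 1 0 s + 0 * t" by simp
    have "((\<lambda>t. exp (- x * t) * tsum a 1 t s) has_real_derivative (exp (- x * t) * (- x)) * tsum a 1 t s + (- tsum a (Suc 1) t s) * exp (- x * t)) (at t)"
      by (rule derivative_eq_intros tsum_deriv_t[OF a s] refl)+ simp
    \<comment> \<open>The equation x H - H' = h: multiplication by x + N cancels the denominator in
      \<open>a\<close>.\<close>
    moreover have id: "x * tsum a 1 t s + tsum a (Suc 1) t s = tsum (\<lambda>n. (-1) ^ n) 1 t s"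
    proof -
      have "(\<lambda>n. x * (a n * real (Suc n) ^ 1 * exp (s * (real (Suc n))\<^sup>2 - t * real (Suc n))) + a n * real (Suc n) ^ Suc 1 * exp (s * (real (Suc n))\<^sup>2 - t * real (Suc n)))
        sums (x * tsum a 1 t s + tsum a (Suc 1) t s)"
        unfolding tsum_def by (intro sums_add sums_mult summable_sums summable_tsum[OF a s])
      moreover have "x * (a n * real (Suc n) ^ 1 * E) + a n * real (Suc n) ^ Suc 1 * E = (-1) ^ n * real (Suc n) ^ 1 * E" for n E
      proof -
        have nz: "x + real (Suc n) \<noteq> 0" using x by simp
        have "x * (a n * real (Suc n) ^ 1 * E) + a n * real (Suc n) ^ Suc 1 * E = a n * (x + real (Suc n)) * real (Suc n) * E"
          by (simp add: algebra_simps)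
        also have "a n * (x + real (Suc n)) = (-1) ^ n" using nz by (simp add: a_def del: of_nat_Suc)
        finally show ?thesis by simp
      qed
      ultimately show ?thesis unfolding tsum_def by (simp only: sums_iff)
    qed
    ultimately show "((\<lambda>t. exp (- x * t) * tsum a 1 t s) has_real_derivative - exp (- x * t) * tsum (\<lambda>n. (-1) ^ n) 1 t s) (at t)"
      unfolding id[symmetric] by (simp add: algebra_simps)
  qed
  then show ?thesis by (simp add: tsum_def gsum_def a_def)
qed

text \<open>Up to the factor sin^2/pi^2 the left-hand side is \<open>L_plus lam (- x)\<close> for s
  = - pi lam. It is the Laplace transform of the kernel in
  \<open>truncated_laplace_kernel_nonpos\<close>: 1/(x + N)^2 comes from t exp(- N t), and N^2/(x (x
  + N)) = N (1/x - 1/(x + N)) from N (1 - exp(- N t)).\<close>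

lemma truncated_minorant_left_nonpos:
  "gsum (\<lambda>n. 1 / (x + real (Suc n))\<^sup>2) s + 2 * s * gsum (\<lambda>n. (real (Suc n))\<^sup>2 / (x * (x + real (Suc n)))) s \<le> 0"
proof -
  define a where "a = (\<lambda>n. 1 / (x + real (Suc n)))"
  define b where "b = (\<lambda>n. 1 / (x + real (Suc n))\<^sup>2)"
  have a: "\<bar>a n\<bar> \<le> 1" and b: "\<bar>b n\<bar> \<le> 1" for n using recip_bound[OF x, of n] by (simp_all add: a_def b_def del: of_nat_Suc)
  define \<Phi> where "\<Phi> = (\<lambda>t. t * psum 0 t s + 2 * s * (psum 1 0 s - psum 1 t s))"
  \<comment> \<open>\<open>H t\<close> is the transform at x of w -> \<open>\<Phi> (t + w)\<close>;
    splitting the factor t + w produces both \<open>tsum a 0\<close> and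
    \<open>tsum b 0\<close>.\<close>
  define H where "H = (\<lambda>t. t * tsum a 0 t s + tsum b 0 t s + 2 * s * (psum 1 0 s / x - tsum a 1 t s))"
  have as: "x * tsum a k t s + tsum a (Suc k) t s = psum k t s" for k t
  proof -
    have "(\<lambda>n. x * (a n * real (Suc n) ^ k * exp (s * (real (Suc n))\<^sup>2 - t * real (Suc n))) + a n * real (Suc n) ^ Suc k * exp (s * (real (Suc n))\<^sup>2 - t * real (Suc n)))
      sums (x * tsum a k t s + tsum a (Suc k) t s)"
      unfolding tsum_def by (intro sums_add sums_mult summable_sums summable_tsum[OF a s])
    moreover have "x * (a n * real (Suc n) ^ k * E) + a n * real (Suc n) ^ Suc k * E = 1 * real (Suc n) ^ k * E" for n E
    proof -
      have nz: "x + real (Suc n) \<noteq> 0" using x by simp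
      have "x * (a n * real (Suc n) ^ k * E) + a n * real (Suc n) ^ Suc k * E = a n * (x + real (Suc n)) * real (Suc n) ^ k * E"
        by (simp add: algebra_simps)
      also have "a n * (x + real (Suc n)) = 1" using nz by (simp add: a_def del: of_nat_Suc)
      finally show ?thesis .
    qed
    ultimately show ?thesis unfolding tsum_def by (simp only: sums_iff)
  qed
  have bs: "x * tsum b 0 t s + tsum b (Suc 0) t s = tsum a 0 t s" for t
  proof -
    have "(\<lambda>n. x * (b n * real (Suc n) ^ 0 * exp (s * (real (Suc n))\<^sup>2 - t * real (Suc n))) + b n * real (Suc n) ^ Suc 0 * exp (s * (real (Suc n))\<^sup>2 - t * real (Suc n)))
      sums (x * tsum b 0 t s + tsum b (Suc 0) t s)"
      unfolding tsum_def by (intro sums_add sums_mult summable_sums summable_tsum[OF b s])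
    moreover have "x * (b n * real (Suc n) ^ 0 * E) + b n * real (Suc n) ^ Suc 0 * E = a n * real (Suc n) ^ 0 * E" for n E
    proof -
      have nz: "x + real (Suc n) \<noteq> 0" using x by simp
      have "x * (b n * real (Suc n) ^ 0 * E) + b n * real (Suc n) ^ Suc 0 * E = b n * (x + real (Suc n)) * E"
        by (simp add: algebra_simps)
      also have "b n * (x + real (Suc n)) = a n" using nz by (simp add: a_def b_def power2_eq_square del: of_nat_Suc)
      finally show ?thesis by simp
    qed
    ultimately show ?thesis unfolding tsum_def by (simp only: sums_iff)
  qed
  have "- H 0 \<ge> 0"
  proof (rule laplace_sign[where h = "\<lambda>t. - \<Phi> t" and A = "psum 0 0 s + \<bar>2 * s\<bar> * (\<bar>psum 1 0 s / x\<bar> + psum 1 0 s)" and B = "psum 0 0 s", OF x])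
    fix t :: real assume t: "t \<ge> 0"
    show "- \<Phi> t \<ge> 0" using truncated_laplace_kernel_nonpos[OF s t] by (simp add: \<Phi>_def)
    have "\<bar>- H t\<bar> \<le> t * \<bar>tsum a 0 t s\<bar> + \<bar>tsum b 0 t s\<bar> + \<bar>2 * s\<bar> * (\<bar>psum 1 0 s / x\<bar> + \<bar>tsum a 1 t s\<bar>)"
    proof -
      have "\<bar>H t\<bar> \<le> \<bar>t * tsum a 0 t s\<bar> + \<bar>tsum b 0 t s\<bar> + \<bar>2 * s * (psum 1 0 s / x - tsum a 1 t s)\<bar>"
        unfolding H_def by (intro order_trans[OF abs_triangle_ineq] add_mono abs_triangle_ineq order_refl)
      moreover have "\<bar>2 * s * (psum 1 0 s / x - tsum a 1 t s)\<bar> \<le> \<bar>2 * s\<bar> * (\<bar>psum 1 0 s / x\<bar> + \<bar>tsum a 1 t s\<bar>)"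
        unfolding abs_mult[of "2 * s"] by (intro mult_left_mono abs_triangle_ineq4) auto
      ultimately show ?thesis using t by (simp add: abs_mult[of t])
    qed
    also have "\<dots> \<le> t * psum 0 0 s + psum 0 0 s + \<bar>2 * s\<bar> * (\<bar>psum 1 0 s / x\<bar> + psum 1 0 s)"
      by (intro add_mono mult_left_mono tsum_bounded a b s t order_refl) (use t in auto)
    finally show "\<bar>- H t\<bar> \<le> psum 0 0 s + \<bar>2 * s\<bar> * (\<bar>psum 1 0 s / x\<bar> + psum 1 0 s) + psum 0 0 s * t"
      by (simp add: algebra_simps)
    have "((\<lambda>t. exp (- x * t) * - H t) has_real_derivative
       (exp (- x * t) * (- x)) * - H t + (- (1 * tsum a 0 t s + (- tsum a (Suc 0) t s) * t + (- tsum b (Suc 0) t s) + 2 * s * (0 - (- tsum a (Suc 1) t s)))) * exp (- x * t)) (at t)"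
      unfolding H_def by (rule derivative_eq_intros tsum_deriv_t[OF a s] tsum_deriv_t[OF b s] refl)+ simp
    moreover have id: "x * H t - tsum a 0 t s + t * tsum a (Suc 0) t s + tsum b (Suc 0) t s - 2 * s * tsum a (Suc 1) t s = \<Phi> t"
    proof -
      have "x * H t = t * (x * tsum a 0 t s) + x * tsum b 0 t s + 2 * s * (psum 1 0 s - x * tsum a 1 t s)"
        using x by (simp add: H_def algebra_simps)
      also have "x * tsum a 0 t s = psum 0 t s - tsum a (Suc 0) t s" using as[of 0 t] by simp
      also have "x * tsum b 0 t s = tsum a 0 t s - tsum b (Suc 0) t s" using bs[of t] by simp
      also have "x * tsum a 1 t s = psum 1 t s - tsum a (Suc 1) t s" using as[of 1 t] by simp
      finally show ?thesis by (simp add: \<Phi>_def algebra_simps)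
    qed
    ultimately show "((\<lambda>t. exp (- x * t) * - H t) has_real_derivative - exp (- x * t) * - \<Phi> t) (at t)"
      unfolding id[symmetric] by (simp add: algebra_simps)
  qed
  moreover have "tsum b 0 0 s = gsum b s" by (simp add: tsum_def gsum_def)
  moreover have "psum 1 0 s / x - tsum a 1 0 s = gsum (\<lambda>n. (real (Suc n))\<^sup>2 / (x * (x + real (Suc n)))) s"
  proof -
    have "(\<lambda>n. 1 * real (Suc n) ^ 1 * exp (s * (real (Suc n))\<^sup>2 - 0 * real (Suc n)) / x - a n * real (Suc n) ^ 1 * exp (s * (real (Suc n))\<^sup>2 - 0 * real (Suc n))) sums (psum 1 0 s / x - tsum a 1 0 s)"
      unfolding tsum_def by (intro sums_diff sums_divide summable_sums summable_tsum[OF a s] summable_tsum[OF _ s]) simp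
    moreover have "1 * N ^ 1 * E / x - 1 / (x + N) * N ^ 1 * E = N\<^sup>2 / (x * (x + N)) * E" if "N > 0" for N E
      using x that by (simp add: divide_simps power2_eq_square) (simp add: algebra_simps)
    then have "1 * real (Suc n) ^ 1 * E / x - a n * real (Suc n) ^ 1 * E = (real (Suc n))\<^sup>2 / (x * (x + real (Suc n))) * E" for n E
      unfolding a_def by (simp only: of_nat_0_less_iff zero_less_Suc)
    ultimately show ?thesis unfolding gsum_def by (simp add: sums_iff)
  qed
  ultimately show ?thesis by (simp add: H_def b_def)
qed

end

section \<open>The comparison inequalities at a fixed nonintegral x > 0\<close>

text \<open>The distance from x to the nearest integer bounds all the denominators from below at
  once.\<close>

lemma recip_bounded_away_from_Ints:
  fixes x :: real
  assumes "x \<notin> \<int>"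
  shows "\<exists>D. \<forall>n. \<bar>1 / (x - real (Suc n))\<bar> \<le> D"
proof -
  define d where "d = min (frac x) (1 - frac x)"
  have "frac x > 0" using assms by (simp add: frac_gt_0_iff)
  then have d: "d > 0" using frac_lt_1[of x] by (simp add: d_def)
  have "\<bar>1 / (x - real (Suc n))\<bar> \<le> 1 / d" for n
  proof -
    have "\<bar>x - of_int k\<bar> \<ge> d" for k :: int
    proof (cases "k \<le> \<lfloor>x\<rfloor>")
      case True
      then have "of_int k \<le> (of_int \<lfloor>x\<rfloor> :: real)" by (simp only: of_int_le_iff)
      then show ?thesis by (simp add: d_def frac_def)
    next
      case False
      then have "\<lfloor>x\<rfloor> + 1 \<le> k" by simp
      then have "of_int (\<lfloor>x\<rfloor> + 1) \<le> (of_int k :: real)" by (simp only: of_int_le_iff)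
      then show ?thesis by (simp add: d_def frac_def)
    qed
    from this[of "int (Suc n)"] have "\<bar>x - real (Suc n)\<bar> \<ge> d" by simp
    then show ?thesis using d by (simp add: abs_divide frac_le del: of_nat_Suc)
  qed
  then show ?thesis by blast
qed

context
  fixes x :: real
  assumes x: "x > 0" "x \<notin> \<int>"
begin

private abbreviation N :: "nat \<Rightarrow> real" where "N n \<equiv> real (Suc n)"

private abbreviation u :: "nat \<Rightarrow> real" where "u n \<equiv> 1 / (x - N n)"

private abbreviation v :: "nat \<Rightarrow> real" where "v n \<equiv> 1 / (x + N n)"

private lemma xN_nonzero: "x - N n \<noteq> 0" "x + N n \<noteq> 0"
  using x by (auto simp: eq_neg_iff_add_eq_0[symmetric] simp del: of_nat_Suc)

private lemma Nu: "N n * u n = x * u n - 1"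
  using xN_nonzero(1)[of n] by (simp add: field_simps)

private lemma Nv: "N n * v n = 1 - x * v n"
  using xN_nonzero(2)[of n] by (simp add: field_simps)

lemma poly_growth_u: "poly_growth u"
proof -
  obtain D where "\<And>n. \<bar>u n\<bar> \<le> D" using recip_bounded_away_from_Ints[OF x(2)] by blast
  then show ?thesis by (rule poly_growth_bounded)
qed

lemma poly_growth_v: "poly_growth v"
  by (rule poly_growth_bounded[OF recip_bound(1)[OF x(1)]])

lemma poly_growth_N: "poly_growth N"
  using poly_growth_power[of 1] by (simp only: power_one_right)

private lemmas pg = poly_growth_u poly_growth_v poly_growth_N poly_growth_intros

text \<open>The left-hand side increases with s, because its derivative is a positive multiple of
  \<open>gsum (\<lambda>n. (-1) ^ n * (N n)\<^sup>2) s\<close>. It therefore stays below its limit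
  at s = 0, which the partial fractions of the cosecant evaluate.\<close>

lemma even_best_approximation_bound:
  assumes s: "s < 0"
  shows "exp (- s * x\<^sup>2) * gsum (\<lambda>n. (-1) ^ Suc n * (N n * u n - N n * v n)) s \<le> pi * x / sin (pi * x)"
proof -
  define c where "c = (\<lambda>n. (-1) ^ Suc n * (N n * u n - N n * v n))"
  define V where "V = (\<lambda>s. exp (- s * x\<^sup>2) * gsum c s)"
  have pgc: "poly_growth c" unfolding c_def by (intro pg)
  define b where "b = (\<lambda>n. (-1) ^ Suc n * (2 * x / (x\<^sup>2 - (N n)\<^sup>2)))"
  have uv: "u n - v n = 2 * N n / (x\<^sup>2 - (N n)\<^sup>2)" "u n + v n = 2 * x / (x\<^sup>2 - (N n)\<^sup>2)" for n
  proof -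
    have sq: "x\<^sup>2 - (N n)\<^sup>2 = (x - N n) * (x + N n)" by (simp add: power2_eq_square algebra_simps)
    show "u n - v n = 2 * N n / (x\<^sup>2 - (N n)\<^sup>2)" "u n + v n = 2 * x / (x\<^sup>2 - (N n)\<^sup>2)"
      unfolding sq using xN_nonzero[of n] by (simp_all add: diff_frac_eq add_frac_eq)
  qed
  have cb: "c n = (-2) * (-1) ^ Suc n + x * b n" for n
    unfolding c_def b_def Nu Nv uv(2)[symmetric] by (simp add: algebra_simps)
  have pgb: "poly_growth b" unfolding b_def uv(2)[symmetric] by (intro pg)
  \<comment> \<open>The coefficients split into a constant alternating part and the summable
    \<open>b\<close>. The alternating part has no ordinary sum at s = 0, but only an upper bound is
    needed, and \<open>alternating_theta_nonneg\<close> supplies the Abel value 1 as that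
    bound.\<close>
  have gc: "gsum c s \<le> 1 + x * gsum b s" if "s < 0" for s
  proof -
    have "gsum c s = (-2) * gsum (\<lambda>n. (-1) ^ Suc n) s + x * gsum b s"
      unfolding cb[abs_def] using that by (simp only: gsum_add gsum_cmult pgb pg)
    moreover have "1 + 2 * gsum (\<lambda>n. (-1) ^ Suc n) s \<ge> 0"
      using alternating_theta_nonneg[of "- s"] that by (simp add: gsum_def)
    ultimately show ?thesis by simp
  qed
  have mono: "eventually (\<lambda>m. - V (null_time m) \<le> - V s) sequentially"
  proof (rule antimono_from_deriv_to_null_time[OF _ s])
    fix s :: real assume s: "s < 0"
    have "(V has_real_derivative exp (- s * x\<^sup>2) * (- (x\<^sup>2)) * gsum c s + gsum (\<lambda>n. c n * (N n)\<^sup>2) s * exp (- s * x\<^sup>2)) (at s)"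
      unfolding V_def by (rule derivative_eq_intros gsum_deriv[OF pgc s] refl)+ simp
    moreover have "exp (- s * x\<^sup>2) * (- (x\<^sup>2)) * gsum c s + gsum (\<lambda>n. c n * (N n)\<^sup>2) s * exp (- s * x\<^sup>2)
        = exp (- s * x\<^sup>2) * (2 * gsum (\<lambda>n. (-1) ^ n * (N n)\<^sup>2) s)"
    proof -
      have "gsum (\<lambda>n. c n * (N n)\<^sup>2 - x\<^sup>2 * c n) s = gsum (\<lambda>n. 2 * ((-1) ^ n * (N n)\<^sup>2)) s"
      proof (rule arg_cong[where f = "\<lambda>c. gsum c s"], rule ext)
        fix n
        \<comment> \<open>Differentiating exp(- s x^2) exp(s N^2) brings down N^2 - x^2 = (N - x)(N
          + x), which clears both denominators. This is how x leaves the derivative.\<close>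
        have "(N n * u n - N n * v n) * ((N n)\<^sup>2 - x\<^sup>2) = - 2 * (N n)\<^sup>2"
        proof -
          define U V M where "U = u n" and "V = v n" and "M = N n"
          have U: "U * (x - M) = 1" and V: "V * (x + M) = 1" using xN_nonzero[of n] by (simp_all add: U_def V_def M_def)
          have "(M * U - M * V) * (M\<^sup>2 - x\<^sup>2) = - (M * (x + M) * (U * (x - M))) - M * (M - x) * (V * (x + M))"
            by (simp add: power2_eq_square algebra_simps)
          also have "\<dots> = - 2 * M\<^sup>2" unfolding U V by (simp add: power2_eq_square algebra_simps)
          finally show ?thesis by (simp only: U_def V_def M_def)
        qed
        then have "(-1) ^ Suc n * ((N n * u n - N n * v n) * ((N n)\<^sup>2 - x\<^sup>2)) = 2 * ((-1) ^ n * (N n)\<^sup>2)" by simp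
        then show "c n * (N n)\<^sup>2 - x\<^sup>2 * c n = 2 * ((-1) ^ n * (N n)\<^sup>2)"
          unfolding c_def by (simp only: right_diff_distrib mult_ac)
      qed
      moreover have "gsum (\<lambda>n. c n * (N n)\<^sup>2 - x\<^sup>2 * c n) s = gsum (\<lambda>n. c n * (N n)\<^sup>2) s - x\<^sup>2 * gsum c s"
        using s by (simp only: gsum_diff gsum_cmult pgc pg)
      moreover have "gsum (\<lambda>n. 2 * ((-1) ^ n * (N n)\<^sup>2)) s = 2 * gsum (\<lambda>n. (-1) ^ n * (N n)\<^sup>2) s"
        using s by (intro gsum_cmult pg)
      ultimately have key: "gsum (\<lambda>n. c n * (N n)\<^sup>2) s - x\<^sup>2 * gsum c s = 2 * gsum (\<lambda>n. (-1) ^ n * (N n)\<^sup>2) s"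
        by (simp only:)
      have gen: "e * (- X) * g + G * e = e * (G - X * g)" for e X g G :: real by (simp add: algebra_simps)
      show ?thesis unfolding gen key ..
    qed
    ultimately have "(V has_real_derivative exp (- s * x\<^sup>2) * (2 * gsum (\<lambda>n. (-1) ^ n * (N n)\<^sup>2) s)) (at s)" by simp
    from DERIV_minus[OF this]
    have "((\<lambda>s. - V s) has_real_derivative - (exp (- s * x\<^sup>2) * (2 * gsum (\<lambda>n. (-1) ^ n * (N n)\<^sup>2) s))) (at s)" .
    moreover have "- (exp (- s * x\<^sup>2) * (2 * gsum (\<lambda>n. (-1) ^ n * (N n)\<^sup>2) s)) \<le> 0"
      using alternating_gsum_square_nonneg[OF s] by simp
    ultimately show "\<exists>D. ((\<lambda>s. - V s) has_real_derivative D) (at s) \<and> D \<le> 0" by blast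
  qed
  have gb: "(\<lambda>m. gsum b (null_time m)) \<longlonglongrightarrow> pi / sin (pi * x) - 1 / x"
    using gsum_tendsto[of b] csc_partial_fractions_summable[of x] csc_partial_fractions[OF x(2)]
    unfolding b_def by (simp only: sums_iff)
  have "(\<lambda>m. exp (- null_time m * x\<^sup>2) * (1 + x * gsum b (null_time m))) \<longlonglongrightarrow> exp (- 0 * x\<^sup>2) * (1 + x * (pi / sin (pi * x) - 1 / x))"
    by (intro tendsto_intros null_time gb)
  also have "exp (- 0 * x\<^sup>2) * (1 + x * (pi / sin (pi * x) - 1 / x)) = pi * x / sin (pi * x)"
    using x(1) by (simp add: algebra_simps)
  finally have "V s \<le> pi * x / sin (pi * x)"
  proof (rule tendsto_lowerbound)
    show "eventually (\<lambda>m. V s \<le> exp (- null_time m * x\<^sup>2) * (1 + x * gsum b (null_time m))) sequentially"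
      using mono
    proof eventually_elim
      case (elim m)
      have "V (null_time m) \<le> exp (- null_time m * x\<^sup>2) * (1 + x * gsum b (null_time m))"
        unfolding V_def by (intro mult_left_mono gc null_time) auto
      then show ?case using elim by simp
    qed
  qed simp
  then show ?thesis by (simp only: V_def c_def)
qed

text \<open>From x (u - v) = (N u - N v) + 2 N v, the odd sum is the even one plus a contribution
  with poles on the negative axis only; the latter is signed by
  \<open>alternating_cauchy_sum_nonneg\<close>.\<close>

theorem odd_best_approximation_bound:
  assumes s: "s < 0"
  shows "gsum (\<lambda>n. (-1) ^ Suc n * (u n - v n)) s \<le> pi * exp (s * x\<^sup>2) / sin (pi * x)"
proof -
  have "gsum (\<lambda>n. (-1) ^ Suc n * (N n * u n - N n * v n)) s = exp (s * x\<^sup>2) * (exp (- s * x\<^sup>2) * gsum (\<lambda>n. (-1) ^ Suc n * (N n * u n - N n * v n)) s)"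
    by (simp flip: mult.assoc exp_add)
  also have "\<dots> \<le> exp (s * x\<^sup>2) * (pi * x / sin (pi * x))"
    by (intro mult_left_mono even_best_approximation_bound s) simp
  finally have 1: "gsum (\<lambda>n. (-1) ^ Suc n * (N n * u n - N n * v n)) s \<le> exp (s * x\<^sup>2) * (pi * x / sin (pi * x))" .
  have 2: "gsum (\<lambda>n. (-1) ^ n * (N n * v n)) s \<ge> 0"
    using alternating_cauchy_sum_nonneg[OF x(1) s] by simp
  have "x * gsum (\<lambda>n. (-1) ^ Suc n * (u n - v n)) s = gsum (\<lambda>n. x * ((-1) ^ Suc n * (u n - v n))) s"
    by (rule gsum_cmult[symmetric, OF _ s]) (intro pg)
  also have "(\<lambda>n. x * ((-1) ^ Suc n * (u n - v n))) = (\<lambda>n. (-1) ^ Suc n * (N n * u n - N n * v n) + (-2) * ((-1) ^ n * (N n * v n)))"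
  proof
    fix n
    show "x * ((-1) ^ Suc n * (u n - v n)) = (-1) ^ Suc n * (N n * u n - N n * v n) + (-2) * ((-1) ^ n * (N n * v n))"
      unfolding Nu Nv by (simp add: algebra_simps)
  qed
  also have "gsum \<dots> s = gsum (\<lambda>n. (-1) ^ Suc n * (N n * u n - N n * v n)) s + (-2) * gsum (\<lambda>n. (-1) ^ n * (N n * v n)) s"
    using s by (subst gsum_add, (intro pg), (intro pg), assumption, subst gsum_cmult) (intro pg, simp_all)
  finally have "x * gsum (\<lambda>n. (-1) ^ Suc n * (u n - v n)) s \<le> x * (pi * exp (s * x\<^sup>2) / sin (pi * x))"
    using 1 2 by (simp add: mult_ac)
  then show ?thesis using x(1) by (simp only: mult_le_cancel_left_pos)
qed

text \<open>Multiplied by sin^2/pi^2 this is the Hermite interpolation series, at all integers, of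
  the even Gaussian exp(s x^2): the double poles carry the values, the simple poles the derivatives
  2 s n exp(s n^2).\<close>

definition even_interp :: "real \<Rightarrow> real" where
  "even_interp s = 1 / x\<^sup>2 + gsum (\<lambda>n. u n * u n + v n * v n) s + 2 * s * gsum (\<lambda>n. N n * u n - N n * v n) s"

text \<open>Multiplied by sin^2/pi^2 this is \<open>M_plus lam (- x)\<close> for s = - pi lam, with
  poles at 0 and the negative integers. The coefficient \<open>1 / x * ((N n)\<^sup>2 * v n)\<close>
  is N (1/x - v), the simple pole together with its correction at 0.\<close>

definition left_interp :: "real \<Rightarrow> real" where
  "left_interp s = 1 / x\<^sup>2 + gsum (\<lambda>n. v n * v n) s + 2 * s * gsum (\<lambda>n. 1 / x * ((N n)\<^sup>2 * v n)) s"

text \<open>The factor N^2 - x^2 lowers the double poles to simple ones, and differentiating the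
  factor 2 s contributes further simple poles; together they cancel, as in u^2 (N^2 - x^2) + 2 N u =
  -1. The remaining bracket is \<open>theta_dilation (- s)\<close>.\<close>

lemma even_interp_deriv:
  assumes s: "s < 0"
  shows "((\<lambda>s. exp (- s * x\<^sup>2) * even_interp s) has_real_derivative - exp (- s * x\<^sup>2) * (1 + 2 * (psum 0 0 s + 2 * s * psum 2 0 s))) (at s)"
proof -
  let ?A = "\<lambda>n. u n * u n + v n * v n" and ?B = "\<lambda>n. N n * u n - N n * v n"
  have pA: "poly_growth ?A" and pB: "poly_growth ?B" by (intro pg)+
  have "((\<lambda>s. exp (- s * x\<^sup>2) * even_interp s) has_real_derivative
      exp (- s * x\<^sup>2) * (- (x\<^sup>2)) * even_interp s + (gsum (\<lambda>n. ?A n * (N n)\<^sup>2) s + (2 * gsum ?B s + gsum (\<lambda>n. ?B n * (N n)\<^sup>2) s * (2 * s))) * exp (- s * x\<^sup>2)) (at s)"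
    unfolding even_interp_def by (rule derivative_eq_intros gsum_deriv[OF pA s] gsum_deriv[OF pB s] refl)+ simp
  moreover have 1: "gsum (\<lambda>n. ?A n * (N n)\<^sup>2) s - x\<^sup>2 * gsum ?A s + 2 * gsum ?B s = - 2 * psum 0 0 s"
  proof -
    have "gsum (\<lambda>n. ?A n * (N n)\<^sup>2 - x\<^sup>2 * ?A n + 2 * ?B n) s = gsum (\<lambda>n. (-2) * N n ^ 0) s"
    proof (rule arg_cong[where f = "\<lambda>c. gsum c s"], rule ext)
      fix n
      define U V M where "U = u n" and "V = v n" and "M = N n"
      have U: "U * (x - M) = 1" and V: "V * (x + M) = 1" using xN_nonzero[of n] by (simp_all add: U_def V_def M_def)
      have "(U * U + V * V) * M\<^sup>2 - x\<^sup>2 * (U * U + V * V) + 2 * (M * U - M * V)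
         = - ((U * (x - M)) * U * (x + M)) - (V * (x + M)) * V * (x - M) + 2 * (M * U - M * V)"
        by (simp add: power2_eq_square algebra_simps)
      also have "\<dots> = - (1 * U * (x + M)) - 1 * V * (x - M) + 2 * (M * U - M * V)" by (simp only: U V)
      also have "\<dots> = - (U * (x - M)) - V * (x + M)" by (simp add: algebra_simps)
      also have "\<dots> = -2" unfolding U V by simp
      finally show "?A n * (N n)\<^sup>2 - x\<^sup>2 * ?A n + 2 * ?B n = (-2) * N n ^ 0" by (simp add: U_def V_def M_def)
    qed
    moreover have "gsum (\<lambda>n. ?A n * (N n)\<^sup>2 - x\<^sup>2 * ?A n + 2 * ?B n) s = gsum (\<lambda>n. ?A n * (N n)\<^sup>2) s - x\<^sup>2 * gsum ?A s + 2 * gsum ?B s"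
      by (simp only: gsum_add gsum_diff gsum_cmult s pA pB pg)
    ultimately show ?thesis unfolding psum_eq_gsum by (simp only: gsum_cmult[OF poly_growth_power s])
  qed
  moreover have 2: "gsum (\<lambda>n. ?B n * (N n)\<^sup>2) s - x\<^sup>2 * gsum ?B s = - 2 * psum 2 0 s"
  proof -
    have "gsum (\<lambda>n. ?B n * (N n)\<^sup>2 - x\<^sup>2 * ?B n) s = gsum (\<lambda>n. (-2) * N n ^ 2) s"
    proof (rule arg_cong[where f = "\<lambda>c. gsum c s"], rule ext)
      fix n
      define U V M where "U = u n" and "V = v n" and "M = N n"
      have U: "U * (x - M) = 1" and V: "V * (x + M) = 1" using xN_nonzero[of n] by (simp_all add: U_def V_def M_def)
      have "(M * U - M * V) * M\<^sup>2 - x\<^sup>2 * (M * U - M * V) = - (M * (x + M) * (U * (x - M))) + M * (x - M) * (V * (x + M))"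
        by (simp add: power2_eq_square algebra_simps)
      also have "\<dots> = (-2) * M\<^sup>2" unfolding U V by (simp add: power2_eq_square algebra_simps)
      finally show "?B n * (N n)\<^sup>2 - x\<^sup>2 * ?B n = (-2) * N n ^ 2" by (simp only: U_def V_def M_def)
    qed
    moreover have "gsum (\<lambda>n. ?B n * (N n)\<^sup>2 - x\<^sup>2 * ?B n) s = gsum (\<lambda>n. ?B n * (N n)\<^sup>2) s - x\<^sup>2 * gsum ?B s"
      by (simp only: gsum_diff gsum_cmult s pB pg)
    ultimately show ?thesis unfolding psum_eq_gsum by (simp only: gsum_cmult[OF poly_growth_power s])
  qed
  moreover have "exp (- s * x\<^sup>2) * (- (x\<^sup>2)) * even_interp s + (gA + (2 * gsum ?B s + gB * (2 * s))) * exp (- s * x\<^sup>2)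
    = exp (- s * x\<^sup>2) * (- 1 + (gA - x\<^sup>2 * gsum ?A s + 2 * gsum ?B s) + 2 * s * (gB - x\<^sup>2 * gsum ?B s))" for gA gB
    using x(1) unfolding even_interp_def by (simp add: algebra_simps)
  ultimately have "((\<lambda>s. exp (- s * x\<^sup>2) * even_interp s) has_real_derivative
      exp (- s * x\<^sup>2) * (- 1 + (- 2 * psum 0 0 s) + 2 * s * (- 2 * psum 2 0 s))) (at s)"
    by (simp only:)
  then show ?thesis by (simp add: algebra_simps)
qed

text \<open>The same cancellation takes place at the negative integers. The corrections at 0 survive
  as odd moments divided by x.\<close>

lemma left_interp_deriv:
  assumes s: "s < 0"
  shows "((\<lambda>s. exp (- s * x\<^sup>2) * left_interp s) has_real_derivative
    exp (- s * x\<^sup>2) * (- 1 + (2 / x * psum 1 0 s - psum 0 0 s) + 2 * s * (1 / x * psum 3 0 s - psum 2 0 s))) (at s)"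
proof -
  let ?A = "\<lambda>n. v n * v n" and ?B = "\<lambda>n. 1 / x * ((N n)\<^sup>2 * v n)"
  have pA: "poly_growth ?A" and pB: "poly_growth ?B" by (intro pg)+
  have "((\<lambda>s. exp (- s * x\<^sup>2) * left_interp s) has_real_derivative
      exp (- s * x\<^sup>2) * (- (x\<^sup>2)) * left_interp s + (gsum (\<lambda>n. ?A n * (N n)\<^sup>2) s + (2 * gsum ?B s + gsum (\<lambda>n. ?B n * (N n)\<^sup>2) s * (2 * s))) * exp (- s * x\<^sup>2)) (at s)"
    unfolding left_interp_def by (rule derivative_eq_intros gsum_deriv[OF pA s] gsum_deriv[OF pB s] refl)+ simp
  moreover have 1: "gsum (\<lambda>n. ?A n * (N n)\<^sup>2) s - x\<^sup>2 * gsum ?A s + 2 * gsum ?B s = 2 / x * psum 1 0 s - psum 0 0 s"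
  proof -
    have "gsum (\<lambda>n. ?A n * (N n)\<^sup>2 - x\<^sup>2 * ?A n + 2 * ?B n) s = gsum (\<lambda>n. 2 / x * N n ^ 1 - N n ^ 0) s"
    proof (rule arg_cong[where f = "\<lambda>c. gsum c s"], rule ext)
      fix n
      define V M where "V = v n" and "M = N n"
      have V: "V * (x + M) = 1" using xN_nonzero[of n] by (simp_all add: V_def M_def)
      have "V * V * M\<^sup>2 - x\<^sup>2 * (V * V) + 2 * (1 / x * (M\<^sup>2 * V)) = (V * (x + M)) * V * (M - x) + 2 / x * (M\<^sup>2 * V)"
        by (simp add: power2_eq_square algebra_simps)
      also have "\<dots> = V * (x * (M - x) + 2 * M\<^sup>2) / x" unfolding V using x(1) by (simp add: field_simps)
      also have "x * (M - x) + 2 * M\<^sup>2 = (x + M) * (2 * M - x)" by (simp add: power2_eq_square algebra_simps)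
      also have "V * ((x + M) * (2 * M - x)) / x = (V * (x + M)) * (2 * M - x) / x" by simp
      also have "\<dots> = 2 / x * M - 1" unfolding V using x(1) by (simp add: field_simps)
      finally show "?A n * (N n)\<^sup>2 - x\<^sup>2 * ?A n + 2 * ?B n = 2 / x * N n ^ 1 - N n ^ 0" by (simp only: V_def M_def power_one_right power_0)
    qed
    moreover have "gsum (\<lambda>n. ?A n * (N n)\<^sup>2 - x\<^sup>2 * ?A n + 2 * ?B n) s = gsum (\<lambda>n. ?A n * (N n)\<^sup>2) s - x\<^sup>2 * gsum ?A s + 2 * gsum ?B s"
      by (simp only: gsum_add gsum_diff gsum_cmult s pA pB pg)
    moreover have "gsum (\<lambda>n. 2 / x * N n ^ 1 - N n ^ 0) s = 2 / x * psum 1 0 s - psum 0 0 s"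
      unfolding psum_eq_gsum by (simp only: gsum_diff gsum_cmult s pg)
    ultimately show ?thesis by (simp only:)
  qed
  moreover have 2: "gsum (\<lambda>n. ?B n * (N n)\<^sup>2) s - x\<^sup>2 * gsum ?B s = 1 / x * psum 3 0 s - psum 2 0 s"
  proof -
    have "gsum (\<lambda>n. ?B n * (N n)\<^sup>2 - x\<^sup>2 * ?B n) s = gsum (\<lambda>n. 1 / x * N n ^ 3 - N n ^ 2) s"
    proof (rule arg_cong[where f = "\<lambda>c. gsum c s"], rule ext)
      fix n
      define V M where "V = v n" and "M = N n"
      have V: "V * (x + M) = 1" using xN_nonzero[of n] by (simp_all add: V_def M_def)
      have "1 / x * (M\<^sup>2 * V) * M\<^sup>2 - x\<^sup>2 * (1 / x * (M\<^sup>2 * V)) = 1 / x * M\<^sup>2 * (M - x) * (V * (x + M))"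
        using x(1) by (simp add: power2_eq_square field_simps)
      also have "\<dots> = 1 / x * M ^ 3 - M\<^sup>2" unfolding V using x(1) by (simp add: field_simps power2_eq_square power3_eq_cube)
      finally show "?B n * (N n)\<^sup>2 - x\<^sup>2 * ?B n = 1 / x * N n ^ 3 - N n ^ 2" by (simp only: V_def M_def)
    qed
    moreover have "gsum (\<lambda>n. ?B n * (N n)\<^sup>2 - x\<^sup>2 * ?B n) s = gsum (\<lambda>n. ?B n * (N n)\<^sup>2) s - x\<^sup>2 * gsum ?B s"
      by (simp only: gsum_diff gsum_cmult[of ?B s "x\<^sup>2"] s pB pg)
    moreover have "gsum (\<lambda>n. 1 / x * N n ^ 3 - N n ^ 2) s = 1 / x * psum 3 0 s - psum 2 0 s"
      unfolding psum_eq_gsum by (simp only: gsum_diff gsum_cmult s pg)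
    ultimately show ?thesis by (simp only:)
  qed
  moreover have "exp (- s * x\<^sup>2) * (- (x\<^sup>2)) * left_interp s + (gA + (2 * gsum ?B s + gB * (2 * s))) * exp (- s * x\<^sup>2)
    = exp (- s * x\<^sup>2) * (- 1 + (gA - x\<^sup>2 * gsum ?A s + 2 * gsum ?B s) + 2 * s * (gB - x\<^sup>2 * gsum ?B s))" for gA gB
  proof -
    have gen: "e * (- (x\<^sup>2)) * (1 / x\<^sup>2 + a + 2 * s * b) + (gA + (2 * b + gB * (2 * s))) * e = e * (- 1 + (gA - x\<^sup>2 * a + 2 * b) + 2 * s * (gB - x\<^sup>2 * b))"
      for e a b using x(1) by (simp add: algebra_simps)
    show ?thesis unfolding left_interp_def by (rule gen)
  qed
  ultimately show ?thesis by (simp only:)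
qed

text \<open>The coefficients N u and N v stay bounded, so the factor s suppresses the derivative
  terms in the limit, and the value terms give the partial fractions of the squared
  cosecant.\<close>

lemma even_interp_limit:
  "(\<lambda>m. exp (- null_time m * x\<^sup>2) * even_interp (null_time m)) \<longlonglongrightarrow> pi\<^sup>2 / (sin (pi * x))\<^sup>2"
proof -
  have sums: "(\<lambda>n. u n * u n + v n * v n) sums (pi\<^sup>2 / (sin (pi * x))\<^sup>2 - 1 / x\<^sup>2)"
    using csc_square_partial_fractions[OF x(2)] by (simp add: power2_eq_square)
  then have "summable (\<lambda>n. \<bar>u n * u n + v n * v n\<bar>)" by (simp add: sums_iff)
  from gsum_tendsto[OF this] have 1: "(\<lambda>m. gsum (\<lambda>n. u n * u n + v n * v n) (null_time m)) \<longlonglongrightarrow> pi\<^sup>2 / (sin (pi * x))\<^sup>2 - 1 / x\<^sup>2"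
    using sums by (simp only: sums_iff)
  obtain D where D: "\<And>n. \<bar>u n\<bar> \<le> D" using recip_bounded_away_from_Ints[OF x(2)] by blast
  have "\<bar>N n * u n - N n * v n\<bar> \<le> x * D + x + 2" for n
  proof -
    have "\<bar>x * u n\<bar> \<le> x * D" unfolding abs_mult abs_of_pos[OF x(1)]
      by (rule mult_left_mono[OF D]) (use x(1) in simp)
    moreover have "\<bar>x * v n\<bar> \<le> x * 1" unfolding abs_mult abs_of_pos[OF x(1)]
      by (rule mult_left_mono[OF recip_bound(1)[OF x(1)]]) (use x(1) in simp)
    ultimately show ?thesis unfolding Nu Nv by linarith
  qed
  from null_time_gsum_bounded_tendsto[OF this]
  have 2: "(\<lambda>m. null_time m * gsum (\<lambda>n. N n * u n - N n * v n) (null_time m)) \<longlonglongrightarrow> 0" .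
  have "(\<lambda>m. exp (- null_time m * x\<^sup>2) * (1 / x\<^sup>2 + gsum (\<lambda>n. u n * u n + v n * v n) (null_time m) + 2 * (null_time m * gsum (\<lambda>n. N n * u n - N n * v n) (null_time m))))
     \<longlonglongrightarrow> exp (- 0 * x\<^sup>2) * (1 / x\<^sup>2 + (pi\<^sup>2 / (sin (pi * x))\<^sup>2 - 1 / x\<^sup>2) + 2 * 0)"
    by (intro tendsto_intros null_time 1 2)
  then show ?thesis by (simp add: even_interp_def mult.assoc)
qed

text \<open>By \<open>theta_dilation_nonneg\<close> the right-hand side decreases in s towards its
  limit, which is the left-hand side.\<close>

theorem even_majorant_bound:
  assumes s: "s < 0"
  shows "pi\<^sup>2 / (sin (pi * x))\<^sup>2 \<le> exp (- s * x\<^sup>2) * even_interp s"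
proof (rule tendsto_upperbound[OF even_interp_limit])
  show "eventually (\<lambda>m. exp (- null_time m * x\<^sup>2) * even_interp (null_time m) \<le> exp (- s * x\<^sup>2) * even_interp s) sequentially"
  proof (rule antimono_from_deriv_to_null_time[OF _ s])
    fix s :: real assume s: "s < 0"
    have "theta_dilation (- s) \<ge> 0" using s by (intro theta_dilation_nonneg) simp
    then have "- exp (- s * x\<^sup>2) * (1 + 2 * (psum 0 0 s + 2 * s * psum 2 0 s)) \<le> 0"
      unfolding theta_dilation_psum[OF s] by (simp add: mult_nonpos_nonneg)
    then show "\<exists>D. ((\<lambda>s. exp (- s * x\<^sup>2) * even_interp s) has_real_derivative D) (at s) \<and> D \<le> 0"
      using even_interp_deriv[OF s] by blast
  qed
qed simp

text \<open>The right-hand side is the trigamma function at x. Telescoping writes 1/x as the sum of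
  1/((x+n)(x+n+1)), each term of which is at most 1/(x+n)^2.\<close>

lemma trigamma_bound: "1 / x \<le> 1 / x\<^sup>2 + (\<Sum>n. v n * v n)" "summable (\<lambda>n. v n * v n)"
proof -
  show sm: "summable (\<lambda>n. v n * v n)"
  proof (rule summable_comparison_test'[where N = 0])
    show "summable (\<lambda>n. 1 / (N n)\<^sup>2)" using inverse_squares_sums by (simp add: sums_iff)
    fix n
    have "(N n)\<^sup>2 \<le> (x + N n)\<^sup>2" using x(1) by (intro power_mono) auto
    then have "1 / (x + N n)\<^sup>2 \<le> 1 / (N n)\<^sup>2"
      using x(1) by (intro divide_left_mono) (auto intro!: mult_pos_pos zero_less_power add_pos_pos simp del: of_nat_Suc)
    then show "norm (v n * v n) \<le> 1 / (N n)\<^sup>2" by (simp add: power2_eq_square del: of_nat_Suc)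
  qed
  have "(\<lambda>n. 1 / (x + real n)) \<longlonglongrightarrow> 0" by real_asymp
  from telescope_sums'[OF this] have t: "(\<lambda>n. 1 / (x + real n) - 1 / (x + real (Suc n))) sums (1 / x)" by simp
  have s0: "(\<lambda>n. 1 / (x + real n)\<^sup>2) sums ((\<Sum>n. v n * v n) + 1 / (x + real 0)\<^sup>2)"
    by (rule sums_Suc) (use summable_sums[OF sm] in \<open>simp add: power2_eq_square\<close>)
  have "1 / x \<le> (\<Sum>n. v n * v n) + 1 / (x + real 0)\<^sup>2"
  proof (rule sums_le[OF _ t s0])
    fix n
    have p: "x + real n > 0" using x(1) by simp
    have "1 / (x + real n) - 1 / (x + real (Suc n)) = 1 / ((x + real n) * (x + real (Suc n)))"
      using p by (simp add: diff_frac_eq)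
    also have "\<dots> \<le> 1 / (x + real n)\<^sup>2"
      unfolding power2_eq_square using p by (intro divide_left_mono mult_left_mono mult_pos_pos) auto
    finally show "1 / (x + real n) - 1 / (x + real (Suc n)) \<le> 1 / (x + real n)\<^sup>2" .
  qed
  then show "1 / x \<le> 1 / x\<^sup>2 + (\<Sum>n. v n * v n)" by simp
qed

text \<open>In the s-derivative of \<open>F\<close> the even moments of the two parts cancel, and
  \<open>first_moment_dilation_nonpos\<close> signs what is left. So \<open>F\<close> decreases, and
  it suffices that a lower bound for it has a nonnegative limit at s = 0, which is
  \<open>trigamma_bound\<close>.\<close>

theorem odd_minorant_bound:
  assumes s: "s < 0"
  shows "even_interp s - 2 * left_interp s \<le> exp (s * x\<^sup>2) * (pi\<^sup>2 / (sin (pi * x))\<^sup>2)"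
proof -
  define q where "q = pi\<^sup>2 / (sin (pi * x))\<^sup>2"
  define F where "F = (\<lambda>s. q - exp (- s * x\<^sup>2) * even_interp s + 2 * (exp (- s * x\<^sup>2) * left_interp s))"
  have anti: "eventually (\<lambda>m. F (null_time m) \<le> F s) sequentially"
  proof (rule antimono_from_deriv_to_null_time[OF _ s])
    fix s :: real assume s: "s < 0"
    have "(F has_real_derivative 0 - (- exp (- s * x\<^sup>2) * (1 + 2 * (psum 0 0 s + 2 * s * psum 2 0 s)))
      + 2 * (exp (- s * x\<^sup>2) * (- 1 + (2 / x * psum 1 0 s - psum 0 0 s) + 2 * s * (1 / x * psum 3 0 s - psum 2 0 s)))) (at s)"
      unfolding F_def by (intro DERIV_add DERIV_diff DERIV_const DERIV_cmult even_interp_deriv left_interp_deriv s)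
    moreover have "0 - (- e * (1 + 2 * (P0 + 2 * s * P2))) + 2 * (e * (- 1 + (2 / x * P1 - P0) + 2 * s * (1 / x * P3 - P2))) = - (e * (1 - 4 / x * (P1 + s * P3)))"
      for e P0 P1 P2 P3 by (simp add: algebra_simps add_divide_distrib)
    moreover have "1 - 4 / x * (psum 1 0 s + s * psum 3 0 s) \<ge> 0"
    proof -
      have "4 / x * (psum 1 0 s + s * psum 3 0 s) \<le> 0"
        by (rule mult_nonneg_nonpos[OF _ first_moment_dilation_nonpos[OF s]]) (use x(1) in simp)
      then show ?thesis by simp
    qed
    ultimately show "\<exists>D. (F has_real_derivative D) (at s) \<and> D \<le> 0"
      by (intro exI[of _ "- (exp (- s * x\<^sup>2) * (1 - 4 / x * (psum 1 0 s + s * psum 3 0 s)))"]) (simp only:, simp)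
  qed
  \<comment> \<open>The simple-pole coefficients grow like N/x, so the factor s does not make their
    sum vanish in the limit. Replacing N v by 1 leaves the first moment, and
    \<open>first_moment_bound\<close> limits the loss to 1/x.\<close>
  have lower: "left_interp s \<ge> 1 / x\<^sup>2 + gsum (\<lambda>n. v n * v n) s - 1 / x" if s: "s < 0" for s
  proof -
    have "gsum (\<lambda>n. 1 / x * ((N n)\<^sup>2 * v n)) s \<le> gsum (\<lambda>n. 1 / x * N n ^ 1) s"
    proof (rule gsum_mono[OF _ _ s])
      fix n
      have "N n * v n \<le> 1" using x(1) by (simp add: divide_le_eq)
      then have "N n * (N n * v n) \<le> N n * 1" by (intro mult_left_mono) auto
      then show "1 / x * ((N n)\<^sup>2 * v n) \<le> 1 / x * N n ^ 1"
        unfolding power2_eq_square mult.assoc power_one_right mult_1_right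
        using x(1) by (intro mult_left_mono) auto
    qed (intro pg)+
    also have "\<dots> = 1 / x * psum 1 0 s" unfolding psum_eq_gsum by (intro gsum_cmult pg s)
    finally have "2 * s * gsum (\<lambda>n. 1 / x * ((N n)\<^sup>2 * v n)) s \<ge> 2 * s * (1 / x * psum 1 0 s)"
      using s by (intro mult_left_mono_neg) auto
    moreover have "2 * s * (1 / x * psum 1 0 s) \<ge> - (1 / x)"
    proof -
      have "1 / x * (- 2 * s * psum 1 0 s) \<le> 1 / x * 1" using x(1) by (intro mult_left_mono first_moment_bound s) auto
      then show ?thesis by (simp add: algebra_simps)
    qed
    ultimately show ?thesis unfolding left_interp_def by linarith
  qed
  have "summable (\<lambda>n. \<bar>v n * v n\<bar>)" using trigamma_bound(2) by simp
  from gsum_tendsto[OF this] have g: "(\<lambda>m. gsum (\<lambda>n. v n * v n) (null_time m)) \<longlonglongrightarrow> (\<Sum>n. v n * v n)" .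
  have "(\<lambda>m. q - exp (- null_time m * x\<^sup>2) * even_interp (null_time m) + 2 * (exp (- null_time m * x\<^sup>2) * (1 / x\<^sup>2 + gsum (\<lambda>n. v n * v n) (null_time m) - 1 / x)))
     \<longlonglongrightarrow> q - q + 2 * (exp (- 0 * x\<^sup>2) * (1 / x\<^sup>2 + (\<Sum>n. v n * v n) - 1 / x))"
    unfolding q_def by (intro tendsto_intros null_time even_interp_limit g)
  then have "q - q + 2 * (exp (- 0 * x\<^sup>2) * (1 / x\<^sup>2 + (\<Sum>n. v n * v n) - 1 / x)) \<le> F s"
  proof (rule tendsto_upperbound)
    show "eventually (\<lambda>m. q - exp (- null_time m * x\<^sup>2) * even_interp (null_time m) + 2 * (exp (- null_time m * x\<^sup>2) * (1 / x\<^sup>2 + gsum (\<lambda>n. v n * v n) (null_time m) - 1 / x)) \<le> F s) sequentially"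
      using anti
    proof eventually_elim
      case (elim m)
      have "exp (- null_time m * x\<^sup>2) * (1 / x\<^sup>2 + gsum (\<lambda>n. v n * v n) (null_time m) - 1 / x) \<le> exp (- null_time m * x\<^sup>2) * left_interp (null_time m)"
        by (intro mult_left_mono lower null_time) auto
      then show ?case using elim unfolding F_def by linarith
    qed
  qed simp
  then have "F s \<ge> 0" using trigamma_bound(1) by simp
  then have "exp (- s * x\<^sup>2) * (even_interp s - 2 * left_interp s) \<le> q" by (simp add: F_def algebra_simps)
  then have "exp (s * x\<^sup>2) * (exp (- s * x\<^sup>2) * (even_interp s - 2 * left_interp s)) \<le> exp (s * x\<^sup>2) * q" by (intro mult_left_mono) auto
  then show ?thesis by (simp add: q_def flip: mult.assoc exp_add)
qed

text \<open>The two parts point the same way: \<open>even_majorant_bound\<close> for the even part,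
  and \<open>truncated_minorant_left_nonpos\<close> for \<open>left_interp\<close> without its pole
  at 0.\<close>

theorem odd_majorant_bound:
  assumes s: "s < 0"
  shows "exp (s * x\<^sup>2) * (pi\<^sup>2 / (sin (pi * x))\<^sup>2) \<le> even_interp s - 2 * left_interp s + 2 / x\<^sup>2"
proof -
  have "exp (s * x\<^sup>2) * (pi\<^sup>2 / (sin (pi * x))\<^sup>2) \<le> exp (s * x\<^sup>2) * (exp (- s * x\<^sup>2) * even_interp s)"
    by (intro mult_left_mono even_majorant_bound s) simp
  also have "\<dots> = even_interp s" by (simp flip: mult.assoc exp_add)
  finally have 1: "exp (s * x\<^sup>2) * (pi\<^sup>2 / (sin (pi * x))\<^sup>2) \<le> even_interp s" .
  have "gsum (\<lambda>n. v n * v n) s + 2 * s * gsum (\<lambda>n. 1 / x * ((N n)\<^sup>2 * v n)) s \<le> 0"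
    using truncated_minorant_left_nonpos[OF x(1) s] by (simp add: power2_eq_square)
  then have "left_interp s - 1 / x\<^sup>2 \<le> 0" by (simp add: left_interp_def)
  then have "0 \<le> - 2 * left_interp s + 2 / x\<^sup>2" by simp
  with 1 show ?thesis by linarith
qed

lemma odd_interp_eq:
  assumes s: "s < 0"
  shows "even_interp s - 2 * left_interp s = gsum (\<lambda>n. u n * u n - v n * v n) s + 2 * s * gsum (\<lambda>n. N n * (u n + v n - 2 / x)) s - 1 / x\<^sup>2"
proof -
  have "gsum (\<lambda>n. u n * u n - v n * v n) s = gsum (\<lambda>n. (u n * u n + v n * v n) - 2 * (v n * v n)) s" by (simp only: diff_add_eq mult_2) simp
  also have "\<dots> = gsum (\<lambda>n. u n * u n + v n * v n) s - 2 * gsum (\<lambda>n. v n * v n) s"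
    by (subst gsum_diff; (intro pg s)?) (subst gsum_cmult; (intro pg s)?; simp)
  finally have 1: "gsum (\<lambda>n. u n * u n - v n * v n) s = gsum (\<lambda>n. u n * u n + v n * v n) s - 2 * gsum (\<lambda>n. v n * v n) s" .
  have e: "N n * (u n + v n - 2 / x) = (N n * u n - N n * v n) - 2 * (1 / x * ((N n)\<^sup>2 * v n))" for n
  proof -
    have "(N n)\<^sup>2 * v n = N n * (1 - x * v n)" unfolding Nv[symmetric] by (simp add: power2_eq_square)
    then have "2 * (1 / x * ((N n)\<^sup>2 * v n)) = 2 * N n / x - 2 * (N n * v n)" using x(1) by (simp add: field_simps)
    then show ?thesis by (simp add: algebra_simps)
  qed
  have 2: "gsum (\<lambda>n. N n * (u n + v n - 2 / x)) s = gsum (\<lambda>n. N n * u n - N n * v n) s - 2 * gsum (\<lambda>n. 1 / x * ((N n)\<^sup>2 * v n)) s"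
    unfolding e by (subst gsum_diff; (intro pg s)?) (subst gsum_cmult; (intro pg s)?; simp)
  have gen: "(i + A + 2 * s * B) - 2 * (i + C + 2 * s * E) = (A - 2 * C) + 2 * s * (B - 2 * E) - i" for i A B C E
    by (simp add: algebra_simps)
  show ?thesis unfolding even_interp_def left_interp_def 1 2 by (rule gen)
qed

end

section \<open>The interpolating entire functions\<close>

text \<open>The integers other than z form a closed set, so near z the two functions agree except
  possibly at z itself, and the limit of the formula is the value of the continuous function
  \<open>g\<close>.\<close>

lemma remove_sings_eq_entire:
  assumes g: "g holomorphic_on UNIV" and eq: "\<And>z. z \<notin> \<int> \<Longrightarrow> f z = g z"
  shows "remove_sings f = g"
proof
  fix z
  have "isCont g z"
    using holomorphic_on_imp_continuous_on[OF g] by (simp add: continuous_on_eq_continuous_at)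
  then have "g \<midarrow>z\<rightarrow> g z" by (simp add: isCont_def)
  moreover have "eventually (\<lambda>w. g w = f w) (at z)"
  proof -
    have "open (- (\<int> - {z}))" by (intro open_Compl closed_subset_Ints) auto
    then have "eventually (\<lambda>w. w \<in> - (\<int> - {z})) (nhds z)" by (rule eventually_nhds_in_open) simp
    then show ?thesis unfolding eventually_at_filter by eventually_elim (use eq in auto)
  qed
  ultimately have "f \<midarrow>z\<rightarrow> g z" by (rule Lim_transform_eventually)
  then show "remove_sings f z = g z" by (rule remove_sings_eqI)
qed

lemma exp_type_series:
  fixes f :: "nat \<Rightarrow> complex \<Rightarrow> complex"
  assumes hol: "\<And>n. f n holomorphic_on UNIV" and \<tau>: "\<tau> \<ge> 0"
    and bound: "\<And>n z. norm (f n z) \<le> M n * exp (\<tau> * norm z)" and M: "summable M"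
  shows "exp_type_le \<tau> (\<lambda>z. \<Sum>n. f n z)"
proof (rule exp_type_leI[where C = "suminf M + 1"])
  have M0: "M n \<ge> 0" for n
    using order_trans[OF norm_ge_zero bound[of n 0]] by simp
  show "suminf M + 1 > 0" using suminf_nonneg[OF M M0] by simp
  show "norm (\<Sum>n. f n z) \<le> (suminf M + 1) * exp (\<tau> * norm z)" for z
  proof -
    have sm: "summable (\<lambda>n. M n * exp (\<tau> * norm z))" by (rule summable_mult2[OF M])
    have "norm (\<Sum>n. f n z) \<le> (\<Sum>n. M n * exp (\<tau> * norm z))"
      by (rule norm_suminf_le[OF bound sm])
    also have "\<dots> = suminf M * exp (\<tau> * norm z)" by (rule suminf_mult2[OF M, symmetric])
    finally show ?thesis by (simp add: distrib_right add_increasing2)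
  qed
  show "(\<lambda>z. \<Sum>n. f n z) holomorphic_on UNIV"
  proof (rule holomorphic_uniform_sequence[OF open_UNIV])
    show "(\<lambda>z. \<Sum>i<n. f i z) holomorphic_on UNIV" for n by (intro holomorphic_intros hol)
    fix z :: complex
    have "uniform_limit (cball z 1) (\<lambda>n z. \<Sum>i<n. f i z) (\<lambda>z. \<Sum>n. f n z) sequentially"
    proof (rule Weierstrass_m_test)
      show "norm (f n w) \<le> M n * exp (\<tau> * (norm z + 1))" if w: "w \<in> cball z 1" for n w
      proof -
        have "norm w \<le> norm z + 1" using w norm_triangle_ineq2[of w z] by (simp add: dist_norm norm_minus_commute)
        then have "M n * exp (\<tau> * norm w) \<le> M n * exp (\<tau> * (norm z + 1))"
          using M0[of n] \<tau> by (intro mult_left_mono) (auto intro: mult_left_mono)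
        then show ?thesis using bound[of n w] by linarith
      qed
      show "summable (\<lambda>n. M n * exp (\<tau> * (norm z + 1)))" by (rule summable_mult2[OF M])
    qed
    then show "\<exists>d>0. cball z d \<subseteq> UNIV \<and> uniform_limit (cball z d) (\<lambda>n z. \<Sum>i<n. f i z) (\<lambda>z. \<Sum>n. f n z) sequentially"
      by (intro exI[of _ 1]) auto
  qed
qed

lemma norm_sin_le_exp_Im: "norm (sin z) \<le> exp \<bar>Im z\<bar>" for z :: complex
proof -
  have "norm (exp (\<i> * z) - exp (- (\<i> * z))) \<le> exp (- Im z) + exp (Im z)"
    by (rule order_trans[OF norm_triangle_ineq4]) simp
  also have "\<dots> \<le> exp \<bar>Im z\<bar> + exp \<bar>Im z\<bar>" by (intro add_mono) auto
  finally show ?thesis unfolding sin_exp_eq by (simp add: norm_divide norm_mult)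
qed

section \<open>The interpolation kernels and the entire series\<close>

definition sincpi :: "complex \<Rightarrow> complex" where
  "sincpi z = csinc (of_real pi * z)"

text \<open>Off 0 this is sin^2(pi z)/(pi^2 z). It vanishes at every integer, has derivative 1 at 0
  and double zeros at the other integers; it carries the derivative data, while the square of
  \<open>sincpi\<close> carries the values.\<close>

definition hermite_ker :: "complex \<Rightarrow> complex" where
  "hermite_ker z = z * (sincpi z)\<^sup>2"

definition rsincpi :: "real \<Rightarrow> real" where
  "rsincpi x = rsinc (pi * x)"

definition rhermite_ker :: "real \<Rightarrow> real" where
  "rhermite_ker x = x * (rsincpi x)\<^sup>2"

lemma sincpi_of_real: "sincpi (of_real x) = of_real (rsincpi x)"
  by (simp add: sincpi_def rsincpi_def csinc_of_real flip: of_real_mult)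

lemma hermite_ker_of_real: "hermite_ker (of_real x) = of_real (rhermite_ker x)"
  by (simp add: hermite_ker_def rhermite_ker_def sincpi_of_real)

lemma sincpi_minus: "sincpi (- z) = sincpi z" and hermite_ker_minus: "hermite_ker (- z) = - hermite_ker z"
  by (simp_all add: sincpi_def hermite_ker_def csinc_minus)

lemma rsincpi_minus: "rsincpi (- x) = rsincpi x" and rhermite_ker_minus: "rhermite_ker (- x) = - rhermite_ker x"
  by (simp_all add: rsincpi_def rhermite_ker_def rsinc_minus)

lemma holomorphic_sincpi [holomorphic_intros]: "f holomorphic_on A \<Longrightarrow> (\<lambda>z. sincpi (f z)) holomorphic_on A"
  unfolding sincpi_def
  by (rule holomorphic_on_compose_gen[OF _ holomorphic_on_csinc[of UNIV], unfolded o_def]) (auto intro: holomorphic_intros)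

lemma holomorphic_hermite_ker [holomorphic_intros]: "f holomorphic_on A \<Longrightarrow> (\<lambda>z. hermite_ker (f z)) holomorphic_on A"
  unfolding hermite_ker_def by (intro holomorphic_intros)

lemma norm_sincpi_le: "norm (sincpi z) \<le> exp (pi * \<bar>Im z\<bar>)"
  unfolding sincpi_def by (rule order_trans[OF norm_csinc_le]) (simp add: abs_mult)

lemma norm_hermite_ker_le: "norm (hermite_ker z) \<le> exp (2 * pi * \<bar>Im z\<bar>)"
proof -
  have "hermite_ker z = sin (of_real pi * z) / of_real pi * sincpi z"
    by (simp add: hermite_ker_def sincpi_def csinc_def power2_eq_square)
  then have "norm (hermite_ker z) = norm (sin (of_real pi * z)) / pi * norm (sincpi z)"
    by (simp add: norm_mult norm_divide)
  also have "\<dots> \<le> exp (pi * \<bar>Im z\<bar>) * exp (pi * \<bar>Im z\<bar>)"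
  proof (rule mult_mono[OF _ norm_sincpi_le])
    have "norm (sin (of_real pi * z)) \<le> exp (pi * \<bar>Im z\<bar>)"
      by (rule order_trans[OF norm_sin_le_exp_Im]) (simp add: abs_mult)
    moreover have "norm (sin (of_real pi * z)) / pi \<le> norm (sin (of_real pi * z)) / 1"
      using pi_gt3 by (intro divide_left_mono) auto
    ultimately show "norm (sin (of_real pi * z)) / pi \<le> exp (pi * \<bar>Im z\<bar>)" by simp
  qed auto
  also have "\<dots> = exp (2 * pi * \<bar>Im z\<bar>)" by (simp flip: exp_add)
  finally show ?thesis .
qed

lemma sin_pi_shift: "sin (of_real pi * (z - of_nat m)) = (-1) ^ m * sin (of_real pi * z)" for z :: complex
proof -
  have "sin (of_real pi * of_nat m) = (0::complex)" "cos (of_real pi * of_nat m) = ((-1) ^ m :: complex)"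
    using sin_of_real[of "pi * real m", where ?'a = complex] cos_of_real[of "pi * real m", where ?'a = complex] by simp_all
  then show ?thesis by (simp add: right_diff_distrib sin_diff)
qed

text \<open>The shift produces the factor (-1)^m, which is why the alternating sign of
  \<open>K_plus\<close> disappears from the shifted kernels in \<open>Kser\<close>.\<close>

lemma sincpi_shift:
  assumes "z \<noteq> of_nat m"
  shows "sincpi (z - of_nat m) = (-1) ^ m * (sin (of_real pi * z) / (of_real pi * (z - of_nat m)))"
  using assms by (simp add: sincpi_def csinc_def sin_pi_shift)

lemma rsincpi_shift:
  assumes "x \<noteq> real m"
  shows "rsincpi (x - real m) = (-1) ^ m * (sin (pi * x) / (pi * (x - real m)))"
proof -
  have "complex_of_real (rsincpi (x - real m)) = complex_of_real ((-1) ^ m * (sin (pi * x) / (pi * (x - real m))))"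
  proof -
    have "complex_of_real x \<noteq> of_nat m" using assms by (metis of_real_eq_iff of_real_of_nat_eq)
    from sincpi_shift[OF this] show ?thesis
      unfolding sincpi_of_real[symmetric] by (simp flip: sin_of_real)
  qed
  then show ?thesis by (simp only: of_real_eq_iff)
qed

lemma rsincpi_shift_plus:
  assumes "x + real m \<noteq> 0"
  shows "rsincpi (x + real m) = (-1) ^ m * (sin (pi * x) / (pi * (x + real m)))"
proof -
  have "rsincpi (x + real m) = rsincpi (- x - real m)" using rsincpi_minus[of "x + real m"] by simp
  also have "\<dots> = (-1) ^ m * (sin (pi * - x) / (pi * (- x - real m)))" using assms by (intro rsincpi_shift) auto
  also have "sin (pi * - x) / (pi * (- x - real m)) = sin (pi * x) / (pi * (x + real m))"
  proof -
    have "pi * (- x - real m) = - (pi * (x + real m))" by (simp add: algebra_simps)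
    then show ?thesis by (simp only: mult_minus_right sin_minus minus_divide_divide)
  qed
  finally show ?thesis .
qed

lemma rsincpi_0: "rsincpi 0 = 1"
  by (simp add: rsincpi_def)

lemma rsincpi_int: "m \<noteq> 0 \<Longrightarrow> rsincpi (of_int m) = 0"
  using sin_int_times_real[of m pi] by (simp add: rsincpi_def rsinc_def sin_times_pi_eq_0 mult.commute[of pi])

lemma rhermite_ker_int: "rhermite_ker (of_int m) = 0"
  by (cases "m = 0") (simp_all add: rhermite_ker_def rsincpi_int)

lemma abs_rsincpi_le: "\<bar>rsincpi x\<bar> \<le> 1"
  using norm_sincpi_le[of "of_real x"] by (simp add: sincpi_of_real)

lemma abs_rhermite_ker_le: "\<bar>rhermite_ker x\<bar> \<le> 1"
  using norm_hermite_ker_le[of "of_real x"] by (simp add: hermite_ker_of_real)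

abbreviation wt :: "real \<Rightarrow> nat \<Rightarrow> real" where
  "wt s n \<equiv> exp (s * (real (Suc n))\<^sup>2)"

abbreviation wt' :: "real \<Rightarrow> nat \<Rightarrow> real" where
  "wt' s n \<equiv> 2 * s * real (Suc n) * exp (s * (real (Suc n))\<^sup>2)"

lemma summable_wt:
  assumes "s < 0" shows "summable (\<lambda>n. real (Suc n) ^ k * wt s n)"
  using summable_theta_terms[OF assms, of k 0] by simp

text \<open>The sine factors of \<open>K_plus\<close> and \<open>L_plus\<close> are absorbed into the terms, each of which then becomes entire.\<close>

definition Kser :: "real \<Rightarrow> complex \<Rightarrow> complex" where
  "Kser s z = (\<Sum>n. of_real (wt s n) * (sincpi (z - of_nat (Suc n)) - (-1) ^ Suc n * sincpi z))"

definition Lser :: "real \<Rightarrow> complex \<Rightarrow> complex" where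
  "Lser s z = (\<Sum>n. of_real (wt s n) * (sincpi (z - of_nat (Suc n)))\<^sup>2
     + of_real (wt' s n) * (hermite_ker (z - of_nat (Suc n)) - hermite_ker z))"

lemma norm_sincpi_shift_le: "norm (sincpi (z - of_nat m)) \<le> exp (pi * norm z)"
proof -
  have "\<bar>Im (z - of_nat m)\<bar> \<le> norm z" using abs_Im_le_cmod[of z] by simp
  then show ?thesis by (intro order_trans[OF norm_sincpi_le]) simp
qed

lemma norm_hermite_ker_shift_le: "norm (hermite_ker (z - of_nat m)) \<le> exp (2 * pi * norm z)"
proof -
  have "\<bar>Im (z - of_nat m)\<bar> \<le> norm z" using abs_Im_le_cmod[of z] by simp
  then show ?thesis by (intro order_trans[OF norm_hermite_ker_le]) simp
qed

lemma Kser_term_bound: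
  "norm (of_real (wt s n) * (sincpi (z - of_nat (Suc n)) - (-1) ^ Suc n * sincpi z)) \<le> (2 * (real (Suc n) ^ 0 * wt s n)) * exp (pi * norm z)"
proof -
  have "norm (sincpi (z - of_nat (Suc n)) - (-1) ^ Suc n * sincpi z) \<le> exp (pi * norm z) + exp (pi * norm z)"
    using norm_sincpi_shift_le[of z "Suc n"] norm_sincpi_shift_le[of z 0]
    by (intro order_trans[OF norm_triangle_ineq4] add_mono) (simp_all add: norm_mult norm_power)
  then have "wt s n * norm (sincpi (z - of_nat (Suc n)) - (-1) ^ Suc n * sincpi z) \<le> wt s n * (exp (pi * norm z) + exp (pi * norm z))"
    by (intro mult_left_mono) auto
  then show ?thesis unfolding norm_mult norm_of_real abs_exp_cancel by (simp add: algebra_simps)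
qed

lemma Lser_term_bound:
  assumes s: "s < 0"
  shows "norm (of_real (wt s n) * (sincpi (z - of_nat (Suc n)))\<^sup>2 + of_real (wt' s n) * (hermite_ker (z - of_nat (Suc n)) - hermite_ker z))
    \<le> (real (Suc n) ^ 0 * wt s n + (- 4 * s) * (real (Suc n) ^ 1 * wt s n)) * exp (2 * pi * norm z)"
proof -
  let ?e = "exp (2 * pi * norm z)"
  have "(norm (sincpi (z - of_nat (Suc n))))\<^sup>2 \<le> (exp (pi * norm z))\<^sup>2"
    by (intro power_mono norm_sincpi_shift_le) simp
  also have "\<dots> = ?e" by (simp add: power2_eq_square flip: exp_add)
  finally have 1: "norm (of_real (wt s n) * (sincpi (z - of_nat (Suc n)))\<^sup>2) \<le> wt s n * ?e"
    unfolding norm_mult norm_of_real norm_power abs_exp_cancel by (rule mult_left_mono) simp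
  have "norm (hermite_ker (z - of_nat (Suc n)) - hermite_ker z) \<le> ?e + ?e"
    using norm_hermite_ker_shift_le[of z "Suc n"] norm_hermite_ker_shift_le[of z 0]
    by (intro order_trans[OF norm_triangle_ineq4] add_mono) simp_all
  then have "norm (of_real (wt' s n) * (hermite_ker (z - of_nat (Suc n)) - hermite_ker z)) \<le> \<bar>wt' s n\<bar> * (?e + ?e)"
    unfolding norm_mult norm_of_real by (rule mult_left_mono) simp
  also have "\<bar>wt' s n\<bar> = (- 2 * s) * (real (Suc n) * wt s n)" using s by (simp add: abs_mult del: of_nat_Suc)
  finally have 2: "norm (of_real (wt' s n) * (hermite_ker (z - of_nat (Suc n)) - hermite_ker z)) \<le> (- 2 * s) * (real (Suc n) * wt s n) * (?e + ?e)" .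
  have "(real (Suc n) ^ 0 * wt s n + (- 4 * s) * (real (Suc n) ^ 1 * wt s n)) * ?e = wt s n * ?e + (- 2 * s) * (real (Suc n) * wt s n) * (?e + ?e)"
    by (simp add: algebra_simps del: of_nat_Suc)
  then show ?thesis using norm_triangle_mono[OF 1 2] by (simp only:)
qed

lemma exp_type_Kser:
  assumes s: "s < 0" shows "exp_type_le pi (Kser s)"
  unfolding Kser_def[abs_def]
proof (rule exp_type_series[OF _ _ Kser_term_bound])
  show "summable (\<lambda>n. 2 * (real (Suc n) ^ 0 * wt s n))" by (intro summable_mult summable_wt s)
qed (auto intro!: holomorphic_intros)

lemma exp_type_Lser:
  assumes s: "s < 0" shows "exp_type_le (2 * pi) (Lser s)"
  unfolding Lser_def[abs_def]
proof (rule exp_type_series[OF _ _ Lser_term_bound[OF s]])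
  show "summable (\<lambda>n. real (Suc n) ^ 0 * wt s n + (- 4 * s) * (real (Suc n) ^ 1 * wt s n))"
    by (intro summable_add summable_mult summable_wt s)
qed (auto intro!: holomorphic_intros)

lemma summable_Kser:
  assumes s: "s < 0"
  shows "summable (\<lambda>n. of_real (wt s n) * (sincpi (z - of_nat (Suc n)) - (-1) ^ Suc n * sincpi z))"
  by (rule summable_comparison_test'[where N = 0, OF _ Kser_term_bound])
    (intro summable_mult2 summable_mult summable_wt s)

lemma summable_Lser:
  assumes s: "s < 0"
  shows "summable (\<lambda>n. of_real (wt s n) * (sincpi (z - of_nat (Suc n)))\<^sup>2 + of_real (wt' s n) * (hermite_ker (z - of_nat (Suc n)) - hermite_ker z))"
  by (rule summable_comparison_test'[where N = 0, OF _ Lser_term_bound[OF s]])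
    (intro summable_mult2 summable_mult summable_add summable_wt s)

lemma gauss_nat: "gauss lam (of_nat n) = of_real (exp (- (pi * lam) * (real n)\<^sup>2))"
  by (simp add: gauss_def flip: exp_of_real)

lemma deriv_gauss_nat: "deriv (gauss lam) (of_nat n) = of_real (2 * (- (pi * lam)) * real n * exp (- (pi * lam) * (real n)\<^sup>2))"
proof -
  have "(gauss lam has_field_derivative - (of_real (pi * lam) * (2 * z)) * gauss lam z) (at z)" for z
    unfolding gauss_def[abs_def] by (auto intro!: derivative_eq_intros)
  from DERIV_imp_deriv[OF this] show ?thesis by (simp add: gauss_nat)
qed

lemma sin_pi_nonzero:
  fixes z :: complex
  assumes "z \<notin> \<int>" shows "sin (of_real pi * z) \<noteq> 0"
proof
  assume "sin (of_real pi * z) = 0"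
  then obtain n :: int where "of_real pi * z = of_real (of_int n * pi)" by (auto simp: sin_eq_0)
  then have "z = of_int n" by simp
  then show False using assms by simp
qed

lemma Ints_minus_nat_nonzero:
  fixes z :: complex
  assumes "z \<notin> \<int>" shows "z \<noteq> 0" "z \<noteq> of_nat n" "z - of_nat n \<noteq> 0"
  using assms by auto

lemma K_plus_eq:
  assumes lam: "lam > 0"
  shows "K_plus lam = Kser (- (pi * lam))"
  unfolding K_plus_def
proof (rule remove_sings_eq_entire)
  let ?s = "- (pi * lam)"
  have s: "?s < 0" using lam by simp
  show "Kser ?s holomorphic_on UNIV" using exp_type_Kser[OF s] by (simp add: exp_type_le_def)
  fix z :: complex assume z: "z \<notin> \<int>"
  note nz = Ints_minus_nat_nonzero[OF z]
  define \<sigma> where "\<sigma> = sin (of_real pi * z) / of_real pi"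
  have \<sigma>: "\<sigma> \<noteq> 0" using sin_pi_nonzero[OF z] by (simp add: \<sigma>_def)
  have "(\<lambda>k. let n = of_nat (Suc k) in (-1) ^ Suc k * (gauss lam n / (z - n) - gauss lam n / z))
     = (\<lambda>k. 1 / \<sigma> * (of_real (wt ?s k) * (sincpi (z - of_nat (Suc k)) - (-1) ^ Suc k * sincpi z)))"
  proof
    fix k
    have S: "sincpi (z - of_nat (Suc k)) = (-1) ^ Suc k * (\<sigma> * (1 / (z - of_nat (Suc k))))" "sincpi z = \<sigma> * (1 / z)"
      using sincpi_shift[OF nz(2), of "Suc k"] nz(1) by (simp_all add: \<sigma>_def sincpi_def csinc_def)
    have gen: "e * (g / a - g / b) = 1 / \<sigma> * (g * (e * (\<sigma> * (1 / a)) - e * (\<sigma> * (1 / b))))" for g e a b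
    proof -
      have "1 / \<sigma> * (g * (e * (\<sigma> * A) - e * (\<sigma> * B))) = e * (g * A - g * B)" for A B
        using \<sigma> by (simp add: field_simps)
      from this[of "1 / a" "1 / b"] show ?thesis by simp
    qed
    show "(let n = of_nat (Suc k) in (-1) ^ Suc k * (gauss lam n / (z - n) - gauss lam n / z))
       = 1 / \<sigma> * (of_real (wt ?s k) * (sincpi (z - of_nat (Suc k)) - (-1) ^ Suc k * sincpi z))"
      unfolding S Let_def gauss_nat by (rule gen)
  qed
  then show "sin (of_real pi * z) / of_real pi * (\<Sum>k. let n = of_nat (Suc k) in (-1) ^ Suc k * (gauss lam n / (z - n) - gauss lam n / z)) = Kser ?s z"
    unfolding \<sigma>_def[symmetric] Kser_def
    using suminf_mult[OF summable_Kser[OF s, of z], of "1 / \<sigma>"] \<sigma> by simp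
qed

lemma L_plus_eq:
  assumes lam: "lam > 0"
  shows "L_plus lam = Lser (- (pi * lam))"
  unfolding L_plus_def
proof (rule remove_sings_eq_entire)
  let ?s = "- (pi * lam)"
  have s: "?s < 0" using lam by simp
  show "Lser ?s holomorphic_on UNIV" using exp_type_Lser[OF s] by (simp add: exp_type_le_def)
  fix z :: complex assume z: "z \<notin> \<int>"
  note nz = Ints_minus_nat_nonzero[OF z]
  define \<sigma> where "\<sigma> = (sin (of_real pi * z))\<^sup>2 / (of_real pi)\<^sup>2"
  have \<sigma>: "\<sigma> \<noteq> 0" using sin_pi_nonzero[OF z] by (simp add: \<sigma>_def)
  have "(\<lambda>k. let n = of_nat (Suc k) in gauss lam n / (z - n)\<^sup>2 + deriv (gauss lam) n / (z - n) - deriv (gauss lam) n / z)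
     = (\<lambda>k. 1 / \<sigma> * (of_real (wt ?s k) * (sincpi (z - of_nat (Suc k)))\<^sup>2 + of_real (wt' ?s k) * (hermite_ker (z - of_nat (Suc k)) - hermite_ker z)))"
  proof
    fix k
    have e: "((-1) ^ m)\<^sup>2 = (1::complex)" for m by (simp flip: power_mult)
    have S: "(sincpi (z - of_nat (Suc k)))\<^sup>2 = \<sigma> * (1 / (z - of_nat (Suc k))\<^sup>2)" "(sincpi z)\<^sup>2 = \<sigma> * (1 / z\<^sup>2)"
      using nz(1) unfolding sincpi_shift[OF nz(2), of "Suc k"] power_mult_distrib e
      by (simp_all add: \<sigma>_def sincpi_def csinc_def power_divide power_mult_distrib)
    have T: "hermite_ker (z - of_nat (Suc k)) = \<sigma> * (1 / (z - of_nat (Suc k)))" "hermite_ker z = \<sigma> * (1 / z)"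
      unfolding hermite_ker_def S using nz by (simp_all add: power2_eq_square del: of_nat_Suc)
    have gen: "g / a + h / b - h / c = 1 / \<sigma> * (g * (\<sigma> * (1 / a)) + h * (\<sigma> * (1 / b) - \<sigma> * (1 / c)))" for g h a b c
    proof -
      have "1 / \<sigma> * (g * (\<sigma> * A) + h * (\<sigma> * B - \<sigma> * C)) = g * A + h * B - h * C" for A B C
        using \<sigma> by (simp add: field_simps)
      from this[of "1 / a" "1 / b" "1 / c"] show ?thesis by simp
    qed
    show "(let n = of_nat (Suc k) in gauss lam n / (z - n)\<^sup>2 + deriv (gauss lam) n / (z - n) - deriv (gauss lam) n / z)
       = 1 / \<sigma> * (of_real (wt ?s k) * (sincpi (z - of_nat (Suc k)))\<^sup>2 + of_real (wt' ?s k) * (hermite_ker (z - of_nat (Suc k)) - hermite_ker z))"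
      unfolding S T Let_def gauss_nat deriv_gauss_nat by (rule gen)
  qed
  then show "(sin (of_real pi * z))\<^sup>2 / (of_real pi)\<^sup>2 * (\<Sum>k. let n = of_nat (Suc k) in gauss lam n / (z - n)\<^sup>2 + deriv (gauss lam) n / (z - n) - deriv (gauss lam) n / z) = Lser ?s z"
    unfolding \<sigma>_def[symmetric] Lser_def
    using suminf_mult[OF summable_Lser[OF s, of z], of "1 / \<sigma>"] \<sigma> by simp
qed

lemma M_plus_eq:
  assumes lam: "lam > 0"
  shows "M_plus lam = (\<lambda>z. Lser (- (pi * lam)) z + (sincpi z)\<^sup>2)"
  unfolding M_plus_def L_plus_eq[OF lam]
proof (rule remove_sings_eq_entire)
  have s: "- (pi * lam) < 0" using lam by simp
  then have "Lser (- (pi * lam)) holomorphic_on UNIV" using exp_type_Lser by (simp add: exp_type_le_def)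
  then show "(\<lambda>z. Lser (- (pi * lam)) z + (sincpi z)\<^sup>2) holomorphic_on UNIV"
    by (intro holomorphic_intros) auto
  fix z :: complex assume z: "z \<notin> \<int>"
  then have "z \<noteq> 0" by auto
  then show "Lser (- (pi * lam)) z + (sin (of_real pi * z))\<^sup>2 / ((of_real pi)\<^sup>2 * z\<^sup>2) = Lser (- (pi * lam)) z + (sincpi z)\<^sup>2"
    by (simp add: sincpi_def csinc_def power_divide power_mult_distrib)
qed

section \<open>Restriction to the real axis\<close>

text \<open>The corrections at 0 cancel in \<open>K_plus lam z - K_plus lam (- z)\<close>, because
  \<open>sincpi\<close> is even.\<close>

definition rK :: "real \<Rightarrow> real \<Rightarrow> real" where
  "rK s x = (\<Sum>n. wt s n * (rsincpi (x - real (Suc n)) - rsincpi (x + real (Suc n))))"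

text \<open>As \<open>hermite_ker\<close> is odd, the corrections at 0 add up instead of cancelling
  and form a second difference. The last square is the extra term of \<open>M_plus\<close> inside
  \<open>L_odd\<close>.\<close>

definition rL :: "real \<Rightarrow> real \<Rightarrow> real" where
  "rL s x = (\<Sum>n. wt s n * ((rsincpi (x - real (Suc n)))\<^sup>2 - (rsincpi (x + real (Suc n)))\<^sup>2)
     + wt' s n * (rhermite_ker (x - real (Suc n)) + rhermite_ker (x + real (Suc n)) - 2 * rhermite_ker x)) - (rsincpi x)\<^sup>2"

lemma shift_of_real:
  "complex_of_real x - of_nat m = of_real (x - real m)" "- complex_of_real x - of_nat m = of_real (- (x + real m))"
  by simp_all

lemma K_odd_of_real:
  assumes lam: "lam > 0"
  shows "K_odd lam (of_real x) = of_real (rK (- (pi * lam)) x)"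
    and "summable (\<lambda>n. wt (- (pi * lam)) n * (rsincpi (x - real (Suc n)) - rsincpi (x + real (Suc n))))"
proof -
  let ?s = "- (pi * lam)"
  have s: "?s < 0" using lam by simp
  have "(\<lambda>n. of_real (wt ?s n) * (sincpi (of_real x - of_nat (Suc n)) - (-1) ^ Suc n * sincpi (of_real x))
     - of_real (wt ?s n) * (sincpi (- of_real x - of_nat (Suc n)) - (-1) ^ Suc n * sincpi (- of_real x))) sums K_odd lam (of_real x)"
    unfolding K_odd_def K_plus_eq[OF lam] Kser_def by (intro sums_diff summable_sums summable_Kser s)
  moreover have "of_real (wt ?s n) * (sincpi (of_real x - of_nat (Suc n)) - (-1) ^ Suc n * sincpi (of_real x))
     - of_real (wt ?s n) * (sincpi (- of_real x - of_nat (Suc n)) - (-1) ^ Suc n * sincpi (- of_real x))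
     = complex_of_real (wt ?s n * (rsincpi (x - real (Suc n)) - rsincpi (x + real (Suc n))))" for n
    unfolding shift_of_real sincpi_minus sincpi_of_real rsincpi_minus by (simp add: algebra_simps del: of_nat_Suc)
  ultimately have *: "(\<lambda>n. complex_of_real (wt ?s n * (rsincpi (x - real (Suc n)) - rsincpi (x + real (Suc n))))) sums K_odd lam (of_real x)"
    by simp
  from sums_Re[OF *] have "(\<lambda>n. wt ?s n * (rsincpi (x - real (Suc n)) - rsincpi (x + real (Suc n)))) sums Re (K_odd lam (of_real x))"
    by (simp only: Re_complex_of_real)
  then have r: "(\<lambda>n. wt ?s n * (rsincpi (x - real (Suc n)) - rsincpi (x + real (Suc n)))) sums rK ?s x"
    unfolding rK_def by (simp only: sums_iff)
  then show "summable (\<lambda>n. wt ?s n * (rsincpi (x - real (Suc n)) - rsincpi (x + real (Suc n))))" by (rule sums_summable)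
  show "K_odd lam (of_real x) = of_real (rK ?s x)"
    by (rule sums_unique2[OF * sums_of_real[OF r]])
qed

lemma L_odd_of_real:
  assumes lam: "lam > 0"
  shows "L_odd lam (of_real x) = of_real (rL (- (pi * lam)) x)"
    and "summable (\<lambda>n. wt (- (pi * lam)) n * ((rsincpi (x - real (Suc n)))\<^sup>2 - (rsincpi (x + real (Suc n)))\<^sup>2)
     + wt' (- (pi * lam)) n * (rhermite_ker (x - real (Suc n)) + rhermite_ker (x + real (Suc n)) - 2 * rhermite_ker x))"
proof -
  let ?s = "- (pi * lam)"
  have s: "?s < 0" using lam by simp
  let ?r = "\<lambda>n. wt ?s n * ((rsincpi (x - real (Suc n)))\<^sup>2 - (rsincpi (x + real (Suc n)))\<^sup>2)
     + wt' ?s n * (rhermite_ker (x - real (Suc n)) + rhermite_ker (x + real (Suc n)) - 2 * rhermite_ker x)"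
  have "(\<lambda>n. (of_real (wt ?s n) * (sincpi (of_real x - of_nat (Suc n)))\<^sup>2 + of_real (wt' ?s n) * (hermite_ker (of_real x - of_nat (Suc n)) - hermite_ker (of_real x)))
     - (of_real (wt ?s n) * (sincpi (- of_real x - of_nat (Suc n)))\<^sup>2 + of_real (wt' ?s n) * (hermite_ker (- of_real x - of_nat (Suc n)) - hermite_ker (- of_real x))))
     sums (Lser ?s (of_real x) - Lser ?s (- of_real x))"
    unfolding Lser_def by (intro sums_diff summable_sums summable_Lser s)
  moreover have "(of_real (wt ?s n) * (sincpi (of_real x - of_nat (Suc n)))\<^sup>2 + of_real (wt' ?s n) * (hermite_ker (of_real x - of_nat (Suc n)) - hermite_ker (of_real x)))
     - (of_real (wt ?s n) * (sincpi (- of_real x - of_nat (Suc n)))\<^sup>2 + of_real (wt' ?s n) * (hermite_ker (- of_real x - of_nat (Suc n)) - hermite_ker (- of_real x)))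
     = complex_of_real (?r n)" for n
    unfolding shift_of_real sincpi_of_real hermite_ker_of_real hermite_ker_minus rsincpi_minus rhermite_ker_minus
    by (simp add: algebra_simps del: of_nat_Suc)
  ultimately have *: "(\<lambda>n. complex_of_real (?r n)) sums (Lser ?s (of_real x) - Lser ?s (- of_real x))"
    by (simp only:)
  from sums_Re[OF *] have "?r sums Re (Lser ?s (of_real x) - Lser ?s (- of_real x))"
    by (simp only: Re_complex_of_real)
  then have r: "?r sums (\<Sum>n. ?r n)" by (simp only: sums_iff)
  then show "summable ?r" by (rule sums_summable)
  have "Lser ?s (of_real x) - Lser ?s (- of_real x) = of_real (\<Sum>n. ?r n)"
    by (rule sums_unique2[OF * sums_of_real[OF r]])
  then show "L_odd lam (of_real x) = of_real (rL ?s x)"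
    unfolding L_odd_def L_plus_eq[OF lam] M_plus_eq[OF lam] rL_def sincpi_minus sincpi_of_real
    by (simp only: diff_add_eq_diff_diff_swap of_real_diff of_real_power) simp
qed

lemma M_odd_eq: "M_odd lam z = - L_odd lam (- z)"
  by (simp add: M_odd_def L_odd_def)

lemma minus_shift: "- x - m = - (x + m)" "- x + m = - (x - m)" for x m :: real
  by simp_all

lemma gauss_odd_deriv:
  assumes a: "a \<noteq> 0"
  obtains d where "(gauss_odd lam has_real_derivative d) (at a)"
proof -
  have "((\<lambda>x. sgn a * exp (- (pi * lam * x\<^sup>2))) has_real_derivative
      sgn a * (exp (- (pi * lam * a\<^sup>2)) * - (pi * lam * (2 * a)))) (at a)"
    by (auto intro!: derivative_eq_intros)
  moreover have "eventually (\<lambda>x. sgn a * exp (- (pi * lam * x\<^sup>2)) = gauss_odd lam x) (nhds a)"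
  proof -
    have "eventually (\<lambda>x. x \<in> (if a > 0 then {0<..} else {..<0})) (nhds a)"
      using a by (intro eventually_nhds_in_open) auto
    then show ?thesis
      by eventually_elim (use a in \<open>auto simp: gauss_odd_def split: if_splits\<close>)
  qed
  ultimately have "(gauss_odd lam has_real_derivative
      sgn a * (exp (- (pi * lam * a\<^sup>2)) * - (pi * lam * (2 * a)))) (at a)"
    by (subst (asm) DERIV_cong_ev[OF refl _ refl])
  then show ?thesis by (rule that)
qed

text \<open>The difference has a local extremum at the point of contact, so its derivative vanishes
  there. Hence derivative interpolation follows from value interpolation and the one-sided
  inequality. The imaginary part of the complex derivative is 0 because \<open>F\<close> is real on
  the real axis.\<close>

lemma touching_deriv:
  assumes F: "F holomorphic_on UNIV" and Ff: "\<And>x. F (of_real x) = of_real (f x)"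
    and g: "(g has_real_derivative d) (at a)"
    and le: "(\<forall>x. f x \<le> g x) \<or> (\<forall>x. g x \<le> f x)" and eq: "f a = g a"
  shows "deriv F (of_real a) = of_real (deriv g a)"
proof -
  define c where "c = deriv F (of_real a)"
  have "(F has_field_derivative c) (at (of_real a))"
    using F unfolding c_def by (intro holomorphic_derivI[of F UNIV]) auto
  then have v: "((\<lambda>x. of_real (f x)) has_vector_derivative c) (at a)"
    using has_vector_derivative_real_field[of F c a UNIV] by (simp add: Ff)
  have f: "(f has_real_derivative Re c) (at a)"
    using bounded_linear.has_vector_derivative[OF bounded_linear_Re v]
    by (simp add: has_real_derivative_iff_has_vector_derivative)
  have "((\<lambda>x. 0::real) has_vector_derivative Im c) (at a)"
    using bounded_linear.has_vector_derivative[OF bounded_linear_Im v] by simp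
  then have im: "Im c = 0"
    using vector_derivative_unique_at[OF _ has_vector_derivative_const] by blast
  have "d = Re c"
    using le
  proof
    assume *: "\<forall>x. f x \<le> g x"
    have "d - Re c = 0"
      by (rule DERIV_local_min[OF DERIV_diff[OF g f] zero_less_one]) (use * eq in auto)
    then show ?thesis by simp
  next
    assume *: "\<forall>x. g x \<le> f x"
    have "d - Re c = 0"
      by (rule DERIV_local_max[OF DERIV_diff[OF g f] zero_less_one]) (use * eq in auto)
    then show ?thesis by simp
  qed
  then show ?thesis using im DERIV_imp_deriv[OF g] unfolding c_def[symmetric] by (simp add: complex_eq_iff)
qed

section \<open>Quadratic decay on the real line\<close>

text \<open>From m^2 <= x^2/4 and 1 <= x^2/4 the left-hand side is at least 3/4 x^2 and 1 + x^2 is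
  at most 5/4 x^2; 3/5 is the quotient.\<close>

lemma one_plus_square_far:
  fixes x m :: real
  assumes m: "m \<ge> 1" and x: "\<bar>x\<bar> > 2 * m"
  shows "x\<^sup>2 - m\<^sup>2 \<ge> 3 / 5 * (1 + x\<^sup>2)"
proof -
  have "(2 * m)\<^sup>2 \<le> \<bar>x\<bar>\<^sup>2" using m x by (intro power_mono) auto
  moreover have "1 \<le> m\<^sup>2" using m by simp
  ultimately show ?thesis by (simp add: power_mult_distrib)
qed

lemma bounded_imp_near_decay:
  fixes x y m c :: real
  assumes m: "m \<ge> 1" and x: "\<bar>x\<bar> \<le> 2 * m" and y: "\<bar>y\<bar> \<le> c"
  shows "\<bar>y\<bar> \<le> 5 * c * m\<^sup>2 / (1 + x\<^sup>2)"
proof -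
  have "\<bar>x\<bar>\<^sup>2 \<le> (2 * m)\<^sup>2" using x by (intro power_mono) auto
  moreover have "1 \<le> m\<^sup>2" using m by simp
  ultimately have "1 + x\<^sup>2 \<le> 5 * m\<^sup>2" by (simp add: power_mult_distrib)
  then have "\<bar>y\<bar> * (1 + x\<^sup>2) \<le> c * (5 * m\<^sup>2)" using y by (intro mult_mono) auto
  moreover have "1 + x\<^sup>2 > 0" by (simp add: add_pos_nonneg)
  ultimately show ?thesis by (simp add: pos_le_divide_eq mult_ac)
qed

lemma rsincpi_square_decay: "(rsincpi x)\<^sup>2 \<le> 2 / (1 + x\<^sup>2)"
proof -
  have "1\<^sup>2 * x\<^sup>2 \<le> pi\<^sup>2 * x\<^sup>2" using pi_gt3 by (intro mult_right_mono power_mono) auto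
  then have "2 / (1 + (pi * x)\<^sup>2) \<le> 2 / (1 + x\<^sup>2)"
    by (intro divide_left_mono) (auto simp: power_mult_distrib intro!: mult_pos_pos add_pos_nonneg)
  then show ?thesis using rsinc_square_decay[of "pi * x"] by (simp add: rsincpi_def)
qed

text \<open>A single sinc decays only like 1/x and is not integrable. Pairing m with - m gives 1/(x
  - m) - 1/(x + m) = 2 m/(x^2 - m^2). For |x| <= 2 m the trivial bound 2 is used, which
  \<open>bounded_imp_near_decay\<close> multiplies by 5.\<close>

lemma rsincpi_pair_decay:
  assumes m: "m \<ge> 1"
  shows "\<bar>rsincpi (x - real m) - rsincpi (x + real m)\<bar> \<le> 10 * (real m)\<^sup>2 / (1 + x\<^sup>2)"
proof (cases "\<bar>x\<bar> \<le> 2 * real m")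
  case True
  have "\<bar>rsincpi (x - real m) - rsincpi (x + real m)\<bar> \<le> 2"
    using abs_rsincpi_le[of "x - real m"] abs_rsincpi_le[of "x + real m"] by linarith
  from bounded_imp_near_decay[OF _ True this] m show ?thesis by simp
next
  case False
  have n: "x \<noteq> real m" "x + real m \<noteq> 0" using False by auto
  have pos: "1 + x\<^sup>2 > 0" by (simp add: add_pos_nonneg)
  have far: "x\<^sup>2 - (real m)\<^sup>2 \<ge> 3 / 5 * (1 + x\<^sup>2)"
    using m False by (intro one_plus_square_far) auto
  have "rsincpi (x - real m) - rsincpi (x + real m) = (-1) ^ m * (sin (pi * x) / pi) * (1 / (x - real m) - 1 / (x + real m))"
    unfolding rsincpi_shift[OF n(1)] rsincpi_shift_plus[OF n(2)] by (simp add: algebra_simps)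
  also have "1 / (x - real m) - 1 / (x + real m) = 2 * real m / (x\<^sup>2 - (real m)\<^sup>2)"
    using n by (simp add: field_simps power2_eq_square)
  finally have "\<bar>rsincpi (x - real m) - rsincpi (x + real m)\<bar> = \<bar>sin (pi * x)\<bar> / pi * (2 * real m / (x\<^sup>2 - (real m)\<^sup>2))"
    using far pos by (simp add: abs_mult power_abs)
  also have "\<dots> \<le> 1 * (2 * real m / (3 / 5 * (1 + x\<^sup>2)))"
  proof (intro mult_mono divide_left_mono)
    show "\<bar>sin (pi * x)\<bar> / pi \<le> 1"
      using order_trans[OF abs_sin_le_one[of "pi * x"], of pi] pi_gt3 by (simp add: pos_divide_le_eq)
  qed (use far pos in auto)
  also have "\<dots> \<le> 10 * (real m)\<^sup>2 / (1 + x\<^sup>2)"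
  proof -
    have "real m \<le> (real m)\<^sup>2" using m by (simp add: power2_eq_square)
    then have "10 / 3 * real m \<le> 10 * (real m)\<^sup>2" by linarith
    then have "10 / 3 * real m / (1 + x\<^sup>2) \<le> 10 * (real m)\<^sup>2 / (1 + x\<^sup>2)"
      using pos by (intro divide_right_mono) auto
    then show ?thesis by simp
  qed
  finally show ?thesis .
qed

text \<open>Squared sincs decay quadratically by themselves. For the Hermite kernels the correction
  - 2/x is essential: 1/(x - m) + 1/(x + m) - 2/x = 2 m^2/(x (x^2 - m^2)). The growth in m is
  harmless against the Gaussian weights.\<close>

lemma hermite_pair_decay:
  assumes m: "m \<ge> 1"
  shows "\<bar>(rsincpi (x - real m))\<^sup>2 - (rsincpi (x + real m))\<^sup>2\<bar> \<le> 20 * (real m)\<^sup>2 / (1 + x\<^sup>2)"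
    and "\<bar>rhermite_ker (x - real m) + rhermite_ker (x + real m) - 2 * rhermite_ker x\<bar> \<le> 20 * (real m)\<^sup>2 / (1 + x\<^sup>2)"
proof -
  have pos: "1 + x\<^sup>2 > 0" by (simp add: add_pos_nonneg)
  have m1: "1 \<le> (real m)\<^sup>2" using m by simp
  show "\<bar>(rsincpi (x - real m))\<^sup>2 - (rsincpi (x + real m))\<^sup>2\<bar> \<le> 20 * (real m)\<^sup>2 / (1 + x\<^sup>2)"
  proof (cases "\<bar>x\<bar> \<le> 2 * real m")
    case True
    have "(rsincpi y)\<^sup>2 \<le> 1" for y using abs_rsincpi_le[of y] by (simp add: abs_square_le_1)
    from this[of "x - real m"] this[of "x + real m"]
    have "\<bar>(rsincpi (x - real m))\<^sup>2 - (rsincpi (x + real m))\<^sup>2\<bar> \<le> 4"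
      using zero_le_power2[of "rsincpi (x - real m)"] zero_le_power2[of "rsincpi (x + real m)"] by linarith
    from bounded_imp_near_decay[OF _ True this] m show ?thesis by simp
  next
    case False
    have d: "(rsincpi y)\<^sup>2 \<le> 20 * (real m)\<^sup>2 / (1 + x\<^sup>2)" if y: "\<bar>x\<bar> \<le> 2 * \<bar>y\<bar>" for y
    proof -
      have "\<bar>x\<bar>\<^sup>2 \<le> (2 * \<bar>y\<bar>)\<^sup>2" using y by (intro power_mono) auto
      then have "(1 + x\<^sup>2) / 4 \<le> 1 + y\<^sup>2" by (simp add: power_mult_distrib)
      then have "2 / (1 + y\<^sup>2) \<le> 2 / ((1 + x\<^sup>2) / 4)"
        using pos by (intro divide_left_mono mult_pos_pos) (auto intro: add_pos_nonneg)
      also have "\<dots> = 8 / (1 + x\<^sup>2)" by simp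
      also have "\<dots> \<le> 20 * (real m)\<^sup>2 / (1 + x\<^sup>2)"
        using m1 pos by (intro divide_right_mono) auto
      finally show ?thesis using rsincpi_square_decay[of y] by linarith
    qed
    have "\<bar>x\<bar> \<le> 2 * \<bar>x - real m\<bar>" "\<bar>x\<bar> \<le> 2 * \<bar>x + real m\<bar>"
      using False by (simp_all add: abs_if split: if_splits)
    from this[THEN d] show ?thesis
      using zero_le_power2[of "rsincpi (x - real m)"] zero_le_power2[of "rsincpi (x + real m)"] by linarith
  qed
  show "\<bar>rhermite_ker (x - real m) + rhermite_ker (x + real m) - 2 * rhermite_ker x\<bar> \<le> 20 * (real m)\<^sup>2 / (1 + x\<^sup>2)"
  proof (cases "\<bar>x\<bar> \<le> 2 * real m")
    case True
    have "\<bar>rhermite_ker (x - real m) + rhermite_ker (x + real m) - 2 * rhermite_ker x\<bar> \<le> 4"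
      using abs_rhermite_ker_le[of "x - real m"] abs_rhermite_ker_le[of "x + real m"] abs_rhermite_ker_le[of x] by linarith
    from bounded_imp_near_decay[OF _ True this] m show ?thesis by simp
  next
    case False
    have n: "x \<noteq> real m" "x + real m \<noteq> 0" "x \<noteq> 0" using False m by auto
    have far: "x\<^sup>2 - (real m)\<^sup>2 \<ge> 3 / 5 * (1 + x\<^sup>2)"
      using m False by (intro one_plus_square_far) auto
    define \<sigma> where "\<sigma> = (sin (pi * x))\<^sup>2 / pi\<^sup>2"
    have e: "((-1) ^ k)\<^sup>2 = (1::real)" for k by (simp flip: power_mult)
    have "rhermite_ker (x - real m) = \<sigma> * (1 / (x - real m))" "rhermite_ker (x + real m) = \<sigma> * (1 / (x + real m))"
      unfolding rhermite_ker_def rsincpi_shift[OF n(1)] rsincpi_shift_plus[OF n(2)] power_mult_distrib e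
      using n by (simp_all add: \<sigma>_def power_divide power_mult_distrib power2_eq_square)
    moreover have "rhermite_ker x = \<sigma> * (1 / x)"
      using n by (simp add: \<sigma>_def rhermite_ker_def rsincpi_def rsinc_def power_divide power_mult_distrib power2_eq_square)
    ultimately have "rhermite_ker (x - real m) + rhermite_ker (x + real m) - 2 * rhermite_ker x
      = \<sigma> * (1 / (x - real m) + 1 / (x + real m) - 2 / x)" by (simp add: algebra_simps)
    also have "1 / (x - real m) + 1 / (x + real m) - 2 / x = 2 * (real m)\<^sup>2 / (x * (x\<^sup>2 - (real m)\<^sup>2))"
    proof -
      have "x\<^sup>2 - (real m)\<^sup>2 = (x - real m) * (x + real m)" by (simp add: power2_eq_square algebra_simps)
      then show ?thesis using n by (simp add: divide_simps) (simp add: algebra_simps power2_eq_square)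
    qed
    finally have "\<bar>rhermite_ker (x - real m) + rhermite_ker (x + real m) - 2 * rhermite_ker x\<bar>
      = \<sigma> * (2 * (real m)\<^sup>2 / (\<bar>x\<bar> * (x\<^sup>2 - (real m)\<^sup>2)))"
      using far pos by (simp add: abs_mult \<sigma>_def)
    also have "\<dots> \<le> 1 * (2 * (real m)\<^sup>2 / (1 * (3 / 5 * (1 + x\<^sup>2))))"
    proof (intro mult_mono divide_left_mono)
      have "(sin (pi * x))\<^sup>2 \<le> 1" by (simp add: abs_square_le_1)
      moreover have "1\<^sup>2 \<le> pi\<^sup>2" using pi_gt3 by (intro power_mono) auto
      ultimately show "\<sigma> \<le> 1" unfolding \<sigma>_def by (simp add: pos_divide_le_eq)
      show "1 \<le> \<bar>x\<bar>" using False m by linarith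
      show "0 < \<bar>x\<bar> * (x\<^sup>2 - (real m)\<^sup>2) * (1 * (3 / 5 * (1 + x\<^sup>2)))"
        using far pos n by (intro mult_pos_pos) auto
    qed (use far pos in \<open>auto simp: \<sigma>_def\<close>)
    also have "\<dots> = 10 / 3 * (real m)\<^sup>2 / (1 + x\<^sup>2)" by simp
    also have "\<dots> \<le> 20 * (real m)\<^sup>2 / (1 + x\<^sup>2)"
      using pos by (intro divide_right_mono) auto
    finally show ?thesis .
  qed
qed

lemma suminf_decay:
  fixes f :: "nat \<Rightarrow> real \<Rightarrow> real"
  assumes "summable M" "\<And>n x. \<bar>f n x\<bar> \<le> M n / (1 + x\<^sup>2)"
  shows "\<bar>\<Sum>n. f n x\<bar> \<le> suminf M / (1 + x\<^sup>2)"
proof -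
  have "norm (\<Sum>n. f n x) \<le> (\<Sum>n. M n / (1 + x\<^sup>2))"
    by (rule norm_suminf_le[OF _ summable_divide[OF assms(1)]]) (use assms(2) in simp)
  also have "\<dots> = suminf M / (1 + x\<^sup>2)" by (rule suminf_divide[OF assms(1)])
  finally show ?thesis by simp
qed

lemma rK_decay:
  assumes s: "s < 0"
  shows "\<exists>C. \<forall>x. \<bar>rK s x\<bar> \<le> C / (1 + x\<^sup>2)"
proof -
  let ?M = "\<lambda>n. 10 * (real (Suc n) ^ 2 * wt s n)"
  have "\<bar>wt s n * (rsincpi (x - real (Suc n)) - rsincpi (x + real (Suc n)))\<bar> \<le> ?M n / (1 + x\<^sup>2)" for n x
  proof -
    have "wt s n * \<bar>rsincpi (x - real (Suc n)) - rsincpi (x + real (Suc n))\<bar> \<le> wt s n * (10 * (real (Suc n))\<^sup>2 / (1 + x\<^sup>2))"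
      by (intro mult_left_mono rsincpi_pair_decay) auto
    then show ?thesis by (simp add: abs_mult mult_ac del: of_nat_Suc)
  qed
  from suminf_decay[OF summable_mult[OF summable_wt[OF s]] this] show ?thesis
    unfolding rK_def by blast
qed

lemma rL_decay:
  assumes s: "s < 0"
  shows "\<exists>C. \<forall>x. \<bar>rL s x\<bar> \<le> C / (1 + x\<^sup>2)"
proof -
  let ?f = "\<lambda>n x. wt s n * ((rsincpi (x - real (Suc n)))\<^sup>2 - (rsincpi (x + real (Suc n)))\<^sup>2)
     + wt' s n * (rhermite_ker (x - real (Suc n)) + rhermite_ker (x + real (Suc n)) - 2 * rhermite_ker x)"
  let ?M = "\<lambda>n. 20 * (real (Suc n) ^ 2 * wt s n) + 40 * \<bar>s\<bar> * (real (Suc n) ^ 3 * wt s n)"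
  have bound: "\<bar>?f n x\<bar> \<le> ?M n / (1 + x\<^sup>2)" for n x
  proof -
    define w m A B where "w = wt s n" and "m = real (Suc n)"
      and "A = (rsincpi (x - m))\<^sup>2 - (rsincpi (x + m))\<^sup>2"
      and "B = rhermite_ker (x - m) + rhermite_ker (x + m) - 2 * rhermite_ker x"
    have w: "w \<ge> 0" and m: "m \<ge> 0" by (simp_all add: w_def m_def)
    have A: "\<bar>A\<bar> \<le> 20 * m\<^sup>2 / (1 + x\<^sup>2)" and B: "\<bar>B\<bar> \<le> 20 * m\<^sup>2 / (1 + x\<^sup>2)"
      unfolding A_def B_def m_def by (intro hermite_pair_decay; simp)+
    have "\<bar>w * A + 2 * s * m * w * B\<bar> \<le> w * \<bar>A\<bar> + 2 * \<bar>s\<bar> * m * w * \<bar>B\<bar>"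
      by (rule order_trans[OF abs_triangle_ineq]) (use w m in \<open>simp add: abs_mult\<close>)
    also have "\<dots> \<le> w * (20 * m\<^sup>2 / (1 + x\<^sup>2)) + 2 * \<bar>s\<bar> * m * w * (20 * m\<^sup>2 / (1 + x\<^sup>2))"
      by (intro add_mono mult_left_mono A B) (use w m in auto)
    also have "\<dots> = (20 * (m ^ 2 * w) + 40 * \<bar>s\<bar> * (m ^ 3 * w)) / (1 + x\<^sup>2)"
      by (simp add: add_divide_distrib power2_eq_square power3_eq_cube mult_ac)
    finally show ?thesis unfolding w_def m_def A_def B_def .
  qed
  have sM: "summable ?M" by (intro summable_add summable_mult summable_wt s)
  have "\<bar>rL s x\<bar> \<le> (suminf ?M + 2) / (1 + x\<^sup>2)" for x
  proof -
    have "\<bar>\<Sum>n. ?f n x\<bar> \<le> suminf ?M / (1 + x\<^sup>2)" by (rule suminf_decay[OF sM bound])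
    then show ?thesis
      using rsincpi_square_decay[of x] zero_le_power2[of "rsincpi x"] unfolding rL_def add_divide_distrib by linarith
  qed
  then show ?thesis by blast
qed

lemma gauss_odd_decay:
  assumes "lam > 0"
  shows "\<exists>C. \<forall>x. \<bar>gauss_odd lam x\<bar> \<le> C / (1 + x\<^sup>2)"
proof -
  have "\<bar>gauss_odd lam x\<bar> \<le> (2 + 4 / (pi * lam)\<^sup>2) / (1 + x\<^sup>2)" for x
  proof -
    have "\<bar>sgn x\<bar> * exp (- (pi * lam * x\<^sup>2)) \<le> 1 * \<bar>1 * exp (- (pi * lam * x\<^sup>2))\<bar>"
      by (intro mult_mono) (auto simp: sgn_if)
    also have "\<dots> \<le> (1 * (2 + 4 / (pi * lam)\<^sup>2)) / (1 + x\<^sup>2)"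
      using gaussian_moment_decay[of "pi * lam" 1 1 x] assms by simp
    finally show ?thesis by (simp add: gauss_odd_def abs_mult)
  qed
  then show ?thesis by blast
qed

lemma gauss_odd_measurable [measurable]: "gauss_odd lam \<in> borel_measurable borel"
  unfolding gauss_odd_def[abs_def] sgn_if by measurable

lemma entire_of_real_measurable:
  assumes "F holomorphic_on UNIV"
  shows "(\<lambda>x::real. F (of_real x)) \<in> borel_measurable borel"
proof (rule borel_measurable_continuous_onI)
  show "continuous_on UNIV (\<lambda>x::real. F (of_real x))"
    by (rule continuous_on_compose2[OF holomorphic_on_imp_continuous_on[OF assms]]) (auto intro: continuous_intros)
qed

lemma integrable_decay_diff:
  fixes f g :: "real \<Rightarrow> real"
  assumes "f \<in> borel_measurable borel" "g \<in> borel_measurable borel"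
    and "\<exists>C. \<forall>x. \<bar>f x\<bar> \<le> C / (1 + x\<^sup>2)" "\<exists>C. \<forall>x. \<bar>g x\<bar> \<le> C / (1 + x\<^sup>2)"
  shows "integrable lborel (\<lambda>x. f x - g x)"
proof -
  have "integrable lborel h" if h: "h \<in> borel_measurable borel" and ex: "\<exists>C. \<forall>x. \<bar>h x\<bar> \<le> C / (1 + x\<^sup>2)" for h :: "real \<Rightarrow> real"
  proof -
    obtain C where C: "\<And>x. \<bar>h x\<bar> \<le> C / (1 + x\<^sup>2)" using ex by blast
    show ?thesis by (rule integrable_bounded_by_inverse_square[OF h]) (use C in simp)
  qed
  from this[OF assms(1,3)] this[OF assms(2,4)] show ?thesis by (rule Bochner_Integration.integrable_diff)
qed

section \<open>Comparison of the objectives\<close>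

text \<open>A competitor whose difference is not integrable has infinite objective, so the
  comparison is needed only among integrable ones, where it can be made with Lebesgue
  integrals.\<close>

lemma nn_integral_minimal:
  fixes f g :: "real \<Rightarrow> real"
  assumes f: "integrable lborel f" "\<And>x. f x \<ge> 0" and g: "g \<in> borel_measurable borel" "\<And>x. g x \<ge> 0"
    and le: "integrable lborel g \<Longrightarrow> (LINT x|lborel. f x) \<le> (LINT x|lborel. g x)"
  shows "(\<integral>\<^sup>+x. ennreal (f x) \<partial>lborel) \<le> (\<integral>\<^sup>+x. ennreal (g x) \<partial>lborel)"
proof (cases "integrable lborel g")
  case True
  then show ?thesis using f g le by (simp add: nn_integral_eq_integral ennreal_leI)
next
  case False
  have "(\<integral>\<^sup>+x. ennreal (g x) \<partial>lborel) = \<infinity>"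
  proof (rule ccontr)
    assume "(\<integral>\<^sup>+x. ennreal (g x) \<partial>lborel) \<noteq> \<infinity>"
    then have "integrable lborel g"
      using g by (intro integrableI_nonneg) (auto simp: less_top)
    then show False using False by simp
  qed
  then show ?thesis by simp
qed

text \<open>The reference function \<open>g\<close> cancels in the difference, so only
  \<open>a\<close> and \<open>b\<close> have to come from functions of exponential type;
  \<open>g\<close> itself may have a jump.\<close>

lemma exp_type_2pi_integral_le:
  assumes A: "exp_type_le (2 * pi) A" "\<And>x. A (of_real x) = of_real (a x)"
    and B: "exp_type_le (2 * pi) B" "\<And>x. B (of_real x) = of_real (b x)"
    and iA: "integrable lborel (\<lambda>x. a x - g x)" and iB: "integrable lborel (\<lambda>x. b x - g x)"
    and le: "\<And>n. b (of_int n) \<le> a (of_int n)"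
  shows "(LINT x|lborel. b x - g x) \<le> (LINT x|lborel. a x - g x)"
proof -
  have "integrable lborel (\<lambda>x. a x - b x)"
    using Bochner_Integration.integrable_diff[OF iA iB] by simp
  then have i: "integrable lborel (\<lambda>x. A (of_real x) - B (of_real x))"
    unfolding A B using integrable_of_real[where ?'a = complex] by (simp flip: of_real_diff)
  have "0 \<le> (LINT x|lborel. a x - b x)"
    by (rule exp_type_2pi_integral_nonneg[OF exp_type_le_diff[OF A(1) B(1)] i])
      (use A(2) B(2) le in simp_all)
  also have "\<dots> = (LINT x|lborel. (a x - g x) - (b x - g x))" by simp
  also have "\<dots> = (LINT x|lborel. a x - g x) - (LINT x|lborel. b x - g x)"
    by (rule Bochner_Integration.integral_diff[OF iA iB])
  finally show ?thesis by simp
qed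

lemma isCont_entire_Re: "F holomorphic_on UNIV \<Longrightarrow> isCont (\<lambda>x::real. Re (F (of_real x))) a"
proof -
  assume "F holomorphic_on UNIV"
  then have "isCont F (of_real a)"
    using holomorphic_on_imp_continuous_on continuous_on_eq_continuous_at[OF open_UNIV] by blast
  then show ?thesis by (intro isCont_Re isCont_o2[where g = F and f = of_real]) simp
qed

section \<open>Inequalities, interpolation and extremality for the odd Gaussian\<close>

context
  fixes lam s :: real
  assumes lam: "lam > 0" and s_def: "s = - (pi * lam)"
begin

lemma s_neg: "s < 0"
  using lam by (simp add: s_def)

lemmas K_odd_real = K_odd_of_real(1)[OF lam, folded s_def]
lemmas rK_summable = K_odd_of_real(2)[OF lam, folded s_def]
lemmas L_odd_real = L_odd_of_real(1)[OF lam, folded s_def]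
lemmas rL_summable = L_odd_of_real(2)[OF lam, folded s_def]

lemma M_odd_real: "M_odd lam (of_real x) = of_real (- rL s (- x))"
  unfolding M_odd_eq using L_odd_real[of "- x"] by simp

lemma gauss_odd_pos: "x > 0 \<Longrightarrow> gauss_odd lam x = exp (s * x\<^sup>2)"
  by (simp add: gauss_odd_def s_def)

lemma gauss_odd_minus: "gauss_odd lam (- x) = - gauss_odd lam x"
  by (simp add: gauss_odd_def sgn_minus)

lemma rK_minus: "rK s (- x) = - rK s x"
proof -
  have "wt s n * (rsincpi (- x - real (Suc n)) - rsincpi (- x + real (Suc n)))
    = - (wt s n * (rsincpi (x - real (Suc n)) - rsincpi (x + real (Suc n))))" for n
    unfolding minus_shift rsincpi_minus by (simp add: algebra_simps del: of_nat_Suc)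
  then show ?thesis unfolding rK_def using suminf_minus[OF rK_summable[of x]] by (simp only:)
qed

lemma rL_minus: "rL s (- x) = - rL s x - 2 * (rsincpi x)\<^sup>2"
proof -
  let ?r = "\<lambda>x n. wt s n * ((rsincpi (x - real (Suc n)))\<^sup>2 - (rsincpi (x + real (Suc n)))\<^sup>2)
     + wt' s n * (rhermite_ker (x - real (Suc n)) + rhermite_ker (x + real (Suc n)) - 2 * rhermite_ker x)"
  have "?r (- x) n = - ?r x n" for n
  proof -
    show ?thesis unfolding minus_shift rsincpi_minus rhermite_ker_minus by (simp add: algebra_simps del: of_nat_Suc)
  qed
  then have "(\<Sum>n. ?r (- x) n) = - (\<Sum>n. ?r x n)"
    using suminf_minus[OF rL_summable[of x]] by (simp only:)
  then show ?thesis unfolding rL_def rsincpi_minus by simp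
qed

text \<open>Off the integers \<open>rK s x\<close> is sin(pi x)/pi times the sum in
  \<open>odd_best_approximation_bound\<close>. Multiplying once more by the sine gives the factor
  sin^2/pi, so the direction of that bound is kept whatever the sign of the sine.\<close>

lemma rK_sign_pos:
  assumes x: "x > 0"
  shows "sin (pi * x) * (gauss_odd lam x - rK s x) \<ge> 0"
proof (cases "x \<in> \<int>")
  case True
  then have "sin (pi * x) = 0" using sin_times_pi_eq_0[of x] by (simp add: mult.commute)
  then show ?thesis by simp
next
  case False
  let ?\<sigma> = "sin (pi * x)"
  have \<sigma>: "?\<sigma> \<noteq> 0" using False sin_times_pi_eq_0[of x] by (simp add: mult.commute)
  let ?g = "gsum (\<lambda>n. (-1) ^ Suc n * (1 / (x - real (Suc n)) - 1 / (x + real (Suc n)))) s"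
  have "rK s x = ?\<sigma> / pi * ?g"
  proof -
    have "wt s n * (rsincpi (x - real (Suc n)) - rsincpi (x + real (Suc n)))
      = ?\<sigma> / pi * ((-1) ^ Suc n * (1 / (x - real (Suc n)) - 1 / (x + real (Suc n))) * wt s n)" for n
    proof -
      have n1: "x \<noteq> real (Suc n)" "x + real (Suc n) \<noteq> 0" using False x by auto
      have "w * (e * (\<sigma> / (pi * a)) - e * (\<sigma> / (pi * b))) = \<sigma> / pi * (e * (1 / a - 1 / b) * w)" for w e \<sigma> a b :: real
        by (simp add: algebra_simps)
      then show ?thesis unfolding rsincpi_shift[OF n1(1)] rsincpi_shift_plus[OF n1(2)] .
    qed
    then have "rK s x = (\<Sum>n. ?\<sigma> / pi * ((-1) ^ Suc n * (1 / (x - real (Suc n)) - 1 / (x + real (Suc n))) * wt s n))"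
      unfolding rK_def by (simp only:)
    also have "\<dots> = ?\<sigma> / pi * ?g" unfolding gsum_def
    proof (rule suminf_mult)
      have "poly_growth (\<lambda>n. (-1) ^ Suc n * (1 / (x - real (Suc n)) - 1 / (x + real (Suc n))))"
        by (intro poly_growth_intros poly_growth_u[OF x False] poly_growth_v[OF x False])
      from gsum_sums[OF this s_neg] show "summable (\<lambda>n. (-1) ^ Suc n * (1 / (x - real (Suc n)) - 1 / (x + real (Suc n))) * wt s n)"
        by (rule sums_summable)
    qed
    finally show ?thesis .
  qed
  then have "?\<sigma> * (gauss_odd lam x - rK s x) = ?\<sigma> * exp (s * x\<^sup>2) - ?\<sigma>\<^sup>2 / pi * ?g"
    unfolding gauss_odd_pos[OF x] by (simp add: algebra_simps power2_eq_square)
  moreover have "?\<sigma>\<^sup>2 / pi * ?g \<le> ?\<sigma>\<^sup>2 / pi * (pi * exp (s * x\<^sup>2) / ?\<sigma>)"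
    by (intro mult_left_mono odd_best_approximation_bound x False s_neg) simp
  moreover have "?\<sigma>\<^sup>2 / pi * (pi * exp (s * x\<^sup>2) / ?\<sigma>) = ?\<sigma> * exp (s * x\<^sup>2)"
    using \<sigma> by (simp add: power2_eq_square)
  ultimately show ?thesis by linarith
qed

lemma rK_sign: "sin (pi * x) * (gauss_odd lam x - rK s x) \<ge> 0"
proof (cases x "0::real" rule: linorder_cases)
  case less
  have "sin (pi * (- x)) * (gauss_odd lam (- x) - rK s (- x)) \<ge> 0" using less by (intro rK_sign_pos) simp
  then show ?thesis unfolding gauss_odd_minus rK_minus by (simp add: algebra_simps)
qed (auto intro: rK_sign_pos)

lemma rL_noninteger:
  assumes x: "x > 0" "x \<notin> \<int>"
  shows "rL s x = (sin (pi * x))\<^sup>2 / pi\<^sup>2 * (even_interp x s - 2 * left_interp x s)"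
proof -
  let ?\<sigma> = "(sin (pi * x))\<^sup>2 / pi\<^sup>2"
  let ?u = "\<lambda>n. 1 / (x - real (Suc n))" and ?v = "\<lambda>n. 1 / (x + real (Suc n))"
  let ?A = "\<lambda>n. ?u n * ?u n - ?v n * ?v n" and ?B = "\<lambda>n. real (Suc n) * (?u n + ?v n - 2 / x)"
  note pgs = poly_growth_u[OF x] poly_growth_v[OF x] poly_growth_N[OF x] poly_growth_intros
  have pA: "poly_growth ?A" and pB: "poly_growth ?B" by (intro pgs)+
  have e: "((-1) ^ m)\<^sup>2 = (1::real)" for m by (simp flip: power_mult)
  have r0: "(rsincpi x)\<^sup>2 = ?\<sigma> * (1 / x\<^sup>2)" "rhermite_ker x = ?\<sigma> * (1 / x)"
    using x(1) by (simp_all add: rhermite_ker_def rsincpi_def rsinc_def power_divide power_mult_distrib power2_eq_square)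
  have trm: "wt s n * ((rsincpi (x - real (Suc n)))\<^sup>2 - (rsincpi (x + real (Suc n)))\<^sup>2)
     + wt' s n * (rhermite_ker (x - real (Suc n)) + rhermite_ker (x + real (Suc n)) - 2 * rhermite_ker x)
     = ?\<sigma> * (?A n * wt s n + 2 * s * (?B n * wt s n))" for n
  proof -
    have n1: "x \<noteq> real (Suc n)" "x + real (Suc n) \<noteq> 0" using x by auto
    have S: "(rsincpi (x - real (Suc n)))\<^sup>2 = ?\<sigma> * (?u n * ?u n)" "(rsincpi (x + real (Suc n)))\<^sup>2 = ?\<sigma> * (?v n * ?v n)"
      unfolding rsincpi_shift[OF n1(1)] rsincpi_shift_plus[OF n1(2)] power_mult_distrib e
      by (simp_all add: power_divide power_mult_distrib power2_eq_square)
    have T: "rhermite_ker (x - real (Suc n)) = ?\<sigma> * ?u n" "rhermite_ker (x + real (Suc n)) = ?\<sigma> * ?v n"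
      unfolding rhermite_ker_def S using n1 by simp_all
    have "w * (\<sigma> * a - \<sigma> * b) + 2 * s * m * w * (\<sigma> * c + \<sigma> * d - 2 * (\<sigma> * (1 / x))) = \<sigma> * ((a - b) * w + 2 * s * (m * (c + d - 2 / x) * w))"
      for w \<sigma> a b c d m :: real by (simp add: algebra_simps)
    then show ?thesis unfolding S T r0 .
  qed
  have "(\<lambda>n. ?\<sigma> * (?A n * wt s n + 2 * s * (?B n * wt s n))) sums (?\<sigma> * (gsum ?A s + 2 * s * gsum ?B s))"
    by (intro sums_mult sums_add gsum_sums pA pB s_neg)
  then have "rL s x = ?\<sigma> * (gsum ?A s + 2 * s * gsum ?B s) - ?\<sigma> * (1 / x\<^sup>2)"
    unfolding rL_def trm unfolding r0(1) by (simp only: sums_iff)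
  then show ?thesis unfolding odd_interp_eq[OF x s_neg] by (simp only: right_diff_distrib)
qed

text \<open>At an integer all Hermite kernels vanish and the sincs form a Kronecker delta. At 0 the
  series contributes nothing and the extra square contributes -1, the left limit of the odd
  Gaussian; this is the correction in the statement.\<close>

lemma rL_int: "rL s (of_int m) = gauss_odd lam (of_int m) - (if m = 0 then 1 else 0)"
proof -
  have nat: "rL s (real k) = gauss_odd lam (real k) - (if k = 0 then 1 else 0)" for k
  proof -
    have h: "rhermite_ker (real k - real (Suc n)) = 0" "rhermite_ker (real k + real (Suc n)) = 0" "rhermite_ker (real k) = 0" for n
      using rhermite_ker_int[of "int k - int (Suc n)"] rhermite_ker_int[of "int k + int (Suc n)"] rhermite_ker_int[of "int k"] by simp_all
    have p: "rsincpi (real k + real (Suc n)) = 0" for n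
      using rsincpi_int[of "int k + int (Suc n)"] by simp
    have q: "rsincpi (real k - real (Suc n)) = (if k = Suc n then 1 else 0)" for n
      using rsincpi_int[of "int k - int (Suc n)"] rsincpi_0 by (auto simp del: of_nat_Suc)
    have "(\<Sum>n. wt s n * ((rsincpi (real k - real (Suc n)))\<^sup>2 - (rsincpi (real k + real (Suc n)))\<^sup>2)
     + wt' s n * (rhermite_ker (real k - real (Suc n)) + rhermite_ker (real k + real (Suc n)) - 2 * rhermite_ker (real k)))
     = (\<Sum>n. wt s n * (if k = Suc n then 1 else 0))"
      unfolding h p q by (intro suminf_cong) simp
    also have "\<dots> = gauss_odd lam (real k)"
    proof (cases k)
      case 0
      then show ?thesis by (simp add: gauss_odd_def)
    next
      case (Suc j)
      have "(\<Sum>n. wt s n * (if k = Suc n then 1 else 0)) = (\<Sum>n\<in>{j}. wt s n * (if k = Suc n then 1 else 0))"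
        by (rule suminf_finite) (auto simp: Suc)
      then show ?thesis using gauss_odd_pos[of "real k"] by (simp add: Suc)
    qed
    finally show ?thesis
      using rsincpi_int[of "int k"] rsincpi_0 unfolding rL_def by (auto simp del: of_nat_Suc)
  qed
  show ?thesis
  proof (cases "m \<ge> 0")
    case True
    then show ?thesis using nat[of "nat m"] by simp
  next
    case False
    have "rL s (of_int m) = - rL s (real (nat (- m))) - 2 * (rsincpi (real (nat (- m))))\<^sup>2"
      using rL_minus[of "real (nat (- m))"] False by simp
    also have "rsincpi (real (nat (- m))) = 0" using rsincpi_int[of "- m"] False by simp
    also have "rL s (real (nat (- m))) = gauss_odd lam (real (nat (- m)))" using nat[of "nat (- m)"] False by simp
    finally show ?thesis using gauss_odd_minus[of "of_int m"] False by simp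
  qed
qed

lemma rK_int: "rK s (of_int m) = gauss_odd lam (of_int m)"
proof -
  have nat: "rK s (real k) = gauss_odd lam (real k)" for k
  proof -
    have p: "rsincpi (real k + real (Suc n)) = 0" for n
      using rsincpi_int[of "int k + int (Suc n)"] by simp
    have q: "rsincpi (real k - real (Suc n)) = (if k = Suc n then 1 else 0)" for n
      using rsincpi_int[of "int k - int (Suc n)"] rsincpi_0 by (auto simp del: of_nat_Suc)
    have "rK s (real k) = (\<Sum>n. wt s n * (if k = Suc n then 1 else 0))"
      unfolding rK_def p q by (intro suminf_cong) simp
    also have "\<dots> = gauss_odd lam (real k)"
    proof (cases k)
      case 0
      then show ?thesis by (simp add: gauss_odd_def)
    next
      case (Suc j)
      have "(\<Sum>n. wt s n * (if k = Suc n then 1 else 0)) = (\<Sum>n\<in>{j}. wt s n * (if k = Suc n then 1 else 0))"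
        by (rule suminf_finite) (auto simp: Suc)
      then show ?thesis using gauss_odd_pos[of "real k"] by (simp add: Suc)
    qed
    finally show ?thesis .
  qed
  show ?thesis
  proof (cases "m \<ge> 0")
    case True
    then show ?thesis using nat[of "nat m"] by simp
  next
    case False
    then show ?thesis using nat[of "nat (- m)"] rK_minus[of "of_int m"] gauss_odd_minus[of "of_int m"] by simp
  qed
qed

lemma rL_le_pos:
  assumes x: "x > 0"
  shows "rL s x \<le> gauss_odd lam x" "gauss_odd lam x \<le> - rL s (- x)"
proof -
  have "rL s x \<le> gauss_odd lam x \<and> gauss_odd lam x \<le> - rL s (- x)"
  proof (cases "x \<in> \<int>")
    case True
    then obtain m where m: "x = of_int m" by (rule Ints_cases)
    have "m \<noteq> 0" using m x by auto
    then show ?thesis using rL_int[of m] rL_int[of "- m"] gauss_odd_minus[of "of_int m"] by (simp add: m)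
  next
    case False
    let ?\<sigma> = "(sin (pi * x))\<^sup>2 / pi\<^sup>2"
    have \<sigma>: "sin (pi * x) \<noteq> 0" using False sin_times_pi_eq_0[of x] by (simp add: mult.commute)
    have c: "?\<sigma> * (exp (s * x\<^sup>2) * (pi\<^sup>2 / (sin (pi * x))\<^sup>2)) = exp (s * x\<^sup>2)" using \<sigma> by simp
    have "rL s x \<le> ?\<sigma> * (exp (s * x\<^sup>2) * (pi\<^sup>2 / (sin (pi * x))\<^sup>2))"
      unfolding rL_noninteger[OF x False] by (intro mult_left_mono odd_minorant_bound x False s_neg) simp
    then have 1: "rL s x \<le> gauss_odd lam x" unfolding c gauss_odd_pos[OF x] .
    have "?\<sigma> * (exp (s * x\<^sup>2) * (pi\<^sup>2 / (sin (pi * x))\<^sup>2)) \<le> ?\<sigma> * (even_interp x s - 2 * left_interp x s + 2 / x\<^sup>2)"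
      by (intro mult_left_mono odd_majorant_bound x False s_neg) simp
    also have "\<dots> = rL s x + 2 * (rsincpi x)\<^sup>2"
      unfolding rL_noninteger[OF x False] using x
      by (simp add: rsincpi_def rsinc_def power_divide power_mult_distrib distrib_left)
    finally have "gauss_odd lam x \<le> rL s x + 2 * (rsincpi x)\<^sup>2" unfolding c gauss_odd_pos[OF x] .
    then show ?thesis using 1 unfolding rL_minus by simp
  qed
  then show "rL s x \<le> gauss_odd lam x" "gauss_odd lam x \<le> - rL s (- x)" by auto
qed

lemma rL_le: "rL s x \<le> gauss_odd lam x" and rM_ge: "gauss_odd lam x \<le> - rL s (- x)"
proof -
  have "rL s x \<le> gauss_odd lam x \<and> gauss_odd lam x \<le> - rL s (- x)"
  proof (cases x "0::real" rule: linorder_cases)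
    case less
    then show ?thesis using rL_le_pos[of "- x"] gauss_odd_minus[of x] by simp
  next
    case equal
    then show ?thesis using rL_int[of 0] by (simp add: gauss_odd_def)
  next
    case greater
    then show ?thesis using rL_le_pos[of x] by simp
  qed
  then show "rL s x \<le> gauss_odd lam x" "gauss_odd lam x \<le> - rL s (- x)" by auto
qed

lemma exp_type_K_odd: "exp_type_le pi (K_odd lam)"
proof -
  have "exp_type_le pi (\<lambda>z. Kser s z - Kser s (- z))"
    by (intro exp_type_le_diff exp_type_le_uminus exp_type_Kser s_neg)
  then show ?thesis by (simp add: K_odd_def[abs_def] K_plus_eq[OF lam] s_def)
qed

lemma exp_type_L_odd: "exp_type_le (2 * pi) (L_odd lam)"
proof -
  have "exp_type_le pi (\<lambda>z. csinc (of_real pi * (z - of_real 0)))" by (rule exp_type_csinc_affine) simp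
  then have c: "exp_type_le pi sincpi" by (simp add: sincpi_def[abs_def])
  have "exp_type_le (2 * pi) (\<lambda>z. (sincpi (- z))\<^sup>2)"
    using exp_type_le_uminus[OF exp_type_le_mult[OF c c]] by (simp add: power2_eq_square)
  then have "exp_type_le (2 * pi) (\<lambda>z. Lser s z - (Lser s (- z) + (sincpi (- z))\<^sup>2))"
    by (intro exp_type_le_diff exp_type_le_add exp_type_le_uminus[of _ "Lser s"] exp_type_Lser s_neg)
  then show ?thesis by (simp add: L_odd_def[abs_def] L_plus_eq[OF lam] M_plus_eq[OF lam] s_def)
qed

lemma exp_type_M_odd: "exp_type_le (2 * pi) (M_odd lam)"
  using exp_type_le_minus[OF exp_type_le_uminus[OF exp_type_L_odd]] by (simp add: M_odd_eq[abs_def])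

lemma rK_measurable: "rK s \<in> borel_measurable borel"
proof -
  have "(\<lambda>x. Re (K_odd lam (of_real x))) \<in> borel_measurable borel"
    using exp_type_K_odd by (intro measurable_compose[OF entire_of_real_measurable borel_measurable_Re]) (simp add: exp_type_le_def)
  then show ?thesis by (simp add: K_odd_real)
qed

lemma rL_measurable: "rL s \<in> borel_measurable borel"
proof -
  have "(\<lambda>x. Re (L_odd lam (of_real x))) \<in> borel_measurable borel"
    using exp_type_L_odd by (intro measurable_compose[OF entire_of_real_measurable borel_measurable_Re]) (simp add: exp_type_le_def)
  then show ?thesis by (simp add: L_odd_real)
qed

lemma integrable_gauss_odd_rK: "integrable lborel (\<lambda>x. gauss_odd lam x - rK s x)"
  by (intro integrable_decay_diff gauss_odd_measurable rK_measurable gauss_odd_decay[OF lam] rK_decay s_neg)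

lemma integrable_gauss_odd_rL: "integrable lborel (\<lambda>x. gauss_odd lam x - rL s x)"
  by (intro integrable_decay_diff gauss_odd_measurable rL_measurable gauss_odd_decay[OF lam] rL_decay s_neg)

lemma integrable_rM_gauss_odd: "integrable lborel (\<lambda>x. - rL s (- x) - gauss_odd lam x)"
proof -
  have "(\<lambda>x. gauss_odd lam (- x) - rL s (- x)) = (\<lambda>x. - rL s (- x) - gauss_odd lam x)"
    unfolding gauss_odd_minus by (intro ext) simp
  then show ?thesis using lborel_integrable_reflect[OF integrable_gauss_odd_rL] by (simp only:)
qed

text \<open>Duality: the pairing of the error with the square wave is the same for every competitor
  with integrable error. For \<open>K_odd\<close> it equals the L1 norm of the error, and for any
  other it is at most that norm.\<close>

lemma best_approximation_K_odd: "best_approximation pi (gauss_odd lam) (K_odd lam)"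
proof -
  let ?G = "gauss_odd lam"
  let ?w = "\<lambda>x. complex_of_real (sgn (sin (pi * x)))"
  have w: "?w \<in> borel_measurable borel" unfolding sgn_if by measurable
  have w1: "norm (?w x) \<le> 1" for x by (simp add: sgn_if)
  have iK: "integrable lborel (\<lambda>x. of_real (?G x) - K_odd lam (of_real x))"
    using integrable_of_real[OF integrable_gauss_odd_rK, where ?'a = complex] by (simp add: K_odd_real)
  \<comment> \<open>At the zeros of the sine, where its sign gives no information, x is an integer
    and the error is 0 by interpolation.\<close>
  have abs_eq: "complex_of_real \<bar>?G x - rK s x\<bar> = (of_real (?G x) - K_odd lam (of_real x)) * ?w x" for x
  proof -
    have "\<bar>?G x - rK s x\<bar> = (?G x - rK s x) * sgn (sin (pi * x))"
    proof (cases "sin (pi * x) = 0")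
      case True
      then have "x \<in> \<int>" using sin_times_pi_eq_0[of x] by (simp add: mult.commute)
      then obtain m where "x = of_int m" by (rule Ints_cases)
      then show ?thesis using rK_int[of m] by simp
    next
      case False
      then show ?thesis using rK_sign[of x]
        by (cases "sin (pi * x) > 0") (auto simp: zero_le_mult_iff)
    qed
    then show ?thesis by (simp add: K_odd_real)
  qed
  have "\<not> (\<integral>\<^sup>+x. ennreal (norm (of_real (?G x) - F (of_real x))) \<partial>lborel)
      < (\<integral>\<^sup>+x. ennreal (norm (of_real (?G x) - K_odd lam (of_real x))) \<partial>lborel)"
    if F: "exp_type_le pi F" for F
  proof
    assume less: "(\<integral>\<^sup>+x. ennreal (norm (of_real (?G x) - F (of_real x))) \<partial>lborel)
      < (\<integral>\<^sup>+x. ennreal (norm (of_real (?G x) - K_odd lam (of_real x))) \<partial>lborel)"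
    \<comment> \<open>A competitor that does strictly better has a finite objective, hence an
      integrable error.\<close>
    have iF: "integrable lborel (\<lambda>x. of_real (?G x) - F (of_real x))"
    proof (rule integrableI_bounded)
      have "(\<lambda>x::real. F (of_real x)) \<in> borel_measurable borel"
        using F by (intro entire_of_real_measurable) (simp add: exp_type_le_def)
      then show "(\<lambda>x. of_real (?G x) - F (of_real x)) \<in> borel_measurable lborel" by simp
      show "(\<integral>\<^sup>+x. ennreal (norm (of_real (?G x) - F (of_real x))) \<partial>lborel) < \<infinity>"
        using less by (rule less_le_trans) simp
    qed
    have "exp_type_le pi (\<lambda>z. K_odd lam z - F z)" by (rule exp_type_le_diff[OF exp_type_K_odd F])
    moreover have "K_odd lam (of_real x) - F (of_real x)
        = (of_real (?G x) - F (of_real x)) - (of_real (?G x) - K_odd lam (of_real x))" for x by simp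
    then have "integrable lborel (\<lambda>x. K_odd lam (of_real x) - F (of_real x))"
      using Bochner_Integration.integrable_diff[OF iF iK] by simp
    ultimately have "0 = (LINT x|lborel. (K_odd lam (of_real x) - F (of_real x)) * ?w x)"
      by (rule exp_type_pi_orthogonal_square_wave[symmetric])
    also have "(LINT x|lborel. (K_odd lam (of_real x) - F (of_real x)) * ?w x)
      = (LINT x|lborel. (of_real (?G x) - F (of_real x)) * ?w x - (of_real (?G x) - K_odd lam (of_real x)) * ?w x)"
      by (intro Bochner_Integration.integral_cong) (simp_all add: left_diff_distrib)
    also have "\<dots> = (LINT x|lborel. (of_real (?G x) - F (of_real x)) * ?w x) - (LINT x|lborel. (of_real (?G x) - K_odd lam (of_real x)) * ?w x)"
      using w by (intro Bochner_Integration.integral_diff integrable_mult_bounded[OF iF _ w1] integrable_mult_bounded[OF iK _ w1]) simp_all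
    finally have eq: "(LINT x|lborel. (of_real (?G x) - K_odd lam (of_real x)) * ?w x) = (LINT x|lborel. (of_real (?G x) - F (of_real x)) * ?w x)"
      by simp
    have "(LINT x|lborel. \<bar>?G x - rK s x\<bar>) = norm (LINT x|lborel. complex_of_real \<bar>?G x - rK s x\<bar>)"
      unfolding integral_complex_of_real by simp
    also have "\<dots> = norm (LINT x|lborel. (of_real (?G x) - F (of_real x)) * ?w x)"
      unfolding abs_eq eq ..
    also have "\<dots> \<le> (LINT x|lborel. norm ((of_real (?G x) - F (of_real x)) * ?w x))"
      by (rule integral_norm_bound)
    also have "\<dots> \<le> (LINT x|lborel. norm (of_real (?G x) - F (of_real x)))"
    proof (rule integral_mono)
      show "integrable lborel (\<lambda>x. norm ((of_real (?G x) - F (of_real x)) * ?w x))"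
        using w w1 iF by (intro integrable_norm integrable_mult_bounded[where B = 1]) auto
      show "integrable lborel (\<lambda>x. norm (of_real (?G x) - F (of_real x)))" using iF by (rule integrable_norm)
      show "norm ((of_real (?G x) - F (of_real x)) * ?w x) \<le> norm (of_real (?G x) - F (of_real x))" for x
        unfolding norm_mult using mult_left_mono[OF w1[of x] norm_ge_zero] by (metis mult.right_neutral)
    qed
    finally have "(LINT x|lborel. norm (of_real (?G x) - K_odd lam (of_real x))) \<le> (LINT x|lborel. norm (of_real (?G x) - F (of_real x)))"
      by (simp only: K_odd_real norm_of_real flip: of_real_diff)
    then have "(\<integral>\<^sup>+x. ennreal (norm (of_real (?G x) - K_odd lam (of_real x))) \<partial>lborel)
      \<le> (\<integral>\<^sup>+x. ennreal (norm (of_real (?G x) - F (of_real x))) \<partial>lborel)"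
      using nn_integral_eq_integral[OF integrable_norm[OF iF]] nn_integral_eq_integral[OF integrable_norm[OF iK]]
      by (simp add: ennreal_leI)
    then show False using less by simp
  qed
  then show ?thesis using iK exp_type_K_odd unfolding best_approximation_def is_arg_min_def by blast
qed

lemma gauss_odd_tendsto_0:
  "(gauss_odd lam \<longlongrightarrow> -1) (at_left 0)" "(gauss_odd lam \<longlongrightarrow> 1) (at_right 0)"
proof -
  have e: "((\<lambda>x. exp (- (pi * lam * x\<^sup>2))) \<longlongrightarrow> 1) (at (0::real))"
    by (rule tendsto_eq_intros | simp)+
  have "((\<lambda>x. - exp (- (pi * lam * x\<^sup>2))) \<longlongrightarrow> -1) (at_left (0::real))"
    by (intro tendsto_minus filterlim_mono[OF e order_refl at_le]) simp
  then show "(gauss_odd lam \<longlongrightarrow> -1) (at_left 0)"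
    by (rule Lim_transform_eventually) (auto simp: eventually_at_filter gauss_odd_def)
  have "((\<lambda>x. exp (- (pi * lam * x\<^sup>2))) \<longlongrightarrow> 1) (at_right (0::real))"
    by (rule filterlim_mono[OF e order_refl at_le]) simp
  then show "(gauss_odd lam \<longlongrightarrow> 1) (at_right 0)"
    by (rule Lim_transform_eventually) (auto simp: eventually_at_filter gauss_odd_def)
qed

text \<open>At 0 the pointwise condition only says that the value is at most 0. Continuity of
  \<open>F\<close> and the left limit of the odd Gaussian improve this to -1, which
  \<open>L_odd\<close> attains.\<close>

lemma minorant_int_le:
  assumes F: "minorant_exp_type (2 * pi) (gauss_odd lam) F"
  shows "Re (F (of_real (of_int n))) \<le> rL s (of_int n)"
proof (cases "n = 0")
  case True
  have "Re (F (of_real 0)) \<le> -1"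
  proof (rule tendsto_le)
    show "((\<lambda>x. Re (F (of_real x))) \<longlongrightarrow> Re (F (of_real 0))) (at_left 0)"
      using isCont_entire_Re[of F 0] F
      by (intro filterlim_mono[OF _ order_refl at_le[of "{..<0}" UNIV]]) (auto simp: isCont_def minorant_exp_type_def exp_type_le_def)
    show "(gauss_odd lam \<longlongrightarrow> -1) (at_left 0)" by (rule gauss_odd_tendsto_0)
  qed (use F in \<open>auto simp: minorant_exp_type_def\<close>)
  then show ?thesis using rL_int[of 0] True by (simp add: gauss_odd_def)
next
  case False
  then show ?thesis using rL_int[of n] F by (simp add: minorant_exp_type_def del: of_real_of_int_eq)
qed

text \<open>At 0 the right limit 1 takes the place of the value 0 of the odd Gaussian.\<close>

lemma majorant_int_ge:
  assumes F: "majorant_exp_type (2 * pi) (gauss_odd lam) F"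
  shows "- rL s (- of_int n) \<le> Re (F (of_real (of_int n)))"
proof (cases "n = 0")
  case True
  have "1 \<le> Re (F (of_real 0))"
  proof (rule tendsto_le)
    show "((\<lambda>x. Re (F (of_real x))) \<longlongrightarrow> Re (F (of_real 0))) (at_right 0)"
      using isCont_entire_Re[of F 0] F
      by (intro filterlim_mono[OF _ order_refl at_le[of "{0<..}" UNIV]]) (auto simp: isCont_def majorant_exp_type_def exp_type_le_def)
    show "(gauss_odd lam \<longlongrightarrow> 1) (at_right 0)" by (rule gauss_odd_tendsto_0)
  qed (use F in \<open>auto simp: majorant_exp_type_def\<close>)
  then show ?thesis using rL_int[of 0] True by (simp add: gauss_odd_def)
next
  case False
  have "gauss_odd lam (of_int n) \<le> Re (F (of_real (of_int n)))" using F unfolding majorant_exp_type_def by blast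
  then show ?thesis using rL_int[of "- n"] gauss_odd_minus[of "of_int n"] False by simp
qed

text \<open>The difference to an integrable competitor is an integrable function of type 2 pi that
  is nonnegative at all integers by \<open>minorant_int_le\<close>, so its integral is
  nonnegative.\<close>

lemma extremal_minorant_L_odd: "extremal_minorant (2 * pi) (gauss_odd lam) (L_odd lam)"
proof -
  let ?G = "gauss_odd lam"
  have L: "Re (L_odd lam (of_real x)) = rL s x" for x by (simp add: L_odd_real)
  have min: "minorant_exp_type (2 * pi) ?G (L_odd lam)"
    unfolding minorant_exp_type_def using exp_type_L_odd rL_le by (simp add: L_odd_real)
  have "(\<integral>\<^sup>+x. ennreal (?G x - rL s x) \<partial>lborel) \<le> (\<integral>\<^sup>+x. ennreal (?G x - Re (F (of_real x))) \<partial>lborel)"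
    if F: "minorant_exp_type (2 * pi) ?G F" for F
  proof (rule nn_integral_minimal[OF integrable_gauss_odd_rL])
    let ?f = "\<lambda>x. Re (F (of_real x))"
    have F1: "exp_type_le (2 * pi) F" and F2: "F (of_real x) = of_real (?f x)" "?f x \<le> ?G x" for x
      using F by (auto simp: minorant_exp_type_def)
    show "?G x - rL s x \<ge> 0" "?G x - ?f x \<ge> 0" for x using rL_le[of x] F2 by simp_all
    have "(\<lambda>x::real. F (of_real x)) \<in> borel_measurable borel"
      using F1 by (intro entire_of_real_measurable) (simp add: exp_type_le_def)
    then show "(\<lambda>x. ?G x - ?f x) \<in> borel_measurable borel" by measurable
    assume i: "integrable lborel (\<lambda>x. ?G x - ?f x)"
    have "(LINT x|lborel. ?f x - ?G x) \<le> (LINT x|lborel. rL s x - ?G x)"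
      by (rule exp_type_2pi_integral_le[OF exp_type_L_odd L_odd_real F1 F2(1) _ _ minorant_int_le[OF F]])
        (use integrable_minus[OF i] integrable_minus[OF integrable_gauss_odd_rL] in simp_all)
    then show "(LINT x|lborel. ?G x - rL s x) \<le> (LINT x|lborel. ?G x - ?f x)"
      using integral_minus[of lborel "\<lambda>x. ?G x - rL s x"] integral_minus[of lborel "\<lambda>x. ?G x - ?f x"] by simp
  qed
  then show ?thesis
    using integrable_gauss_odd_rL min unfolding extremal_minorant_def is_arg_min_def L by (auto simp: not_less)
qed

lemma extremal_majorant_M_odd: "extremal_majorant (2 * pi) (gauss_odd lam) (M_odd lam)"
proof -
  let ?G = "gauss_odd lam"
  have M: "Re (M_odd lam (of_real x)) = - rL s (- x)" for x by (simp add: M_odd_real)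
  have maj: "majorant_exp_type (2 * pi) ?G (M_odd lam)"
    unfolding majorant_exp_type_def using exp_type_M_odd rM_ge by (simp add: M_odd_real)
  have "(\<integral>\<^sup>+x. ennreal (- rL s (- x) - ?G x) \<partial>lborel) \<le> (\<integral>\<^sup>+x. ennreal (Re (F (of_real x)) - ?G x) \<partial>lborel)"
    if F: "majorant_exp_type (2 * pi) ?G F" for F
  proof (rule nn_integral_minimal[OF integrable_rM_gauss_odd])
    let ?f = "\<lambda>x. Re (F (of_real x))"
    have F1: "exp_type_le (2 * pi) F" and F2: "F (of_real x) = of_real (?f x)" "?G x \<le> ?f x" for x
      using F by (auto simp: majorant_exp_type_def)
    show "- rL s (- x) - ?G x \<ge> 0" "?f x - ?G x \<ge> 0" for x using rM_ge[of x] F2 by simp_all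
    have "(\<lambda>x::real. F (of_real x)) \<in> borel_measurable borel"
      using F1 by (intro entire_of_real_measurable) (simp add: exp_type_le_def)
    then show "(\<lambda>x. ?f x - ?G x) \<in> borel_measurable borel" by measurable
    assume i: "integrable lborel (\<lambda>x. ?f x - ?G x)"
    show "(LINT x|lborel. - rL s (- x) - ?G x) \<le> (LINT x|lborel. ?f x - ?G x)"
      by (rule exp_type_2pi_integral_le[OF F1 F2(1) exp_type_M_odd M_odd_real i integrable_rM_gauss_odd majorant_int_ge[OF F]])
  qed
  then show ?thesis
    using integrable_rM_gauss_odd maj unfolding extremal_majorant_def is_arg_min_def M by (auto simp: not_less)
qed

lemma L_odd_interpolates:
  assumes "n \<noteq> 0"
  shows "L_odd lam (of_int n) = of_real (gauss_odd lam (of_int n))"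
    and "deriv (L_odd lam) (of_int n) = of_real (deriv (gauss_odd lam) (of_int n))"
proof -
  have r: "rL s (of_int n) = gauss_odd lam (of_int n)" using rL_int[of n] assms by simp
  then show "L_odd lam (of_int n) = of_real (gauss_odd lam (of_int n))"
    using L_odd_real[of "of_int n"] by simp
  obtain d where "(gauss_odd lam has_real_derivative d) (at (of_int n))"
    using gauss_odd_deriv[of "of_int n" lam] assms by auto
  from touching_deriv[where F = "L_odd lam" and f = "\<lambda>x. rL s x" and g = "gauss_odd lam", OF _ L_odd_real this _ r]
    exp_type_L_odd rL_le
  show "deriv (L_odd lam) (of_int n) = of_real (deriv (gauss_odd lam) (of_int n))"
    by (simp add: exp_type_le_def)
qed

lemma M_odd_interpolates:
  assumes "n \<noteq> 0"
  shows "M_odd lam (of_int n) = of_real (gauss_odd lam (of_int n))"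
    and "deriv (M_odd lam) (of_int n) = of_real (deriv (gauss_odd lam) (of_int n))"
proof -
  have r: "- rL s (- of_int n) = gauss_odd lam (of_int n)"
    using rL_int[of "- n"] gauss_odd_minus[of "of_int n"] assms by simp
  then show "M_odd lam (of_int n) = of_real (gauss_odd lam (of_int n))"
    using M_odd_real[of "of_int n"] by simp
  obtain d where "(gauss_odd lam has_real_derivative d) (at (of_int n))"
    using gauss_odd_deriv[of "of_int n" lam] assms by auto
  from touching_deriv[where F = "M_odd lam" and f = "\<lambda>x. - rL s (- x)" and g = "gauss_odd lam", OF _ M_odd_real this _ r]
    exp_type_M_odd rM_ge
  show "deriv (M_odd lam) (of_int n) = of_real (deriv (gauss_odd lam) (of_int n))"
    by (simp add: exp_type_le_def)
qed

lemma K_odd_interpolates: "K_odd lam (of_int n) = of_real (gauss_odd lam (of_int n))"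
  using K_odd_real[of "of_int n"] rK_int[of n] by simp

end

theorem mainTheorem5:
  fixes lam :: real
  assumes "lam > 0"
  shows "(\<forall>x::real. K_odd lam (of_real x) \<in> \<real> \<and>
           sin (pi * x) * (gauss_odd lam x - Re (K_odd lam (of_real x))) \<ge> 0) \<and>
         (\<forall>x::real. L_odd lam (of_real x) \<in> \<real> \<and> M_odd lam (of_real x) \<in> \<real> \<and>
           Re (L_odd lam (of_real x)) \<le> gauss_odd lam x \<and>
           gauss_odd lam x \<le> Re (M_odd lam (of_real x))) \<and>
         (\<forall>n::int. n \<noteq> 0 \<longrightarrow>
           K_odd lam (of_int n) = of_real (gauss_odd lam (of_int n))) \<and>
         (\<forall>n::int. n \<noteq> 0 \<longrightarrow>
           L_odd lam (of_int n) = of_real (gauss_odd lam (of_int n)) \<and>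
           deriv (L_odd lam) (of_int n) = of_real (deriv (gauss_odd lam) (of_int n))) \<and>
         (\<forall>n::int. n \<noteq> 0 \<longrightarrow>
           M_odd lam (of_int n) = of_real (gauss_odd lam (of_int n)) \<and>
           deriv (M_odd lam) (of_int n) = of_real (deriv (gauss_odd lam) (of_int n))) \<and>
         best_approximation pi (gauss_odd lam) (K_odd lam) \<and>
         extremal_minorant (2 * pi) (gauss_odd lam) (L_odd lam) \<and>
         extremal_majorant (2 * pi) (gauss_odd lam) (M_odd lam)"
proof (intro conjI allI impI)
  note K = K_odd_real[OF assms refl] and L = L_odd_real[OF assms refl] and M = M_odd_real[OF assms refl]
  fix x :: real
  show "K_odd lam (of_real x) \<in> \<real>" unfolding K by simp
  show "L_odd lam (of_real x) \<in> \<real>" unfolding L by simp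
  show "M_odd lam (of_real x) \<in> \<real>" unfolding M by simp
  show "sin (pi * x) * (gauss_odd lam x - Re (K_odd lam (of_real x))) \<ge> 0"
    unfolding K Re_complex_of_real by (rule rK_sign[OF assms refl])
  show "Re (L_odd lam (of_real x)) \<le> gauss_odd lam x"
    unfolding L Re_complex_of_real by (rule rL_le[OF assms refl])
  show "gauss_odd lam x \<le> Re (M_odd lam (of_real x))"
    unfolding M Re_complex_of_real by (rule rM_ge[OF assms refl])
next
  fix n :: int assume n: "n \<noteq> 0"
  show "K_odd lam (of_int n) = of_real (gauss_odd lam (of_int n))" by (rule K_odd_interpolates[OF assms refl])
  show "L_odd lam (of_int n) = of_real (gauss_odd lam (of_int n))"
    "deriv (L_odd lam) (of_int n) = of_real (deriv (gauss_odd lam) (of_int n))"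
    by (rule L_odd_interpolates[OF assms refl n])+
  show "M_odd lam (of_int n) = of_real (gauss_odd lam (of_int n))"
    "deriv (M_odd lam) (of_int n) = of_real (deriv (gauss_odd lam) (of_int n))"
    by (rule M_odd_interpolates[OF assms refl n])+
next
  show "best_approximation pi (gauss_odd lam) (K_odd lam)" by (rule best_approximation_K_odd[OF assms refl])
  show "extremal_minorant (2 * pi) (gauss_odd lam) (L_odd lam)" by (rule extremal_minorant_L_odd[OF assms refl])
  show "extremal_majorant (2 * pi) (gauss_odd lam) (M_odd lam)" by (rule extremal_majorant_M_odd[OF assms refl])
qed

end
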